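(* Let $(\mathcal G,\rho)$ be a locally compact Hausdorff Real groupoid. Then the Real Picard group $\operatorname{PicR}(\mathcal G)$ is an Abelian group. Furthermore, $$\operatorname{PicR}(\mathcal G)\cong\check{H}R^1(\mathcal G_\bullet,\mathbb S^1),$$ where $\mathbb S^1$ carries complex conjugation as its Real structure.
   Context: **Real groupoids.** A Real space is a locally compact Hausdorff space with a homeomorphism of square the identity; a Real map intertwines the involutions. Groupoids $\mathcal G\rightrightarrows X$ are topological, locally compact, Hausdorff, with range and source maps $r,s$. A Real groupoid $(\mathcal G,\rho)$ is a groupoid with a homeomorphism $\rho:\mathcal G\to\mathcal G$ which is a functor and satisfies $\rho^2=\mathrm{id}$; $\rho$ also denotes the induced involution of $X$. A Real open cover of a Real space $(Y,\varrho)$ is an open cover $(U_j)_{j\in J}$ with an involution $j\mapsto\bar j$ of $J$ such that $U_{\bar j}=\varrho(U_j)$. **Real line $\mathcal G$-bundles.** A Real line $\mathcal G$-bundle is a Real space $(\mathcal L,\nu)$ with a continuous surjective Real map $\pi:(\mathcal L,\nu)\to(X,\rho)$ which is a complex vector bundle of rank 1, such that every induced isomorphism $\nu_x:\mathcal L_x\to\mathcal L_{\rho(x)}$ is conjugate-linear, together with a continuous left Real action of $\mathcal G$ on $\mathcal L$ with respect to $\pi$ (a continuous groupoid action $(g,v)\mapsto g\cdot v$, defined for $\pi(v)=s(g)$, with $\pi(g\cdot v)=r(g)$ and $\nu(g\cdot v)=\rho(g)\cdot\nu(v)$). Homomorphisms are $\mathcal G$-equivariant homomorphisms of complex vector bundles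 intertwining the Real structures. $(\mathcal L,\nu)$ is locally trivial if there are a Real open cover $(U_j)$ of $(X,\rho)$ and a family of isomorphisms of complex vector bundles $\varphi_j:U_j\times\mathbb C\to\mathcal L_{|U_j}$ such that - $\varphi_{\bar j}(\rho(x),\bar z)=\nu(\varphi_j(x,z))$ for all $(x,z)\in U_j\times\mathbb C$; - if $r(g)\in U_{j_0}$ and $s(g)\in U_{j_1}$, then $g\cdot\varphi_{j_1}(s(g),z)=\varphi_{j_0}(r(g),z)$. A Real hermitian $\mathcal G$-metric on a locally trivial Real line $\mathcal G$-bundle $(\mathcal L,\nu)$ is a continuous $\mathrm h:\mathcal L\to\mathbb R_+$ with $\mathrm h(\nu(v))=\mathrm h(v)$ and $\mathrm h(v\cdot z)=\mathrm h(v)|z|^2$ for $v\in\mathcal L$, $z\in\mathbb C$, with $\mathrm h(g\cdot v)=\mathrm h(v)$ whenever $g\cdot v$ is defined, and $\mathrm h(v)>0$ for $v$ not in the zero section; $(\mathcal L,\nu,\mathrm h)$ is then called a hermitian Real line $\mathcal G$-bundle. $\operatorname{PicR}(\mathcal G)$ is the set of isomorphism classes of locally trivial hermitian Real line $\mathcal G$-bundles, the group operation being induced by the tensor product. **Real Čech cohomology** (for an abelian topological group $\mathrm S$ with involutive automorphism $t\mapsto\bar t$; here $\mathrm S=\mathbb S^1$). Let $\Delta$ (resp. $\Delta'$) be the category of the sets $[n]=\{0,\dots,n\}$ with nondecreasing (resp. strictly increasing) maps. Let $\mathcal G_0=X$ and, for $n\ge1$, $\mathcal G_n=\{(g_1,\dots,g_n):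 s(g_i)=r(g_{i+1})\}$, with the componentwise Real structure $\rho_n$. Identify $\vec g\in\mathcal G_n$ with the functor $[n]\times[n]\to\mathcal G$ from the pair groupoid of $[n]$ with $\vec g(i-1,i)=g_i$; a map $f:[m]\to[n]$ in $\Delta$ induces $\tilde f:\mathcal G_n\to\mathcal G_m$, $\tilde f(\vec g)=\vec g\circ(f\times f)$. Let $\varepsilon_k:[n]\to[n+1]$ be the increasing map omitting $k$. A Real open cover $\mathcal U_\bullet$ of $(\mathcal G_\bullet,\rho_\bullet)$ is a sequence of Real open covers $\mathcal U_n=(U^n_j)_{j\in J_n}$ of $(\mathcal G_n,\rho_n)$. Let $\mathcal P_n^k=\operatorname{Hom}_{\Delta'}([k],[n])$ and let $\Lambda_n$ be the set of maps $\lambda:\bigcup_{k\le n}\mathcal P_n^k\to\bigcup_k J_k$ with $\lambda(\mathcal P^k_n)\subset J_k$, with involution $\bar\lambda(\varphi)=\overline{\lambda(\varphi)}$, and put $U^n_\lambda=\bigcap_{k\le n}\bigcap_{\varphi\in\mathcal P_n^k}\tilde\varphi^{-1}(U^k_{\lambda(\varphi)})$. For $f\in\operatorname{Hom}_{\Delta'}([m],[n])$ put $(\tilde f\lambda)(\varphi)=\lambda(f\circ\varphi)$, so $\tilde f(U^n_\lambda)\subset U^m_{\tilde f\lambda}$. The group $CR^n(\mathcal U_\bullet,\mathrm S)$ consists of families $(c_\lambda)_{\lambda\in\Lambda_n}$ of continuous maps $c_\lambda:U^n_\lambda\to\mathrm S$ with $c_{\bar\lambda}(\rho_n(\vec g))=\overline{c_\lambda(\vec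 g)}$; the differential is (additively) $(dc)_\lambda=\sum_{k=0}^{n+1}(-1)^k c_{\tilde\varepsilon_k\lambda}\circ\tilde\varepsilon_k$ on $U^{n+1}_\lambda$. $HR^n(\mathcal U_\bullet,\mathrm S)$ is the $n$-th cohomology of this complex. Let $\mathfrak N(n)$ be the collection of Real open covers $\mathcal U_\bullet$ for which there is $N\ge n+1$ such that the index sets $(J_k)_{k\le N}$ admit an $N$-truncated simplicial structure by involution-preserving maps with $\tilde f(U^p_j)\subset U^m_{\tilde f(j)}$ for all $f\in\operatorname{Hom}_\Delta([m],[p])$, $m,p\le N$. It is preordered by refinement: $\mathcal V_\bullet=(V^k_i)_{i\in I_k}$ is finer than $\mathcal U_\bullet$ if there are involution-preserving maps $\theta_k:I_k\to J_k$ with $V_i^k\subset U^k_{\theta_k(i)}$ (required to be pre-simplicial, resp. $N$-simplicial, when both covers are). Refinement induces, by restriction, a map $HR^n(\mathcal U_\bullet,\mathrm S)\to HR^n(\mathcal V_\bullet,\mathrm S)$ independent of the choice of $\theta_\bullet$, and $\check HR^n(\mathcal G_\bullet,\mathrm S):=\varinjlim_{\mathcal U_\bullet\in\mathfrak N(n)}HR^n(\mathcal U_\bullet,\mathrm S)$.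
   Formalization: In local triviality, g·φ_{j1}(s(g),z)=φ_{j0}(r(g),z) is replaced by φ_{j0}(r(g),cz) with a nonzero scalar c depending on g, j0, j1; taken literally every such bundle is trivial, and the claim fails for Z/2 over a point with ρ=id. *)

theory Defs
  imports "HOL-Analysis.Analysis" "HOL-Algebra.Coset" "HOL-Algebra.FiniteProduct"
begin

section \<open>Real groupoids\<close>

text \<open>
  The structure maps are total HOL functions that only matter on the relevant carriers.
  \<open>gcomp G g h\<close> is the product \<open>gh\<close>, meaningful when the source of \<open>g\<close> is the range of \<open>h\<close>.
\<close>

record ('g, 'x) real_groupoid =
  arrows :: "'g topology"
  objects :: "'x topology"
  src :: "'g \<Rightarrow> 'x"
  rng :: "'g \<Rightarrow> 'x"
  ident :: "'x \<Rightarrow> 'g"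
  gcomp :: "'g \<Rightarrow> 'g \<Rightarrow> 'g"
  ginv :: "'g \<Rightarrow> 'g"
  rho :: "'g \<Rightarrow> 'g"

definition lch_space :: "'a topology \<Rightarrow> bool" where
  "lch_space X \<longleftrightarrow> locally_compact_space X \<and> Hausdorff_space X"

definition real_space :: "'a topology \<Rightarrow> ('a \<Rightarrow> 'a) \<Rightarrow> bool" where
  "real_space X \<sigma> \<longleftrightarrow>
     lch_space X \<and> homeomorphic_map X X \<sigma> \<and> (\<forall>x\<in>topspace X. \<sigma> (\<sigma> x) = x)"

definition composable :: "('g, 'x) real_groupoid \<Rightarrow> ('g \<times> 'g) set" where
  "composable G = {(g, h). g \<in> topspace (arrows G) \<and> h \<in> topspace (arrows G) \<and> src G g = rng G h}"

definition topological_groupoid :: "('g, 'x) real_groupoid \<Rightarrow> bool" where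
  "topological_groupoid G \<longleftrightarrow>
     continuous_map (arrows G) (objects G) (src G) \<and>
     continuous_map (arrows G) (objects G) (rng G) \<and>
     continuous_map (objects G) (arrows G) (ident G) \<and>
     continuous_map (arrows G) (arrows G) (ginv G) \<and>
     continuous_map (subtopology (prod_topology (arrows G) (arrows G)) (composable G))
       (arrows G) (\<lambda>(g, h). gcomp G g h) \<and>
     (\<forall>x\<in>topspace (objects G). src G (ident G x) = x \<and> rng G (ident G x) = x) \<and>
     (\<forall>(g, h)\<in>composable G. src G (gcomp G g h) = src G h \<and> rng G (gcomp G g h) = rng G g) \<and>
     (\<forall>g h k. (g, h) \<in> composable G \<and> (h, k) \<in> composable G \<longrightarrow>
        gcomp G (gcomp G g h) k = gcomp G g (gcomp G h k)) \<and>
     (\<forall>g\<in>topspace (arrows G).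
        gcomp G (ident G (rng G g)) g = g \<and> gcomp G g (ident G (src G g)) = g \<and>
        src G (ginv G g) = rng G g \<and> rng G (ginv G g) = src G g \<and>
        gcomp G g (ginv G g) = ident G (rng G g) \<and> gcomp G (ginv G g) g = ident G (src G g))"

text \<open>The involution of the object space induced by the functor \<open>rho G\<close>.\<close>

definition rho_obj :: "('g, 'x) real_groupoid \<Rightarrow> 'x \<Rightarrow> 'x" where
  "rho_obj G x = src G (rho G (ident G x))"

definition lch_real_groupoid :: "('g, 'x) real_groupoid \<Rightarrow> bool" where
  "lch_real_groupoid G \<longleftrightarrow>
     topological_groupoid G \<and> lch_space (arrows G) \<and> lch_space (objects G) \<and>
     homeomorphic_map (arrows G) (arrows G) (rho G) \<and>
     (\<forall>g\<in>topspace (arrows G). rho G (rho G g) = g \<and>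
        src G (rho G g) = rho_obj G (src G g) \<and> rng G (rho G g) = rho_obj G (rng G g)) \<and>
     (\<forall>x\<in>topspace (objects G). rho G (ident G x) = ident G (rho_obj G x)) \<and>
     (\<forall>(g, h)\<in>composable G. rho G (gcomp G g h) = gcomp G (rho G g) (rho G h))"

definition real_open_cover ::
    "'a topology \<Rightarrow> ('a \<Rightarrow> 'a) \<Rightarrow> 'j set \<Rightarrow> ('j \<Rightarrow> 'j) \<Rightarrow> ('j \<Rightarrow> 'a set) \<Rightarrow> bool" where
  "real_open_cover X \<sigma> J b U \<longleftrightarrow>
     (\<forall>j\<in>J. openin X (U j) \<and> b j \<in> J \<and> b (b j) = j \<and> U (b j) = \<sigma> ` U j) \<and>
     \<Union> (U ` J) = topspace X"


section \<open>Real line bundles\<close>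

text \<open>
  The data of a hermitian Real line bundle over a groupoid; \<open>vadd\<close> and \<open>smul\<close> are the fibrewise
  vector space operations.
\<close>

record ('l, 'g, 'x) line_bundle =
  total :: "'l topology"
  proj :: "'l \<Rightarrow> 'x"
  vadd :: "'l \<Rightarrow> 'l \<Rightarrow> 'l"
  smul :: "complex \<Rightarrow> 'l \<Rightarrow> 'l"
  nu :: "'l \<Rightarrow> 'l"
  act :: "'g \<Rightarrow> 'l \<Rightarrow> 'l"
  metric :: "'l \<Rightarrow> real"

definition fibre :: "('l, 'g, 'x) line_bundle \<Rightarrow> 'x \<Rightarrow> 'l set" where
  "fibre L x = {v \<in> topspace (total L). proj L v = x}"

definition complex_vector_space_on ::
    "'v set \<Rightarrow> ('v \<Rightarrow> 'v \<Rightarrow> 'v) \<Rightarrow> (complex \<Rightarrow> 'v \<Rightarrow> 'v) \<Rightarrow> bool" where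
  "complex_vector_space_on V add mul \<longleftrightarrow>
     (\<forall>u\<in>V. \<forall>v\<in>V. add u v \<in> V \<and> add u v = add v u) \<and>
     (\<forall>u\<in>V. \<forall>v\<in>V. \<forall>w\<in>V. add (add u v) w = add u (add v w)) \<and>
     (\<exists>z\<in>V. \<forall>v\<in>V. add z v = v \<and> (\<exists>w\<in>V. add v w = z)) \<and>
     (\<forall>a. \<forall>v\<in>V. mul a v \<in> V) \<and>
     (\<forall>a. \<forall>u\<in>V. \<forall>v\<in>V. mul a (add u v) = add (mul a u) (mul a v)) \<and>
     (\<forall>a b. \<forall>v\<in>V. mul (a + b) v = add (mul a v) (mul b v) \<and> mul a (mul b v) = mul (a * b) v) \<and>
     (\<forall>v\<in>V. mul 1 v = v)"

text \<open>Isomorphisms of complex vector bundles from \<open>U \<times> \<complex>\<close> to the restriction of \<open>L\<close> to \<open>U\<close>.\<close>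

definition trivialization ::
    "('g, 'x) real_groupoid \<Rightarrow> ('l, 'g, 'x) line_bundle \<Rightarrow> 'x set \<Rightarrow> ('x \<times> complex \<Rightarrow> 'l) \<Rightarrow> bool" where
  "trivialization G L U \<phi> \<longleftrightarrow>
     homeomorphic_map (prod_topology (subtopology (objects G) U) euclidean)
       (subtopology (total L) {v. proj L v \<in> U}) \<phi> \<and>
     (\<forall>x\<in>U. \<forall>z w. proj L (\<phi> (x, z)) = x \<and>
        vadd L (\<phi> (x, z)) (\<phi> (x, w)) = \<phi> (x, z + w) \<and>
        smul L z (\<phi> (x, w)) = \<phi> (x, z * w))"

definition complex_line_bundle ::
    "('g, 'x) real_groupoid \<Rightarrow> ('l, 'g, 'x) line_bundle \<Rightarrow> bool" where
  "complex_line_bundle G L \<longleftrightarrow>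
     continuous_map (total L) (objects G) (proj L) \<and>
     proj L ` topspace (total L) = topspace (objects G) \<and>
     (\<forall>x\<in>topspace (objects G). complex_vector_space_on (fibre L x) (vadd L) (smul L)) \<and>
     (\<forall>x\<in>topspace (objects G). \<exists>U \<phi>. openin (objects G) U \<and> x \<in> U \<and> trivialization G L U \<phi>)"

definition action_domain ::
    "('g, 'x) real_groupoid \<Rightarrow> ('l, 'g, 'x) line_bundle \<Rightarrow> ('g \<times> 'l) set" where
  "action_domain G L =
     {(g, v). g \<in> topspace (arrows G) \<and> v \<in> topspace (total L) \<and> proj L v = src G g}"

definition continuous_action ::
    "('g, 'x) real_groupoid \<Rightarrow> ('l, 'g, 'x) line_bundle \<Rightarrow> bool" where
  "continuous_action G L \<longleftrightarrow>
     continuous_map (subtopology (prod_topology (arrows G) (total L)) (action_domain G L))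
       (total L) (\<lambda>(g, v). act L g v) \<and>
     (\<forall>(g, v)\<in>action_domain G L. proj L (act L g v) = rng G g) \<and>
     (\<forall>v\<in>topspace (total L). act L (ident G (proj L v)) v = v) \<and>
     (\<forall>g h v. (g, h) \<in> composable G \<and> (h, v) \<in> action_domain G L \<longrightarrow>
        act L (gcomp G g h) v = act L g (act L h v))"

definition real_line_bundle ::
    "('g, 'x) real_groupoid \<Rightarrow> ('l, 'g, 'x) line_bundle \<Rightarrow> bool" where
  "real_line_bundle G L \<longleftrightarrow>
     complex_line_bundle G L \<and> continuous_action G L \<and>
     real_space (total L) (nu L) \<and>
     (\<forall>v\<in>topspace (total L). proj L (nu L v) = rho_obj G (proj L v)) \<and>
     (\<forall>x\<in>topspace (objects G). \<forall>u\<in>fibre L x. \<forall>v\<in>fibre L x. \<forall>a.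
        nu L (vadd L u v) = vadd L (nu L u) (nu L v) \<and>
        nu L (smul L a v) = smul L (cnj a) (nu L v)) \<and>
     (\<forall>(g, v)\<in>action_domain G L. nu L (act L g v) = act L (rho G g) (nu L v))"

text \<open>
  The second condition says that in the chosen trivializations every arrow acts by multiplication
  by a nonzero scalar, \<open>g \<cdot> \<phi>\<^sub>j\<^sub>1(s(g), z) = \<phi>\<^sub>j\<^sub>0(r(g), c z)\<close>, where \<open>c\<close> depends on \<open>g, j\<^sub>0, j\<^sub>1\<close> but
  not on \<open>z\<close>. Demanding \<open>c = 1\<close> here would, applied to units, make the \<open>\<phi>\<^sub>j\<close> agree on overlaps and
  glue to a global equivariant trivialization, so that every locally trivial bundle would be trivial.

  Indexing the cover by a subset of \<open>'x \<times> bool\<close> loses no generality: from a cover with arbitrary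
  index set choose for every object \<open>x\<close> a member \<open>j\<close> containing it, and index by \<open>(x, True)\<close> and
  \<open>(x, False)\<close> the members \<open>j\<close> and \<open>bar j\<close>.
\<close>

definition locally_trivial ::
    "('g, 'x) real_groupoid \<Rightarrow> ('l, 'g, 'x) line_bundle \<Rightarrow> bool" where
  "locally_trivial G L \<longleftrightarrow>
     (\<exists>(J :: ('x \<times> bool) set) b U \<phi>.
        real_open_cover (objects G) (rho_obj G) J b U \<and>
        (\<forall>j\<in>J. trivialization G L (U j) (\<phi> j)) \<and>
        (\<forall>j\<in>J. \<forall>x\<in>U j. \<forall>z. \<phi> (b j) (rho_obj G x, cnj z) = nu L (\<phi> j (x, z))) \<and>
        (\<forall>g\<in>topspace (arrows G). \<forall>j0\<in>J. \<forall>j1\<in>J. rng G g \<in> U j0 \<and> src G g \<in> U j1 \<longrightarrow>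
           (\<exists>c. c \<noteq> 0 \<and> (\<forall>z. act L g (\<phi> j1 (src G g, z)) = \<phi> j0 (rng G g, c * z)))))"

text \<open>\<open>smul L 0 v\<close> is the zero vector of the fibre of \<open>v\<close>.\<close>

definition hermitian_metric ::
    "('g, 'x) real_groupoid \<Rightarrow> ('l, 'g, 'x) line_bundle \<Rightarrow> bool" where
  "hermitian_metric G L \<longleftrightarrow>
     continuous_map (total L) euclideanreal (metric L) \<and>
     (\<forall>v\<in>topspace (total L). metric L v \<ge> 0 \<and> metric L (nu L v) = metric L v \<and>
        (\<forall>z. metric L (smul L z v) = metric L v * (cmod z)\<^sup>2) \<and>
        (v \<noteq> smul L 0 v \<longrightarrow> metric L v > 0)) \<and>
     (\<forall>(g, v)\<in>action_domain G L. metric L (act L g v) = metric L v)"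

definition hermitian_real_line_bundle ::
    "('g, 'x) real_groupoid \<Rightarrow> ('l, 'g, 'x) line_bundle \<Rightarrow> bool" where
  "hermitian_real_line_bundle G L \<longleftrightarrow>
     real_line_bundle G L \<and> locally_trivial G L \<and> hermitian_metric G L"

definition bundle_hom ::
    "('g, 'x) real_groupoid \<Rightarrow> ('l, 'g, 'x) line_bundle \<Rightarrow> ('m, 'g, 'x) line_bundle \<Rightarrow> ('l \<Rightarrow> 'm) \<Rightarrow> bool"
  where
  "bundle_hom G L M f \<longleftrightarrow>
     continuous_map (total L) (total M) f \<and>
     (\<forall>v\<in>topspace (total L). proj M (f v) = proj L v \<and> f (nu L v) = nu M (f v)) \<and>
     (\<forall>x\<in>topspace (objects G). \<forall>u\<in>fibre L x. \<forall>v\<in>fibre L x. \<forall>a.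
        f (vadd L u v) = vadd M (f u) (f v) \<and> f (smul L a v) = smul M a (f v)) \<and>
     (\<forall>(g, v)\<in>action_domain G L. f (act L g v) = act M g (f v))"

definition bundle_isomorphic ::
    "('g, 'x) real_groupoid \<Rightarrow> ('l, 'g, 'x) line_bundle \<Rightarrow> ('m, 'g, 'x) line_bundle \<Rightarrow> bool" where
  "bundle_isomorphic G L M \<longleftrightarrow>
     (\<exists>f f'. bundle_hom G L M f \<and> bundle_hom G M L f' \<and>
        (\<forall>v\<in>topspace (total L). f' (f v) = v) \<and> (\<forall>w\<in>topspace (total M). f (f' w) = w))"

definition trivial_bundle ::
    "('g, 'x) real_groupoid \<Rightarrow> ('x \<times> complex, 'g, 'x) line_bundle" where
  "trivial_bundle G =
     \<lparr>total = prod_topology (objects G) euclidean,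
      proj = fst,
      vadd = (\<lambda>(x, z) (y, w). (x, z + w)),
      smul = (\<lambda>a (x, z). (x, a * z)),
      nu = (\<lambda>(x, z). (rho_obj G x, cnj z)),
      act = (\<lambda>g (x, z). (rng G g, z)),
      metric = (\<lambda>(x, z). (cmod z)\<^sup>2)\<rparr>"

definition fibre_product :: "('l, 'g, 'x) line_bundle \<Rightarrow> ('m, 'g, 'x) line_bundle \<Rightarrow> ('l \<times> 'm) set" where
  "fibre_product L M =
     {(v, w). v \<in> topspace (total L) \<and> w \<in> topspace (total M) \<and> proj L v = proj M w}"

definition bilinear_form_on ::
    "('l, 'g, 'x) line_bundle \<Rightarrow> ('m, 'g, 'x) line_bundle \<Rightarrow> 'x \<Rightarrow> ('l \<Rightarrow> 'm \<Rightarrow> complex) \<Rightarrow> bool" where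
  "bilinear_form_on L M x \<beta> \<longleftrightarrow>
     (\<forall>v\<in>fibre L x. \<forall>v'\<in>fibre L x. \<forall>w\<in>fibre M x. \<forall>w'\<in>fibre M x. \<forall>a.
        \<beta> (vadd L v v') w = \<beta> v w + \<beta> v' w \<and> \<beta> v (vadd M w w') = \<beta> v w + \<beta> v w' \<and>
        \<beta> (smul L a v) w = a * \<beta> v w \<and> \<beta> v (smul M a w) = a * \<beta> v w)"

definition linear_form_on :: "('l, 'g, 'x) line_bundle \<Rightarrow> 'x \<Rightarrow> ('l \<Rightarrow> complex) \<Rightarrow> bool" where
  "linear_form_on L x f \<longleftrightarrow>
     (\<forall>v\<in>fibre L x. \<forall>w\<in>fibre L x. \<forall>a. f (vadd L v w) = f v + f w \<and> f (smul L a v) = a * f v)"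

text \<open>
  \<open>T\<close> is a tensor product of \<open>L\<close> and \<open>M\<close> via a continuous, fibrewise bilinear and fibrewise universal
  map \<open>(v, w) \<mapsto> v \<otimes> w\<close>; Real structure, action and metric are the diagonal ones. Fibrewise, the
  universal property for complex-valued bilinear forms implies the one for arbitrary targets.
\<close>

definition is_tensor_product ::
    "('g, 'x) real_groupoid \<Rightarrow> ('l, 'g, 'x) line_bundle \<Rightarrow> ('m, 'g, 'x) line_bundle \<Rightarrow>
     ('t, 'g, 'x) line_bundle \<Rightarrow> bool" where
  "is_tensor_product G L M T \<longleftrightarrow> hermitian_real_line_bundle G T \<and>
     (\<exists>t. continuous_map (subtopology (prod_topology (total L) (total M)) (fibre_product L M))
            (total T) (\<lambda>(v, w). t v w) \<and>
        (\<forall>(v, w)\<in>fibre_product L M. proj T (t v w) = proj L v \<and>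
           nu T (t v w) = t (nu L v) (nu M w) \<and> metric T (t v w) = metric L v * metric M w) \<and>
        (\<forall>g v w. (g, v) \<in> action_domain G L \<and> (g, w) \<in> action_domain G M \<longrightarrow>
           act T g (t v w) = t (act L g v) (act M g w)) \<and>
        (\<forall>x\<in>topspace (objects G).
           (\<forall>v\<in>fibre L x. \<forall>v'\<in>fibre L x. \<forall>w\<in>fibre M x. \<forall>w'\<in>fibre M x. \<forall>a.
              t (vadd L v v') w = vadd T (t v w) (t v' w) \<and>
              t v (vadd M w w') = vadd T (t v w) (t v w') \<and>
              t (smul L a v) w = smul T a (t v w) \<and> t v (smul M a w) = smul T a (t v w)) \<and>
           (\<forall>\<beta>. bilinear_form_on L M x \<beta> \<longrightarrow>
              (\<exists>!f. f \<in> extensional (fibre T x) \<and> linear_form_on T x f \<and>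
                 (\<forall>v\<in>fibre L x. \<forall>w\<in>fibre M x. f (t v w) = \<beta> v w)))))"

text \<open>
  Total spaces are taken in an arbitrary but fixed type \<open>'l\<close>, which plays the role of the universe.
  As soon as \<open>X \<times> \<complex>\<close> injects into \<open>'l\<close>, every line bundle over \<open>X\<close>, whatever the type of its total
  space, is isomorphic to one whose total space is in \<open>'l\<close>.
\<close>

definition PicR :: "'l itself \<Rightarrow> ('g, 'x) real_groupoid \<Rightarrow> ('l, 'g, 'x) line_bundle set monoid" where
  "PicR _ G =
     \<lparr>carrier = {L :: ('l, 'g, 'x) line_bundle. hermitian_real_line_bundle G L} //
        {(L, M). hermitian_real_line_bundle G L \<and> hermitian_real_line_bundle G M \<and>
                 bundle_isomorphic G L M},
      mult = (\<lambda>A B. {T. hermitian_real_line_bundle G T \<and>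
        (\<exists>L\<in>A. \<exists>M\<in>B. \<exists>T' :: ('l, 'g, 'x) line_bundle.
           is_tensor_product G L M T' \<and> bundle_isomorphic G T T')}),
      one = {L. hermitian_real_line_bundle G L \<and> bundle_isomorphic G L (trivial_bundle G)}\<rparr>"


section \<open>Real Cech cohomology\<close>

text \<open>
  The maps \<open>[m] \<rightarrow> [n]\<close> of the simplicial category (\<open>hom_Delta\<close>) and of its subcategory of strictly
  increasing maps (\<open>hom_Delta'\<close>), with \<open>[n] = {..n}\<close>; for \<open>k \<le> n\<close> the set \<open>hom_Delta' k n\<close> is the set
  denoted \<open>P\<close> with indices \<open>n, k\<close>.
\<close>

definition hom_Delta :: "nat \<Rightarrow> nat \<Rightarrow> (nat \<Rightarrow> nat) set" where
  "hom_Delta m n = {f \<in> {..m} \<rightarrow>\<^sub>E {..n}. mono_on {..m} f}"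

definition hom_Delta' :: "nat \<Rightarrow> nat \<Rightarrow> (nat \<Rightarrow> nat) set" where
  "hom_Delta' m n = {f \<in> {..m} \<rightarrow>\<^sub>E {..n}. strict_mono_on {..m} f}"

definition omit :: "nat \<Rightarrow> nat \<Rightarrow> nat \<Rightarrow> nat" where
  "omit n k = (\<lambda>i\<in>{..n}. if i < k then i else Suc i)"

text \<open>
  The space \<open>G\<^sub>n\<close>, an element being identified with a functor from the pair groupoid of \<open>[n]\<close>: the
  chain \<open>(g\<^sub>1, \<dots>, g\<^sub>n)\<close> corresponds to the functor with \<open>\<gamma> (i - 1, i) = g\<^sub>i\<close>. All entries of \<open>\<gamma>\<close> depend
  continuously on the chain, so that the topology below is the usual one. For \<open>n = 0\<close> this
  is \<open>X\<close>, embedded via its identity arrows.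
\<close>

definition nerve_set :: "('g, 'x) real_groupoid \<Rightarrow> nat \<Rightarrow> (nat \<times> nat \<Rightarrow> 'g) set" where
  "nerve_set G n =
     {\<gamma> \<in> {..n} \<times> {..n} \<rightarrow>\<^sub>E topspace (arrows G).
        (\<forall>i\<le>n. \<gamma> (i, i) \<in> ident G ` topspace (objects G)) \<and>
        (\<forall>i\<le>n. \<forall>j\<le>n. \<forall>k\<le>n. src G (\<gamma> (i, j)) = rng G (\<gamma> (j, k)) \<and>
           \<gamma> (i, k) = gcomp G (\<gamma> (i, j)) (\<gamma> (j, k)))}"

definition nerve :: "('g, 'x) real_groupoid \<Rightarrow> nat \<Rightarrow> (nat \<times> nat \<Rightarrow> 'g) topology" where
  "nerve G n = subtopology (product_topology (\<lambda>_. arrows G) ({..n} \<times> {..n})) (nerve_set G n)"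

definition rho_nerve ::
    "('g, 'x) real_groupoid \<Rightarrow> nat \<Rightarrow> (nat \<times> nat \<Rightarrow> 'g) \<Rightarrow> (nat \<times> nat \<Rightarrow> 'g)" where
  "rho_nerve G n \<gamma> = (\<lambda>p\<in>{..n} \<times> {..n}. rho G (\<gamma> p))"

text \<open>\<open>pull m f\<close> is the map \<open>G\<^sub>n \<rightarrow> G\<^sub>m\<close> induced by \<open>f : [m] \<rightarrow> [n]\<close>.\<close>

definition pull :: "nat \<Rightarrow> (nat \<Rightarrow> nat) \<Rightarrow> (nat \<times> nat \<Rightarrow> 'g) \<Rightarrow> (nat \<times> nat \<Rightarrow> 'g)" where
  "pull m f \<gamma> = (\<lambda>p\<in>{..m} \<times> {..m}. \<gamma> (f (fst p), f (snd p)))"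

text \<open>
  A sequence of covers together with a truncated simplicial structure on its index sets:
  \<open>cidx U n\<close>, \<open>cbar U n\<close> and \<open>copn U n\<close> are the index set, its involution and the open sets in degree
  \<open>n\<close>; the structure is \<open>clevel U\<close>-truncated, and \<open>cface U m p f\<close> is the map from \<open>cidx U p\<close> to
  \<open>cidx U m\<close> induced by \<open>f : [m] \<rightarrow> [p]\<close>.
\<close>

record ('i, 'g) cover_seq =
  cidx :: "nat \<Rightarrow> 'i set"
  cbar :: "nat \<Rightarrow> 'i \<Rightarrow> 'i"
  copn :: "nat \<Rightarrow> 'i \<Rightarrow> (nat \<times> nat \<Rightarrow> 'g) set"
  clevel :: nat
  cface :: "nat \<Rightarrow> nat \<Rightarrow> (nat \<Rightarrow> nat) \<Rightarrow> 'i \<Rightarrow> 'i"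

definition real_cover_seq :: "('g, 'x) real_groupoid \<Rightarrow> ('i, 'g) cover_seq \<Rightarrow> bool" where
  "real_cover_seq G U \<longleftrightarrow>
     (\<forall>n. real_open_cover (nerve G n) (rho_nerve G n) (cidx U n) (cbar U n) (copn U n))"

definition simplicial_cover :: "('i, 'g) cover_seq \<Rightarrow> bool" where
  "simplicial_cover U \<longleftrightarrow>
     (\<forall>m p. m \<le> clevel U \<and> p \<le> clevel U \<longrightarrow>
        (\<forall>f\<in>hom_Delta m p. \<forall>j\<in>cidx U p.
           cface U m p f j \<in> cidx U m \<and>
           cface U m p f (cbar U p j) = cbar U m (cface U m p f j) \<and>
           pull m f ` copn U p j \<subseteq> copn U m (cface U m p f j))) \<and>
     (\<forall>p\<le>clevel U. \<forall>j\<in>cidx U p. cface U p p (\<lambda>i\<in>{..p}. i) j = j) \<and>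
     (\<forall>l m p. l \<le> clevel U \<and> m \<le> clevel U \<and> p \<le> clevel U \<longrightarrow>
        (\<forall>e\<in>hom_Delta l m. \<forall>f\<in>hom_Delta m p. \<forall>j\<in>cidx U p.
           cface U l p (compose {..l} f e) j = cface U l m e (cface U m p f j)))"

definition cover_system :: "('g, 'x) real_groupoid \<Rightarrow> nat \<Rightarrow> ('i, 'g) cover_seq set" where
  "cover_system G n = {U. real_cover_seq G U \<and> simplicial_cover U \<and> n + 1 \<le> clevel U}"

text \<open>
  \<open>\<theta>\<close> exhibits \<open>V\<close> as finer than \<open>U\<close>; it is required to be \<open>N\<close>-simplicial for some \<open>N \<ge> n + 1\<close> for
  which both covers are, a condition stable under composition.
\<close>

definition refinement ::
    "nat \<Rightarrow> ('i, 'g) cover_seq \<Rightarrow> ('i, 'g) cover_seq \<Rightarrow> (nat \<Rightarrow> 'i \<Rightarrow> 'i) \<Rightarrow> bool" where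
  "refinement n V U \<theta> \<longleftrightarrow>
     (\<forall>k. \<forall>i\<in>cidx V k. \<theta> k i \<in> cidx U k \<and> \<theta> k (cbar V k i) = cbar U k (\<theta> k i) \<and>
        copn V k i \<subseteq> copn U k (\<theta> k i)) \<and>
     (\<exists>N. n + 1 \<le> N \<and> N \<le> clevel V \<and> N \<le> clevel U \<and>
        (\<forall>m p. m \<le> N \<and> p \<le> N \<longrightarrow>
           (\<forall>f\<in>hom_Delta m p. \<forall>i\<in>cidx V p.
              \<theta> m (cface V m p f i) = cface U m p f (\<theta> p i))))"

text \<open>
  The elements of \<open>\<Lambda>\<^sub>n\<close>, with \<open>\<lambda> k \<phi>\<close> for the value at \<open>\<phi> : [k] \<rightarrow> [n]\<close>. The degree \<open>k\<close> is a separate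
  argument because extensional functions do not determine their domain.
\<close>

type_synonym 'i multi_index = "nat \<Rightarrow> (nat \<Rightarrow> nat) \<Rightarrow> 'i"

definition Lam :: "('i, 'g) cover_seq \<Rightarrow> nat \<Rightarrow> 'i multi_index set" where
  "Lam U n = (\<Pi>\<^sub>E k\<in>{..n}. hom_Delta' k n \<rightarrow>\<^sub>E cidx U k)"

definition Lam_bar :: "('i, 'g) cover_seq \<Rightarrow> nat \<Rightarrow> 'i multi_index \<Rightarrow> 'i multi_index" where
  "Lam_bar U n l = (\<lambda>k\<in>{..n}. \<lambda>\<phi>\<in>hom_Delta' k n. cbar U k (l k \<phi>))"

definition Lam_pull :: "nat \<Rightarrow> (nat \<Rightarrow> nat) \<Rightarrow> 'i multi_index \<Rightarrow> 'i multi_index" where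
  "Lam_pull m f l = (\<lambda>k\<in>{..m}. \<lambda>\<phi>\<in>hom_Delta' k m. l k (compose {..k} f \<phi>))"

definition Lam_map :: "nat \<Rightarrow> (nat \<Rightarrow> 'i \<Rightarrow> 'i) \<Rightarrow> 'i multi_index \<Rightarrow> 'i multi_index" where
  "Lam_map n \<theta> l = (\<lambda>k\<in>{..n}. \<lambda>\<phi>\<in>hom_Delta' k n. \<theta> k (l k \<phi>))"

definition Lam_set ::
    "('g, 'x) real_groupoid \<Rightarrow> ('i, 'g) cover_seq \<Rightarrow> nat \<Rightarrow> 'i multi_index \<Rightarrow> (nat \<times> nat \<Rightarrow> 'g) set" where
  "Lam_set G U n l =
     {\<gamma> \<in> topspace (nerve G n). \<forall>k\<le>n. \<forall>\<phi>\<in>hom_Delta' k n. pull k \<phi> \<gamma> \<in> copn U k (l k \<phi>)}"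

text \<open>Topological groups with an involution, written multiplicatively.\<close>

record 's real_group = "'s monoid" +
  gtop :: "'s topology"
  gbar :: "'s \<Rightarrow> 's"

definition circle_group :: "complex real_group" where
  "circle_group =
     \<lparr>carrier = sphere 0 1, mult = (*), one = 1, gtop = top_of_set (sphere 0 1), gbar = cnj\<rparr>"

type_synonym ('i, 'g, 's) cochain = "'i multi_index \<Rightarrow> (nat \<times> nat \<Rightarrow> 'g) \<Rightarrow> 's"

definition CR ::
    "('g, 'x) real_groupoid \<Rightarrow> 's real_group \<Rightarrow> ('i, 'g) cover_seq \<Rightarrow> nat \<Rightarrow> ('i, 'g, 's) cochain monoid"
  where
  "CR G S U n =
     \<lparr>carrier = {c \<in> (\<Pi>\<^sub>E l\<in>Lam U n. extensional (Lam_set G U n l)).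
        \<forall>l\<in>Lam U n. continuous_map (subtopology (nerve G n) (Lam_set G U n l)) (gtop S) (c l) \<and>
          (\<forall>\<gamma>\<in>Lam_set G U n l. c (Lam_bar U n l) (rho_nerve G n \<gamma>) = gbar S (c l \<gamma>))},
      mult = (\<lambda>c d. \<lambda>l\<in>Lam U n. \<lambda>\<gamma>\<in>Lam_set G U n l. c l \<gamma> \<otimes>\<^bsub>S\<^esub> d l \<gamma>),
      one = (\<lambda>l\<in>Lam U n. \<lambda>\<gamma>\<in>Lam_set G U n l. \<one>\<^bsub>S\<^esub>)\<rparr>"

definition differential ::
    "('g, 'x) real_groupoid \<Rightarrow> 's real_group \<Rightarrow> ('i, 'g) cover_seq \<Rightarrow> nat \<Rightarrow>
     ('i, 'g, 's) cochain \<Rightarrow> ('i, 'g, 's) cochain" where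
  "differential G S U n c =
     (\<lambda>l\<in>Lam U (Suc n). \<lambda>\<gamma>\<in>Lam_set G U (Suc n) l.
        \<Otimes>\<^bsub>S\<^esub>k\<in>{..Suc n}. c (Lam_pull n (omit n k) l) (pull n (omit n k) \<gamma>) [^]\<^bsub>S\<^esub> ((-1) ^ k :: int))"

definition cocycles ::
    "('g, 'x) real_groupoid \<Rightarrow> 's real_group \<Rightarrow> ('i, 'g) cover_seq \<Rightarrow> nat \<Rightarrow> ('i, 'g, 's) cochain set" where
  "cocycles G S U n = kernel (CR G S U n) (CR G S U (Suc n)) (differential G S U n)"

definition coboundaries ::
    "('g, 'x) real_groupoid \<Rightarrow> 's real_group \<Rightarrow> ('i, 'g) cover_seq \<Rightarrow> nat \<Rightarrow> ('i, 'g, 's) cochain set" where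
  "coboundaries G S U n =
     (case n of 0 \<Rightarrow> {\<one>\<^bsub>CR G S U 0\<^esub>} | Suc m \<Rightarrow> differential G S U m ` carrier (CR G S U m))"

definition HR ::
    "('g, 'x) real_groupoid \<Rightarrow> 's real_group \<Rightarrow> ('i, 'g) cover_seq \<Rightarrow> nat \<Rightarrow>
     ('i, 'g, 's) cochain set monoid" where
  "HR G S U n = (CR G S U n)\<lparr>carrier := cocycles G S U n\<rparr> Mod coboundaries G S U n"

definition cochain_restrict ::
    "('g, 'x) real_groupoid \<Rightarrow> ('i, 'g) cover_seq \<Rightarrow> nat \<Rightarrow> (nat \<Rightarrow> 'i \<Rightarrow> 'i) \<Rightarrow>
     ('i, 'g, 's) cochain \<Rightarrow> ('i, 'g, 's) cochain" where
  "cochain_restrict G V n \<theta> c = (\<lambda>l\<in>Lam V n. \<lambda>\<gamma>\<in>Lam_set G V n l. c (Lam_map n \<theta> l) \<gamma>)"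

text \<open>
  The map \<open>HR(U) \<rightarrow> HR(V)\<close> induced by a refinement \<open>V\<close> of \<open>U\<close>; it does not depend on the choice of
  \<open>\<theta>\<close>. Classes are cosets of the group of coboundaries.
\<close>

definition HR_restrict ::
    "('g, 'x) real_groupoid \<Rightarrow> 's real_group \<Rightarrow> nat \<Rightarrow> ('i, 'g) cover_seq \<Rightarrow> ('i, 'g) cover_seq \<Rightarrow>
     ('i, 'g, 's) cochain set \<Rightarrow> ('i, 'g, 's) cochain set" where
  "HR_restrict G S n U V A =
     (\<Union>c\<in>A. coboundaries G S V n #>\<^bsub>CR G S V n\<^esub>
        cochain_restrict G V n (SOME \<theta>. refinement n V U \<theta>) c)"

text \<open>
  The direct limit of the groups \<open>H i\<close>, \<open>i \<in> I\<close>, over a directed preorder \<open>prec\<close>, along the maps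
  \<open>r i j : H i \<rightarrow> H j\<close> for \<open>prec i j\<close>: classes of pairs \<open>(i, x)\<close> that become equal at a later stage.
\<close>

definition direct_limit ::
    "'i set \<Rightarrow> ('i \<Rightarrow> 'i \<Rightarrow> bool) \<Rightarrow> ('i \<Rightarrow> 'a monoid) \<Rightarrow> ('i \<Rightarrow> 'i \<Rightarrow> 'a \<Rightarrow> 'a) \<Rightarrow> ('i \<times> 'a) set monoid"
  where
  "direct_limit I prec H r =
     \<lparr>carrier = (SIGMA i:I. carrier (H i)) //
        {((i, x), (j, y)). i \<in> I \<and> x \<in> carrier (H i) \<and> j \<in> I \<and> y \<in> carrier (H j) \<and>
           (\<exists>m\<in>I. prec i m \<and> prec j m \<and> r i m x = r j m y)},
      mult = (\<lambda>A B. {(k, z). k \<in> I \<and> z \<in> carrier (H k) \<and>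
        (\<exists>(i, x)\<in>A. \<exists>(j, y)\<in>B. \<exists>m\<in>I. prec i m \<and> prec j m \<and> prec k m \<and>
           r k m z = r i m x \<otimes>\<^bsub>H m\<^esub> r j m y)}),
      one = {(k, z). k \<in> I \<and> z \<in> carrier (H k) \<and> (\<exists>m\<in>I. prec k m \<and> r k m z = \<one>\<^bsub>H m\<^esub>)}\<rparr>"

text \<open>
  As for total spaces of bundles, index sets of covers are taken in a fixed type \<open>'i\<close>. If \<open>'i\<close> is
  infinite and \<open>X\<close> injects into it, the covers indexed in \<open>'i\<close> are cofinal among all covers as far
  as the limit in degree one is concerned.
\<close>

definition CechHR ::
    "'i itself \<Rightarrow> ('g, 'x) real_groupoid \<Rightarrow> 's real_group \<Rightarrow> nat \<Rightarrow>
     (('i, 'g) cover_seq \<times> ('i, 'g, 's) cochain set) set monoid" where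
  "CechHR _ G S n =
     direct_limit (cover_system G n :: ('i, 'g) cover_seq set) (\<lambda>U V. \<exists>\<theta>. refinement n V U \<theta>)
       (\<lambda>U. HR G S U n) (HR_restrict G S n)"

text \<open>Types satisfying the size conditions on \<open>'l\<close> and \<open>'i\<close> always exist.\<close>

lemma universe_bundles_example:
  "topspace (objects (G :: ('g, 'x) real_groupoid)) \<times> (UNIV :: complex set) \<lesssim> (UNIV :: ('x \<times> complex) set)"
  by (rule subset_imp_lepoll) simp

lemma universe_covers_example:
  "infinite (UNIV :: 'x list set)"
  "topspace (objects (G :: ('g, 'x) real_groupoid)) \<lesssim> (UNIV :: 'x list set)"
  unfolding lepoll_def by (auto simp: infinite_UNIV_listI inj_on_def intro: exI [of _ "\<lambda>x. [x]"])

end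

theory Submission
  imports Defs
begin

text \<open>
  A hermitian Real line bundle is described by unit sections over a Real cover of the object space:
  comparing them along arrows gives a Real 1-cocycle on \<open>\<G>\<close> with values in the circle, and a change of
  sections changes the cocycle by a coboundary. Conversely a cocycle glues to a bundle, whose
  isomorphism class consists of the hermitian bundles admitting sections with this cocycle (an
  isomorphism can be made isometric because metrics differ by a positive invariant Real function).
  Tensor products multiply cocycles, hence the group laws, by passing to common refinements.

  A Cech cocycle of degree one, evaluated on degenerate 2-chains, turns out not to depend on the member
  of the cover of \<open>\<G>\<^sub>1\<close>, so it is the same as a cocycle on the cover of \<open>X\<close>. Two classes over different
  covers agree in the limit iff they define the same bundle, since over a common refinement both
  cocycles belong to that bundle; and every Real cover of \<open>X\<close> comes from a simplicial one, given in
  degree \<open>n\<close> by the intersections of the preimages under the \<open>n + 1\<close> vertex maps.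
\<close>


section \<open>Topological preliminaries\<close>

text \<open>Different covers are compared through one device: \<open>cls G C c\<close>, the set of
  all bundles presented by the cocycle \<open>c\<close>, has a type that does not mention the index
  type of \<open>C\<close>. It is a full isomorphism class, so cocycles over unrelated covers have
  equal classes as soon as one bundle has frames for both. Independence of the refining map,
  well-definedness of restriction and the description of the relation in the direct limit follow by
  mapping everything injectively into the Picard group; no cochain homotopy is built. Injectivity
  holds cover by cover, since two frames over the same cover differ by a 0-cochain on that very
  cover.

  Two size constraints shape the constructions. The total space of a bundle must lie in
  \<open>'l\<close>, so bundles are glued on a copy of the product of the object space with the
  complex numbers, not on a quotient of a disjoint union. Covers must be indexed in
  \<open>'i\<close>, so they are cut down to two indices per object, and pairs and tuples of indices
  are coded by a bijection between \<open>'i \<times> 'i\<close> and \<open>'i\<close>.\<close>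

lemma continuous_map_locally:
  assumes "\<And>x. x \<in> topspace X \<Longrightarrow> \<exists>U. openin X U \<and> x \<in> U \<and> continuous_map (subtopology X U) Y f"
  shows "continuous_map X Y f"
proof -
  obtain U where U: "\<And>x. x \<in> topspace X \<Longrightarrow>
      openin X (U x) \<and> x \<in> U x \<and> continuous_map (subtopology X (U x)) Y f"
    using assms by metis
  show ?thesis
  proof (rule pasting_lemma [where T = U and I = "topspace X" and f = "\<lambda>_. f"])
    show "\<exists>j. j \<in> topspace X \<and> x \<in> U j \<and> f x = f x" if "x \<in> topspace X" for x
      using that U by blast
  qed (use U in auto)
qed

lemma continuous_map_into_subtopology_compose:
  assumes "continuous_map X Y f" "continuous_map (subtopology Y S) Z g" "f ` topspace X \<subseteq> S"
  shows "continuous_map X Z (\<lambda>x. g (f x))"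
  using continuous_map_compose [of X "subtopology Y S" f Z g] assms
  by (auto simp: continuous_map_in_subtopology o_def)

lemma continuous_map_in_topspace:
  "continuous_map X Y f \<Longrightarrow> x \<in> topspace X \<Longrightarrow> f x \<in> topspace Y"
  by (meson continuous_map_image_subset_topspace image_subset_iff)

lemma continuous_map_mult:
  fixes f g :: "'a \<Rightarrow> complex"
  shows "\<lbrakk>continuous_map X euclidean f; continuous_map X euclidean g\<rbrakk> \<Longrightarrow> continuous_map X euclidean (\<lambda>x. f x * g x)"
  by (simp add: continuous_map_atin limitin_canonical_iff tendsto_mult)

lemma continuous_map_divide:
  fixes f g :: "'a \<Rightarrow> complex"
  shows "\<lbrakk>continuous_map X euclidean f; continuous_map X euclidean g; \<And>x. x \<in> topspace X \<Longrightarrow> g x \<noteq> 0\<rbrakk>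
    \<Longrightarrow> continuous_map X euclidean (\<lambda>x. f x / g x)"
  by (simp add: continuous_map_atin limitin_canonical_iff tendsto_divide)

lemma continuous_map_cnj:
  "continuous_map X euclidean f \<Longrightarrow> continuous_map X euclidean (\<lambda>x. cnj (f x))"
  by (simp add: continuous_map_atin limitin_canonical_iff tendsto_cnj)

text \<open>This is the factor that normalises a nowhere vanishing section to length one. It is
  stated with complex values because it enters through scalar multiplication.\<close>

lemma continuous_map_inverse_sqrt:
  assumes "continuous_map X euclideanreal f" "\<And>x. x \<in> topspace X \<Longrightarrow> f x > 0"
  shows "continuous_map X euclidean (\<lambda>x. complex_of_real (1 / sqrt (f x)))"
proof -
  have "f x \<noteq> 0" if "x \<in> topspace X" for x
    using assms(2) [OF that] by simp
  then show ?thesis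
    using assms(1)
    by (auto simp: continuous_map_atin limitin_canonical_iff simp del: of_real_divide
        intro!: tendsto_of_real tendsto_divide tendsto_real_sqrt)
qed

section \<open>Real groupoids\<close>

text \<open>The range comes first so that products behave like matrix entries:
  \<open>edges G U V\<close> times \<open>edges G V W\<close> lands in
  \<open>edges G U W\<close>.\<close>

definition edges :: "('g, 'x) real_groupoid \<Rightarrow> 'x set \<Rightarrow> 'x set \<Rightarrow> 'g set" where
  "edges G U V = {g \<in> topspace (arrows G). rng G g \<in> U \<and> src G g \<in> V}"

locale real_grpd =
  fixes G :: "('g, 'x) real_groupoid"
  assumes lch: "lch_real_groupoid G"
begin

abbreviation "Ob \<equiv> topspace (objects G)"
abbreviation "Ar \<equiv> topspace (arrows G)"

lemma tg: "topological_groupoid G"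
  using lch unfolding lch_real_groupoid_def by blast

lemma cont_src: "continuous_map (arrows G) (objects G) (src G)"
  and cont_rng: "continuous_map (arrows G) (objects G) (rng G)"
  and cont_ident: "continuous_map (objects G) (arrows G) (ident G)"
  and cont_ginv: "continuous_map (arrows G) (arrows G) (ginv G)"
  and cont_gcomp: "continuous_map (subtopology (prod_topology (arrows G) (arrows G)) (composable G))
       (arrows G) (\<lambda>(g, h). gcomp G g h)"
  using tg unfolding topological_groupoid_def by blast+

lemma cont_rho: "continuous_map (arrows G) (arrows G) (rho G)"
  using lch unfolding lch_real_groupoid_def by (auto dest: homeomorphic_imp_continuous_map)

lemma src_in [simp]: "g \<in> Ar \<Longrightarrow> src G g \<in> Ob"
  and rng_in [simp]: "g \<in> Ar \<Longrightarrow> rng G g \<in> Ob"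
  and ident_in [simp]: "x \<in> Ob \<Longrightarrow> ident G x \<in> Ar"
  and ginv_in [simp]: "g \<in> Ar \<Longrightarrow> ginv G g \<in> Ar"
  and rho_in [simp]: "g \<in> Ar \<Longrightarrow> rho G g \<in> Ar"
  by (rule continuous_map_in_topspace [OF cont_src] continuous_map_in_topspace [OF cont_rng]
      continuous_map_in_topspace [OF cont_ident] continuous_map_in_topspace [OF cont_ginv]
      continuous_map_in_topspace [OF cont_rho], assumption)+

lemma gcomp_in [simp]: "\<lbrakk>g \<in> Ar; h \<in> Ar; src G g = rng G h\<rbrakk> \<Longrightarrow> gcomp G g h \<in> Ar"
  using continuous_map_image_subset_topspace [OF cont_gcomp, THEN subsetD, OF imageI, of "(g, h)"]
  by (simp add: composable_def)

lemma src_ident [simp]: "x \<in> Ob \<Longrightarrow> src G (ident G x) = x"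
  and rng_ident [simp]: "x \<in> Ob \<Longrightarrow> rng G (ident G x) = x"
  and src_gcomp [simp]: "\<lbrakk>g \<in> Ar; h \<in> Ar; src G g = rng G h\<rbrakk> \<Longrightarrow> src G (gcomp G g h) = src G h"
  and rng_gcomp [simp]: "\<lbrakk>g \<in> Ar; h \<in> Ar; src G g = rng G h\<rbrakk> \<Longrightarrow> rng G (gcomp G g h) = rng G g"
  and gcomp_assoc: "\<lbrakk>g \<in> Ar; h \<in> Ar; k \<in> Ar; src G g = rng G h; src G h = rng G k\<rbrakk> \<Longrightarrow>
        gcomp G (gcomp G g h) k = gcomp G g (gcomp G h k)"
  and ident_gcomp [simp]: "\<lbrakk>g \<in> Ar; x = rng G g\<rbrakk> \<Longrightarrow> gcomp G (ident G x) g = g"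
  and gcomp_ident [simp]: "\<lbrakk>g \<in> Ar; x = src G g\<rbrakk> \<Longrightarrow> gcomp G g (ident G x) = g"
  and src_ginv [simp]: "g \<in> Ar \<Longrightarrow> src G (ginv G g) = rng G g"
  and rng_ginv [simp]: "g \<in> Ar \<Longrightarrow> rng G (ginv G g) = src G g"
  and gcomp_ginv [simp]: "g \<in> Ar \<Longrightarrow> gcomp G g (ginv G g) = ident G (rng G g)"
  and ginv_gcomp [simp]: "g \<in> Ar \<Longrightarrow> gcomp G (ginv G g) g = ident G (src G g)"
  using tg unfolding topological_groupoid_def composable_def by auto

lemma rho_rho [simp]: "g \<in> Ar \<Longrightarrow> rho G (rho G g) = g"
  and src_rho [simp]: "g \<in> Ar \<Longrightarrow> src G (rho G g) = rho_obj G (src G g)"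
  and rng_rho [simp]: "g \<in> Ar \<Longrightarrow> rng G (rho G g) = rho_obj G (rng G g)"
  and rho_ident [simp]: "x \<in> Ob \<Longrightarrow> rho G (ident G x) = ident G (rho_obj G x)"
  and rho_gcomp [simp]: "\<lbrakk>g \<in> Ar; h \<in> Ar; src G g = rng G h\<rbrakk> \<Longrightarrow>
        rho G (gcomp G g h) = gcomp G (rho G g) (rho G h)"
  using lch unfolding lch_real_groupoid_def composable_def by auto

lemma rho_obj_in [simp]: "x \<in> Ob \<Longrightarrow> rho_obj G x \<in> Ob"
  unfolding rho_obj_def by (intro src_in rho_in ident_in)

lemma rho_obj_rho_obj [simp]: "x \<in> Ob \<Longrightarrow> rho_obj G (rho_obj G x) = x"
  by (metis ident_in rho_ident rho_rho src_ident rho_obj_in src_rho)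

lemma cont_rho_obj: "continuous_map (objects G) (objects G) (rho_obj G)"
  unfolding rho_obj_def
  using continuous_map_compose [OF continuous_map_compose [OF cont_ident cont_rho] cont_src]
  by (simp add: o_def)

lemma Hausdorff_objects: "Hausdorff_space (objects G)"
  and locally_compact_objects: "locally_compact_space (objects G)"
  using lch unfolding lch_real_groupoid_def lch_space_def by auto

lemma openin_edges:
  assumes "openin (objects G) U" "openin (objects G) V"
  shows "openin (arrows G) (edges G U V)"
proof -
  have "edges G U V = {g \<in> Ar. rng G g \<in> U} \<inter> {g \<in> Ar. src G g \<in> V}"
    by (auto simp: edges_def)
  then show ?thesis
    using openin_continuous_map_preimage [OF cont_rng assms(1)]
      openin_continuous_map_preimage [OF cont_src assms(2)] by (simp only: openin_Int)
qed

end

section \<open>Coordinates in hermitian line bundles\<close>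

text \<open>Junk unless \<open>u\<close> is a nonzero vector in the fibre of \<open>v\<close>.\<close>

definition coord :: "('l, 'g, 'x) line_bundle \<Rightarrow> 'l \<Rightarrow> 'l \<Rightarrow> complex" where
  "coord L u v = (THE z. v = smul L z u)"

text \<open>A trivialization preserves fibres, so the first component of its inverse is forced to be
  \<open>proj L\<close>; the second component is the coordinate \<open>a\<close>.\<close>

lemma trivialization_coordinate:
  assumes "trivialization G L U \<phi>" "U \<subseteq> topspace (objects G)"
  obtains a where "continuous_map (subtopology (total L) {v. proj L v \<in> U}) euclidean a"
    "\<And>v. v \<in> topspace (total L) \<Longrightarrow> proj L v \<in> U \<Longrightarrow> \<phi> (proj L v, a v) = v"
    "\<And>x z. x \<in> U \<Longrightarrow> a (\<phi> (x, z)) = z"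
    "\<And>x z. x \<in> U \<Longrightarrow> \<phi> (x, z) \<in> topspace (total L) \<and> proj L (\<phi> (x, z)) = x"
proof -
  let ?P = "prod_topology (subtopology (objects G) U) (euclidean :: complex topology)"
  let ?T = "subtopology (total L) {v. proj L v \<in> U}"
  have h: "homeomorphic_map ?P ?T \<phi>" and pr: "\<And>x z. x \<in> U \<Longrightarrow> proj L (\<phi> (x, z)) = x"
    using assms(1) by (auto simp: trivialization_def)
  then obtain \<psi> where \<psi>: "homeomorphic_maps ?P ?T \<phi> \<psi>"
    by (auto simp: homeomorphic_map_maps)
  have UX: "topspace ?P = U \<times> UNIV"
    using assms(2) by auto
  have \<phi>in: "\<phi> (x, z) \<in> topspace (total L)" if "x \<in> U" for x z
    using h that UX homeomorphic_imp_surjective_map [OF h] by auto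
  have c: "continuous_map ?T ?P \<psi>" and i1: "\<And>p. p \<in> topspace ?P \<Longrightarrow> \<psi> (\<phi> p) = p"
    and i2: "\<And>v. v \<in> topspace ?T \<Longrightarrow> \<phi> (\<psi> v) = v"
    using \<psi> by (auto simp: homeomorphic_maps_def)
  show thesis
  proof
    show "continuous_map ?T euclidean (\<lambda>v. snd (\<psi> v))"
      using continuous_map_compose [OF c continuous_map_snd] by (simp add: o_def)
    show "\<phi> (proj L v, snd (\<psi> v)) = v" if v: "v \<in> topspace (total L)" "proj L v \<in> U" for v
    proof -
      have vT: "v \<in> topspace ?T" using v by simp
      then have "\<psi> v \<in> topspace ?P"
        by (rule continuous_map_in_topspace [OF c])
      then have "fst (\<psi> v) \<in> U"
        unfolding UX by (simp add: mem_Times_iff)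
      moreover have "\<phi> (fst (\<psi> v), snd (\<psi> v)) = v"
        using i2 [OF vT] by simp
      ultimately show ?thesis
        using pr by (metis)
    qed
    show "snd (\<psi> (\<phi> (x, z))) = z" if "x \<in> U" for x z
      using i1 [of "(x, z)"] that assms(2) by auto
    show "\<phi> (x, z) \<in> topspace (total L) \<and> proj L (\<phi> (x, z)) = x" if "x \<in> U" for x z
      using \<phi>in pr that by simp
  qed
qed

locale herm_bundle = real_grpd G for G :: "('g, 'x) real_groupoid" +
  fixes L :: "('l, 'g, 'x) line_bundle"
  assumes herm: "hermitian_real_line_bundle G L"
begin

lemma clb: "complex_line_bundle G L" and ca: "continuous_action G L"
  and rlb: "real_line_bundle G L" and hm: "hermitian_metric G L" and lt: "locally_trivial G L"
  using herm by (auto simp: hermitian_real_line_bundle_def real_line_bundle_def)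

lemma cont_proj: "continuous_map (total L) (objects G) (proj L)"
  using clb by (simp add: complex_line_bundle_def)

lemma proj_in [simp]: "v \<in> topspace (total L) \<Longrightarrow> proj L v \<in> Ob"
  using continuous_map_in_topspace [OF cont_proj] .

lemma cont_nu: "continuous_map (total L) (total L) (nu L)"
  using rlb by (auto simp: real_line_bundle_def real_space_def dest: homeomorphic_imp_continuous_map)

lemma nu_in [simp]: "v \<in> topspace (total L) \<Longrightarrow> nu L v \<in> topspace (total L)"
  using continuous_map_in_topspace [OF cont_nu] .

lemma nu_nu [simp]: "v \<in> topspace (total L) \<Longrightarrow> nu L (nu L v) = v"
  and proj_nu [simp]: "v \<in> topspace (total L) \<Longrightarrow> proj L (nu L v) = rho_obj G (proj L v)"
  using rlb by (auto simp: real_line_bundle_def real_space_def)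

lemma nu_smul [simp]: "v \<in> topspace (total L) \<Longrightarrow> nu L (smul L a v) = smul L (cnj a) (nu L v)"
  using rlb proj_in [of v] unfolding real_line_bundle_def fibre_def by blast

lemma nu_act: "\<lbrakk>g \<in> Ar; v \<in> topspace (total L); proj L v = src G g\<rbrakk> \<Longrightarrow>
    nu L (act L g v) = act L (rho G g) (nu L v)"
  using rlb by (auto simp: real_line_bundle_def action_domain_def)

lemma cont_act: "continuous_map (subtopology (prod_topology (arrows G) (total L)) (action_domain G L))
       (total L) (\<lambda>(g, v). act L g v)"
  using ca by (simp add: continuous_action_def)

lemma act_in [simp]: "\<lbrakk>g \<in> Ar; v \<in> topspace (total L); proj L v = src G g\<rbrakk> \<Longrightarrow> act L g v \<in> topspace (total L)"
  using continuous_map_image_subset_topspace [OF cont_act, THEN subsetD, OF imageI, of "(g, v)"]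
  by (simp add: action_domain_def)

lemma proj_act [simp]: "\<lbrakk>g \<in> Ar; v \<in> topspace (total L); proj L v = src G g\<rbrakk> \<Longrightarrow> proj L (act L g v) = rng G g"
  and act_ident [simp]: "v \<in> topspace (total L) \<Longrightarrow> act L (ident G (proj L v)) v = v"
  and act_gcomp: "\<lbrakk>g \<in> Ar; h \<in> Ar; src G g = rng G h; v \<in> topspace (total L); proj L v = src G h\<rbrakk> \<Longrightarrow>
     act L (gcomp G g h) v = act L g (act L h v)"
  using ca by (auto simp: continuous_action_def action_domain_def composable_def)

lemma cont_metric: "continuous_map (total L) euclideanreal (metric L)"
  using hm by (simp add: hermitian_metric_def)

lemma metric_nonneg [simp]: "v \<in> topspace (total L) \<Longrightarrow> metric L v \<ge> 0"
  and metric_nu [simp]: "v \<in> topspace (total L) \<Longrightarrow> metric L (nu L v) = metric L v"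
  and metric_smul [simp]: "v \<in> topspace (total L) \<Longrightarrow> metric L (smul L z v) = metric L v * (cmod z)\<^sup>2"
  and metric_act [simp]: "\<lbrakk>g \<in> Ar; v \<in> topspace (total L); proj L v = src G g\<rbrakk> \<Longrightarrow> metric L (act L g v) = metric L v"
  and metric_pos: "\<lbrakk>v \<in> topspace (total L); v \<noteq> smul L 0 v\<rbrakk> \<Longrightarrow> metric L v > 0"
  using hm by (auto simp: hermitian_metric_def action_domain_def)

lemma vs: "x \<in> Ob \<Longrightarrow> complex_vector_space_on (fibre L x) (vadd L) (smul L)"
  using clb by (simp add: complex_line_bundle_def)

lemma
  assumes "v \<in> topspace (total L)"
  shows smul_in [simp]: "smul L a v \<in> topspace (total L)"
    and proj_smul [simp]: "proj L (smul L a v) = proj L v"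
    and smul_smul [simp]: "smul L a (smul L b v) = smul L (a * b) v"
    and smul_one [simp]: "smul L 1 v = v"
    and smul_add: "smul L (a + b) v = vadd L (smul L a v) (smul L b v)"
proof -
  have x: "v \<in> fibre L (proj L v)" using assms by (simp add: fibre_def)
  note V = vs [OF proj_in [OF assms], unfolded complex_vector_space_on_def]
  have "smul L a v \<in> fibre L (proj L v)"
    using V x by blast
  then show "smul L a v \<in> topspace (total L)" "proj L (smul L a v) = proj L v"
    by (auto simp: fibre_def)
  show "smul L a (smul L b v) = smul L (a * b) v" "smul L 1 v = v"
    "smul L (a + b) v = vadd L (smul L a v) (smul L b v)"
    using V x by blast+
qed

lemma chart_at:
  assumes "x \<in> Ob"
  shows "\<exists>U \<phi> a. openin (objects G) U \<and> x \<in> U \<and> trivialization G L U \<phi> \<and>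
    continuous_map (subtopology (total L) {v. proj L v \<in> U}) euclidean a \<and>
    (\<forall>v\<in>topspace (total L). proj L v \<in> U \<longrightarrow> \<phi> (proj L v, a v) = v) \<and>
    (\<forall>x\<in>U. \<forall>z w. a (\<phi> (x, z)) = z \<and> smul L z (\<phi> (x, w)) = \<phi> (x, z * w))"
proof -
  obtain U \<phi> where U: "openin (objects G) U" "x \<in> U" and t: "trivialization G L U \<phi>"
    using clb assms unfolding complex_line_bundle_def by blast
  obtain a where "continuous_map (subtopology (total L) {v. proj L v \<in> U}) euclidean a"
    "\<forall>v\<in>topspace (total L). proj L v \<in> U \<longrightarrow> \<phi> (proj L v, a v) = v" "\<forall>x\<in>U. \<forall>z. a (\<phi> (x, z)) = z"
    by (rule trivialization_coordinate [OF t openin_subset [OF U(1)]]) blast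
  moreover have "\<forall>x\<in>U. \<forall>z w. smul L z (\<phi> (x, w)) = \<phi> (x, z * w)"
    using t by (simp add: trivialization_def)
  ultimately have "openin (objects G) U \<and> x \<in> U \<and> trivialization G L U \<phi> \<and>
    continuous_map (subtopology (total L) {v. proj L v \<in> U}) euclidean a \<and>
    (\<forall>v\<in>topspace (total L). proj L v \<in> U \<longrightarrow> \<phi> (proj L v, a v) = v) \<and>
    (\<forall>x\<in>U. \<forall>z w. a (\<phi> (x, z)) = z \<and> smul L z (\<phi> (x, w)) = \<phi> (x, z * w))"
    using U t by simp
  then show ?thesis
    by (intro exI)
qed

text \<open>In a chart around the common base point both vectors become numbers. The number of
  \<open>u\<close> is not 0, since otherwise \<open>u\<close> would equal its zero multiple and have
  metric 0. The condition on the metric thus serves as the definition of a nonzero vector.\<close>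

lemma smul_coord_ex1:
  assumes "u \<in> topspace (total L)" "v \<in> topspace (total L)" "proj L u = proj L v" "metric L u \<noteq> 0"
  shows "\<exists>!z. v = smul L z u"
proof -
  obtain U \<phi> a where U: "proj L u \<in> U"
    and a: "\<forall>v\<in>topspace (total L). proj L v \<in> U \<longrightarrow> \<phi> (proj L v, a v) = v"
    and ax: "\<forall>x\<in>U. \<forall>z w. a (\<phi> (x, z)) = z \<and> smul L z (\<phi> (x, w)) = \<phi> (x, z * w)"
    using chart_at [OF proj_in [OF assms(1)]] by blast
  let ?x = "proj L u"
  have u: "u = \<phi> (?x, a u)" and v: "v = \<phi> (?x, a v)"
    and sm: "\<And>x z w. x \<in> U \<Longrightarrow> smul L z (\<phi> (x, w)) = \<phi> (x, z * w)"
    and a': "\<And>x z. x \<in> U \<Longrightarrow> a (\<phi> (x, z)) = z"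
    using bspec [OF a, of u] bspec [OF a, of v] ax assms U by auto
  have s: "smul L z u = \<phi> (?x, z * a u)" for z
    using sm [OF U, of z "a u"] u by simp
  have "a u \<noteq> 0"
  proof
    assume "a u = 0"
    then have "smul L 0 u = u" using s [of 0] u by simp
    then show False using metric_smul [OF assms(1), of 0] assms(4) by simp
  qed
  then show ?thesis
    using s v a' [OF U] by (metis (no_types) nonzero_eq_divide_eq)
qed

lemma smul_coord [simp]:
  assumes "u \<in> topspace (total L)" "v \<in> topspace (total L)" "proj L u = proj L v" "metric L u \<noteq> 0"
  shows "smul L (coord L u v) u = v"
  using theI' [OF smul_coord_ex1 [OF assms]] by (simp add: coord_def)

lemma coord_eqI:
  assumes "u \<in> topspace (total L)" "metric L u \<noteq> 0" "v = smul L z u"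
  shows "coord L u v = z"
  unfolding coord_def
  using smul_coord_ex1 [of u v] assms by (intro the1_equality) auto

lemma coord_smul [simp]:
  assumes "u \<in> topspace (total L)" "metric L u \<noteq> 0"
  shows "coord L u (smul L z u) = z"
  using assms by (rule coord_eqI) simp

text \<open>The last step in the calculations with cocycles: an equation between vectors becomes one
  between scalars.\<close>

lemma smul_cancel:
  assumes "smul L z u = smul L w u" "u \<in> topspace (total L)" "metric L u \<noteq> 0"
  shows "z = w"
  using coord_smul assms by metis

lemma coord_vadd:
  assumes "u \<in> topspace (total L)" "v \<in> topspace (total L)" "w \<in> topspace (total L)"
    "proj L u = proj L v" "proj L w = proj L v" "metric L u \<noteq> 0"
  shows "coord L u (vadd L v w) = coord L u v + coord L u w"
  by (rule coord_eqI) (use assms in \<open>auto simp: smul_add\<close>)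

lemma coord_smul_right:
  assumes "u \<in> topspace (total L)" "v \<in> topspace (total L)"
    "proj L u = proj L v" "metric L u \<noteq> 0"
  shows "coord L u (smul L a v) = a * coord L u v"
  by (rule coord_eqI) (use assms smul_smul [of u a "coord L u v"] in auto)

text \<open>Joint continuity of scalar multiplication is not among the axioms; it is read off in
  charts, where the operation is multiplication of complex numbers.\<close>

lemma continuous_map_smul:
  assumes f: "continuous_map T (total L) f" and z: "continuous_map T euclidean z"
  shows "continuous_map T (total L) (\<lambda>t. smul L (z t) (f t))"
proof (rule continuous_map_locally)
  fix t assume t: "t \<in> topspace T"
  have fin: "\<And>t. t \<in> topspace T \<Longrightarrow> f t \<in> topspace (total L)"
    using continuous_map_in_topspace [OF f] .
  obtain U \<phi> a where U: "openin (objects G) U" "proj L (f t) \<in> U"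
    and tr: "trivialization G L U \<phi>"
    and ca: "continuous_map (subtopology (total L) {v. proj L v \<in> U}) euclidean a"
    and a0: "\<forall>v\<in>topspace (total L). proj L v \<in> U \<longrightarrow> \<phi> (proj L v, a v) = v"
    and ax: "\<forall>x\<in>U. \<forall>z w. a (\<phi> (x, z)) = z \<and> smul L z (\<phi> (x, w)) = \<phi> (x, z * w)"
    using chart_at [OF proj_in [OF fin [OF t]]] by blast
  note a = a0 [rule_format] and sm = ax [rule_format, THEN conjunct2]
  let ?S = "{t \<in> topspace T. proj L (f t) \<in> U}"
  have pf: "continuous_map T (objects G) (\<lambda>t. proj L (f t))"
    using continuous_map_compose [OF f cont_proj] by (simp add: o_def)
  have S: "openin T ?S"
    using openin_continuous_map_preimage [OF pf U(1)] .
  have cf: "continuous_map (subtopology T ?S) euclidean (\<lambda>t. a (f t))"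
    by (rule continuous_map_into_subtopology_compose [OF continuous_map_from_subtopology [OF f] ca]) auto
  have "continuous_map (subtopology T ?S) (prod_topology (subtopology (objects G) U) euclidean)
      (\<lambda>t. (proj L (f t), z t * a (f t)))"
    unfolding continuous_map_pairwise o_def fst_conv snd_conv
    using pf cf z by (auto simp: continuous_map_in_subtopology continuous_map_from_subtopology
        intro: continuous_map_mult)
  moreover have "continuous_map (prod_topology (subtopology (objects G) U) euclidean) (total L) \<phi>"
    using tr by (auto simp: trivialization_def continuous_map_in_subtopology dest: homeomorphic_imp_continuous_map)
  ultimately have A: "continuous_map (subtopology T ?S) (total L) (\<lambda>t. \<phi> (proj L (f t), z t * a (f t)))"
    using continuous_map_compose by (fastforce simp: o_def)
  have B: "smul L (z t) (f t) = \<phi> (proj L (f t), z t * a (f t))" if "t \<in> ?S" for t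
    using sm [of "proj L (f t)" "z t" "a (f t)"] a [of "f t"] fin that by simp
  have "continuous_map (subtopology T ?S) (total L) (\<lambda>t. smul L (z t) (f t))"
    by (rule continuous_map_eq [OF A]) (use B in auto)
  then show "\<exists>U. openin T U \<and> t \<in> U \<and> continuous_map (subtopology T U) (total L) (\<lambda>t. smul L (z t) (f t))"
    using S t U(2) by blast
qed

text \<open>Locally the coordinate is the quotient of the two chart coordinates, whose denominator
  does not vanish because the metric of \<open>u t\<close> does not.\<close>

lemma continuous_map_coord:
  assumes u: "continuous_map T (total L) u" and v: "continuous_map T (total L) v"
    and "\<And>t. t \<in> topspace T \<Longrightarrow> proj L (u t) = proj L (v t) \<and> metric L (u t) \<noteq> 0"
  shows "continuous_map T euclidean (\<lambda>t. coord L (u t) (v t))"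
proof (rule continuous_map_locally)
  fix t assume t: "t \<in> topspace T"
  have uin: "\<And>t. t \<in> topspace T \<Longrightarrow> u t \<in> topspace (total L)"
    and vin: "\<And>t. t \<in> topspace T \<Longrightarrow> v t \<in> topspace (total L)"
    by (rule continuous_map_in_topspace [OF u] continuous_map_in_topspace [OF v], assumption)+
  obtain U \<phi> a where U: "openin (objects G) U" "proj L (u t) \<in> U"
    and tr: "trivialization G L U \<phi>"
    and ca: "continuous_map (subtopology (total L) {v. proj L v \<in> U}) euclidean a"
    and a0: "\<forall>v\<in>topspace (total L). proj L v \<in> U \<longrightarrow> \<phi> (proj L v, a v) = v"
    and ax: "\<forall>x\<in>U. \<forall>z w. a (\<phi> (x, z)) = z \<and> smul L z (\<phi> (x, w)) = \<phi> (x, z * w)"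
    using chart_at [OF proj_in [OF uin [OF t]]] by blast
  note a = a0 [rule_format] and sm = ax [rule_format, THEN conjunct2]
  let ?S = "{t \<in> topspace T. proj L (u t) \<in> U}"
  have pu: "continuous_map T (objects G) (\<lambda>t. proj L (u t))"
    using continuous_map_compose [OF u cont_proj] by (simp add: o_def)
  have S: "openin T ?S"
    using openin_continuous_map_preimage [OF pu U(1)] .
  have cu: "continuous_map (subtopology T ?S) euclidean (\<lambda>t. a (u t))"
    by (rule continuous_map_into_subtopology_compose [OF continuous_map_from_subtopology [OF u] ca]) auto
  have cv: "continuous_map (subtopology T ?S) euclidean (\<lambda>t. a (v t))"
    by (rule continuous_map_into_subtopology_compose [OF continuous_map_from_subtopology [OF v] ca])
      (use assms(3) in auto)
  have nz: "a (u t) \<noteq> 0" if "t \<in> ?S" for t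
  proof
    assume z: "a (u t) = 0"
    have ut: "u t \<in> topspace (total L)" using uin that by simp
    have "smul L 0 (u t) = u t"
      using a [OF ut] sm [of "proj L (u t)" 0 0] that z by auto
    then show False
      using metric_smul [OF ut, of 0] assms(3) that by auto
  qed
  have eq: "coord L (u t) (v t) = a (v t) / a (u t)" if "t \<in> ?S" for t
  proof (rule coord_eqI)
    have "u t = \<phi> (proj L (u t), a (u t))" "v t = \<phi> (proj L (u t), a (v t))"
      using a [of "u t"] a [of "v t"] uin vin assms(3) that by auto
    then show "v t = smul L (a (v t) / a (u t)) (u t)"
      using sm [of "proj L (u t)" "a (v t) / a (u t)" "a (u t)"] nz [OF that] that by simp
  qed (use uin assms(3) that in auto)
  have "continuous_map (subtopology T ?S) euclidean (\<lambda>t. a (v t) / a (u t))"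
    using nz by (intro continuous_map_divide cu cv) auto
  then have "continuous_map (subtopology T ?S) euclidean (\<lambda>t. coord L (u t) (v t))"
    by (rule continuous_map_eq) (use eq in auto)
  then show "\<exists>U. openin T U \<and> t \<in> U \<and> continuous_map (subtopology T U) euclidean (\<lambda>t. coord L (u t) (v t))"
    using S t U(2) by blast
qed

end


section \<open>Cocycles and unitary frames\<close>

text \<open>The index type is a parameter because reindexing and intersecting covers change
  it.\<close>

record ('j, 'x) rcov =
  Idx :: "'j set"
  Bar :: "'j \<Rightarrow> 'j"
  Opn :: "'j \<Rightarrow> 'x set"

definition rcover :: "('g, 'x) real_groupoid \<Rightarrow> ('j, 'x) rcov \<Rightarrow> bool" where
  "rcover G C \<longleftrightarrow> real_open_cover (objects G) (rho_obj G) (Idx C) (Bar C) (Opn C)"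

text \<open>These are the continuous Real functors to the circle from the groupoid of triples
  \<open>(i, g, j)\<close>, the pullback of the groupoid to the disjoint union of the cover. Values
  outside \<open>edges\<close> are arbitrary, so distinct elements may describe the same
  cocycle.\<close>

definition Z1 :: "('g, 'x) real_groupoid \<Rightarrow> ('j, 'x) rcov \<Rightarrow> ('j \<Rightarrow> 'j \<Rightarrow> 'g \<Rightarrow> complex) set" where
  "Z1 G C = {c.
     (\<forall>i\<in>Idx C. \<forall>j\<in>Idx C.
        continuous_map (subtopology (arrows G) (edges G (Opn C i) (Opn C j))) euclidean (c i j) \<and>
        (\<forall>g\<in>edges G (Opn C i) (Opn C j).
           cmod (c i j g) = 1 \<and> c (Bar C i) (Bar C j) (rho G g) = cnj (c i j g))) \<and>
     (\<forall>i\<in>Idx C. \<forall>j\<in>Idx C. \<forall>k\<in>Idx C. \<forall>g\<in>edges G (Opn C i) (Opn C j). \<forall>h\<in>edges G (Opn C j) (Opn C k).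
        src G g = rng G h \<longrightarrow> c i k (gcomp G g h) = c i j g * c j k h)}"

definition C0 :: "('g, 'x) real_groupoid \<Rightarrow> ('j, 'x) rcov \<Rightarrow> ('j \<Rightarrow> 'x \<Rightarrow> complex) set" where
  "C0 G C = {b. \<forall>j\<in>Idx C. continuous_map (subtopology (objects G) (Opn C j)) euclidean (b j) \<and>
     (\<forall>x\<in>Opn C j. cmod (b j x) = 1 \<and> b (Bar C j) (rho_obj G x) = cnj (b j x))}"

text \<open>The source stands in the numerator because face 0 of an arrow, the one with sign +1 in
  the Cech differential, omits vertex 0, which is its range.\<close>

definition delta :: "('g, 'x) real_groupoid \<Rightarrow> ('j \<Rightarrow> 'x \<Rightarrow> complex) \<Rightarrow> 'j \<Rightarrow> 'j \<Rightarrow> 'g \<Rightarrow> complex" where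
  "delta G b i j g = b j (src G g) / b i (rng G g)"

definition cohom :: "('g, 'x) real_groupoid \<Rightarrow> ('j, 'x) rcov \<Rightarrow>
    ('j \<Rightarrow> 'j \<Rightarrow> 'g \<Rightarrow> complex) \<Rightarrow> ('j \<Rightarrow> 'j \<Rightarrow> 'g \<Rightarrow> complex) \<Rightarrow> bool" where
  "cohom G C c d \<longleftrightarrow> (\<exists>b\<in>C0 G C. \<forall>i\<in>Idx C. \<forall>j\<in>Idx C. \<forall>g\<in>edges G (Opn C i) (Opn C j).
     d i j g = c i j g * delta G b i j g)"

text \<open>Unit sections replace trivializations: \<open>\<sigma> j\<close> determines the
  trivialization that sends \<open>(x, z)\<close> to the multiple of \<open>\<sigma> j x\<close> by
  \<open>z\<close>, and length one will make all transition values unimodular.\<close>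

definition frame :: "('g, 'x) real_groupoid \<Rightarrow> ('l, 'g, 'x) line_bundle \<Rightarrow> ('j, 'x) rcov \<Rightarrow>
    ('j \<Rightarrow> 'x \<Rightarrow> 'l) \<Rightarrow> bool" where
  "frame G L C \<sigma> \<longleftrightarrow> (\<forall>j\<in>Idx C. continuous_map (subtopology (objects G) (Opn C j)) (total L) (\<sigma> j) \<and>
     (\<forall>x\<in>Opn C j. \<sigma> j x \<in> topspace (total L) \<and> proj L (\<sigma> j x) = x \<and> metric L (\<sigma> j x) = 1 \<and>
        nu L (\<sigma> j x) = \<sigma> (Bar C j) (rho_obj G x)))"

definition transition :: "('g, 'x) real_groupoid \<Rightarrow> ('l, 'g, 'x) line_bundle \<Rightarrow> ('j, 'x) rcov \<Rightarrow>
    ('j \<Rightarrow> 'x \<Rightarrow> 'l) \<Rightarrow> ('j \<Rightarrow> 'j \<Rightarrow> 'g \<Rightarrow> complex) \<Rightarrow> bool" where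
  "transition G L C \<sigma> c \<longleftrightarrow> (\<forall>i\<in>Idx C. \<forall>j\<in>Idx C. \<forall>g\<in>edges G (Opn C i) (Opn C j).
     act L g (\<sigma> j (src G g)) = smul L (c i j g) (\<sigma> i (rng G g)))"

text \<open>For a cover \<open>C\<close> and \<open>c\<close> in \<open>Z1 G C\<close> this is
  either empty or a whole isomorphism class of hermitian bundles, and it is nonempty once
  \<open>'l\<close> is large enough. It serves as the element of the Picard group presented by
  \<open>c\<close>.\<close>

definition cls :: "('g, 'x) real_groupoid \<Rightarrow> ('j, 'x) rcov \<Rightarrow> ('j \<Rightarrow> 'j \<Rightarrow> 'g \<Rightarrow> complex) \<Rightarrow>
    ('l, 'g, 'x) line_bundle set" where
  "cls G C c = {L. hermitian_real_line_bundle G L \<and> (\<exists>\<sigma>. frame G L C \<sigma> \<and> transition G L C \<sigma> c)}"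

definition rrefines :: "('i, 'x) rcov \<Rightarrow> ('j, 'x) rcov \<Rightarrow> ('i \<Rightarrow> 'j) \<Rightarrow> bool" where
  "rrefines D C \<theta> \<longleftrightarrow> (\<forall>i\<in>Idx D. \<theta> i \<in> Idx C \<and> \<theta> (Bar D i) = Bar C (\<theta> i) \<and> Opn D i \<subseteq> Opn C (\<theta> i))"

lemma edgesD:
  assumes "g \<in> edges G U V"
  shows "g \<in> topspace (arrows G)" "rng G g \<in> U" "src G g \<in> V"
  using assms by (auto simp: edges_def)

lemma edges_mono: "U \<subseteq> U' \<Longrightarrow> V \<subseteq> V' \<Longrightarrow> edges G U V \<subseteq> edges G U' V'"
  by (auto simp: edges_def)

section \<open>Covers, cocycles and their restriction\<close>

context real_grpd
begin

lemma rcoverD: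
  assumes "rcover G C" "j \<in> Idx C"
  shows "openin (objects G) (Opn C j)" "Bar C j \<in> Idx C" "Bar C (Bar C j) = j"
    "Opn C j \<subseteq> Ob" "Opn C (Bar C j) = rho_obj G ` Opn C j"
    "x \<in> Opn C j \<Longrightarrow> rho_obj G x \<in> Opn C (Bar C j)" "x \<in> Opn C j \<Longrightarrow> x \<in> Ob"
  using assms openin_subset unfolding rcover_def real_open_cover_def by (fastforce, fastforce, fastforce, fast, fastforce, fastforce, fast)

lemma rcover_ex:
  assumes "rcover G C" "x \<in> Ob"
  obtains j where "j \<in> Idx C" "x \<in> Opn C j"
  using assms unfolding rcover_def real_open_cover_def by blast

lemma rho_edges:
  assumes "rcover G C" "i \<in> Idx C" "j \<in> Idx C" "g \<in> edges G (Opn C i) (Opn C j)"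
  shows "rho G g \<in> edges G (Opn C (Bar C i)) (Opn C (Bar C j))"
  using edgesD [OF assms(4)] rcoverD(6) [OF assms(1)] assms(2,3) by (simp add: edges_def)

lemma gcomp_edges:
  assumes "g \<in> edges G U V" "h \<in> edges G V W" "src G g = rng G h"
  shows "gcomp G g h \<in> edges G U W"
  using edgesD [OF assms(1)] edgesD [OF assms(2)] assms(3) by (simp add: edges_def)

lemma ident_edges: "x \<in> Ob \<Longrightarrow> x \<in> U \<Longrightarrow> x \<in> V \<Longrightarrow> ident G x \<in> edges G U V"
  by (simp add: edges_def)

lemma cont_rng_edges: "continuous_map (subtopology (arrows G) (edges G U V)) (subtopology (objects G) U) (rng G)"
  and cont_src_edges: "continuous_map (subtopology (arrows G) (edges G U V)) (subtopology (objects G) V) (src G)"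
  by (auto simp: continuous_map_in_subtopology edges_def cont_rng cont_src continuous_map_from_subtopology)

lemma Z1D:
  assumes "c \<in> Z1 G C" "i \<in> Idx C" "j \<in> Idx C"
  shows "continuous_map (subtopology (arrows G) (edges G (Opn C i) (Opn C j))) euclidean (c i j)"
    "g \<in> edges G (Opn C i) (Opn C j) \<Longrightarrow> cmod (c i j g) = 1"
    "g \<in> edges G (Opn C i) (Opn C j) \<Longrightarrow> c i j g \<noteq> 0"
    "g \<in> edges G (Opn C i) (Opn C j) \<Longrightarrow> c (Bar C i) (Bar C j) (rho G g) = cnj (c i j g)"
    "\<lbrakk>k \<in> Idx C; g \<in> edges G (Opn C i) (Opn C j); h \<in> edges G (Opn C j) (Opn C k); src G g = rng G h\<rbrakk>
      \<Longrightarrow> c i k (gcomp G g h) = c i j g * c j k h"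
  using assms unfolding Z1_def by (simp_all, force)

lemma C0D:
  assumes "b \<in> C0 G C" "j \<in> Idx C"
  shows "continuous_map (subtopology (objects G) (Opn C j)) euclidean (b j)"
    "x \<in> Opn C j \<Longrightarrow> cmod (b j x) = 1"
    "x \<in> Opn C j \<Longrightarrow> b j x \<noteq> 0"
    "x \<in> Opn C j \<Longrightarrow> b (Bar C j) (rho_obj G x) = cnj (b j x)"
  using assms unfolding C0_def by (simp_all, force)

text \<open>An identity arrow is idempotent, hence so is its value, which is nonzero.\<close>

lemma Z1_ident:
  assumes "c \<in> Z1 G C" "i \<in> Idx C" "x \<in> Ob" "x \<in> Opn C i"
  shows "c i i (ident G x) = 1"
proof -
  have e: "ident G x \<in> edges G (Opn C i) (Opn C i)"
    using assms by (simp add: ident_edges)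
  show ?thesis
    using Z1D(5) [OF assms(1,2,2,2) e e] Z1D(3) [OF assms(1,2,2) e] assms(3) by simp
qed

lemma Z1_one: "(\<lambda>i j g. 1) \<in> Z1 G C"
  by (simp add: Z1_def)

lemma Z1_mult:
  assumes "c \<in> Z1 G C" "d \<in> Z1 G C"
  shows "(\<lambda>i j g. c i j g * d i j g) \<in> Z1 G C"
  using assms unfolding Z1_def by (simp add: continuous_map_mult norm_mult)

text \<open>On the circle the conjugate is the inverse, and conjugation commutes with products and
  with the Real structure.\<close>

lemma Z1_inverse:
  assumes "c \<in> Z1 G C"
  shows "(\<lambda>i j g. cnj (c i j g)) \<in> Z1 G C"
  using assms unfolding Z1_def by (simp add: continuous_map_cnj)

text \<open>In a product of composable arrows the factors at the middle object cancel.\<close>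

lemma delta_Z1:
  assumes C: "rcover G C" and b: "b \<in> C0 G C"
  shows "delta G b \<in> Z1 G C"
  unfolding Z1_def
proof (intro CollectI conjI ballI impI)
  fix i j assume i: "i \<in> Idx C" and j: "j \<in> Idx C"
  let ?E = "edges G (Opn C i) (Opn C j)"
  have *: "continuous_map (subtopology (arrows G) ?E) euclidean (\<lambda>g. b j (src G g))"
    "continuous_map (subtopology (arrows G) ?E) euclidean (\<lambda>g. b i (rng G g))"
    using continuous_map_compose [OF cont_src_edges C0D(1) [OF b j]]
      continuous_map_compose [OF cont_rng_edges C0D(1) [OF b i]] by (auto simp: o_def)
  show "continuous_map (subtopology (arrows G) ?E) euclidean (delta G b i j)"
    unfolding delta_def
    by (intro continuous_map_divide *) (use C0D(3) [OF b i] in \<open>simp add: edges_def\<close>)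
  fix g assume g: "g \<in> ?E"
  show "cmod (delta G b i j g) = 1"
    using C0D(2) [OF b i] C0D(2) [OF b j] edgesD [OF g] by (simp add: delta_def norm_divide)
  show "delta G b (Bar C i) (Bar C j) (rho G g) = cnj (delta G b i j g)"
    using C0D(4) [OF b i] C0D(4) [OF b j] edgesD [OF g] by (simp add: delta_def)
next
  fix i j k g h
  assume *: "i \<in> Idx C" "j \<in> Idx C" "k \<in> Idx C" "g \<in> edges G (Opn C i) (Opn C j)"
    "h \<in> edges G (Opn C j) (Opn C k)" "src G g = rng G h"
  then show "delta G b i k (gcomp G g h) = delta G b i j g * delta G b j k h"
    using edgesD [OF *(4)] edgesD [OF *(5)] C0D(3) [OF b *(2)] by (simp add: delta_def)
qed

lemma Z1_refine:
  assumes "rrefines D C \<theta>" "c \<in> Z1 G C"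
  shows "(\<lambda>i j. c (\<theta> i) (\<theta> j)) \<in> Z1 G D"
proof -
  have \<theta>: "\<And>i. i \<in> Idx D \<Longrightarrow> \<theta> i \<in> Idx C" "\<And>i. i \<in> Idx D \<Longrightarrow> \<theta> (Bar D i) = Bar C (\<theta> i)"
    "\<And>i. i \<in> Idx D \<Longrightarrow> Opn D i \<subseteq> Opn C (\<theta> i)"
    using assms(1) by (auto simp: rrefines_def)
  have e: "g \<in> edges G (Opn C (\<theta> i)) (Opn C (\<theta> j))"
    if "g \<in> edges G (Opn D i) (Opn D j)" "i \<in> Idx D" "j \<in> Idx D" for g i j
    using subsetD [OF edges_mono [OF \<theta>(3) [OF that(2)] \<theta>(3) [OF that(3)]] that(1)] .
  show ?thesis
    unfolding Z1_def
  proof (intro CollectI conjI ballI impI)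
    fix i j assume i: "i \<in> Idx D" and j: "j \<in> Idx D"
    show "continuous_map (subtopology (arrows G) (edges G (Opn D i) (Opn D j))) euclidean (c (\<theta> i) (\<theta> j))"
      using continuous_map_from_subtopology_mono [OF Z1D(1) [OF assms(2) \<theta>(1) [OF i] \<theta>(1) [OF j]]
        edges_mono [OF \<theta>(3) [OF i] \<theta>(3) [OF j]]] .
    fix g assume g: "g \<in> edges G (Opn D i) (Opn D j)"
    show "cmod (c (\<theta> i) (\<theta> j) g) = 1" "c (\<theta> (Bar D i)) (\<theta> (Bar D j)) (rho G g) = cnj (c (\<theta> i) (\<theta> j) g)"
      using Z1D(2,4) [OF assms(2) \<theta>(1) [OF i] \<theta>(1) [OF j] e [OF g i j]] \<theta>(2) i j by auto
  next
    fix i j k g h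
    assume *: "i \<in> Idx D" "j \<in> Idx D" "k \<in> Idx D" "g \<in> edges G (Opn D i) (Opn D j)"
      "h \<in> edges G (Opn D j) (Opn D k)" "src G g = rng G h"
    show "c (\<theta> i) (\<theta> k) (gcomp G g h) = c (\<theta> i) (\<theta> j) g * c (\<theta> j) (\<theta> k) h"
      using Z1D(5) [OF assms(2) \<theta>(1) [OF *(1)] \<theta>(1) [OF *(2)] \<theta>(1) [OF *(3)]
        e [OF *(4,1,2)] e [OF *(5,2,3)] *(6)] .
  qed
qed

lemma frameD:
  assumes "frame G L C \<sigma>" "j \<in> Idx C"
  shows "continuous_map (subtopology (objects G) (Opn C j)) (total L) (\<sigma> j)"
    "x \<in> Opn C j \<Longrightarrow> \<sigma> j x \<in> topspace (total L)"
    "x \<in> Opn C j \<Longrightarrow> proj L (\<sigma> j x) = x"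
    "x \<in> Opn C j \<Longrightarrow> metric L (\<sigma> j x) = 1"
    "x \<in> Opn C j \<Longrightarrow> nu L (\<sigma> j x) = \<sigma> (Bar C j) (rho_obj G x)"
  using assms unfolding frame_def by simp_all

lemma transitionD:
  assumes "transition G L C \<sigma> c" "i \<in> Idx C" "j \<in> Idx C" "g \<in> edges G (Opn C i) (Opn C j)"
  shows "act L g (\<sigma> j (src G g)) = smul L (c i j g) (\<sigma> i (rng G g))"
  using assms unfolding transition_def by simp

text \<open>The bundle stays the same and its frame is merely restricted along
  \<open>\<theta>\<close>. This is why passing to finer covers does not move the class in the Picard
  group.\<close>

lemma cls_refine:
  assumes "rrefines D C \<theta>" "L \<in> cls G C c"
  shows "L \<in> cls G D (\<lambda>i j. c (\<theta> i) (\<theta> j))"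
proof -
  have \<theta>: "\<And>i. i \<in> Idx D \<Longrightarrow> \<theta> i \<in> Idx C" "\<And>i. i \<in> Idx D \<Longrightarrow> \<theta> (Bar D i) = Bar C (\<theta> i)"
    "\<And>i. i \<in> Idx D \<Longrightarrow> Opn D i \<subseteq> Opn C (\<theta> i)"
    using assms(1) by (auto simp: rrefines_def)
  obtain \<sigma> where h: "hermitian_real_line_bundle G L" and f: "frame G L C \<sigma>" and t: "transition G L C \<sigma> c"
    using assms(2) by (auto simp: cls_def)
  have "frame G L D (\<lambda>i. \<sigma> (\<theta> i))"
    unfolding frame_def
  proof (intro ballI conjI)
    fix j assume j: "j \<in> Idx D"
    show "continuous_map (subtopology (objects G) (Opn D j)) (total L) (\<sigma> (\<theta> j))"
      by (rule continuous_map_from_subtopology_mono [OF frameD(1) [OF f \<theta>(1) [OF j]] \<theta>(3) [OF j]])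
    fix x assume "x \<in> Opn D j"
    then have "x \<in> Opn C (\<theta> j)" using \<theta>(3) [OF j] by blast
    then show "\<sigma> (\<theta> j) x \<in> topspace (total L)" "proj L (\<sigma> (\<theta> j) x) = x" "metric L (\<sigma> (\<theta> j) x) = 1"
      "nu L (\<sigma> (\<theta> j) x) = \<sigma> (\<theta> (Bar D j)) (rho_obj G x)"
      using frameD [OF f \<theta>(1) [OF j]] \<theta>(2) [OF j] by auto
  qed
  moreover have "transition G L D (\<lambda>i. \<sigma> (\<theta> i)) (\<lambda>i j. c (\<theta> i) (\<theta> j))"
    unfolding transition_def
  proof (intro ballI)
    fix i j g assume *: "i \<in> Idx D" "j \<in> Idx D" "g \<in> edges G (Opn D i) (Opn D j)"
    have "g \<in> edges G (Opn C (\<theta> i)) (Opn C (\<theta> j))"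
      using subsetD [OF edges_mono [OF \<theta>(3) [OF *(1)] \<theta>(3) [OF *(2)]] *(3)] .
    then show "act L g (\<sigma> (\<theta> j) (src G g)) = smul L (c (\<theta> i) (\<theta> j) g) (\<sigma> (\<theta> i) (rng G g))"
      by (rule transitionD [OF t \<theta>(1) [OF *(1)] \<theta>(1) [OF *(2)]])
  qed
  ultimately show ?thesis
    using h by (auto simp: cls_def)
qed

lemma herm_bundleI: "hermitian_real_line_bundle G L \<Longrightarrow> herm_bundle G L"
  by unfold_locales

lemma cls_herm: "L \<in> cls G C c \<Longrightarrow> hermitian_real_line_bundle G L"
  by (simp add: cls_def)

end

section \<open>Frames of a hermitian bundle and their transition cocycles\<close>

context herm_bundle
begin

lemma continuous_map_act:
  assumes "continuous_map T (arrows G) a" "continuous_map T (total L) v"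
    "\<And>t. t \<in> topspace T \<Longrightarrow> proj L (v t) = src G (a t)"
  shows "continuous_map T (total L) (\<lambda>t. act L (a t) (v t))"
proof -
  have "continuous_map T (prod_topology (arrows G) (total L)) (\<lambda>t. (a t, v t))"
    using assms by (simp add: continuous_map_pairedI)
  moreover have "(\<lambda>t. (a t, v t)) ` topspace T \<subseteq> action_domain G L"
    using assms continuous_map_in_topspace [OF assms(1)] continuous_map_in_topspace [OF assms(2)]
    by (auto simp: action_domain_def)
  ultimately show ?thesis
    using continuous_map_into_subtopology_compose [OF _ cont_act] by fastforce
qed

lemma local_trivializations:
  obtains J :: "('x \<times> bool) set" and b U \<phi> where
    "real_open_cover (objects G) (rho_obj G) J b U"
    "\<forall>j\<in>J. trivialization G L (U j) (\<phi> j)"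
    "\<forall>j\<in>J. \<forall>x\<in>U j. \<forall>z. \<phi> (b j) (rho_obj G x, cnj z) = nu L (\<phi> j (x, z))"
    "\<forall>g\<in>Ar. \<forall>j0\<in>J. \<forall>j1\<in>J. rng G g \<in> U j0 \<and> src G g \<in> U j1 \<longrightarrow>
           (\<exists>c. c \<noteq> 0 \<and> (\<forall>z. act L g (\<phi> j1 (src G g, z)) = \<phi> j0 (rng G g, c * z)))"
  using lt unfolding locally_trivial_def by blast

text \<open>The axioms of \<open>continuous_action\<close> do not contain linearity. It comes from
  local triviality: in the given trivializations an arrow multiplies by a scalar, which commutes
  with \<open>a\<close>.\<close>

lemma act_smul:
  assumes g: "g \<in> Ar" and v: "v \<in> topspace (total L)" "proj L v = src G g"
  shows "act L g (smul L a v) = smul L a (act L g v)"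
proof (rule local_trivializations)
  fix J :: "('x \<times> bool) set" and b U \<phi>
  assume cov: "real_open_cover (objects G) (rho_obj G) J b U"
    and triv: "\<forall>j\<in>J. trivialization G L (U j) (\<phi> j)"
    and A: "\<forall>g\<in>Ar. \<forall>j0\<in>J. \<forall>j1\<in>J. rng G g \<in> U j0 \<and> src G g \<in> U j1 \<longrightarrow>
           (\<exists>c. c \<noteq> 0 \<and> (\<forall>z. act L g (\<phi> j1 (src G g, z)) = \<phi> j0 (rng G g, c * z)))"
  have UJ: "\<Union> (U ` J) = Ob"
    using cov by (simp add: real_open_cover_def)
  obtain i where i: "i \<in> J" "rng G g \<in> U i"
    using UJ rng_in [OF g] by blast
  obtain j where j: "j \<in> J" "src G g \<in> U j"
    using UJ src_in [OF g] by blast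
  have Uj: "U j \<subseteq> Ob"
    using cov j(1) by (auto simp: real_open_cover_def)
  obtain \<alpha> where \<alpha>: "\<And>v. v \<in> topspace (total L) \<Longrightarrow> proj L v \<in> U j \<Longrightarrow> \<phi> j (proj L v, \<alpha> v) = v"
    using trivialization_coordinate [OF bspec [OF triv j(1)] Uj] by metis
  have sm: "smul L z (\<phi> k (x, w)) = \<phi> k (x, z * w)" if "k \<in> J" "x \<in> U k" for k x z w
    using bspec [OF triv that(1)] that(2) by (simp add: trivialization_def)
  obtain c where c: "\<And>z. act L g (\<phi> j (src G g, z)) = \<phi> i (rng G g, c * z)"
    using A g i j by meson
  have "v = \<phi> j (src G g, \<alpha> v)"
    using \<alpha> [OF v(1)] j(2) unfolding v(2) by simp
  then show ?thesis
    using sm [OF j, of a "\<alpha> v"] sm [OF i] c by (metis mult.left_commute)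
qed

text \<open>The images of 1 under the local trivializations are divided by their lengths. The frame
  is Real because 1 is its own conjugate, the trivializations are compatible with
  \<open>nu L\<close>, and the metric is invariant under \<open>nu L\<close>.\<close>

lemma frame_exists:
  obtains C :: "('x \<times> bool, 'x) rcov" and \<sigma> where "rcover G C" "frame G L C \<sigma>"
proof (rule local_trivializations)
  fix J :: "('x \<times> bool) set" and b U \<phi>
  assume cov: "real_open_cover (objects G) (rho_obj G) J b U"
    and triv: "\<forall>j\<in>J. trivialization G L (U j) (\<phi> j)"
    and R: "\<forall>j\<in>J. \<forall>x\<in>U j. \<forall>z. \<phi> (b j) (rho_obj G x, cnj z) = nu L (\<phi> j (x, z))"
  define C where "C = \<lparr>Idx = J, Bar = b, Opn = U\<rparr>"
  have C: "rcover G C" using cov by (simp add: C_def rcover_def)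
  define \<sigma> where "\<sigma> = (\<lambda>j x. smul L (complex_of_real (1 / sqrt (metric L (\<phi> j (x, 1))))) (\<phi> j (x, 1)))"
  have "frame G L C \<sigma>"
    unfolding frame_def
  proof (intro ballI conjI)
    fix j assume "j \<in> Idx C"
    then have j: "j \<in> J" by (simp add: C_def)
    have UC: "Opn C j = U j" by (simp add: C_def)
    have Uj: "U j \<subseteq> Ob"
      using cov j(1) by (auto simp: real_open_cover_def)
    let ?s = "\<lambda>x. \<phi> j (x, 1)"
    obtain \<alpha> where a: "\<And>x z. x \<in> U j \<Longrightarrow> \<alpha> (\<phi> j (x, z)) = z"
      and in': "\<And>x z. x \<in> U j \<Longrightarrow> \<phi> j (x, z) \<in> topspace (total L) \<and> proj L (\<phi> j (x, z)) = x"
      using trivialization_coordinate [OF bspec [OF triv j(1)] Uj] by metis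
    have sm: "smul L z (\<phi> j (x, w)) = \<phi> j (x, z * w)" if "x \<in> U j" for x z w
      using bspec [OF triv j] that by (simp add: trivialization_def)
    have pos: "metric L (?s x) > 0" if x: "x \<in> U j" for x
    proof (rule metric_pos)
      show "?s x \<in> topspace (total L)" using in' x by simp
      \<comment> \<open>The images of 0 and 1 differ, since \<open>\<alpha>\<close> recovers both
        numbers from them.\<close>
      show "?s x \<noteq> smul L 0 (?s x)"
        using sm [OF x, of 0 1] a [OF x, of 1] a [OF x, of 0] by auto
    qed
    have cs: "continuous_map (subtopology (objects G) (U j)) (total L) ?s"
    proof -
      have 1: "continuous_map (prod_topology (subtopology (objects G) (U j)) euclidean) (total L) (\<phi> j)"
        using bspec [OF triv j]
        by (auto simp: trivialization_def continuous_map_in_subtopology dest: homeomorphic_imp_continuous_map)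
      have 2: "continuous_map (subtopology (objects G) (U j))
          (prod_topology (subtopology (objects G) (U j)) euclidean) (\<lambda>x. (x, 1 :: complex))"
        by (simp add: continuous_map_pairedI)
      show ?thesis
        using continuous_map_compose [OF 2 1] by (simp add: o_def)
    qed
    have "continuous_map (subtopology (objects G) (U j)) euclideanreal (\<lambda>x. metric L (?s x))"
      using continuous_map_compose [OF cs cont_metric] by (simp add: o_def)
    then have "continuous_map (subtopology (objects G) (U j)) euclidean
        (\<lambda>x. complex_of_real (1 / sqrt (metric L (?s x))))"
      by (rule continuous_map_inverse_sqrt) (use pos in auto)
    then show "continuous_map (subtopology (objects G) (Opn C j)) (total L) (\<sigma> j)"
      unfolding UC \<sigma>_def by (rule continuous_map_smul [OF cs])
    fix x assume "x \<in> Opn C j"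
    then have x: "x \<in> U j" by (simp add: UC)
    show "\<sigma> j x \<in> topspace (total L)" "proj L (\<sigma> j x) = x"
      using in' [OF x] by (auto simp: \<sigma>_def)
    show "metric L (\<sigma> j x) = 1"
      using in' [OF x] pos [OF x] by (simp add: \<sigma>_def norm_divide power_divide)
    have "\<phi> (b j) (rho_obj G x, 1) = nu L (?s x)"
      using R [rule_format, OF j x, of 1] by simp
    then show "nu L (\<sigma> j x) = \<sigma> (Bar C j) (rho_obj G x)"
      using in' [OF x] by (simp add: \<sigma>_def C_def)
  qed
  then show thesis using that C by blast
qed

text \<open>Each property of the cocycle reflects one property of the bundle: modulus one comes from
  invariance of the metric, compatibility with the involutions from \<open>nu_act\<close>, and
  multiplicativity from the action law together with its linearity.\<close>

lemma transition_exists: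
  assumes C: "rcover G C" and f: "frame G L C \<sigma>"
  obtains c where "c \<in> Z1 G C" "transition G L C \<sigma> c"
proof -
  define c where "c = (\<lambda>i j g. coord L (\<sigma> i (rng G g)) (act L g (\<sigma> j (src G g))))"
  have t: "act L g (\<sigma> j (src G g)) = smul L (c i j g) (\<sigma> i (rng G g))"
    if "i \<in> Idx C" "j \<in> Idx C" "g \<in> edges G (Opn C i) (Opn C j)" for i j g
    using frameD [OF f that(1)] frameD [OF f that(2)] edgesD [OF that(3)] unfolding c_def by simp
  have "transition G L C \<sigma> c"
    using t by (simp add: transition_def)
  moreover have "c \<in> Z1 G C"
    unfolding Z1_def
  proof (intro CollectI conjI ballI impI)
    fix i j assume i: "i \<in> Idx C" and j: "j \<in> Idx C"
    note fi = frameD [OF f i] and fj = frameD [OF f j]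
    let ?T = "subtopology (arrows G) (edges G (Opn C i) (Opn C j))"
    have 1: "continuous_map ?T (total L) (\<lambda>g. \<sigma> i (rng G g))"
      "continuous_map ?T (total L) (\<lambda>g. \<sigma> j (src G g))"
      using continuous_map_compose [OF cont_rng_edges fi(1)]
        continuous_map_compose [OF cont_src_edges fj(1)] by (auto simp: o_def)
    have 2: "continuous_map ?T (total L) (\<lambda>g. act L g (\<sigma> j (src G g)))"
      by (rule continuous_map_act [OF _ 1(2)]) (use fj in \<open>auto simp: edges_def continuous_map_from_subtopology\<close>)
    show "continuous_map ?T euclidean (c i j)"
      unfolding c_def
      by (rule continuous_map_coord [OF 1(1) 2]) (use fi fj in \<open>auto simp: edges_def\<close>)
    fix g assume g: "g \<in> edges G (Opn C i) (Opn C j)"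
    note g' = edgesD [OF g]
    have "metric L (smul L (c i j g) (\<sigma> i (rng G g))) = 1"
      using t [OF i j g] g' fj by (metis metric_act)
    then have "(cmod (c i j g))\<^sup>2 = 1"
      using fi g' by simp
    then show "cmod (c i j g) = 1"
      by (metis norm_ge_zero power2_eq_iff_nonneg power_one zero_le_one)
    have r: "rho G g \<in> edges G (Opn C (Bar C i)) (Opn C (Bar C j))"
      by (rule rho_edges [OF C i j g])
    have bi: "Bar C i \<in> Idx C" and bj: "Bar C j \<in> Idx C"
      using rcoverD(2) [OF C] i j by auto
    \<comment> \<open>Applying \<open>nu L\<close> to the equation that defines
      \<open>c i j g\<close> must give the one that defines the value at the conjugate indices and
      the conjugate arrow.\<close>
    have "smul L (c (Bar C i) (Bar C j) (rho G g)) (\<sigma> (Bar C i) (rho_obj G (rng G g)))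
        = act L (rho G g) (\<sigma> (Bar C j) (rho_obj G (src G g)))"
      using t [OF bi bj r] g' by simp
    also have "\<dots> = nu L (act L g (\<sigma> j (src G g)))"
      using nu_act [of g "\<sigma> j (src G g)"] fj g' by simp
    also have "\<dots> = smul L (cnj (c i j g)) (\<sigma> (Bar C i) (rho_obj G (rng G g)))"
      using t [OF i j g] fi g' by simp
    finally show "c (Bar C i) (Bar C j) (rho G g) = cnj (c i j g)"
      by (rule smul_cancel) (use frameD(2,4) [OF f bi] rcoverD(6) [OF C i] g' in auto)
  next
    fix i j k g h
    assume *: "i \<in> Idx C" "j \<in> Idx C" "k \<in> Idx C" and g: "g \<in> edges G (Opn C i) (Opn C j)"
      and h: "h \<in> edges G (Opn C j) (Opn C k)" and gh: "src G g = rng G h"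
    note fi = frameD [OF f *(1)] and fj = frameD [OF f *(2)] and fk = frameD [OF f *(3)]
      and g' = edgesD [OF g] and h' = edgesD [OF h]
    have "smul L (c i k (gcomp G g h)) (\<sigma> i (rng G g)) = act L (gcomp G g h) (\<sigma> k (src G h))"
      using t [OF *(1,3) gcomp_edges [OF g h gh]] g' h' gh by simp
    also have "\<dots> = act L g (act L h (\<sigma> k (src G h)))"
      using g' h' fk gh by (intro act_gcomp) auto
    also have "\<dots> = act L g (smul L (c j k h) (\<sigma> j (src G g)))"
      using t [OF *(2,3) h] gh by simp
    also have "\<dots> = smul L (c j k h) (act L g (\<sigma> j (src G g)))"
      using g' fj by (intro act_smul) auto
    also have "\<dots> = smul L (c i j g * c j k h) (\<sigma> i (rng G g))"
      using t [OF *(1,2) g] g' fi by (simp add: mult.commute)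
    finally show "c i k (gcomp G g h) = c i j g * c j k h"
      by (rule smul_cancel) (use fi g' in auto)
  qed
  ultimately show thesis using that by blast
qed

text \<open>The coordinates of the second frame with respect to the first form the 0-cochain
  \<open>b\<close>. Acting with an arrow on both frames and comparing coefficients gives the
  coboundary relation.\<close>

lemma transition_cohom:
  assumes C: "rcover G C" and \<sigma>: "frame G L C \<sigma>" "transition G L C \<sigma> c"
    and \<tau>: "frame G L C \<tau>" "transition G L C \<tau> d"
  shows "cohom G C c d"
proof -
  define b where "b = (\<lambda>j x. coord L (\<sigma> j x) (\<tau> j x))"
  have b: "\<tau> j x = smul L (b j x) (\<sigma> j x)" if "j \<in> Idx C" "x \<in> Opn C j" for j x
    using frameD [OF \<sigma>(1) that(1)] frameD [OF \<tau>(1) that(1)] that(2) unfolding b_def by simp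
  have bC: "b \<in> C0 G C"
    unfolding C0_def
  proof (intro CollectI ballI conjI)
    fix j assume j: "j \<in> Idx C"
    note s = frameD [OF \<sigma>(1) j] and t = frameD [OF \<tau>(1) j]
    show "continuous_map (subtopology (objects G) (Opn C j)) euclidean (b j)"
      unfolding b_def by (rule continuous_map_coord [OF s(1) t(1)]) (use s t in auto)
    fix x assume x: "x \<in> Opn C j"
    have "(cmod (b j x))\<^sup>2 = 1"
      using b [OF j x] s(2,4) [OF x] t(4) [OF x] metric_smul [of "\<sigma> j x" "b j x"] by simp
    then show "cmod (b j x) = 1"
      by (metis norm_ge_zero power2_eq_iff_nonneg power_one zero_le_one)
    have bj: "Bar C j \<in> Idx C" and rx: "rho_obj G x \<in> Opn C (Bar C j)"
      using rcoverD [OF C j] x by auto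
    have "smul L (b (Bar C j) (rho_obj G x)) (\<sigma> (Bar C j) (rho_obj G x)) = nu L (\<tau> j x)"
      using b [OF bj rx] t(5) [OF x] by simp
    also have "\<dots> = smul L (cnj (b j x)) (\<sigma> (Bar C j) (rho_obj G x))"
      using b [OF j x] s x by simp
    finally show "b (Bar C j) (rho_obj G x) = cnj (b j x)"
      by (rule smul_cancel) (use frameD(2,4) [OF \<sigma>(1) bj rx] in auto)
  qed
  moreover have "d i j g = c i j g * delta G b i j g"
    if i: "i \<in> Idx C" and j: "j \<in> Idx C" and g: "g \<in> edges G (Opn C i) (Opn C j)" for i j g
  proof -
    note g' = edgesD [OF g]
    note si = frameD(2-) [OF \<sigma>(1) i, of "rng G g"] and sj = frameD(2-) [OF \<sigma>(1) j, of "src G g"]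
    have "smul L (d i j g * b i (rng G g)) (\<sigma> i (rng G g)) = act L g (\<tau> j (src G g))"
      using transitionD [OF \<tau>(2) i j g] b [OF i] g' si by simp
    also have "\<dots> = smul L (b j (src G g)) (act L g (\<sigma> j (src G g)))"
      using b [OF j, of "src G g"] g' sj act_smul by simp
    also have "\<dots> = smul L (b j (src G g) * c i j g) (\<sigma> i (rng G g))"
      using transitionD [OF \<sigma>(2) i j g] g' si by simp
    finally have "d i j g * b i (rng G g) = b j (src G g) * c i j g"
      by (rule smul_cancel) (use si g' in auto)
    then show ?thesis
      using C0D(3) [OF bC i g'(2)] by (simp add: delta_def field_simps)
  qed
  ultimately show ?thesis unfolding cohom_def by blast
qed

text \<open>Rescaling the frame by the 0-cochain changes its transition cocycle by exactly the
  coboundary; the frame stays of length one and Real because the 0-cochain is unimodular and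
  Real.\<close>

lemma cls_cohom_closed:
  assumes C: "rcover G C" and L: "L \<in> cls G C c" and cd: "cohom G C c d"
  shows "L \<in> cls G C d"
proof -
  obtain \<sigma> where f: "frame G L C \<sigma>" and t: "transition G L C \<sigma> c"
    using L by (auto simp: cls_def)
  obtain b where b: "b \<in> C0 G C" and d: "\<And>i j g. \<lbrakk>i \<in> Idx C; j \<in> Idx C; g \<in> edges G (Opn C i) (Opn C j)\<rbrakk>
      \<Longrightarrow> d i j g = c i j g * delta G b i j g"
    using cd unfolding cohom_def by blast
  define \<tau> where "\<tau> = (\<lambda>j x. smul L (b j x) (\<sigma> j x))"
  have "frame G L C \<tau>"
    unfolding frame_def
  proof (intro ballI conjI)
    fix j assume j: "j \<in> Idx C"
    note s = frameD [OF f j] and b' = C0D [OF b j]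
    show "continuous_map (subtopology (objects G) (Opn C j)) (total L) (\<tau> j)"
      unfolding \<tau>_def by (rule continuous_map_smul [OF s(1) b'(1)])
    fix x assume x: "x \<in> Opn C j"
    then show "\<tau> j x \<in> topspace (total L)" "proj L (\<tau> j x) = x" "metric L (\<tau> j x) = 1"
      "nu L (\<tau> j x) = \<tau> (Bar C j) (rho_obj G x)"
      using s b' by (auto simp: \<tau>_def)
  qed
  moreover have "transition G L C \<tau> d"
    unfolding transition_def
  proof (intro ballI)
    fix i j g assume i: "i \<in> Idx C" and j: "j \<in> Idx C" and g: "g \<in> edges G (Opn C i) (Opn C j)"
    note g' = edgesD [OF g]
    note si = frameD(2-) [OF f i, of "rng G g"] and sj = frameD(2-) [OF f j, of "src G g"]
    show "act L g (\<tau> j (src G g)) = smul L (d i j g) (\<tau> i (rng G g))"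
      using transitionD [OF t i j g] d [OF i j g] g' si sj C0D(3) [OF b i]
      by (simp add: \<tau>_def act_smul delta_def mult.commute)
  qed
  ultimately show ?thesis
    using herm by (auto simp: cls_def)
qed

text \<open>Both directions stay on the given cover, with no passage to a refinement. Hence the
  first cohomology of each single cover will embed into the Picard group.\<close>

lemma cls_iff_cohom:
  assumes "rcover G C" "L \<in> cls G C c"
  shows "L \<in> cls G C d \<longleftrightarrow> cohom G C c d"
  using assms cls_cohom_closed transition_cohom unfolding cls_def by blast

lemma cls_exists:
  obtains C :: "('x \<times> bool, 'x) rcov" and c where "rcover G C" "c \<in> Z1 G C" "L \<in> cls G C c"
proof -
  obtain C :: "('x \<times> bool, 'x) rcov" and \<sigma> where C: "rcover G C" and f: "frame G L C \<sigma>"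
    using frame_exists by blast
  obtain c where "c \<in> Z1 G C" "transition G L C \<sigma> c"
    using transition_exists [OF C f] by blast
  then show thesis
    using that [OF C] herm f by (auto simp: cls_def)
qed

end


section \<open>Isomorphisms and tensor products in frames\<close>

definition fcoord :: "('l, 'g, 'x) line_bundle \<Rightarrow> ('j \<Rightarrow> 'x \<Rightarrow> 'l) \<Rightarrow> 'j \<Rightarrow> 'l \<Rightarrow> complex" where
  "fcoord L \<sigma> j v = coord L (\<sigma> j (proj L v)) v"

definition pick :: "('j, 'x) rcov \<Rightarrow> 'x \<Rightarrow> 'j" where
  "pick C x = (SOME j. j \<in> Idx C \<and> x \<in> Opn C j)"

lemma (in real_grpd) pick:
  assumes "rcover G C" "x \<in> Ob"
  shows "pick C x \<in> Idx C" "x \<in> Opn C (pick C x)"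
proof -
  have "\<exists>j. j \<in> Idx C \<and> x \<in> Opn C j"
    using rcover_ex [OF assms] by blast
  from someI_ex [OF this] show "pick C x \<in> Idx C" "x \<in> Opn C (pick C x)"
    by (auto simp: pick_def)
qed

section \<open>Coordinates with respect to a frame\<close>

locale framed_bundle = herm_bundle G L for G :: "('g, 'x) real_groupoid" and L :: "('l, 'g, 'x) line_bundle" +
  fixes C :: "('j, 'x) rcov" and \<sigma> c
  assumes C: "rcover G C" and fr: "frame G L C \<sigma>" and tr: "transition G L C \<sigma> c"
begin

abbreviation "V j \<equiv> {v \<in> topspace (total L). proj L v \<in> Opn C j}"

lemma openin_V: "j \<in> Idx C \<Longrightarrow> openin (total L) (V j)"
  using openin_continuous_map_preimage [OF cont_proj rcoverD(1) [OF C]] .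

lemma V_ex: "v \<in> topspace (total L) \<Longrightarrow> \<exists>j\<in>Idx C. v \<in> V j"
  using rcover_ex [OF C proj_in] by blast

lemma smul_fcoord: "j \<in> Idx C \<Longrightarrow> v \<in> V j \<Longrightarrow> smul L (fcoord L \<sigma> j v) (\<sigma> j (proj L v)) = v"
  unfolding fcoord_def using frameD(2-4) [OF fr] by (intro smul_coord) auto

lemma fcoord_frame: "j \<in> Idx C \<Longrightarrow> x \<in> Opn C j \<Longrightarrow> fcoord L \<sigma> j (smul L a (\<sigma> j x)) = a"
  unfolding fcoord_def using frameD(2-4) [OF fr] by simp

lemma fcoord_frame_one: "j \<in> Idx C \<Longrightarrow> x \<in> Opn C j \<Longrightarrow> fcoord L \<sigma> j (\<sigma> j x) = 1"
  using fcoord_frame [of j x 1] frameD(2) [OF fr] by simp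

text \<open>Identities between maps of bundles are verified below in this form: same base point and
  same coordinate in one member of the cover.\<close>

lemma fcoord_eqD:
  assumes "j \<in> Idx C" "v \<in> V j" "w \<in> V j" "proj L v = proj L w" "fcoord L \<sigma> j v = fcoord L \<sigma> j w"
  shows "v = w"
proof -
  have "v = smul L (fcoord L \<sigma> j v) (\<sigma> j (proj L v))"
    by (rule smul_fcoord [OF assms(1,2), symmetric])
  also have "\<dots> = w"
    unfolding assms(4,5) by (rule smul_fcoord [OF assms(1,3)])
  finally show ?thesis .
qed

lemma fcoord_smul: "j \<in> Idx C \<Longrightarrow> v \<in> V j \<Longrightarrow> fcoord L \<sigma> j (smul L a v) = a * fcoord L \<sigma> j v"
  unfolding fcoord_def using frameD(2-4) [OF fr] by (simp add: coord_smul_right)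

lemma fcoord_vadd:
  assumes j: "j \<in> Idx C" and v: "v \<in> V j" "w \<in> V j" "proj L v = proj L w"
  shows "fcoord L \<sigma> j (vadd L v w) = fcoord L \<sigma> j v + fcoord L \<sigma> j w"
    "vadd L v w \<in> topspace (total L)" "proj L (vadd L v w) = proj L v"
proof -
  have "vadd L v w \<in> fibre L (proj L v)"
    using vs [OF proj_in, of v] v by (auto simp: complex_vector_space_on_def fibre_def)
  then show 1: "vadd L v w \<in> topspace (total L)" "proj L (vadd L v w) = proj L v"
    by (auto simp: fibre_def)
  show "fcoord L \<sigma> j (vadd L v w) = fcoord L \<sigma> j v + fcoord L \<sigma> j w"
    unfolding fcoord_def 1(2) v(3)
    by (rule coord_vadd) (use frameD(2-4) [OF fr j, of "proj L w"] v in auto)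
qed

lemma fcoord_nu:
  assumes "j \<in> Idx C" "v \<in> V j"
  shows "nu L v \<in> V (Bar C j)" "fcoord L \<sigma> (Bar C j) (nu L v) = cnj (fcoord L \<sigma> j v)"
proof -
  let ?x = "proj L v"
  have x: "?x \<in> Opn C j" and v: "v \<in> topspace (total L)" using assms(2) by auto
  have b: "Bar C j \<in> Idx C" "rho_obj G ?x \<in> Opn C (Bar C j)"
    using rcoverD(2,6) [OF C assms(1)] x by auto
  show "nu L v \<in> V (Bar C j)" using v b by simp
  have "nu L v = nu L (smul L (fcoord L \<sigma> j v) (\<sigma> j ?x))"
    using smul_fcoord [OF assms] by simp
  also have "\<dots> = smul L (cnj (fcoord L \<sigma> j v)) (\<sigma> (Bar C j) (rho_obj G ?x))"
    using frameD [OF fr assms(1)] x by simp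
  finally show "fcoord L \<sigma> (Bar C j) (nu L v) = cnj (fcoord L \<sigma> j v)"
    using fcoord_frame [OF b] by simp
qed

lemma fcoord_act:
  assumes "i \<in> Idx C" "j \<in> Idx C" "g \<in> edges G (Opn C i) (Opn C j)"
    "v \<in> topspace (total L)" "proj L v = src G g"
  shows "fcoord L \<sigma> i (act L g v) = c i j g * fcoord L \<sigma> j v"
proof -
  note g = edgesD [OF assms(3)]
  have v: "v \<in> V j" using assms(4,5) g by simp
  note sj = frameD(2-4) [OF fr assms(2) g(3)] and si = frameD(2-4) [OF fr assms(1) g(2)]
  have "act L g v = act L g (smul L (fcoord L \<sigma> j v) (\<sigma> j (src G g)))"
    using smul_fcoord [OF assms(2) v] assms(5) by simp
  also have "\<dots> = smul L (c i j g * fcoord L \<sigma> j v) (\<sigma> i (rng G g))"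
    using transitionD [OF tr assms(1-3)] sj si g by (simp add: act_smul mult.commute)
  finally show ?thesis
    using fcoord_frame [OF assms(1) g(2)] by simp
qed

text \<open>A change of chart is the action of an identity arrow, so the transition functions on
  overlaps are the values of the cocycle on units.\<close>

lemma fcoord_change:
  assumes "i \<in> Idx C" "j \<in> Idx C" "v \<in> V i" "v \<in> V j"
  shows "fcoord L \<sigma> i v = c i j (ident G (proj L v)) * fcoord L \<sigma> j v"
  using fcoord_act [OF assms(1,2) ident_edges, of "proj L v" v] assms(3,4) by simp

lemma frame_change:
  assumes "i \<in> Idx C" "j \<in> Idx C" "x \<in> Opn C i" "x \<in> Opn C j"
  shows "\<sigma> j x = smul L (c i j (ident G x)) (\<sigma> i x)"
proof -
  have x: "x \<in> Ob" using rcoverD(7) [OF C assms(1,3)] .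
  show ?thesis
    using transitionD [OF tr assms(1,2) ident_edges [OF x assms(3,4)]] x frameD(2,3) [OF fr assms(2,4)]
      act_ident [of "\<sigma> j x"] by simp
qed

lemma cont_fcoord:
  assumes j: "j \<in> Idx C"
  shows "continuous_map (subtopology (total L) (V j)) euclidean (fcoord L \<sigma> j)"
  unfolding fcoord_def
proof (rule continuous_map_coord)
  show "continuous_map (subtopology (total L) (V j)) (total L) (\<lambda>v. \<sigma> j (proj L v))"
    by (rule continuous_map_into_subtopology_compose [OF continuous_map_from_subtopology [OF cont_proj] frameD(1) [OF fr j]])
      auto
qed (use frameD(3,4) [OF fr j] in \<open>auto simp: continuous_map_from_subtopology\<close>)

lemma metric_fcoord: "j \<in> Idx C \<Longrightarrow> v \<in> V j \<Longrightarrow> metric L v = (cmod (fcoord L \<sigma> j v))\<^sup>2"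
  using smul_fcoord [of j v] metric_smul [of "\<sigma> j (proj L v)" "fcoord L \<sigma> j v"] frameD(2,4) [OF fr] by simp

end

section \<open>The isomorphism of bundles with a common cocycle\<close>

locale two_framed = A: framed_bundle G L C \<sigma> c + B: framed_bundle G M C \<tau> d
  for G :: "('g, 'x) real_groupoid" and L :: "('l, 'g, 'x) line_bundle" and M :: "('m, 'g, 'x) line_bundle"
    and C :: "('j, 'x) rcov" and \<sigma> c \<tau> d

locale same_framed = two_framed G L M C \<sigma> c \<tau> c
  for G :: "('g, 'x) real_groupoid" and L :: "('l, 'g, 'x) line_bundle" and M :: "('m, 'g, 'x) line_bundle"
    and C :: "('j, 'x) rcov" and \<sigma> \<tau> c
begin

text \<open>The map that keeps frame coordinates. It is written with the member selected by
  \<open>pick\<close> so as to be a single global function; the next lemma removes the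
  choice.\<close>

definition "fm v = smul M (fcoord L \<sigma> (pick C (proj L v)) v) (\<tau> (pick C (proj L v)) (proj L v))"

text \<open>Passing from \<open>j\<close> to \<open>?i\<close> multiplies the coordinate by
  \<open>c ?i j\<close> at the unit, while \<open>\<tau> j\<close> is that same multiple of
  \<open>\<tau> ?i\<close>. As both bundles have the same cocycle, coordinate times frame vector
  does not depend on the member.\<close>

lemma fm:
  assumes "j \<in> Idx C" "v \<in> A.V j"
  shows "fm v = smul M (fcoord L \<sigma> j v) (\<tau> j (proj L v))"
proof -
  let ?i = "pick C (proj L v)"
  have i: "?i \<in> Idx C" "proj L v \<in> Opn C ?i"
    using A.pick [OF A.C A.proj_in] assms(2) by auto
  have vi: "v \<in> A.V ?i" using i assms(2) by simp
  have x: "proj L v \<in> Opn C j" using assms(2) by simp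
  have "smul M (fcoord L \<sigma> j v) (\<tau> j (proj L v)) =
      smul M (fcoord L \<sigma> j v) (smul M (c ?i j (ident G (proj L v))) (\<tau> ?i (proj L v)))"
    using B.frame_change [OF i(1) assms(1) i(2) x] by simp
  also have "\<dots> = fm v"
    using A.fcoord_change [OF i(1) assms(1) vi assms(2)] A.frameD(2) [OF B.fr i]
    by (simp add: fm_def mult.commute)
  finally show ?thesis by simp
qed

lemma fm_in:
  assumes "j \<in> Idx C" "v \<in> A.V j"
  shows "fm v \<in> B.V j" "proj M (fm v) = proj L v" "fcoord M \<tau> j (fm v) = fcoord L \<sigma> j v"
  using fm [OF assms] A.frameD(2,3) [OF B.fr assms(1)] B.fcoord_frame [OF assms(1)] assms(2) by auto

lemma cont_fm: "continuous_map (total L) (total M) fm"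
proof (rule continuous_map_locally)
  fix v assume v: "v \<in> topspace (total L)"
  then obtain j where j: "j \<in> Idx C" "v \<in> A.V j"
    using A.V_ex by blast
  have 1: "continuous_map (subtopology (total L) (A.V j)) (total M) (\<lambda>v. \<tau> j (proj L v))"
    by (rule continuous_map_into_subtopology_compose [OF continuous_map_from_subtopology [OF A.cont_proj] A.frameD(1) [OF B.fr j(1)]])
      auto
  have "continuous_map (subtopology (total L) (A.V j)) (total M) fm"
    by (rule continuous_map_eq [OF B.continuous_map_smul [OF 1 A.cont_fcoord [OF j(1)]]])
      (use fm [OF j(1)] in auto)
  then show "\<exists>U. openin (total L) U \<and> v \<in> U \<and> continuous_map (subtopology (total L) U) (total M) fm"
    using A.openin_V [OF j(1)] j(2) by blast
qed

text \<open>In coordinates the operations of both bundles are given by the same formulas, with the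
  same \<open>c\<close> for the action, and \<open>fm\<close> is the identity on
  coordinates.\<close>

lemma fm_hom: "bundle_hom G L M fm"
  unfolding bundle_hom_def
proof (intro conjI ballI allI)
  show "continuous_map (total L) (total M) fm" by (rule cont_fm)
next
  fix v assume v: "v \<in> topspace (total L)"
  then obtain j where j: "j \<in> Idx C" "v \<in> A.V j"
    using A.V_ex by blast
  show "proj M (fm v) = proj L v" by (rule fm_in [OF j])
  have bj: "Bar C j \<in> Idx C" by (rule A.rcoverD(2) [OF A.C j(1)])
  show "fm (nu L v) = nu M (fm v)"
    using fm_in [OF bj A.fcoord_nu(1) [OF j]] A.fcoord_nu [OF j] fm_in [OF j] v
      B.fcoord_nu [OF j(1) fm_in(1) [OF j]] by (intro B.fcoord_eqD [OF bj]) auto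
next
  fix x u v a assume x: "x \<in> A.Ob" and u: "u \<in> fibre L x" and v: "v \<in> fibre L x"
  obtain j where j: "j \<in> Idx C" "x \<in> Opn C j" using A.rcover_ex [OF A.C x] .
  have uv: "u \<in> A.V j" "v \<in> A.V j" and p: "proj L u = proj L v" "proj L v = x"
    using u v j by (auto simp: fibre_def)
  note add = A.fcoord_vadd [OF j(1) uv p(1)]
  have s: "vadd L u v \<in> A.V j" using add j p by simp
  note fu = fm_in [OF j(1) uv(1)] and fv = fm_in [OF j(1) uv(2)] and fs = fm_in [OF j(1) s]
  have p': "proj M (fm u) = proj M (fm v)" using fu fv p by simp
  show "fm (vadd L u v) = vadd M (fm u) (fm v)"
    using B.fcoord_vadd [OF j(1) fu(1) fv(1) p'] fs fu fv add p by (intro B.fcoord_eqD [OF j(1)]) auto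
  have a: "smul L a v \<in> A.V j" using uv by simp
  note fa = fm_in [OF j(1) a]
  show "fm (smul L a v) = smul M a (fm v)"
    using fa fv A.fcoord_smul [OF j(1) uv(2)] B.fcoord_smul [OF j(1) fv(1)] uv p
    by (intro B.fcoord_eqD [OF j(1)]) auto
next
  fix gv assume "gv \<in> action_domain G L"
  then obtain g v where gv: "gv = (g, v)" and g: "g \<in> A.Ar" and v: "v \<in> topspace (total L)" "proj L v = src G g"
    by (auto simp: action_domain_def)
  obtain i where i: "i \<in> Idx C" "rng G g \<in> Opn C i" using A.rcover_ex [OF A.C A.rng_in [OF g]] .
  obtain j where j: "j \<in> Idx C" "src G g \<in> Opn C j" using A.rcover_ex [OF A.C A.src_in [OF g]] .
  have e: "g \<in> edges G (Opn C i) (Opn C j)" using g i j by (simp add: edges_def)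
  have vj: "v \<in> A.V j" using v j by simp
  have ai: "act L g v \<in> A.V i" using v i g by simp
  note fv = fm_in [OF j(1) vj] and fa = fm_in [OF i(1) ai]
  have fv': "fm v \<in> topspace (total M)" "proj M (fm v) = src G g" using fv v by auto
  have "fm (act L g v) = act M g (fm v)"
    using fa fv A.fcoord_act [OF i(1) j(1) e v] B.fcoord_act [OF i(1) j(1) e fv'] g v i fv'
    by (intro B.fcoord_eqD [OF i(1)]) auto
  then show "case gv of (g, v) \<Rightarrow> fm (act L g v) = act M g (fm v)"
    using gv by simp
qed

end

section \<open>Isomorphism classes and tensor products in terms of cocycles\<close>

context real_grpd
begin

lemma clsE:
  assumes "rcover G C" "L \<in> cls G C c"
  obtains \<sigma> where "framed_bundle G L C \<sigma> c"
proof -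
  obtain \<sigma> where h: "hermitian_real_line_bundle G L" and f: "frame G L C \<sigma>" "transition G L C \<sigma> c"
    using assms(2) by (auto simp: cls_def)
  interpret herm_bundle G L by (rule herm_bundleI [OF h])
  have "framed_bundle G L C \<sigma> c"
    by unfold_locales (use assms(1) f in auto)
  then show thesis by (rule that)
qed

text \<open>The maps in the two directions both preserve coordinates, so they are inverse to each
  other.\<close>

lemma cls_isomorphic:
  assumes C: "rcover G C" and L: "L \<in> cls G C c" and M: "M \<in> cls G C c"
  shows "bundle_isomorphic G L M"
proof -
  obtain \<sigma> where s: "framed_bundle G L C \<sigma> c" using clsE [OF C L] .
  obtain \<tau> where t: "framed_bundle G M C \<tau> c" using clsE [OF C M] .
  interpret s: framed_bundle G L C \<sigma> c by (rule s)
  interpret t: framed_bundle G M C \<tau> c by (rule t)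
  interpret P: same_framed G L M C \<sigma> \<tau> c by unfold_locales
  interpret Q: same_framed G M L C \<tau> \<sigma> c by unfold_locales
  have "Q.fm (P.fm v) = v" if v: "v \<in> topspace (total L)" for v
  proof -
    obtain j where j: "j \<in> Idx C" "v \<in> s.V j" using s.V_ex [OF v] by blast
    show ?thesis
      using P.fm_in [OF j] Q.fm_in [OF j(1) P.fm_in(1) [OF j]] j by (intro s.fcoord_eqD [OF j(1)]) auto
  qed
  moreover have "P.fm (Q.fm v) = v" if v: "v \<in> topspace (total M)" for v
  proof -
    obtain j where j: "j \<in> Idx C" "v \<in> t.V j" using t.V_ex [OF v] by blast
    show ?thesis
      using Q.fm_in [OF j] P.fm_in [OF j(1) Q.fm_in(1) [OF j]] j by (intro t.fcoord_eqD [OF j(1)]) auto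
  qed
  ultimately show ?thesis
    unfolding bundle_isomorphic_def using P.fm_hom Q.fm_hom by blast
qed

text \<open>An isomorphism need not preserve the metrics, so the image of the frame is normalised.
  The cocycle is still exactly \<open>c\<close>, not just cohomologous to it, because the
  normalising factors at the two ends of an arrow agree.\<close>

lemma cls_isomorphic_closed:
  assumes C: "rcover G C" and c: "c \<in> Z1 G C" and L: "L \<in> cls G C c"
    and hM: "hermitian_real_line_bundle G M" and iso: "bundle_isomorphic G L M"
  shows "M \<in> cls G C c"
proof -
  obtain \<sigma> where s: "framed_bundle G L C \<sigma> c" using clsE [OF C L] .
  interpret s: framed_bundle G L C \<sigma> c by (rule s)
  interpret t: herm_bundle G M by (rule herm_bundleI [OF hM])
  obtain f f' where f: "bundle_hom G L M f" and inv: "\<And>v. v \<in> topspace (total L) \<Longrightarrow> f' (f v) = v"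
    using iso by (auto simp: bundle_isomorphic_def)
  have cf: "continuous_map (total L) (total M) f" using f by (simp add: bundle_hom_def)
  note fin = continuous_map_in_topspace [OF cf]
  have pf: "proj M (f v) = proj L v" and nf: "f (nu L v) = nu M (f v)" if "v \<in> topspace (total L)" for v
    using f that by (simp_all add: bundle_hom_def)
  have sf: "f (smul L a v) = smul M a (f v)" if v: "v \<in> topspace (total L)" for v a
  proof -
    have "v \<in> fibre L (proj L v)" using v by (simp add: fibre_def)
    then show ?thesis
      using f s.proj_in [OF v] unfolding bundle_hom_def by blast
  qed
  have af: "f (act L g v) = act M g (f v)" if "g \<in> Ar" "v \<in> topspace (total L)" "proj L v = src G g" for g v
    using f that by (auto simp: bundle_hom_def action_domain_def)
  define k where "k = (\<lambda>j x. complex_of_real (1 / sqrt (metric M (f (\<sigma> j x)))))"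
  define \<tau> where "\<tau> = (\<lambda>j x. smul M (k j x) (f (\<sigma> j x)))"
  have pos: "metric M (f (\<sigma> j x)) > 0" if "j \<in> Idx C" "x \<in> Opn C j" for j x
  proof (rule t.metric_pos)
    note sj = frameD(2-) [OF s.fr that]
    show "f (\<sigma> j x) \<in> topspace (total M)" using fin sj by simp
    \<comment> \<open>By the left inverse \<open>f'\<close>, an image equal to the zero vector would
      force the unit vector \<open>\<sigma> j x\<close> to be zero.\<close>
    show "f (\<sigma> j x) \<noteq> smul M 0 (f (\<sigma> j x))"
    proof
      assume "f (\<sigma> j x) = smul M 0 (f (\<sigma> j x))"
      then have "f (smul L 0 (\<sigma> j x)) = f (\<sigma> j x)" using sf sj by simp
      then have "smul L 0 (\<sigma> j x) = \<sigma> j x" using inv s.smul_in sj by metis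
      then have "metric L (smul L 0 (\<sigma> j x)) = 1" using sj by simp
      then show False using sj by simp
    qed
  qed
  have "frame G M C \<tau>"
    unfolding frame_def
  proof (intro ballI conjI)
    fix j assume j: "j \<in> Idx C"
    have 1: "continuous_map (subtopology (objects G) (Opn C j)) (total M) (\<lambda>x. f (\<sigma> j x))"
      using continuous_map_compose [OF frameD(1) [OF s.fr j] cf] by (simp add: o_def)
    have "continuous_map (subtopology (objects G) (Opn C j)) euclideanreal (\<lambda>x. metric M (f (\<sigma> j x)))"
      using continuous_map_compose [OF 1 t.cont_metric] by (simp add: o_def)
    then have "continuous_map (subtopology (objects G) (Opn C j)) euclidean (k j)"
      unfolding k_def by (rule continuous_map_inverse_sqrt) (use pos [OF j] in auto)
    then show "continuous_map (subtopology (objects G) (Opn C j)) (total M) (\<tau> j)"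
      unfolding \<tau>_def by (rule t.continuous_map_smul [OF 1])
    fix x assume x: "x \<in> Opn C j"
    note sj = frameD(2-) [OF s.fr j x] and sb = frameD(2-) [OF s.fr rcoverD(2) [OF C j] rcoverD(6) [OF C j x]]
    have i: "f (\<sigma> j x) \<in> topspace (total M)" using fin sj by simp
    show "\<tau> j x \<in> topspace (total M)" "proj M (\<tau> j x) = x"
      using i pf sj by (auto simp: \<tau>_def)
    show "metric M (\<tau> j x) = 1"
      using i pos [OF j x] by (simp add: \<tau>_def k_def norm_divide power_divide)
    have "nu M (f (\<sigma> j x)) = f (\<sigma> (Bar C j) (rho_obj G x))"
      using nf [OF sj(1)] sj(4) by simp
    moreover have "metric M (f (\<sigma> (Bar C j) (rho_obj G x))) = metric M (f (\<sigma> j x))"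
      using t.metric_nu [OF i] calculation by simp
    ultimately show "nu M (\<tau> j x) = \<tau> (Bar C j) (rho_obj G x)"
      using i by (simp add: \<tau>_def k_def)
  qed
  moreover have "transition G M C \<tau> c"
    unfolding transition_def
  proof (intro ballI)
    fix i j g assume i: "i \<in> Idx C" and j: "j \<in> Idx C" and e: "g \<in> edges G (Opn C i) (Opn C j)"
    note g = edgesD [OF e]
    note sj = frameD(2-) [OF s.fr j g(3)] and si = frameD(2-) [OF s.fr i g(2)]
    have 1: "act M g (f (\<sigma> j (src G g))) = smul M (c i j g) (f (\<sigma> i (rng G g)))"
      using af [OF g(1) sj(1,2)] transitionD [OF s.tr i j e] sf [OF si(1)] by simp
    have m: "f (\<sigma> j (src G g)) \<in> topspace (total M)" "proj M (f (\<sigma> j (src G g))) = src G g"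
      "f (\<sigma> i (rng G g)) \<in> topspace (total M)"
      using fin pf sj si by auto
    \<comment> \<open>The arrow preserves the metric of \<open>M\<close> and carries one image to a
      unimodular multiple of the other. Equal lengths give equal normalising factors
      \<open>k\<close>, which then cancel.\<close>
    have "metric M (f (\<sigma> j (src G g))) = metric M (f (\<sigma> i (rng G g)))"
      using t.metric_act [OF g(1) m(1,2)] m(3) Z1D(2) [OF c i j e] unfolding 1 by simp
    then show "act M g (\<tau> j (src G g)) = smul M (c i j g) (\<tau> i (rng G g))"
      using t.act_smul [OF g(1) m(1,2)] 1 m(3) by (simp add: \<tau>_def k_def mult.commute)
  qed
  ultimately show ?thesis
    using hM by (auto simp: cls_def)
qed

lemma cls_eq_isomorphism_class:
  assumes "rcover G C" "c \<in> Z1 G C" "L \<in> cls G C c"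
  shows "cls G C c = {M. hermitian_real_line_bundle G M \<and> bundle_isomorphic G L M}"
  using cls_isomorphic [OF assms(1)] cls_isomorphic_closed [OF assms(1,2)] assms(3) cls_herm by blast

lemma bundle_isomorphic_refl: "hermitian_real_line_bundle G L \<Longrightarrow> bundle_isomorphic G L L"
  using herm_bundle.cls_exists [OF herm_bundleI] cls_isomorphic by metis

lemma bundle_isomorphic_sym:
  assumes "bundle_isomorphic G L M"
  shows "bundle_isomorphic G M L"
  using assms unfolding bundle_isomorphic_def by blast

text \<open>The vectors \<open>t (\<sigma> j x) (\<tau> j x)\<close> form a unit frame. Acting on
  them multiplies the first argument by \<open>c\<close> and the second by \<open>d\<close>, and
  bilinearity pulls both scalars out.\<close>

lemma tensor_product_cls:
  assumes C: "rcover G C" and L: "L \<in> cls G C c" and M: "M \<in> cls G C d"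
    and T: "is_tensor_product G L M T"
  shows "T \<in> cls G C (\<lambda>i j g. c i j g * d i j g)"
proof -
  obtain \<sigma> where s: "framed_bundle G L C \<sigma> c" using clsE [OF C L] .
  obtain \<tau> where t: "framed_bundle G M C \<tau> d" using clsE [OF C M] .
  interpret s: framed_bundle G L C \<sigma> c by (rule s)
  interpret t: framed_bundle G M C \<tau> d by (rule t)
  have hT: "hermitian_real_line_bundle G T" using T by (simp add: is_tensor_product_def)
  interpret T: herm_bundle G T by (rule herm_bundleI [OF hT])
  obtain t where ct: "continuous_map (subtopology (prod_topology (total L) (total M)) (fibre_product L M))
            (total T) (\<lambda>(v, w). t v w)"
    and t1: "\<forall>(v, w)\<in>fibre_product L M. proj T (t v w) = proj L v \<and>
           nu T (t v w) = t (nu L v) (nu M w) \<and> metric T (t v w) = metric L v * metric M w"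
    and t2: "\<forall>g v w. (g, v) \<in> action_domain G L \<and> (g, w) \<in> action_domain G M \<longrightarrow>
           act T g (t v w) = t (act L g v) (act M g w)"
    and t3: "\<forall>x\<in>Ob. \<forall>v\<in>fibre L x. \<forall>w\<in>fibre M x. \<forall>a.
              t (smul L a v) w = smul T a (t v w) \<and> t v (smul M a w) = smul T a (t v w)"
    using T unfolding is_tensor_product_def by (elim conjE exE) (rule that, assumption, assumption, assumption, fast)
  define \<upsilon> where "\<upsilon> = (\<lambda>j x. t (\<sigma> j x) (\<tau> j x))"
  have fp: "(\<sigma> j x, \<tau> j x) \<in> fibre_product L M" if "j \<in> Idx C" "x \<in> Opn C j" for j x
    using frameD(2,3) [OF s.fr that] frameD(2,3) [OF t.fr that] by (simp add: fibre_product_def)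
  have cv: "continuous_map (subtopology (objects G) (Opn C j)) (total T) (\<upsilon> j)" if j: "j \<in> Idx C" for j
  proof -
    have 1: "continuous_map (subtopology (objects G) (Opn C j)) (prod_topology (total L) (total M)) (\<lambda>x. (\<sigma> j x, \<tau> j x))"
      using frameD(1) [OF s.fr j] frameD(1) [OF t.fr j] by (simp add: continuous_map_pairedI)
    have "(\<lambda>x. (\<sigma> j x, \<tau> j x)) ` topspace (subtopology (objects G) (Opn C j)) \<subseteq> fibre_product L M"
      using fp [OF j] by auto
    from continuous_map_into_subtopology_compose [OF 1 ct this] show ?thesis
      by (simp add: \<upsilon>_def)
  qed
  have vin: "\<upsilon> j x \<in> topspace (total T)" if "j \<in> Idx C" "x \<in> Opn C j" for j x
    using continuous_map_in_topspace [OF cv [OF that(1)]] that rcoverD(7) [OF C that] by simp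
  have "frame G T C \<upsilon>"
    unfolding frame_def
  proof (intro ballI conjI)
    fix j assume j: "j \<in> Idx C"
    show "continuous_map (subtopology (objects G) (Opn C j)) (total T) (\<upsilon> j)" by (rule cv [OF j])
    fix x assume x: "x \<in> Opn C j"
    note sj = frameD(2-) [OF s.fr j x] and tj = frameD(2-) [OF t.fr j x]
    show "\<upsilon> j x \<in> topspace (total T)" by (rule vin [OF j x])
    show "proj T (\<upsilon> j x) = x" "metric T (\<upsilon> j x) = 1" "nu T (\<upsilon> j x) = \<upsilon> (Bar C j) (rho_obj G x)"
      using bspec [OF t1 fp [OF j x]] sj tj by (simp_all add: \<upsilon>_def)
  qed
  moreover have "transition G T C \<upsilon> (\<lambda>i j g. c i j g * d i j g)"
    unfolding transition_def
  proof (intro ballI)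
    fix i j g assume i: "i \<in> Idx C" and j: "j \<in> Idx C" and e: "g \<in> edges G (Opn C i) (Opn C j)"
    note g = edgesD [OF e]
    note sj = frameD(2-) [OF s.fr j g(3)] and si = frameD(2-) [OF s.fr i g(2)]
    note tj = frameD(2-) [OF t.fr j g(3)] and ti = frameD(2-) [OF t.fr i g(2)]
    have f: "\<sigma> i (rng G g) \<in> fibre L (rng G g)" "\<tau> i (rng G g) \<in> fibre M (rng G g)"
      "smul M (d i j g) (\<tau> i (rng G g)) \<in> fibre M (rng G g)"
      using si ti by (simp_all add: fibre_def)
    have "act T g (\<upsilon> j (src G g)) = t (act L g (\<sigma> j (src G g))) (act M g (\<tau> j (src G g)))"
      using t2 g sj tj by (simp add: \<upsilon>_def action_domain_def)
    also have "\<dots> = t (smul L (c i j g) (\<sigma> i (rng G g))) (smul M (d i j g) (\<tau> i (rng G g)))"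
      using transitionD [OF s.tr i j e] transitionD [OF t.tr i j e] by simp
    also have "\<dots> = smul T (c i j g) (smul T (d i j g) (\<upsilon> i (rng G g)))"
      using t3 [rule_format, OF rng_in [OF g(1)] f(1) f(2)] t3 [rule_format, OF rng_in [OF g(1)] f(1) f(3)]
      by (simp add: \<upsilon>_def)
    also have "\<dots> = smul T (c i j g * d i j g) (\<upsilon> i (rng G g))"
      using vin [OF i g(2)] by simp
    finally show "act T g (\<upsilon> j (src G g)) = smul T (c i j g * d i j g) (\<upsilon> i (rng G g))" .
  qed
  ultimately show ?thesis
    using hT by (auto simp: cls_def)
qed

end

section \<open>The tensor product of framed bundles\<close>

locale tensor_framed = A: framed_bundle G L C \<sigma> c + B: framed_bundle G M C \<tau> d +
    T: framed_bundle G T C \<upsilon> "\<lambda>i j g. c i j g * d i j g"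
  for G :: "('g, 'x) real_groupoid" and L :: "('l, 'g, 'x) line_bundle" and M :: "('m, 'g, 'x) line_bundle"
    and T :: "('t, 'g, 'x) line_bundle" and C :: "('j, 'x) rcov" and \<sigma> \<tau> \<upsilon> c d
begin

definition "tp v w = smul T (fcoord L \<sigma> (pick C (proj L v)) v * fcoord M \<tau> (pick C (proj L v)) w)
   (\<upsilon> (pick C (proj L v)) (proj L v))"

text \<open>The coordinates of the two arguments change with factors from \<open>c\<close> and
  \<open>d\<close>, and the frame of \<open>T\<close> with their product, which is its cocycle;
  hence the choice made by \<open>pick\<close> is immaterial.\<close>

lemma tp:
  assumes "j \<in> Idx C" "v \<in> A.V j" "w \<in> B.V j" "proj L v = proj M w"
  shows "tp v w = smul T (fcoord L \<sigma> j v * fcoord M \<tau> j w) (\<upsilon> j (proj L v))"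
proof -
  let ?x = "proj L v" let ?i = "pick C ?x"
  have i: "?i \<in> Idx C" "?x \<in> Opn C ?i"
    using A.pick [OF A.C A.proj_in] assms(2) by auto
  have vi: "v \<in> A.V ?i" "w \<in> B.V ?i" using i assms(2,3,4) by simp_all
  have x: "?x \<in> Opn C j" using assms(2) by simp
  have "smul T (fcoord L \<sigma> j v * fcoord M \<tau> j w) (\<upsilon> j ?x) =
      smul T (fcoord L \<sigma> j v * fcoord M \<tau> j w) (smul T (c ?i j (ident G ?x) * d ?i j (ident G ?x)) (\<upsilon> ?i ?x))"
    using T.frame_change [OF i(1) assms(1) i(2) x] by simp
  also have "\<dots> = tp v w"
    using A.fcoord_change [OF i(1) assms(1) vi(1) assms(2)] B.fcoord_change [OF i(1) assms(1) vi(2) assms(3)]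
      A.frameD(2) [OF T.fr i] assms(4) by (simp add: tp_def mult_ac)
  finally show ?thesis by simp
qed

lemma tp_in:
  assumes "j \<in> Idx C" "v \<in> A.V j" "w \<in> B.V j" "proj L v = proj M w"
  shows "tp v w \<in> T.V j" "proj T (tp v w) = proj L v"
    "fcoord T \<upsilon> j (tp v w) = fcoord L \<sigma> j v * fcoord M \<tau> j w"
  using tp [OF assms] A.frameD(2,3) [OF T.fr assms(1)] T.fcoord_frame [OF assms(1)] assms(2) by auto

lemma cont_tp: "continuous_map (subtopology (prod_topology (total L) (total M)) (fibre_product L M))
            (total T) (\<lambda>(v, w). tp v w)" (is "continuous_map ?P _ _")
proof (rule continuous_map_locally)
  fix vw assume "vw \<in> topspace ?P"
  then obtain v w where vw: "vw = (v, w)" "(v, w) \<in> fibre_product L M"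
    by auto
  then have v: "v \<in> topspace (total L)" "w \<in> topspace (total M)" "proj L v = proj M w"
    by (auto simp: fibre_product_def)
  obtain j where j: "j \<in> Idx C" "v \<in> A.V j"
    using A.V_ex [OF v(1)] by blast
  let ?S = "A.V j \<times> B.V j"
  let ?Q = "subtopology ?P (fibre_product L M \<inter> ?S)"
  have op: "openin ?P (fibre_product L M \<inter> ?S)"
    by (rule openin_subtopology_Int2) (use A.openin_V [OF j(1)] B.openin_V [OF j(1)] in \<open>simp add: openin_prod_Times_iff\<close>)
  have cf: "continuous_map ?Q (total L) fst" and cs: "continuous_map ?Q (total M) snd"
    by (auto intro!: continuous_map_from_subtopology continuous_map_fst continuous_map_snd)
  have 1: "continuous_map ?Q euclidean (\<lambda>p. fcoord L \<sigma> j (fst p))"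
    by (rule continuous_map_into_subtopology_compose [OF cf A.cont_fcoord [OF j(1)]]) auto
  have 2: "continuous_map ?Q euclidean (\<lambda>p. fcoord M \<tau> j (snd p))"
    by (rule continuous_map_into_subtopology_compose [OF cs B.cont_fcoord [OF j(1)]]) auto
  have 3: "continuous_map ?Q (objects G) (\<lambda>p. proj L (fst p))"
    using continuous_map_compose [OF cf A.cont_proj] by (simp add: o_def)
  have 4: "continuous_map ?Q (total T) (\<lambda>p. \<upsilon> j (proj L (fst p)))"
    by (rule continuous_map_into_subtopology_compose [OF 3 A.frameD(1) [OF T.fr j(1)]]) auto
  have "continuous_map ?Q (total T) (\<lambda>(v, w). tp v w)"
  proof (rule continuous_map_eq [OF T.continuous_map_smul [OF 4 continuous_map_mult [OF 1 2]]])
    fix p assume "p \<in> topspace ?Q"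
    then have "fst p \<in> A.V j" "snd p \<in> B.V j" "proj L (fst p) = proj M (snd p)"
      by (auto simp: fibre_product_def)
    from tp [OF j(1) this]
    show "smul T (fcoord L \<sigma> j (fst p) * fcoord M \<tau> j (snd p)) (\<upsilon> j (proj L (fst p))) = (case p of (v, w) \<Rightarrow> tp v w)"
      by (simp add: case_prod_beta)
  qed
  moreover have "vw \<in> fibre_product L M \<inter> ?S" using vw j v by simp
  ultimately show "\<exists>U. openin ?P U \<and> vw \<in> U \<and> continuous_map (subtopology ?P U) (total T) (\<lambda>(v, w). tp v w)"
    using op by blast
qed

text \<open>In coordinates \<open>tp\<close> is multiplication of complex numbers, so compatibility
  with all structures can be checked there. The universal property is that of the multiplication map
  for one-dimensional spaces.\<close>

lemma tensor: "is_tensor_product G L M T"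
proof -
  have 1: "proj T (tp v w) = proj L v \<and> nu T (tp v w) = tp (nu L v) (nu M w) \<and>
      metric T (tp v w) = metric L v * metric M w" if "(v, w) \<in> fibre_product L M" for v w
  proof -
    have v: "v \<in> topspace (total L)" "w \<in> topspace (total M)" "proj L v = proj M w"
      using that by (auto simp: fibre_product_def)
    obtain j where j: "j \<in> Idx C" "v \<in> A.V j"
      using A.V_ex [OF v(1)] by blast
    have w: "w \<in> B.V j" using v j by simp
    note t = tp_in [OF j w v(3)]
    have b: "Bar C j \<in> Idx C" by (rule A.rcoverD(2) [OF A.C j(1)])
    note t' = tp_in [OF b A.fcoord_nu(1) [OF j] B.fcoord_nu(1) [OF j(1) w]]
    have p: "proj L (nu L v) = proj M (nu M w)" using v by simp
    have "nu T (tp v w) = tp (nu L v) (nu M w)"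
      using t'[OF p] T.fcoord_nu [OF j(1) t(1)] t A.fcoord_nu [OF j] B.fcoord_nu [OF j(1) w] v
      by (intro T.fcoord_eqD [OF b]) auto
    moreover have "metric T (tp v w) = metric L v * metric M w"
      using T.metric_fcoord [OF j(1) t(1)] A.metric_fcoord [OF j] B.metric_fcoord [OF j(1) w] t(3)
      by (simp add: norm_mult power_mult_distrib)
    ultimately show ?thesis using t by simp
  qed
  have 2: "act T g (tp v w) = tp (act L g v) (act M g w)"
    if "(g, v) \<in> action_domain G L" "(g, w) \<in> action_domain G M" for g v w
  proof -
    have g: "g \<in> A.Ar" and v: "v \<in> topspace (total L)" "proj L v = src G g"
      and w: "w \<in> topspace (total M)" "proj M w = src G g"
      using that by (auto simp: action_domain_def)
    obtain i where i: "i \<in> Idx C" "rng G g \<in> Opn C i" using A.rcover_ex [OF A.C A.rng_in [OF g]] .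
    obtain j where j: "j \<in> Idx C" "src G g \<in> Opn C j" using A.rcover_ex [OF A.C A.src_in [OF g]] .
    have e: "g \<in> edges G (Opn C i) (Opn C j)" using g i j by (simp add: edges_def)
    have vj: "v \<in> A.V j" "w \<in> B.V j" "proj L v = proj M w" using v w j by simp_all
    have ai: "act L g v \<in> A.V i" "act M g w \<in> B.V i" "proj L (act L g v) = proj M (act M g w)"
      using v w i g by simp_all
    note t = tp_in [OF j(1) vj] and a = tp_in [OF i(1) ai]
    have t': "tp v w \<in> topspace (total T)" "proj T (tp v w) = src G g" using t v by auto
    show ?thesis
      using a t' A.fcoord_act [OF i(1) j(1) e v] B.fcoord_act [OF i(1) j(1) e w]
        T.fcoord_act [OF i(1) j(1) e t'] t g v i
      by (intro T.fcoord_eqD [OF i(1)]) auto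
  qed
  have 3: "tp (vadd L v v') w = vadd T (tp v w) (tp v' w) \<and>
      tp v (vadd M w w') = vadd T (tp v w) (tp v w') \<and>
      tp (smul L a v) w = smul T a (tp v w) \<and> tp v (smul M a w) = smul T a (tp v w)"
    if x: "x \<in> A.Ob" and "v \<in> fibre L x" "v' \<in> fibre L x" "w \<in> fibre M x" "w' \<in> fibre M x" for x v v' w w' a
  proof -
    obtain j where j: "j \<in> Idx C" "x \<in> Opn C j" using A.rcover_ex [OF A.C x] .
    have V: "v \<in> A.V j" "v' \<in> A.V j" "w \<in> B.V j" "w' \<in> B.V j"
      and p: "proj L v = x" "proj L v' = x" "proj M w = x" "proj M w' = x"
      using that j by (auto simp: fibre_def)
    have pl: "proj L v = proj L v'" "proj M w = proj M w'" using p by auto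
    note av = A.fcoord_vadd [OF j(1) V(1,2) pl(1)] and aw = B.fcoord_vadd [OF j(1) V(3,4) pl(2)]
    have s: "vadd L v v' \<in> A.V j" "vadd M w w' \<in> B.V j" "smul L a v \<in> A.V j" "smul M a w \<in> B.V j"
      using av aw V p j by auto
    have q: "proj L (vadd L v v') = x" "proj M (vadd M w w') = x" "proj L (smul L a v) = x" "proj M (smul M a w) = x"
      using av aw V p by auto
    have tpj: "tp v w \<in> T.V j" "proj T (tp v w) = x" "fcoord T \<upsilon> j (tp v w) = fcoord L \<sigma> j v * fcoord M \<tau> j w"
      if "v \<in> A.V j" "w \<in> B.V j" "proj L v = x" "proj M w = x" for v w
      using tp_in [OF j(1) that(1,2)] that(3,4) by auto
    note t0 = tpj [OF V(1,3) p(1,3)] and t1 = tpj [OF V(2,3) p(2,3)] and t2 = tpj [OF V(1,4) p(1,4)]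
      and t3 = tpj [OF s(1) V(3) q(1) p(3)] and t4 = tpj [OF V(1) s(2) p(1) q(2)]
      and t5 = tpj [OF s(3) V(3) q(3) p(3)] and t6 = tpj [OF V(1) s(4) p(1) q(4)]
    have e: "proj T (tp v w) = proj T (tp v' w)" "proj T (tp v w) = proj T (tp v w')"
      using t0 t1 t2 by auto
    note a1 = T.fcoord_vadd [OF j(1) t0(1) t1(1) e(1)] and a2 = T.fcoord_vadd [OF j(1) t0(1) t2(1) e(2)]
    have "tp (vadd L v v') w = vadd T (tp v w) (tp v' w)"
      using t3 t0 t1 a1 av j by (intro T.fcoord_eqD [OF j(1)]) (auto simp: algebra_simps)
    moreover have "tp v (vadd M w w') = vadd T (tp v w) (tp v w')"
      using t4 t0 t2 a2 aw j by (intro T.fcoord_eqD [OF j(1)]) (auto simp: algebra_simps)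
    moreover have "tp (smul L a v) w = smul T a (tp v w)"
      using t5 t0 A.fcoord_smul [OF j(1) V(1)] T.fcoord_smul [OF j(1) t0(1)] by (intro T.fcoord_eqD [OF j(1)]) auto
    moreover have "tp v (smul M a w) = smul T a (tp v w)"
      using t6 t0 B.fcoord_smul [OF j(1) V(3)] T.fcoord_smul [OF j(1) t0(1)] by (intro T.fcoord_eqD [OF j(1)]) auto
    ultimately show ?thesis by blast
  qed
  have 4: "\<exists>!f. f \<in> extensional (fibre T x) \<and> linear_form_on T x f \<and>
      (\<forall>v\<in>fibre L x. \<forall>w\<in>fibre M x. f (tp v w) = \<beta> v w)"
    if x: "x \<in> A.Ob" and \<beta>: "bilinear_form_on L M x \<beta>" for x \<beta>
  proof -
    obtain j where j: "j \<in> Idx C" "x \<in> Opn C j" using A.rcover_ex [OF A.C x] .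
    note s = A.frameD(2-3) [OF A.fr j] and t = A.frameD(2-3) [OF B.fr j] and u = A.frameD(2-3) [OF T.fr j]
    have fs: "\<sigma> j x \<in> fibre L x" "\<tau> j x \<in> fibre M x" "\<upsilon> j x \<in> fibre T x"
      using s t u by (auto simp: fibre_def)
    have V: "v \<in> A.V j" "proj L v = x" if "v \<in> fibre L x" for v
      using that j by (auto simp: fibre_def)
    have W: "v \<in> B.V j" "proj M v = x" if "v \<in> fibre M x" for v
      using that j by (auto simp: fibre_def)
    have U: "v \<in> T.V j" "proj T v = x" if "v \<in> fibre T x" for v
      using that j by (auto simp: fibre_def)
    \<comment> \<open>The fibres have rank one, so a bilinear form is determined by its value on the
      pair of frame vectors.\<close>
    have bv: "\<beta> v w = fcoord L \<sigma> j v * fcoord M \<tau> j w * \<beta> (\<sigma> j x) (\<tau> j x)"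
      if v: "v \<in> fibre L x" and w: "w \<in> fibre M x" for v w
    proof -
      have "v = smul L (fcoord L \<sigma> j v) (\<sigma> j x)" "w = smul M (fcoord M \<tau> j w) (\<tau> j x)"
        using A.smul_fcoord [OF j(1) V(1) [OF v]] B.smul_fcoord [OF j(1) W(1) [OF w]] V [OF v] W [OF w] by auto
      moreover have "\<beta> (smul L a (\<sigma> j x)) w = a * \<beta> (\<sigma> j x) w" for a
        using \<beta> fs w unfolding bilinear_form_on_def by blast
      moreover have "\<beta> (\<sigma> j x) (smul M a (\<tau> j x)) = a * \<beta> (\<sigma> j x) (\<tau> j x)" for a
        using \<beta> fs unfolding bilinear_form_on_def by blast
      ultimately show ?thesis by (metis mult.assoc)
    qed
    define f where "f = (\<lambda>u\<in>fibre T x. fcoord T \<upsilon> j u * \<beta> (\<sigma> j x) (\<tau> j x))"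
    have tpf: "tp v w \<in> fibre T x" "fcoord T \<upsilon> j (tp v w) = fcoord L \<sigma> j v * fcoord M \<tau> j w"
      if "v \<in> fibre L x" "w \<in> fibre M x" for v w
      using tp_in [OF j(1) V(1) [OF that(1)] W(1) [OF that(2)]] V [OF that(1)] W [OF that(2)]
      by (auto simp: fibre_def)
    show ?thesis
    proof (rule ex1I [of _ f], intro conjI ballI)
      show "f \<in> extensional (fibre T x)" by (simp add: f_def)
      show "linear_form_on T x f"
        unfolding linear_form_on_def
      proof (intro ballI allI conjI)
        fix v w a assume v: "v \<in> fibre T x" and w: "w \<in> fibre T x"
        have p: "proj T v = proj T w" using U v w by simp
        note a = T.fcoord_vadd [OF j(1) U(1) [OF v] U(1) [OF w] p]
        have "vadd T v w \<in> fibre T x" using a U(2) [OF v] by (simp add: fibre_def)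
        then show "f (vadd T v w) = f v + f w"
          using a(1) v w by (simp add: f_def algebra_simps)
        have "smul T a v \<in> fibre T x" using v by (simp add: fibre_def)
        then show "f (smul T a v) = a * f v"
          using T.fcoord_smul [OF j(1) U(1) [OF v]] v by (simp add: f_def)
      qed
      show "f (tp v w) = \<beta> v w" if "v \<in> fibre L x" "w \<in> fibre M x" for v w
        using tpf [OF that] bv [OF that] by (simp add: f_def)
      fix h assume h: "h \<in> extensional (fibre T x) \<and> linear_form_on T x h \<and>
          (\<forall>v\<in>fibre L x. \<forall>w\<in>fibre M x. h (tp v w) = \<beta> v w)"
      \<comment> \<open>Uniqueness: the frame vector of \<open>T\<close>, which spans the fibre, is
        itself a pure tensor, so the prescribed values fix the linear form.\<close>
      have "tp (\<sigma> j x) (\<tau> j x) = \<upsilon> j x"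
        using tp [OF j(1) V(1) [OF fs(1)] W(1) [OF fs(2)]] s t u A.fcoord_frame_one [OF j] B.fcoord_frame_one [OF j]
        by simp
      then have hu: "h (\<upsilon> j x) = \<beta> (\<sigma> j x) (\<tau> j x)" using h fs by metis
      show "h = f"
      proof (rule extensionalityI [of _ "fibre T x"])
        show "h \<in> extensional (fibre T x)" "f \<in> extensional (fibre T x)"
          using h by (auto simp: f_def)
        fix v assume v: "v \<in> fibre T x"
        have "v = smul T (fcoord T \<upsilon> j v) (\<upsilon> j x)"
          using T.smul_fcoord [OF j(1) U(1) [OF v]] U [OF v] by simp
        moreover have "h (smul T a (\<upsilon> j x)) = a * h (\<upsilon> j x)" for a
          using h fs unfolding linear_form_on_def by blast
        ultimately show "h v = f v"
          using hu v by (metis (no_types, lifting) f_def restrict_apply')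
      qed
    qed
  qed
  have 5: "\<forall>(v, w)\<in>fibre_product L M. proj T (tp v w) = proj L v \<and>
      nu T (tp v w) = tp (nu L v) (nu M w) \<and> metric T (tp v w) = metric L v * metric M w"
    using 1 by (simp add: Ball_def)
  show ?thesis
    unfolding is_tensor_product_def
    by (rule conjI [OF T.herm], rule exI [of _ tp], rule conjI [OF cont_tp], rule conjI [OF 5], rule conjI,
        use 2 in blast, rule ballI, rule conjI, (intro ballI allI 3; assumption), (intro allI impI 4; assumption))
qed

end

text \<open>The existence of tensor products is hereby reduced to the existence of a bundle with a
  given cocycle: any bundle presented by the product cocycle will do.\<close>

lemma (in real_grpd) cls_tensor_product:
  assumes C: "rcover G C" and L: "L \<in> cls G C c" and M: "M \<in> cls G C d"
    and T: "T \<in> cls G C (\<lambda>i j g. c i j g * d i j g)"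
  shows "is_tensor_product G L M T"
proof -
  obtain \<sigma> where "framed_bundle G L C \<sigma> c" using clsE [OF C L] .
  moreover obtain \<tau> where "framed_bundle G M C \<tau> d" using clsE [OF C M] .
  moreover obtain \<upsilon> where "framed_bundle G T C \<upsilon> (\<lambda>i j g. c i j g * d i j g)" using clsE [OF C T] .
  ultimately have "tensor_framed G L M T C \<sigma> \<tau> \<upsilon> c d"
    unfolding tensor_framed_def by blast
  then show ?thesis by (rule tensor_framed.tensor)
qed


section \<open>Bundles from cocycles\<close>

text \<open>Local triviality is defined with covers indexed in \<open>'x \<times> bool\<close>.\<close>

definition reindex :: "('g, 'x) real_groupoid \<Rightarrow> ('j, 'x) rcov \<Rightarrow> ('x \<times> bool, 'x) rcov" where
  "reindex G C = \<lparr>Idx = topspace (objects G) \<times> UNIV, Bar = (\<lambda>(x, t). (x, \<not> t)),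
     Opn = (\<lambda>(x, t). if t then Opn C (pick C x) else Opn C (Bar C (pick C x)))\<rparr>"

definition reindex_map :: "('j, 'x) rcov \<Rightarrow> 'x \<times> bool \<Rightarrow> 'j" where
  "reindex_map C = (\<lambda>(x, t). if t then pick C x else Bar C (pick C x))"

text \<open>For a bundle still under construction the continuity of its projection is not yet
  available. Over a chart the projection is the first component of the inverse chart.\<close>

lemma trivialization_continuous_proj:
  assumes "trivialization G L U \<phi>" "U \<subseteq> topspace (objects G)"
  shows "continuous_map (subtopology (total L) {v. proj L v \<in> U}) (objects G) (proj L)"
proof -
  let ?P = "prod_topology (subtopology (objects G) U) (euclidean :: complex topology)"
  let ?T = "subtopology (total L) {v. proj L v \<in> U}"
  have h: "homeomorphic_map ?P ?T \<phi>" and pr: "\<And>x z. x \<in> U \<Longrightarrow> proj L (\<phi> (x, z)) = x"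
    using assms(1) by (auto simp: trivialization_def)
  then obtain \<psi> where \<psi>: "homeomorphic_maps ?P ?T \<phi> \<psi>"
    by (auto simp: homeomorphic_map_maps)
  have c: "continuous_map ?T ?P \<psi>" and i2: "\<And>v. v \<in> topspace ?T \<Longrightarrow> \<phi> (\<psi> v) = v"
    using \<psi> by (auto simp: homeomorphic_maps_def)
  have "continuous_map ?P (objects G) fst"
    using continuous_map_fst [of "subtopology (objects G) U" "euclidean :: complex topology"]
    by (simp add: continuous_map_in_subtopology)
  from continuous_map_compose [OF c this] have 1: "continuous_map ?T (objects G) (\<lambda>v. fst (\<psi> v))"
    by (simp add: o_def)
  show ?thesis
  proof (rule continuous_map_eq [OF 1])
    fix v assume v: "v \<in> topspace ?T"
    have "fst (\<psi> v) \<in> U"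
      using continuous_map_in_topspace [OF c v] by (auto simp: mem_Times_iff)
    then show "fst (\<psi> v) = proj L v"
      using pr [of "fst (\<psi> v)" "snd (\<psi> v)"] i2 [OF v] by simp
  qed
qed

text \<open>The topology is the final one for the maps \<open>\<phi> j\<close>. The hypothesis
  \<open>tr\<close> says that images of open sets are again open, so each \<open>\<phi> j\<close> is
  an injective continuous open map, hence an open embedding. No quotient is formed: the points are
  already identified in the target type.\<close>

lemma glue_topology:
  fixes Y :: "'j \<Rightarrow> 'a topology" and \<phi> :: "'j \<Rightarrow> 'a \<Rightarrow> 'b"
  assumes inj: "\<And>j. j \<in> J \<Longrightarrow> inj_on (\<phi> j) (topspace (Y j))"
    and tr: "\<And>i j W. \<lbrakk>i \<in> J; j \<in> J; openin (Y j) W\<rbrakk> \<Longrightarrow> openin (Y i) {p \<in> topspace (Y i). \<phi> i p \<in> \<phi> j ` W}"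
  shows "\<exists>T. topspace T = (\<Union>j\<in>J. \<phi> j ` topspace (Y j)) \<and>
    (\<forall>j\<in>J. openin T (\<phi> j ` topspace (Y j)) \<and>
      homeomorphic_map (Y j) (subtopology T (\<phi> j ` topspace (Y j))) (\<phi> j))"
proof -
  let ?E = "\<Union>j\<in>J. \<phi> j ` topspace (Y j)"
  define P where "P = (\<lambda>V. V \<subseteq> ?E \<and> (\<forall>j\<in>J. openin (Y j) {p \<in> topspace (Y j). \<phi> j p \<in> V}))"
  have "istopology P"
    unfolding istopology_def
  proof (intro conjI allI impI)
    fix S T assume "P S" "P T"
    moreover have "{p \<in> topspace (Y j). \<phi> j p \<in> S \<inter> T} =
        {p \<in> topspace (Y j). \<phi> j p \<in> S} \<inter> {p \<in> topspace (Y j). \<phi> j p \<in> T}" for j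
      by auto
    ultimately show "P (S \<inter> T)"
      unfolding P_def by (auto simp only: openin_Int)
  next
    fix K assume K: "\<forall>V\<in>K. P V"
    have "{p \<in> topspace (Y j). \<phi> j p \<in> \<Union> K} = (\<Union>V\<in>K. {p \<in> topspace (Y j). \<phi> j p \<in> V})" for j
      by auto
    moreover have "openin (Y j) (\<Union>V\<in>K. {p \<in> topspace (Y j). \<phi> j p \<in> V})" if "j \<in> J" for j
      using K that by (intro openin_Union) (auto simp: P_def)
    ultimately show "P (\<Union> K)"
      using K unfolding P_def by auto
  qed
  then have oT: "openin (topology P) = P"
    by (rule topology_inverse')
  have img: "P (\<phi> j ` W)" if "j \<in> J" "openin (Y j) W" for j W
  proof -
    have "\<phi> j ` W \<subseteq> ?E"
      using openin_subset [OF that(2)] that(1) by blast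
    then show ?thesis using tr that by (simp add: P_def)
  qed
  have top: "topspace (topology P) = ?E"
  proof
    show "topspace (topology P) \<subseteq> ?E"
      unfolding topspace_def [of "topology P"] oT by (auto simp: P_def)
    show "?E \<subseteq> topspace (topology P)"
      unfolding topspace_def [of "topology P"] oT using img by blast
  qed
  have "homeomorphic_map (Y j) (subtopology (topology P) (\<phi> j ` topspace (Y j))) (\<phi> j)" if j: "j \<in> J" for j
  proof -
    have "continuous_map (Y j) (topology P) (\<phi> j)"
      unfolding continuous_map_def oT top using j by (auto simp: P_def)
    moreover have "open_map (Y j) (topology P) (\<phi> j)"
      unfolding open_map_def oT using img [OF j] by blast
    ultimately have "embedding_map (Y j) (topology P) (\<phi> j)"
      using inj [OF j] by (rule injective_open_imp_embedding_map)
    then show ?thesis by (simp add: embedding_map_def)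
  qed
  then show ?thesis
    using top img by (intro exI [of _ "topology P"]) (simp add: oT)
qed

context real_grpd
begin

lemma reindex:
  assumes C: "rcover G C"
  shows "rcover G (reindex G C)" "rrefines (reindex G C) C (reindex_map C)"
proof -
  have p: "pick C x \<in> Idx C" "x \<in> Opn C (pick C x)" if "x \<in> Ob" for x
    using pick [OF C that] by auto
  have "\<Union> (Opn (reindex G C) ` Idx (reindex G C)) = Ob"
  proof
    show "\<Union> (Opn (reindex G C) ` Idx (reindex G C)) \<subseteq> Ob"
    proof
      fix y assume "y \<in> \<Union> (Opn (reindex G C) ` Idx (reindex G C))"
      then obtain j where j: "j \<in> Idx (reindex G C)" "y \<in> Opn (reindex G C) j" by blast
      obtain x t where xt: "j = (x, t)" by (cases j) blast
      have x: "x \<in> Ob" using j(1) by (simp add: xt reindex_def)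
      show "y \<in> Ob"
        using j(2) rcoverD(4) [OF C p(1) [OF x]] rcoverD(4) [OF C rcoverD(2) [OF C p(1) [OF x]]]
        by (cases t) (auto simp: xt reindex_def)
    qed
    show "Ob \<subseteq> \<Union> (Opn (reindex G C) ` Idx (reindex G C))"
    proof
      fix x assume x: "x \<in> Ob"
      then have "x \<in> Opn (reindex G C) (x, True)" "(x, True) \<in> Idx (reindex G C)"
        using p by (auto simp: reindex_def)
      then show "x \<in> \<Union> (Opn (reindex G C) ` Idx (reindex G C))" by blast
    qed
  qed
  moreover have "openin (objects G) (Opn (reindex G C) j) \<and> Bar (reindex G C) j \<in> Idx (reindex G C) \<and>
      Bar (reindex G C) (Bar (reindex G C) j) = j \<and>
      Opn (reindex G C) (Bar (reindex G C) j) = rho_obj G ` Opn (reindex G C) j"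
    if "j \<in> Idx (reindex G C)" for j
  proof -
    obtain x t where xt: "j = (x, t)" by (cases j) blast
    with that have j: "j = (x, t)" "x \<in> Ob" by (simp_all add: reindex_def)
    note q = p(1) [OF j(2)]
    note b = rcoverD(2) [OF C q]
    have "Opn C (pick C x) = rho_obj G ` Opn C (Bar C (pick C x))"
      using rcoverD(5) [OF C b] rcoverD(3) [OF C q] by simp
    then show ?thesis
      using rcoverD(1,5) [OF C q] rcoverD(1) [OF C b] j by (cases t) (simp_all add: reindex_def)
  qed
  ultimately show "rcover G (reindex G C)"
    unfolding rcover_def real_open_cover_def by blast
  show "rrefines (reindex G C) C (reindex_map C)"
    unfolding rrefines_def
  proof
    fix j assume ji: "j \<in> Idx (reindex G C)"
    obtain x t where xt: "j = (x, t)" by (cases j) blast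
    with ji have j: "j = (x, t)" "x \<in> Ob" by (simp_all add: reindex_def)
    show "reindex_map C j \<in> Idx C \<and> reindex_map C (Bar (reindex G C) j) = Bar C (reindex_map C j) \<and>
         Opn (reindex G C) j \<subseteq> Opn C (reindex_map C j)"
      using p(1) [OF j(2)] rcoverD(2,3) [OF C p(1) [OF j(2)]] j
      by (cases t) (simp_all add: reindex_def reindex_map_def)
  qed
qed

end

text \<open>All operations are prescribed in charts, and the axioms of a hermitian Real line bundle
  are derived from these formulas and from \<open>c\<close> being a cocycle. Both the trivial bundle
  and the glued bundles are instances.\<close>

locale chart_bundle = real_grpd G for G :: "('g, 'x) real_groupoid" +
  fixes L :: "('l, 'g, 'x) line_bundle" and C :: "('j, 'x) rcov" and \<phi> c
  assumes C: "rcover G C" and c: "c \<in> Z1 G C"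
    and pin: "\<And>v. v \<in> topspace (total L) \<Longrightarrow> proj L v \<in> Ob"
    and op: "\<And>j. j \<in> Idx C \<Longrightarrow> openin (total L) {v \<in> topspace (total L). proj L v \<in> Opn C j}"
    and hom: "\<And>j. j \<in> Idx C \<Longrightarrow> homeomorphic_map (prod_topology (subtopology (objects G) (Opn C j)) euclidean)
       (subtopology (total L) {v. proj L v \<in> Opn C j}) (\<phi> j)"
    and pr: "\<And>j x z. \<lbrakk>j \<in> Idx C; x \<in> Opn C j\<rbrakk> \<Longrightarrow> proj L (\<phi> j (x, z)) = x"
    and ad: "\<And>j x z w. \<lbrakk>j \<in> Idx C; x \<in> Opn C j\<rbrakk> \<Longrightarrow> vadd L (\<phi> j (x, z)) (\<phi> j (x, w)) = \<phi> j (x, z + w)"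
    and sm: "\<And>j x z w. \<lbrakk>j \<in> Idx C; x \<in> Opn C j\<rbrakk> \<Longrightarrow> smul L z (\<phi> j (x, w)) = \<phi> j (x, z * w)"
    and nu: "\<And>j x z. \<lbrakk>j \<in> Idx C; x \<in> Opn C j\<rbrakk> \<Longrightarrow> nu L (\<phi> j (x, z)) = \<phi> (Bar C j) (rho_obj G x, cnj z)"
    and me: "\<And>j x z. \<lbrakk>j \<in> Idx C; x \<in> Opn C j\<rbrakk> \<Longrightarrow> metric L (\<phi> j (x, z)) = (cmod z)\<^sup>2"
    and ac: "\<And>i j g z. \<lbrakk>i \<in> Idx C; j \<in> Idx C; g \<in> edges G (Opn C i) (Opn C j)\<rbrakk> \<Longrightarrow>
        act L g (\<phi> j (src G g, z)) = \<phi> i (rng G g, c i j g * z)"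
begin

abbreviation "V j \<equiv> {v \<in> topspace (total L). proj L v \<in> Opn C j}"
abbreviation "Y j \<equiv> prod_topology (subtopology (objects G) (Opn C j)) (euclidean :: complex topology)"

lemma triv: "j \<in> Idx C \<Longrightarrow> trivialization G L (Opn C j) (\<phi> j)"
  using hom pr ad sm by (simp add: trivialization_def)

lemma subtopology_V: "subtopology (total L) (V j) = subtopology (total L) {v. proj L v \<in> Opn C j}"
proof -
  have "V j = topspace (total L) \<inter> {v. proj L v \<in> Opn C j}" by auto
  then show ?thesis by (simp only: subtopology_restrict)
qed

text \<open>The second components of the inverse charts, fixed here for all members of the cover at
  once.\<close>

definition "\<alpha> = (SOME a. \<forall>j\<in>Idx C. continuous_map (subtopology (total L) (V j)) euclidean (a j) \<and>
    (\<forall>v\<in>V j. \<phi> j (proj L v, a j v) = v) \<and>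
    (\<forall>x\<in>Opn C j. \<forall>z. a j (\<phi> j (x, z)) = z \<and> \<phi> j (x, z) \<in> V j))"

lemma \<alpha>_ex: "\<forall>j\<in>Idx C. continuous_map (subtopology (total L) (V j)) euclidean (\<alpha> j) \<and>
    (\<forall>v\<in>V j. \<phi> j (proj L v, \<alpha> j v) = v) \<and>
    (\<forall>x\<in>Opn C j. \<forall>z. \<alpha> j (\<phi> j (x, z)) = z \<and> \<phi> j (x, z) \<in> V j)"
proof -
  have E: "\<exists>a. continuous_map (subtopology (total L) (V j)) euclidean a \<and>
    (\<forall>v\<in>V j. \<phi> j (proj L v, a v) = v) \<and>
    (\<forall>x\<in>Opn C j. \<forall>z. a (\<phi> j (x, z)) = z \<and> \<phi> j (x, z) \<in> V j)" if "j \<in> Idx C" for j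
    by (rule trivialization_coordinate [OF triv [OF that] rcoverD(4) [OF C that]])
      (rule exI, auto simp: subtopology_V)
  have "\<exists>a. \<forall>j\<in>Idx C. continuous_map (subtopology (total L) (V j)) euclidean (a j) \<and>
    (\<forall>v\<in>V j. \<phi> j (proj L v, a j v) = v) \<and>
    (\<forall>x\<in>Opn C j. \<forall>z. a j (\<phi> j (x, z)) = z \<and> \<phi> j (x, z) \<in> V j)"
    by (rule bchoice, rule ballI, rule E)
  then show ?thesis unfolding \<alpha>_def by (rule someI_ex)
qed

lemma cont_\<alpha>: "j \<in> Idx C \<Longrightarrow> continuous_map (subtopology (total L) (V j)) euclidean (\<alpha> j)"
  and \<phi>_\<alpha>: "\<lbrakk>j \<in> Idx C; v \<in> V j\<rbrakk> \<Longrightarrow> \<phi> j (proj L v, \<alpha> j v) = v"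
  and \<alpha>_\<phi>: "\<lbrakk>j \<in> Idx C; x \<in> Opn C j\<rbrakk> \<Longrightarrow> \<alpha> j (\<phi> j (x, z)) = z"
  and \<phi>_in: "\<lbrakk>j \<in> Idx C; x \<in> Opn C j\<rbrakk> \<Longrightarrow> \<phi> j (x, z) \<in> V j"
  using bspec [OF \<alpha>_ex, of j] by (blast, blast, blast, blast)

lemma point:
  assumes "v \<in> topspace (total L)" "j \<in> Idx C" "proj L v \<in> Opn C j"
  obtains z where "v = \<phi> j (proj L v, z)"
  using that [of "\<alpha> j v"] \<phi>_\<alpha> [OF assms(2), of v] assms(1,3) by simp

lemma index:
  assumes "v \<in> topspace (total L)"
  obtains j where "j \<in> Idx C" "proj L v \<in> Opn C j" "v \<in> V j"
  using rcover_ex [OF C pin [OF assms]] assms by blast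

lemma cont_\<phi>: "j \<in> Idx C \<Longrightarrow> continuous_map (Y j) (total L) (\<phi> j)"
  using homeomorphic_imp_continuous_map [OF hom] by (auto simp: continuous_map_in_subtopology)

lemma cont_proj: "continuous_map (total L) (objects G) (proj L)"
proof (rule continuous_map_locally)
  fix v assume "v \<in> topspace (total L)"
  then obtain j where j: "j \<in> Idx C" "v \<in> V j" using index by blast
  then show "\<exists>U. openin (total L) U \<and> v \<in> U \<and> continuous_map (subtopology (total L) U) (objects G) (proj L)"
    using op [OF j(1)] trivialization_continuous_proj [OF triv [OF j(1)] rcoverD(4) [OF C j(1)]]
    unfolding subtopology_V [symmetric] by blast
qed

lemma proj_surj: "proj L ` topspace (total L) = Ob"
proof
  show "proj L ` topspace (total L) \<subseteq> Ob" using pin by blast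
  show "Ob \<subseteq> proj L ` topspace (total L)"
  proof
    fix x assume "x \<in> Ob"
    then obtain j where "j \<in> Idx C" "x \<in> Opn C j" using rcover_ex [OF C] by blast
    then show "x \<in> proj L ` topspace (total L)"
      using pr [of j x 0] \<phi>_in [of j x 0] by (metis (no_types, lifting) image_eqI mem_Collect_eq)
  qed
qed

lemma fibre_eq:
  assumes "j \<in> Idx C" "x \<in> Opn C j"
  shows "fibre L x = range (\<lambda>z. \<phi> j (x, z))"
proof (intro equalityI subsetI)
  fix v assume "v \<in> fibre L x"
  then have v: "v \<in> topspace (total L)" "proj L v = x" by (auto simp: fibre_def)
  then obtain z where "v = \<phi> j (x, z)" using point [OF v(1) assms(1)] assms(2) by auto
  then show "v \<in> range (\<lambda>z. \<phi> j (x, z))" by simp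
next
  fix v assume "v \<in> range (\<lambda>z. \<phi> j (x, z))"
  then show "v \<in> fibre L x"
    using \<phi>_in [OF assms] pr [OF assms] by (auto simp: fibre_def)
qed

lemma vector_space:
  assumes "x \<in> Ob"
  shows "complex_vector_space_on (fibre L x) (vadd L) (smul L)"
proof -
  obtain j where j: "j \<in> Idx C" "x \<in> Opn C j" using rcover_ex [OF C assms] .
  have "\<exists>z. \<forall>v. \<phi> j (x, z + v) = \<phi> j (x, v) \<and> (\<exists>w. \<phi> j (x, v + w) = \<phi> j (x, z))"
    by (rule exI [of _ 0]) (metis add.left_neutral add.right_inverse)
  then show ?thesis
    unfolding fibre_eq [OF j] complex_vector_space_on_def
    by (simp add: ad [OF j] sm [OF j] algebra_simps)
qed

lemma line: "complex_line_bundle G L"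
  unfolding complex_line_bundle_def
proof (intro conjI ballI cont_proj proj_surj vector_space)
  fix x assume "x \<in> Ob"
  then obtain j where "j \<in> Idx C" "x \<in> Opn C j" using rcover_ex [OF C] by blast
  then show "\<exists>U \<phi>. openin (objects G) U \<and> x \<in> U \<and> trivialization G L U \<phi>"
    using triv rcoverD(1) [OF C] by blast
qed

text \<open>Over an open piece determined by members \<open>i\<close> and \<open>j\<close> the
  action is the chart \<open>\<phi> i\<close> applied to \<open>rng G g\<close> and
  \<open>c i j g\<close> times the coordinate, all of which are continuous.\<close>

lemma cont_act: "continuous_map (subtopology (prod_topology (arrows G) (total L)) (action_domain G L))
       (total L) (\<lambda>(g, v). act L g v)" (is "continuous_map ?P _ _")
proof (rule continuous_map_locally)
  fix p assume "p \<in> topspace ?P"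
  then obtain g v where p: "p = (g, v)" "(g, v) \<in> action_domain G L" by auto
  then have g: "g \<in> Ar" and v: "v \<in> topspace (total L)" "proj L v = src G g"
    by (auto simp: action_domain_def)
  obtain i where i: "i \<in> Idx C" "rng G g \<in> Opn C i" using rcover_ex [OF C rng_in [OF g]] .
  obtain j where j: "j \<in> Idx C" "src G g \<in> Opn C j" using rcover_ex [OF C src_in [OF g]] .
  let ?E = "edges G (Opn C i) (Opn C j)"
  let ?S = "?E \<times> V j"
  let ?Q = "subtopology ?P (action_domain G L \<inter> ?S)"
  have o: "openin ?P (action_domain G L \<inter> ?S)"
    by (rule openin_subtopology_Int2)
      (use op [OF j(1)] openin_edges [OF rcoverD(1) [OF C i(1)] rcoverD(1) [OF C j(1)]] in \<open>simp add: openin_prod_Times_iff\<close>)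
  have cf: "continuous_map ?Q (arrows G) fst" and cs: "continuous_map ?Q (total L) snd"
    by (auto intro!: continuous_map_from_subtopology continuous_map_fst continuous_map_snd)
  have 1: "continuous_map ?Q euclidean (\<lambda>p. c i j (fst p))"
    by (rule continuous_map_into_subtopology_compose [OF cf Z1D(1) [OF c i(1) j(1)]]) auto
  have 2: "continuous_map ?Q euclidean (\<lambda>p. \<alpha> j (snd p))"
    by (rule continuous_map_into_subtopology_compose [OF cs cont_\<alpha> [OF j(1)]]) auto
  have 3: "continuous_map ?Q (objects G) (\<lambda>p. rng G (fst p))"
    using continuous_map_compose [OF cf cont_rng] by (simp add: o_def)
  have "continuous_map ?Q (subtopology (objects G) (Opn C i)) (\<lambda>p. rng G (fst p))"
    unfolding continuous_map_in_subtopology using 3 by (auto simp: edges_def)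
  then have "continuous_map ?Q (Y i) (\<lambda>p. (rng G (fst p), c i j (fst p) * \<alpha> j (snd p)))"
    by (intro continuous_map_pairedI continuous_map_mult [OF 1 2])
  from continuous_map_compose [OF this cont_\<phi> [OF i(1)]]
  have 4: "continuous_map ?Q (total L) (\<lambda>p. \<phi> i (rng G (fst p), c i j (fst p) * \<alpha> j (snd p)))"
    by (simp add: o_def)
  have "continuous_map ?Q (total L) (\<lambda>(g, v). act L g v)"
  proof (rule continuous_map_eq [OF 4])
    fix q assume "q \<in> topspace ?Q"
    then obtain h w where q: "q = (h, w)" "h \<in> ?E" "w \<in> V j" "proj L w = src G h"
      by (auto simp: action_domain_def)
    then show "\<phi> i (rng G (fst q), c i j (fst q) * \<alpha> j (snd q)) = (case q of (g, v) \<Rightarrow> act L g v)"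
      using ac [OF i(1) j(1) q(2), of "\<alpha> j w"] \<phi>_\<alpha> [OF j(1) q(3)] by simp
  qed
  moreover have "p \<in> action_domain G L \<inter> ?S" using p i j g v by (simp add: edges_def)
  ultimately show "\<exists>U. openin ?P U \<and> p \<in> U \<and> continuous_map (subtopology ?P U) (total L) (\<lambda>(g, v). act L g v)"
    using o by blast
qed

lemma act_point:
  assumes "g \<in> Ar" "v \<in> topspace (total L)" "proj L v = src G g"
  obtains i j z where "i \<in> Idx C" "j \<in> Idx C" "g \<in> edges G (Opn C i) (Opn C j)" "v = \<phi> j (src G g, z)"
proof -
  obtain i where i: "i \<in> Idx C" "rng G g \<in> Opn C i" using rcover_ex [OF C rng_in [OF assms(1)]] .
  obtain j where j: "j \<in> Idx C" "src G g \<in> Opn C j" using rcover_ex [OF C src_in [OF assms(1)]] .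
  obtain z where "v = \<phi> j (proj L v, z)"
    using point [OF assms(2) j(1)] j(2) assms(3) by auto
  then show thesis
    using that [OF i(1) j(1), of z] i j assms by (simp add: edges_def)
qed

text \<open>The unit law is the value 1 of a cocycle on identities, and the law for products is the
  cocycle equation.\<close>

lemma action: "continuous_action G L"
  unfolding continuous_action_def
proof (intro conjI allI impI)
  show "continuous_map (subtopology (prod_topology (arrows G) (total L)) (action_domain G L))
       (total L) (\<lambda>(g, v). act L g v)" by (rule cont_act)
  have "proj L (act L g v) = rng G g" if gv: "g \<in> Ar" "v \<in> topspace (total L)" "proj L v = src G g" for g v
  proof -
    obtain i j z where *: "i \<in> Idx C" "j \<in> Idx C" "g \<in> edges G (Opn C i) (Opn C j)" "v = \<phi> j (src G g, z)"
      using act_point [OF gv] .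
    show ?thesis using ac [OF *(1-3)] pr [OF *(1)] edgesD [OF *(3)] *(4) by simp
  qed
  then show "\<forall>(g, v)\<in>action_domain G L. proj L (act L g v) = rng G g"
    by (simp add: action_domain_def)
  show "\<forall>v\<in>topspace (total L). act L (ident G (proj L v)) v = v"
  proof
    fix v assume v: "v \<in> topspace (total L)"
    obtain j where j: "j \<in> Idx C" "proj L v \<in> Opn C j" using index [OF v] .
    obtain z where z: "v = \<phi> j (proj L v, z)" using point [OF v j] .
    show "act L (ident G (proj L v)) v = v"
      using ac [OF j(1) j(1) ident_edges [OF pin [OF v] j(2) j(2)], of z]
        Z1_ident [OF c j(1) pin [OF v] j(2)] z pin [OF v] by simp
  qed
next
  fix g h v assume *: "(g, h) \<in> composable G \<and> (h, v) \<in> action_domain G L"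
  then have g: "g \<in> Ar" and h: "h \<in> Ar" and gh: "src G g = rng G h"
    and v: "v \<in> topspace (total L)" "proj L v = src G h"
    by (auto simp: composable_def action_domain_def)
  obtain i j z where j: "i \<in> Idx C" "j \<in> Idx C" "h \<in> edges G (Opn C i) (Opn C j)" "v = \<phi> j (src G h, z)"
    using act_point [OF h v] .
  obtain k where k: "k \<in> Idx C" "rng G g \<in> Opn C k" using rcover_ex [OF C rng_in [OF g]] .
  have e: "g \<in> edges G (Opn C k) (Opn C i)" using g k gh edgesD [OF j(3)] by (simp add: edges_def)
  show "act L (gcomp G g h) v = act L g (act L h v)"
    using ac [OF k(1) j(2) gcomp_edges [OF e j(3) gh], of z] ac [OF j(1-3), of z] ac [OF k(1) j(1) e, of "c i j h * z"]
      Z1D(5) [OF c k(1) j(1,2) e j(3) gh] j(4) g h gh by (simp add: mult.assoc)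
qed

text \<open>Vectors over different objects are separated by preimages of disjoint open sets of
  objects. Vectors over one object lie in a common chart, which is Hausdorff and open in the total
  space.\<close>

lemma Hausdorff: "Hausdorff_space (total L)"
  unfolding Hausdorff_space_def
proof (intro allI impI)
  fix v w assume vw: "v \<in> topspace (total L) \<and> w \<in> topspace (total L) \<and> v \<noteq> w"
  show "\<exists>U W. openin (total L) U \<and> openin (total L) W \<and> v \<in> U \<and> w \<in> W \<and> disjnt U W"
  proof (cases "proj L v = proj L w")
    case False
    obtain U W where UW: "openin (objects G) U" "openin (objects G) W" "proj L v \<in> U" "proj L w \<in> W" "disjnt U W"
      using Hausdorff_objects False pin vw unfolding Hausdorff_space_def by metis
    then show ?thesis
      using openin_continuous_map_preimage [OF cont_proj UW(1)] openin_continuous_map_preimage [OF cont_proj UW(2)] vw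
      by (intro exI [of _ "{v \<in> topspace (total L). proj L v \<in> U}"] exI [of _ "{v \<in> topspace (total L). proj L v \<in> W}"])
        (auto simp: disjnt_def)
  next
    case True
    obtain j where j: "j \<in> Idx C" "proj L v \<in> Opn C j" using index vw by blast
    have h: "homeomorphic_map (Y j) (subtopology (total L) (V j)) (\<phi> j)"
      using hom [OF j(1)] by (simp only: subtopology_V)
    have "Hausdorff_space (Y j)"
      by (simp add: Hausdorff_space_prod_topology Hausdorff_space_subtopology Hausdorff_objects)
    then have H: "Hausdorff_space (subtopology (total L) (V j))"
      using homeomorphic_Hausdorff_space [OF homeomorphic_map_imp_homeomorphic_space [OF h]] by simp
    have "v \<in> topspace (subtopology (total L) (V j))" "w \<in> topspace (subtopology (total L) (V j))"
      using vw j True by auto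
    then obtain U W where "openin (subtopology (total L) (V j)) U" "openin (subtopology (total L) (V j)) W"
      "v \<in> U" "w \<in> W" "disjnt U W"
      using H [unfolded Hausdorff_space_def, rule_format, of v w] vw by blast
    then show ?thesis
      using openin_trans_full [OF _ op [OF j(1)]] by blast
  qed
qed

text \<open>Charts are open and homeomorphic to a product of locally compact spaces, and a compact
  neighbourhood inside a chart stays compact in the total space.\<close>

lemma locally_compact: "locally_compact_space (total L)"
  unfolding locally_compact_space_def
proof
  fix v assume v: "v \<in> topspace (total L)"
  obtain j where j: "j \<in> Idx C" "v \<in> V j" using index [OF v] .
  have h: "homeomorphic_map (Y j) (subtopology (total L) (V j)) (\<phi> j)"
    using hom [OF j(1)] by (simp only: subtopology_V)
  have "locally_compact_space (subtopology (objects G) (Opn C j))"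
    using locally_compact_space_open_subset [OF _ locally_compact_objects rcoverD(1) [OF C j(1)]] Hausdorff_objects
    by blast
  then have "locally_compact_space (Y j)"
    by (simp add: locally_compact_space_prod_topology locally_compact_space_euclidean)
  then have "locally_compact_space (subtopology (total L) (V j))"
    using homeomorphic_locally_compact_space [OF homeomorphic_map_imp_homeomorphic_space [OF h]] by simp
  moreover have "v \<in> topspace (subtopology (total L) (V j))" using j v by simp
  ultimately obtain U K where UK: "openin (subtopology (total L) (V j)) U"
    "compactin (subtopology (total L) (V j)) K" "v \<in> U" "U \<subseteq> K"
    unfolding locally_compact_space_def by blast
  have "compactin (total L) K" using UK(2) by (simp add: compactin_subtopology)
  then show "\<exists>U K. openin (total L) U \<and> compactin (total L) K \<and> v \<in> U \<and> U \<subseteq> K"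
    using openin_trans_full [OF UK(1) op [OF j(1)]] UK(3,4) by blast
qed

lemma nu_V: "\<lbrakk>j \<in> Idx C; v \<in> V j\<rbrakk> \<Longrightarrow> nu L v = \<phi> (Bar C j) (rho_obj G (proj L v), cnj (\<alpha> j v))"
  using nu [of j "proj L v" "\<alpha> j v"] \<phi>_\<alpha> [of j v] by simp

lemma nu_facts:
  assumes "v \<in> topspace (total L)"
  shows "nu L v \<in> topspace (total L)" "nu L (nu L v) = v" "proj L (nu L v) = rho_obj G (proj L v)"
proof -
  obtain j where j: "j \<in> Idx C" "proj L v \<in> Opn C j" using index [OF assms] .
  obtain z where z: "v = \<phi> j (proj L v, z)" using point [OF assms j] .
  note b = rcoverD(2,3,6) [OF C j(1)]
  have n: "nu L v = \<phi> (Bar C j) (rho_obj G (proj L v), cnj z)"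
    using nu [OF j] z by metis
  show "nu L v \<in> topspace (total L)" "proj L (nu L v) = rho_obj G (proj L v)"
    using n \<phi>_in [OF b(1) b(3) [OF j(2)]] pr [OF b(1) b(3) [OF j(2)]] by auto
  show "nu L (nu L v) = v"
    using nu [OF b(1) b(3) [OF j(2)], of "cnj z"] n z b(2) pin [OF assms] by simp
qed

lemma cont_nu: "continuous_map (total L) (total L) (nu L)"
proof (rule continuous_map_locally)
  fix v assume "v \<in> topspace (total L)"
  then obtain j where j: "j \<in> Idx C" "v \<in> V j" using index by blast
  note b = rcoverD(2,3,6) [OF C j(1)]
  let ?S = "subtopology (total L) (V j)"
  have "continuous_map ?S (objects G) (\<lambda>v. rho_obj G (proj L v))"
    using continuous_map_compose [OF continuous_map_from_subtopology [OF cont_proj] cont_rho_obj] by (simp add: o_def)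
  then have "continuous_map ?S (subtopology (objects G) (Opn C (Bar C j))) (\<lambda>v. rho_obj G (proj L v))"
    unfolding continuous_map_in_subtopology using b by auto
  then have "continuous_map ?S (Y (Bar C j)) (\<lambda>v. (rho_obj G (proj L v), cnj (\<alpha> j v)))"
    by (intro continuous_map_pairedI continuous_map_cnj cont_\<alpha> j(1))
  from continuous_map_compose [OF this cont_\<phi> [OF b(1)]]
  have 1: "continuous_map ?S (total L) (\<lambda>v. \<phi> (Bar C j) (rho_obj G (proj L v), cnj (\<alpha> j v)))"
    by (simp add: o_def)
  have "continuous_map ?S (total L) (nu L)"
    by (rule continuous_map_eq [OF 1]) (use nu_V [OF j(1)] in auto)
  then show "\<exists>U. openin (total L) U \<and> v \<in> U \<and> continuous_map (subtopology (total L) U) (total L) (nu L)"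
    using op [OF j(1)] j(2) by blast
qed

lemma real: "real_line_bundle G L"
  unfolding real_line_bundle_def
proof (intro conjI line action ballI allI)
  have "homeomorphic_maps (total L) (total L) (nu L) (nu L)"
    using cont_nu nu_facts by (simp add: homeomorphic_maps_def)
  then have "homeomorphic_map (total L) (total L) (nu L)"
    by (rule homeomorphic_maps_imp_map)
  then show "real_space (total L) (nu L)"
    using Hausdorff locally_compact nu_facts(2) by (simp add: real_space_def lch_space_def)
next
  fix v assume "v \<in> topspace (total L)"
  then show "proj L (nu L v) = rho_obj G (proj L v)" by (rule nu_facts)
next
  fix x u v a assume x: "x \<in> Ob" and uv: "u \<in> fibre L x" "v \<in> fibre L x"
  obtain j where j: "j \<in> Idx C" "x \<in> Opn C j" using rcover_ex [OF C x] .
  note b = rcoverD(2) [OF C j(1)] rcoverD(6) [OF C j]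
  obtain z w where zw: "u = \<phi> j (x, z)" "v = \<phi> j (x, w)"
    using uv unfolding fibre_eq [OF j] by blast
  show "nu L (vadd L u v) = vadd L (nu L u) (nu L v)" "nu L (smul L a v) = smul L (cnj a) (nu L v)"
    unfolding zw by (simp_all add: ad [OF j] sm [OF j] nu [OF j] ad [OF b] sm [OF b])
next
  fix p assume "p \<in> action_domain G L"
  then obtain g v where p: "p = (g, v)" and g: "g \<in> Ar" and v: "v \<in> topspace (total L)" "proj L v = src G g"
    by (auto simp: action_domain_def)
  obtain i j z where j: "i \<in> Idx C" "j \<in> Idx C" "g \<in> edges G (Opn C i) (Opn C j)" "v = \<phi> j (src G g, z)"
    using act_point [OF g v] .
  note e = edgesD [OF j(3)]
  have "nu L (act L g v) = act L (rho G g) (nu L v)"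
    using ac [OF j(1-3), of z] nu [OF j(1) e(2)] nu [OF j(2) e(3)] j(4) Z1D(4) [OF c j(1-3)]
      ac [OF rcoverD(2) [OF C j(1)] rcoverD(2) [OF C j(2)] rho_edges [OF C j(1-3)], of "cnj z"] g by simp
  then show "case p of (g, v) \<Rightarrow> nu L (act L g v) = act L (rho G g) (nu L v)"
    by (simp add: p)
qed

text \<open>The metric is the squared modulus of the chart coordinate; its invariance under the
  action and under \<open>nu L\<close> is the unimodularity of \<open>c\<close> and of
  conjugation.\<close>

lemma hermitian: "hermitian_metric G L"
  unfolding hermitian_metric_def
proof (intro conjI ballI allI impI)
  show "continuous_map (total L) euclideanreal (metric L)"
  proof (rule continuous_map_locally)
    fix v assume "v \<in> topspace (total L)"
    then obtain j where j: "j \<in> Idx C" "v \<in> V j" using index by blast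
    have 1: "continuous_map (subtopology (total L) (V j)) euclideanreal (\<lambda>v. (cmod (\<alpha> j v))\<^sup>2)"
      by (intro continuous_map_real_pow continuous_map_norm cont_\<alpha> j(1))
    have "continuous_map (subtopology (total L) (V j)) euclideanreal (metric L)"
    proof (rule continuous_map_eq [OF 1])
      fix w assume "w \<in> topspace (subtopology (total L) (V j))"
      then have w: "w \<in> V j" by simp
      show "(cmod (\<alpha> j w))\<^sup>2 = metric L w"
        using me [OF j(1), of "proj L w" "\<alpha> j w"] \<phi>_\<alpha> [OF j(1) w] w by simp
    qed
    then show "\<exists>U. openin (total L) U \<and> v \<in> U \<and> continuous_map (subtopology (total L) U) euclideanreal (metric L)"
      using op [OF j(1)] j(2) by blast
  qed
next
  fix v assume v: "v \<in> topspace (total L)"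
  obtain j where j: "j \<in> Idx C" "proj L v \<in> Opn C j" using index [OF v] .
  obtain z where z: "v = \<phi> j (proj L v, z)" using point [OF v j] .
  have m: "metric L v = (cmod z)\<^sup>2" using me [OF j, of z] z by simp
  have s: "smul L a v = \<phi> j (proj L v, a * z)" for a using sm [OF j, of a z] z by simp
  note b = rcoverD(2) [OF C j(1)] rcoverD(6) [OF C j]
  show "0 \<le> metric L v" by (simp add: m)
  show "metric L (smul L a v) = metric L v * (cmod a)\<^sup>2" for a
    using me [OF j] by (simp add: m s norm_mult power_mult_distrib mult.commute)
  show "metric L (nu L v) = metric L v"
    using nu [OF j, of z] me [OF b, of "cnj z"] z m by simp
  show "0 < metric L v" if "v \<noteq> smul L 0 v"
  proof -
    have "z \<noteq> 0" using that s [of 0] z by auto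
    then show ?thesis by (simp add: m)
  qed
next
  fix p assume "p \<in> action_domain G L"
  then obtain g v where p: "p = (g, v)" and g: "g \<in> Ar" and v: "v \<in> topspace (total L)" "proj L v = src G g"
    by (auto simp: action_domain_def)
  obtain i j z where j: "i \<in> Idx C" "j \<in> Idx C" "g \<in> edges G (Opn C i) (Opn C j)" "v = \<phi> j (src G g, z)"
    using act_point [OF g v] .
  note e = edgesD [OF j(3)]
  have "metric L (act L g v) = metric L v"
    using ac [OF j(1-3), of z] me [OF j(1) e(2)] me [OF j(2) e(3)] j(4) Z1D(2) [OF c j(1-3)] by (simp add: norm_mult)
  then show "case p of (g, v) \<Rightarrow> metric L (act L g v) = metric L v"
    by (simp add: p)
qed

text \<open>The definition asks for a cover indexed in \<open>'x \<times> bool\<close>, so the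
  charts are pulled back along \<open>reindex_map\<close>. The scalar by which an arrow acts is the
  value of the cocycle.\<close>

lemma local_triviality: "locally_trivial G L"
proof -
  let ?D = "reindex G C" let ?\<theta> = "reindex_map C"
  have \<theta>: "\<And>i. i \<in> Idx ?D \<Longrightarrow> ?\<theta> i \<in> Idx C" "\<And>i. i \<in> Idx ?D \<Longrightarrow> ?\<theta> (Bar ?D i) = Bar C (?\<theta> i)"
    using reindex(2) [OF C] by (auto simp: rrefines_def)
  have O: "Opn ?D i = Opn C (?\<theta> i)" for i
    by (cases i) (simp add: reindex_def reindex_map_def)
  have 1: "real_open_cover (objects G) (rho_obj G) (Idx ?D) (Bar ?D) (Opn ?D)"
    using reindex(1) [OF C] by (simp add: rcover_def)
  have 2: "\<forall>j\<in>Idx ?D. trivialization G L (Opn ?D j) (\<phi> (?\<theta> j))"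
    using triv \<theta> O by simp
  have 3: "\<forall>j\<in>Idx ?D. \<forall>x\<in>Opn ?D j. \<forall>z. \<phi> (?\<theta> (Bar ?D j)) (rho_obj G x, cnj z) = nu L (\<phi> (?\<theta> j) (x, z))"
    using nu \<theta> O by simp
  have 4: "\<forall>g\<in>Ar. \<forall>j0\<in>Idx ?D. \<forall>j1\<in>Idx ?D. rng G g \<in> Opn ?D j0 \<and> src G g \<in> Opn ?D j1 \<longrightarrow>
           (\<exists>c. c \<noteq> 0 \<and> (\<forall>z. act L g (\<phi> (?\<theta> j1) (src G g, z)) = \<phi> (?\<theta> j0) (rng G g, c * z)))"
  proof (intro ballI impI)
    fix g i j assume *: "g \<in> Ar" "i \<in> Idx ?D" "j \<in> Idx ?D" "rng G g \<in> Opn ?D i \<and> src G g \<in> Opn ?D j"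
    have e: "g \<in> edges G (Opn C (?\<theta> i)) (Opn C (?\<theta> j))"
      using * by (simp add: edges_def O)
    show "\<exists>c. c \<noteq> 0 \<and> (\<forall>z. act L g (\<phi> (?\<theta> j) (src G g, z)) = \<phi> (?\<theta> i) (rng G g, c * z))"
      using ac [OF \<theta>(1) \<theta>(1) e] Z1D(3) [OF c \<theta>(1) \<theta>(1) e] * by (intro exI [of _ "c (?\<theta> i) (?\<theta> j) g"]) simp
  qed
  show ?thesis
    unfolding locally_trivial_def
    by (rule exI [of _ "Idx ?D"], rule exI [of _ "Bar ?D"], rule exI [of _ "Opn ?D"], rule exI [of _ "\<lambda>j. \<phi> (?\<theta> j)"])
      (intro conjI 1 2 3 4)
qed

text \<open>The frame consists of the vectors with chart coordinate 1.\<close>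

lemma in_cls: "L \<in> cls G C c"
proof -
  define \<sigma> where "\<sigma> = (\<lambda>j x. \<phi> j (x, 1 :: complex))"
  have "frame G L C \<sigma>"
    unfolding frame_def
  proof (intro ballI conjI)
    fix j assume j: "j \<in> Idx C"
    have "continuous_map (subtopology (objects G) (Opn C j)) (Y j) (\<lambda>x. (x, 1))"
      by (simp add: continuous_map_pairedI)
    from continuous_map_compose [OF this cont_\<phi> [OF j]]
    show "continuous_map (subtopology (objects G) (Opn C j)) (total L) (\<sigma> j)"
      by (simp add: o_def \<sigma>_def)
    fix x assume x: "x \<in> Opn C j"
    show "\<sigma> j x \<in> topspace (total L)" "proj L (\<sigma> j x) = x" "metric L (\<sigma> j x) = 1"
      "nu L (\<sigma> j x) = \<sigma> (Bar C j) (rho_obj G x)"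
      using \<phi>_in [OF j x] pr [OF j x] me [OF j x] nu [OF j x] by (auto simp: \<sigma>_def)
  qed
  moreover have "transition G L C \<sigma> c"
    unfolding transition_def
  proof (intro ballI)
    fix i j g assume *: "i \<in> Idx C" "j \<in> Idx C" "g \<in> edges G (Opn C i) (Opn C j)"
    show "act L g (\<sigma> j (src G g)) = smul L (c i j g) (\<sigma> i (rng G g))"
      using ac [OF *, of 1] sm [OF *(1) edgesD(2) [OF *(3)]] by (simp add: \<sigma>_def)
  qed
  ultimately show ?thesis
    using real local_triviality hermitian by (auto simp: cls_def hermitian_real_line_bundle_def)
qed

end

section \<open>The trivial bundle and the realisation of arbitrary cocycles\<close>

context real_grpd
begin

definition unit_cover :: "(unit, 'x) rcov" where
  "unit_cover = \<lparr>Idx = UNIV, Bar = id, Opn = (\<lambda>_. Ob)\<rparr>"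

lemma unit_cover: "rcover G unit_cover"
proof -
  have "rho_obj G ` Ob = Ob"
    by (metis (no_types, lifting) image_cong image_image image_subset_iff order_antisym rho_obj_in rho_obj_rho_obj
        image_ident image_mono)
  then show ?thesis
    by (simp add: rcover_def real_open_cover_def unit_cover_def)
qed

lemma trivial_bundle_cls: "trivial_bundle G \<in> cls G unit_cover (\<lambda>i j g. 1)"
proof (rule chart_bundle.in_cls, rule chart_bundle.intro, unfold_locales)
  show "rcover G unit_cover" by (rule unit_cover)
  show "homeomorphic_map (prod_topology (subtopology (objects G) (Opn unit_cover j)) euclidean)
       (subtopology (total (trivial_bundle G)) {v. proj (trivial_bundle G) v \<in> Opn unit_cover j}) (\<lambda>p. p)" for j
  proof -
    have "subtopology (total (trivial_bundle G)) {v. proj (trivial_bundle G) v \<in> Ob} = total (trivial_bundle G)"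
      by (rule subtopology_superset) (auto simp: trivial_bundle_def)
    then show ?thesis
      by (simp add: unit_cover_def trivial_bundle_def homeomorphic_map_maps homeomorphic_maps_def)
        (rule exI [of _ "\<lambda>p. p"], simp)
  qed
  show "openin (total (trivial_bundle G)) {v \<in> topspace (total (trivial_bundle G)). proj (trivial_bundle G) v \<in> Opn unit_cover j}" for j
  proof -
    have "{v \<in> topspace (total (trivial_bundle G)). proj (trivial_bundle G) v \<in> Opn unit_cover j} = topspace (total (trivial_bundle G))"
      by (auto simp: trivial_bundle_def unit_cover_def)
    then show ?thesis by (simp only: openin_topspace)
  qed
qed (auto simp: trivial_bundle_def unit_cover_def Z1_one edges_def)

text \<open>Each fibre is given the coordinate of the one member chosen by \<open>pick\<close>, so
  that the total space is the injective image of \<open>Ob \<times> UNIV\<close> under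
  \<open>e\<close>. The chart of another member \<open>j\<close> differs from this reference by the
  unimodular factor \<open>k j x\<close>. The factors need not be continuous in \<open>x\<close>, as
  the choice is arbitrary, but their ratios are values of \<open>c\<close> on identities, and only
  these enter the gluing.\<close>

lemma cls_nonempty:
  fixes C :: "('j, 'x) rcov"
  assumes univ: "Ob \<times> (UNIV :: complex set) \<lesssim> (UNIV :: 'l set)"
    and C: "rcover G C" and c: "c \<in> Z1 G C"
  obtains L :: "('l, 'g, 'x) line_bundle" where "L \<in> cls G C c"
proof -
  obtain e :: "'x \<times> complex \<Rightarrow> 'l" where e: "inj_on e (Ob \<times> UNIV)"
    using univ by (auto simp: lepoll_def)
  define d where "d = inv_into (Ob \<times> UNIV) e"
  have de: "d (e (x, z)) = (x, z)" if "x \<in> Ob" for x z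
    unfolding d_def using e that by (intro inv_into_f_f) auto
  have e_eq: "e (x, z) = e (y, w) \<longleftrightarrow> x = y \<and> z = w" if "x \<in> Ob" "y \<in> Ob" for x y z w
    using inj_on_eq_iff [OF e, of "(x, z)" "(y, w)"] that by simp
  define k where "k = (\<lambda>j x. c (pick C x) j (ident G x))"
  define \<phi> where "\<phi> = (\<lambda>j (x, z). e (x, k j x * z))"
  let ?Y = "\<lambda>j. prod_topology (subtopology (objects G) (Opn C j)) (euclidean :: complex topology)"
  have topY: "topspace (?Y j) = Opn C j \<times> UNIV" if "j \<in> Idx C" for j
    using rcoverD(4) [OF C that] by auto
  have p: "pick C x \<in> Idx C" "x \<in> Opn C (pick C x)" if "x \<in> Ob" for x
    using pick [OF C that] by auto
  \<comment> \<open>The cocycle equation for \<open>g\<close> preceded by the identity at its range,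
    read as an arrow from the member \<open>i\<close> to the chosen one.\<close>
  have kc: "c (pick C (rng G g)) i (ident G (rng G g)) * c i j g = c (pick C (rng G g)) j g"
    if "i \<in> Idx C" "j \<in> Idx C" "g \<in> edges G (Opn C i) (Opn C j)" for i j g
  proof -
    note g = edgesD [OF that(3)]
    note q = p [OF rng_in [OF g(1)]]
    show ?thesis
      using Z1D(5) [OF c q(1) that(1,2) ident_edges [OF rng_in [OF g(1)] q(2) g(2)] that(3)] g by simp
  qed
  have k1: "cmod (k j x) = 1" "k j x \<noteq> 0" if "j \<in> Idx C" "x \<in> Opn C j" for j x
  proof -
    note x = rcoverD(7) [OF C that]
    show "cmod (k j x) = 1" "k j x \<noteq> 0"
      unfolding k_def using Z1D(2,3) [OF c p(1) [OF x] that(1) ident_edges [OF x p(2) [OF x] that(2)]] by simp_all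
  qed
  have kk: "k i x = k j x * c j i (ident G x)" if "i \<in> Idx C" "j \<in> Idx C" "x \<in> Opn C i" "x \<in> Opn C j" for i j x
    using kc [OF that(2,1) ident_edges [OF _ that(4,3)]] rcoverD(7) [OF C that(1,3)] by (simp add: k_def)
  have inj: "inj_on (\<phi> j) (topspace (?Y j))" if j: "j \<in> Idx C" for j
    using k1 [OF j] rcoverD(7) [OF C j] unfolding topY [OF j] by (auto simp: inj_on_def \<phi>_def e_eq)
  \<comment> \<open>On the overlap the change of charts sends \<open>(x, z)\<close> to
    \<open>x\<close> and \<open>c j i (ident G x) * z\<close>. It is continuous, so the set in
    question is the preimage of \<open>W\<close>, open in the open piece over the overlap.\<close>
  have tr: "openin (?Y i) {p \<in> topspace (?Y i). \<phi> i p \<in> \<phi> j ` W}"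
    if i: "i \<in> Idx C" and j: "j \<in> Idx C" and W: "openin (?Y j) W" for i j W
  proof -
    let ?E = "Opn C i \<inter> Opn C j"
    let ?D = "prod_topology (subtopology (objects G) ?E) (euclidean :: complex topology)"
    have E: "openin (objects G) ?E" "?E \<subseteq> Ob"
      using rcoverD(1) [OF C i] rcoverD(1) [OF C j] rcoverD(4) [OF C i] by auto
    have WY: "W \<subseteq> Opn C j \<times> UNIV" using openin_subset [OF W] topY [OF j] by simp
    have cf: "continuous_map ?D (subtopology (objects G) ?E) fst"
      by (rule continuous_map_fst)
    then have cf': "continuous_map ?D (objects G) fst" "continuous_map ?D (subtopology (objects G) (Opn C j)) fst"
      by (auto simp: continuous_map_in_subtopology)
    have ci: "continuous_map ?D (arrows G) (\<lambda>q. ident G (fst q))"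
      using continuous_map_compose [OF cf'(1) cont_ident] by (simp add: o_def)
    have "(\<lambda>q. ident G (fst q)) ` topspace ?D \<subseteq> edges G (Opn C j) (Opn C i)"
      using E by (auto intro!: ident_edges)
    from continuous_map_into_subtopology_compose [OF ci Z1D(1) [OF c j i] this]
    have cc: "continuous_map ?D euclidean (\<lambda>q. c j i (ident G (fst q)))" .
    have cm: "continuous_map ?D (?Y j) (\<lambda>q. (fst q, c j i (ident G (fst q)) * snd q))"
      by (intro continuous_map_pairedI cf' continuous_map_mult cc continuous_map_snd)
    define S where "S = {q \<in> topspace ?D. (fst q, c j i (ident G (fst q)) * snd q) \<in> W}"
    have "openin ?D S"
      unfolding S_def by (rule openin_continuous_map_preimage [OF cm W])
    then have "openin (subtopology (?Y i) (?E \<times> UNIV)) S"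
      by (simp add: subtopology_Times subtopology_subtopology Int_absorb1)
    moreover have "openin (?Y i) (?E \<times> UNIV)"
      using openin_subtopology_Int2 [OF rcoverD(1) [OF C j], of "Opn C i"] by (simp add: openin_prod_Times_iff)
    ultimately have "openin (?Y i) S"
      using openin_trans_full [of "?Y i" "?E \<times> UNIV" S] by (simp only: S_def)
    moreover have "{p \<in> topspace (?Y i). \<phi> i p \<in> \<phi> j ` W} = S"
    proof -
      have iff: "\<phi> i (x, z) \<in> \<phi> j ` W \<longleftrightarrow> x \<in> Opn C j \<and> (x, c j i (ident G x) * z) \<in> W" if x: "x \<in> Opn C i" for x z
      proof
        assume "\<phi> i (x, z) \<in> \<phi> j ` W"
        then obtain y w where yw: "(y, w) \<in> W" "e (x, k i x * z) = e (y, k j y * w)"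
          by (auto simp: \<phi>_def)
        have y: "y \<in> Opn C j" using WY yw(1) by auto
        have xy: "x = y" "k i x * z = k j x * w"
          using yw(2) e_eq rcoverD(7) [OF C i x] rcoverD(7) [OF C j y] by auto
        then have "c j i (ident G x) * z = w"
          using kk [OF i j x] k1(2) [OF j] y by auto
        then show "x \<in> Opn C j \<and> (x, c j i (ident G x) * z) \<in> W" using yw xy y by simp
      next
        assume *: "x \<in> Opn C j \<and> (x, c j i (ident G x) * z) \<in> W"
        then have "\<phi> i (x, z) = \<phi> j (x, c j i (ident G x) * z)"
          using kk [OF i j x] by (simp add: \<phi>_def mult.assoc)
        then show "\<phi> i (x, z) \<in> \<phi> j ` W" using * by (metis imageI)
      qed
      show ?thesis
      proof (rule Set.set_eqI)
        fix p :: "'x \<times> complex"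
        obtain x z where p: "p = (x, z)" by (cases p) blast
        show "p \<in> {p \<in> topspace (?Y i). \<phi> i p \<in> \<phi> j ` W} \<longleftrightarrow> p \<in> S"
        proof (cases "x \<in> Opn C i")
          case True
          show ?thesis
            using rcoverD(7) [OF C i True] True unfolding S_def p mem_Collect_eq iff [OF True] by simp
        qed (simp add: p S_def)
      qed
    qed
    ultimately show ?thesis by simp
  qed
  have img: "\<phi> j ` topspace (?Y j) = e ` (Opn C j \<times> UNIV)" if j: "j \<in> Idx C" for j
  proof -
    have "e (x, z) \<in> \<phi> j ` (Opn C j \<times> UNIV)" if "x \<in> Opn C j" for x z
      using k1(2) [OF j that] that by (intro image_eqI [of _ _ "(x, z / k j x)"]) (auto simp: \<phi>_def)
    then show ?thesis unfolding topY [OF j] by (auto simp: \<phi>_def)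
  qed
  have "\<exists>T. topspace T = (\<Union>j\<in>Idx C. \<phi> j ` topspace (?Y j)) \<and>
    (\<forall>j\<in>Idx C. openin T (\<phi> j ` topspace (?Y j)) \<and>
      homeomorphic_map (?Y j) (subtopology T (\<phi> j ` topspace (?Y j))) (\<phi> j))"
    by (rule glue_topology [of "Idx C" \<phi> ?Y]; (rule inj tr; assumption))
  then obtain T where gT: "topspace T = (\<Union>j\<in>Idx C. \<phi> j ` topspace (?Y j)) \<and>
    (\<forall>j\<in>Idx C. openin T (\<phi> j ` topspace (?Y j)) \<and>
      homeomorphic_map (?Y j) (subtopology T (\<phi> j ` topspace (?Y j))) (\<phi> j))"
    by (elim exE) (erule that)
  note topT = conjunct1 [OF gT] and oT = conjunct1 [OF bspec [OF conjunct2 [OF gT]]]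
    and hT = conjunct2 [OF bspec [OF conjunct2 [OF gT]]]
  have "topspace T = (\<Union>j\<in>Idx C. e ` (Opn C j \<times> UNIV))" unfolding topT using img by simp
  also have "\<dots> = e ` (Ob \<times> UNIV)"
  proof -
    have "(\<Union>j\<in>Idx C. Opn C j) = Ob" using C by (simp add: rcover_def real_open_cover_def)
    then show ?thesis by blast
  qed
  finally have topT': "topspace T = e ` (Ob \<times> UNIV)" .
  \<comment> \<open>Addition, scalars and metric are read in the reference coordinate. The
    involution is expressed through the chart of the conjugate member, because the member chosen at
    \<open>rho_obj G x\<close> need not be the conjugate of the one chosen at
    \<open>x\<close>.\<close>
  define L :: "('l, 'g, 'x) line_bundle" where "L = \<lparr>total = T, proj = (\<lambda>v. fst (d v)),
      vadd = (\<lambda>v w. e (fst (d v), snd (d v) + snd (d w))), smul = (\<lambda>a v. e (fst (d v), a * snd (d v))),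
      nu = (\<lambda>v. \<phi> (Bar C (pick C (fst (d v)))) (rho_obj G (fst (d v)), cnj (snd (d v)))),
      act = (\<lambda>g v. e (rng G g, c (pick C (rng G g)) (pick C (fst (d v))) g * snd (d v))),
      metric = (\<lambda>v. (cmod (snd (d v)))\<^sup>2)\<rparr>"
  have d\<phi>: "d (\<phi> j (x, z)) = (x, k j x * z)" if "j \<in> Idx C" "x \<in> Opn C j" for j x z
    using rcoverD(7) [OF C that] by (simp add: \<phi>_def de)
  have Vj: "{v \<in> topspace (total L). proj L v \<in> Opn C j} = \<phi> j ` topspace (?Y j)" if j: "j \<in> Idx C" for j
    unfolding img [OF j] using rcoverD(7) [OF C j] by (auto simp: L_def topT' de)
  have "chart_bundle G L C \<phi> c"
  proof (unfold_locales)
    show "rcover G C" by (rule C)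
    show "c \<in> Z1 G C" by (rule c)
    show "proj L v \<in> Ob" if "v \<in> topspace (total L)" for v
      using that by (auto simp: L_def topT' de)
    fix j assume j: "j \<in> Idx C"
    show "openin (total L) {v \<in> topspace (total L). proj L v \<in> Opn C j}"
      unfolding Vj [OF j] using oT [OF j] by (simp add: L_def)
    have "subtopology (total L) {v. proj L v \<in> Opn C j} = subtopology (total L) {v \<in> topspace (total L). proj L v \<in> Opn C j}"
    proof -
      have "{v \<in> topspace (total L). proj L v \<in> Opn C j} = topspace (total L) \<inter> {v. proj L v \<in> Opn C j}" by auto
      then show ?thesis by (simp only: subtopology_restrict)
    qed
    also have "\<dots> = subtopology T (\<phi> j ` topspace (?Y j))"
      unfolding Vj [OF j] by (simp add: L_def)
    finally show "homeomorphic_map (?Y j) (subtopology (total L) {v. proj L v \<in> Opn C j}) (\<phi> j)"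
      using hT [OF j] by simp
    fix x z assume x: "x \<in> Opn C j"
    note xX = rcoverD(7) [OF C j x]
    show "proj L (\<phi> j (x, z)) = x" by (simp add: L_def d\<phi> [OF j x])
    show "metric L (\<phi> j (x, z)) = (cmod z)\<^sup>2"
      using k1 [OF j x] by (simp add: L_def d\<phi> [OF j x] norm_mult)
    show "vadd L (\<phi> j (x, z)) (\<phi> j (x, w)) = \<phi> j (x, z + w)" for w
      by (simp add: L_def d\<phi> [OF j x]) (simp add: \<phi>_def algebra_simps)
    show "smul L z (\<phi> j (x, w)) = \<phi> j (x, z * w)" for w
      by (simp add: L_def d\<phi> [OF j x]) (simp add: \<phi>_def algebra_simps)
    have e1: "ident G x \<in> edges G (Opn C (pick C x)) (Opn C j)"
      by (rule ident_edges [OF xX p(2) [OF xX] x])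
    \<comment> \<open>This is \<open>kc\<close> for the identity at \<open>rho_obj G x\<close> and
      the conjugates of the chosen member and of \<open>j\<close>; the Real condition on
      \<open>c\<close> turns the second factor into a conjugate.\<close>
    have "k (Bar C j) (rho_obj G x) = k (Bar C (pick C x)) (rho_obj G x) * cnj (k j x)"
      using kc [OF rcoverD(2) [OF C p(1) [OF xX]] rcoverD(2) [OF C j] rho_edges [OF C p(1) [OF xX] j e1]]
        Z1D(4) [OF c p(1) [OF xX] j e1] xX by (simp add: k_def)
    then show "nu L (\<phi> j (x, z)) = \<phi> (Bar C j) (rho_obj G x, cnj z)"
      by (simp add: L_def d\<phi> [OF j x]) (simp add: \<phi>_def mult.assoc)
  next
    fix i j g z assume *: "i \<in> Idx C" "j \<in> Idx C" and e: "g \<in> edges G (Opn C i) (Opn C j)"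
    note g = edgesD [OF e]
    let ?r = "rng G g" and ?s = "src G g"
    note r = rng_in [OF g(1)] and s = src_in [OF g(1)]
    have e1: "g \<in> edges G (Opn C (pick C ?r)) (Opn C (pick C ?s))"
      using p [OF r] p [OF s] g by (simp add: edges_def)
    have "c (pick C ?r) (pick C ?s) g * k j ?s = c (pick C ?r) j g"
      using Z1D(5) [OF c p(1) [OF r] p(1) [OF s] *(2) e1 ident_edges [OF s p(2) [OF s] g(3)]] g by (simp add: k_def)
    moreover have "k i ?r * c i j g = c (pick C ?r) j g"
      using kc [OF * e] by (simp add: k_def)
    ultimately show "act L g (\<phi> j (?s, z)) = \<phi> i (?r, c i j g * z)"
      by (simp add: L_def d\<phi> [OF *(2) g(3)]) (simp add: \<phi>_def flip: mult.assoc)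
  qed
  then show thesis
    by (intro that [of L] chart_bundle.in_cls)
qed

end


section \<open>The Real Picard group\<close>

definition cinter :: "('i, 'x) rcov \<Rightarrow> ('j, 'x) rcov \<Rightarrow> ('i \<times> 'j, 'x) rcov" where
  "cinter C D = \<lparr>Idx = Idx C \<times> Idx D, Bar = map_prod (Bar C) (Bar D), Opn = (\<lambda>(i, j). Opn C i \<inter> Opn D j)\<rparr>"

context real_grpd
begin

lemma cls_cong:
  assumes "\<And>i j g. \<lbrakk>i \<in> Idx C; j \<in> Idx C; g \<in> edges G (Opn C i) (Opn C j)\<rbrakk> \<Longrightarrow> c i j g = d i j g"
  shows "cls G C c = cls G C d"
  using assms by (simp add: cls_def transition_def)

lemma inj_on_rho_obj: "inj_on (rho_obj G) Ob"
  by (metis inj_on_inverseI rho_obj_rho_obj)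

lemma cinter:
  assumes C: "rcover G C" and D: "rcover G D"
  shows "rcover G (cinter C D)" "rrefines (cinter C D) C fst" "rrefines (cinter C D) D snd"
proof -
  have "openin (objects G) (Opn (cinter C D) k) \<and> Bar (cinter C D) k \<in> Idx (cinter C D) \<and>
      Bar (cinter C D) (Bar (cinter C D) k) = k \<and> Opn (cinter C D) (Bar (cinter C D) k) = rho_obj G ` Opn (cinter C D) k"
    if k: "k \<in> Idx (cinter C D)" for k
  proof -
    obtain i j where ij: "k = (i, j)" by (cases k) blast
    with k have i: "i \<in> Idx C" "j \<in> Idx D" by (simp_all add: cinter_def)
    have "rho_obj G ` (Opn C i \<inter> Opn D j) = rho_obj G ` Opn C i \<inter> rho_obj G ` Opn D j"
      by (rule inj_on_image_Int [OF inj_on_rho_obj rcoverD(4) [OF C i(1)] rcoverD(4) [OF D i(2)]])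
    then show ?thesis
      using rcoverD(1,2,3,5) [OF C i(1)] rcoverD(1,2,3,5) [OF D i(2)] by (simp add: ij cinter_def openin_Int)
  qed
  moreover have "\<Union> (Opn (cinter C D) ` Idx (cinter C D)) = Ob"
  proof
    show "\<Union> (Opn (cinter C D) ` Idx (cinter C D)) \<subseteq> Ob"
      using rcoverD(7) [OF C] by (auto simp: cinter_def)
    show "Ob \<subseteq> \<Union> (Opn (cinter C D) ` Idx (cinter C D))"
    proof
      fix x assume x: "x \<in> Ob"
      obtain i where i: "i \<in> Idx C" "x \<in> Opn C i" using rcover_ex [OF C x] .
      obtain j where j: "j \<in> Idx D" "x \<in> Opn D j" using rcover_ex [OF D x] .
      have "x \<in> Opn (cinter C D) (i, j)" "(i, j) \<in> Idx (cinter C D)"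
        using i j by (auto simp: cinter_def)
      then show "x \<in> \<Union> (Opn (cinter C D) ` Idx (cinter C D))" by blast
    qed
  qed
  ultimately show "rcover G (cinter C D)"
    unfolding rcover_def real_open_cover_def by blast
  show "rrefines (cinter C D) C fst" "rrefines (cinter C D) D snd"
    by (auto simp: rrefines_def cinter_def)
qed

end

text \<open>The argument \<open>bundle_type\<close> carries the type \<open>'l\<close> of total
  spaces, which \<open>G\<close> does not mention.\<close>

locale real_picard = real_grpd G for G :: "('g, 'x) real_groupoid" +
  fixes bundle_type :: "'l itself"
  assumes univ: "topspace (objects G) \<times> (UNIV :: complex set) \<lesssim> (UNIV :: 'l set)"
begin

abbreviation "Pic \<equiv> PicR TYPE('l) G"
abbreviation lcls :: "('j, 'x) rcov \<Rightarrow> ('j \<Rightarrow> 'j \<Rightarrow> 'g \<Rightarrow> complex) \<Rightarrow> ('l, 'g, 'x) line_bundle set" where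
  "lcls \<equiv> cls G"

lemma lcls_ex:
  assumes "rcover G C" "c \<in> Z1 G C"
  obtains L where "L \<in> lcls C c"
  using cls_nonempty [OF univ assms] .

text \<open>Both sides are the isomorphism class of \<open>L\<close>. The two covers may have
  different index types and need not refine each other.\<close>

lemma lcls_eq:
  assumes "rcover G C" "c \<in> Z1 G C" "rcover G D" "d \<in> Z1 G D" "L \<in> lcls C c" "L \<in> lcls D d"
  shows "lcls C c = lcls D d"
  unfolding cls_eq_isomorphism_class [OF assms(1,2,5)] cls_eq_isomorphism_class [OF assms(3,4,6)] by (rule refl)

text \<open>A bundle on the right is presented by the restricted cocycle as well, so the two classes
  share a member. As the right side does not mention \<open>\<theta>\<close>, the choice of the
  refining map does not matter.\<close>

lemma lcls_refine:
  assumes "rcover G C" "c \<in> Z1 G C" "rcover G D" "rrefines D C \<theta>"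
  shows "lcls D (\<lambda>i j. c (\<theta> i) (\<theta> j)) = lcls C c"
proof -
  obtain L where L: "L \<in> lcls C c" using lcls_ex [OF assms(1,2)] .
  show ?thesis
    by (rule lcls_eq [OF assms(3) Z1_refine [OF assms(4,2)] assms(1,2) cls_refine [OF assms(4) L] L])
qed

lemma lcls_eq_iff_cohom:
  assumes "rcover G C" "c \<in> Z1 G C" "d \<in> Z1 G C"
  shows "lcls C c = lcls C d \<longleftrightarrow> cohom G C c d"
proof -
  obtain L where L: "L \<in> lcls C c" using lcls_ex [OF assms(1,2)] .
  interpret herm_bundle G L by (rule herm_bundleI [OF cls_herm [OF L]])
  have "L \<in> lcls C d \<longleftrightarrow> cohom G C c d" by (rule cls_iff_cohom [OF assms(1) L])
  then show ?thesis using L lcls_eq [OF assms(1,2) assms(1,3) L] by blast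
qed

text \<open>A bundle comes with a cover indexed in \<open>'x \<times> bool\<close>, so covers of
  this one type present all elements of the group; in the other direction each cocycle is realised
  in \<open>'l\<close>.\<close>

lemma carrier_Pic: "carrier Pic = {A. \<exists>(C :: ('x \<times> bool, 'x) rcov) c. rcover G C \<and> c \<in> Z1 G C \<and> A = lcls C c}"
proof -
  let ?R = "{(L, M). hermitian_real_line_bundle G L \<and> hermitian_real_line_bundle G M \<and> bundle_isomorphic G L M}
    :: ('l, 'g, 'x) line_bundle rel"
  have R: "?R `` {L} = lcls C c" if "rcover G C" "c \<in> Z1 G C" "L \<in> lcls C c"
    for L and C :: "('x \<times> bool, 'x) rcov" and c
    using cls_eq_isomorphism_class [OF that] cls_herm [OF that(3)] by auto
  have c: "carrier Pic = {?R `` {L} | L. hermitian_real_line_bundle G L}"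
    by (auto simp: PicR_def quotient_def)
  show ?thesis
  proof (intro equalityI subsetI)
    fix A assume "A \<in> carrier Pic"
    then obtain L where L: "hermitian_real_line_bundle G L" "A = ?R `` {L}" unfolding c by blast
    interpret herm_bundle G L by (rule herm_bundleI [OF L(1)])
    obtain C :: "('x \<times> bool, 'x) rcov" and c where "rcover G C" "c \<in> Z1 G C" "L \<in> lcls C c"
      using cls_exists .
    then show "A \<in> {A. \<exists>(C :: ('x \<times> bool, 'x) rcov) c. rcover G C \<and> c \<in> Z1 G C \<and> A = lcls C c}"
      using L(2) R by blast
  next
    fix A assume "A \<in> {A. \<exists>(C :: ('x \<times> bool, 'x) rcov) c. rcover G C \<and> c \<in> Z1 G C \<and> A = lcls C c}"
    then obtain C :: "('x \<times> bool, 'x) rcov" and c where C: "rcover G C" "c \<in> Z1 G C" "A = lcls C c" by blast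
    obtain L where L: "L \<in> lcls C c" using lcls_ex [OF C(1,2)] .
    then show "A \<in> carrier Pic"
      unfolding c using R [OF C(1,2) L] C(3) cls_herm [OF L] by blast
  qed
qed

lemma Pic_obtain:
  assumes "A \<in> carrier Pic"
  obtains C :: "('x \<times> bool, 'x) rcov" and c where "rcover G C" "c \<in> Z1 G C" "A = lcls C c"
  using assms unfolding carrier_Pic by blast

lemma lcls_carrier:
  assumes "rcover G C" "c \<in> Z1 G C"
  shows "lcls C c \<in> carrier Pic"
proof -
  have "lcls C c = lcls (reindex G C) (\<lambda>i j. c (reindex_map C i) (reindex_map C j))"
    using lcls_refine [OF assms reindex [OF assms(1)]] by simp
  then show ?thesis
    unfolding carrier_Pic using reindex(1) [OF assms(1)] Z1_refine [OF reindex(2) [OF assms(1)] assms(2)] by blast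
qed

text \<open>One inclusion holds since every tensor product has the product cocycle. For the other,
  any bundle with the product cocycle is a tensor product of arbitrarily chosen
  representatives.\<close>

lemma lcls_mult:
  assumes C: "rcover G C" and c: "c \<in> Z1 G C" and d: "d \<in> Z1 G C"
  shows "lcls C c \<otimes>\<^bsub>Pic\<^esub> lcls C d = lcls C (\<lambda>i j g. c i j g * d i j g)"
proof -
  let ?cd = "\<lambda>i j g. c i j g * d i j g"
  have cd: "?cd \<in> Z1 G C" by (rule Z1_mult [OF c d])
  have m: "lcls C c \<otimes>\<^bsub>Pic\<^esub> lcls C d = {T. hermitian_real_line_bundle G T \<and>
        (\<exists>L\<in>lcls C c. \<exists>M\<in>lcls C d. \<exists>T' :: ('l, 'g, 'x) line_bundle.
           is_tensor_product G L M T' \<and> bundle_isomorphic G T T')}"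
    by (simp add: PicR_def)
  show ?thesis
    unfolding m
  proof (intro equalityI subsetI)
    fix T :: "('l, 'g, 'x) line_bundle" assume "T \<in> {T. hermitian_real_line_bundle G T \<and>
        (\<exists>L\<in>lcls C c. \<exists>M\<in>lcls C d. \<exists>T' :: ('l, 'g, 'x) line_bundle.
           is_tensor_product G L M T' \<and> bundle_isomorphic G T T')}"
    then obtain L M and T' :: "('l, 'g, 'x) line_bundle" where h: "hermitian_real_line_bundle G T"
      and L: "L \<in> lcls C c" and M: "M \<in> lcls C d" and T': "is_tensor_product G L M T'" "bundle_isomorphic G T T'"
      by blast
    show "T \<in> lcls C ?cd"
      by (rule cls_isomorphic_closed [OF C cd tensor_product_cls [OF C L M T'(1)] h bundle_isomorphic_sym [OF T'(2)]])
  next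
    fix T assume T: "T \<in> lcls C ?cd"
    obtain L where L: "L \<in> lcls C c" using lcls_ex [OF C c] .
    obtain M where M: "M \<in> lcls C d" using lcls_ex [OF C d] .
    show "T \<in> {T. hermitian_real_line_bundle G T \<and>
        (\<exists>L\<in>lcls C c. \<exists>M\<in>lcls C d. \<exists>T' :: ('l, 'g, 'x) line_bundle.
           is_tensor_product G L M T' \<and> bundle_isomorphic G T T')}"
      using cls_herm [OF T] L M cls_tensor_product [OF C L M T] bundle_isomorphic_refl [OF cls_herm [OF T]] by blast
  qed
qed

text \<open>The trivial bundle has cocycle 1 on the cover with a single member, and every cover
  refines that one.\<close>

lemma lcls_one:
  assumes C: "rcover G C"
  shows "\<one>\<^bsub>Pic\<^esub> = lcls C (\<lambda>i j g. 1)"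
proof -
  let ?t = "trivial_bundle G"
  have "{L. hermitian_real_line_bundle G L \<and> bundle_isomorphic G ?t L} = lcls unit_cover (\<lambda>i j g. 1)"
    using cls_isomorphic [OF unit_cover trivial_bundle_cls] cls_herm
      cls_isomorphic_closed [OF unit_cover Z1_one trivial_bundle_cls] by blast
  moreover have "\<one>\<^bsub>Pic\<^esub> = {L. hermitian_real_line_bundle G L \<and> bundle_isomorphic G ?t L}"
    unfolding PicR_def monoid.simps by (intro Collect_cong) (auto intro: bundle_isomorphic_sym)
  ultimately have "\<one>\<^bsub>Pic\<^esub> = lcls unit_cover (\<lambda>i j g. 1)" by simp
  moreover have "rrefines C unit_cover (\<lambda>_. ())"
    using rcoverD(4) [OF C] by (auto simp: rrefines_def unit_cover_def)
  ultimately show ?thesis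
    using lcls_refine [OF unit_cover Z1_one C] by simp
qed

text \<open>Two classes are brought to one cover by intersecting their covers, which pairs the
  indices; products of classes can then be computed pointwise.\<close>

lemma Pic_obtain2:
  assumes A: "A \<in> carrier Pic" and B: "B \<in> carrier Pic"
  obtains C :: "(('x \<times> bool) \<times> ('x \<times> bool), 'x) rcov" and a b where
    "rcover G C" "a \<in> Z1 G C" "b \<in> Z1 G C" "A = lcls C a" "B = lcls C b"
proof -
  obtain C :: "('x \<times> bool, 'x) rcov" and c where C: "rcover G C" "c \<in> Z1 G C" "A = lcls C c"
    using Pic_obtain [OF A] .
  obtain D :: "('x \<times> bool, 'x) rcov" and d where D: "rcover G D" "d \<in> Z1 G D" "B = lcls D d"
    using Pic_obtain [OF B] .
  note E = cinter [OF C(1) D(1)]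
  show thesis
    by (rule that [OF E(1) Z1_refine [OF E(2) C(2)] Z1_refine [OF E(3) D(2)]])
      (use lcls_refine [OF C(1,2) E(1,2)] lcls_refine [OF D(1,2) E(1,3)] C(3) D(3) in auto)
qed

lemma Pic_comm_group: "comm_group Pic"
proof (rule comm_groupI)
  fix A B assume A: "A \<in> carrier Pic" and B: "B \<in> carrier Pic"
  obtain C :: "(('x \<times> bool) \<times> ('x \<times> bool), 'x) rcov" and a b where
    C: "rcover G C" "a \<in> Z1 G C" "b \<in> Z1 G C" "A = lcls C a" "B = lcls C b"
    using Pic_obtain2 [OF A B] .
  show "A \<otimes>\<^bsub>Pic\<^esub> B \<in> carrier Pic"
    unfolding C(4,5) lcls_mult [OF C(1-3)] by (rule lcls_carrier [OF C(1) Z1_mult [OF C(2,3)]])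
  show "A \<otimes>\<^bsub>Pic\<^esub> B = B \<otimes>\<^bsub>Pic\<^esub> A"
    unfolding C(4,5) lcls_mult [OF C(1-3)] lcls_mult [OF C(1,3,2)] by (simp add: mult.commute)
next
  show "\<one>\<^bsub>Pic\<^esub> \<in> carrier Pic"
    unfolding lcls_one [OF unit_cover] by (rule lcls_carrier [OF unit_cover Z1_one])
next
  fix A B D assume A: "A \<in> carrier Pic" and B: "B \<in> carrier Pic" and D: "D \<in> carrier Pic"
  obtain C :: "(('x \<times> bool) \<times> ('x \<times> bool), 'x) rcov" and a b where
    C: "rcover G C" "a \<in> Z1 G C" "b \<in> Z1 G C" "A = lcls C a" "B = lcls C b"
    using Pic_obtain2 [OF A B] .
  obtain C' :: "('x \<times> bool, 'x) rcov" and d where C': "rcover G C'" "d \<in> Z1 G C'" "D = lcls C' d"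
    using Pic_obtain [OF D] .
  note E = cinter [OF C(1) C'(1)]
  let ?E = "cinter C C'"
  define a' b' d' where "a' = (\<lambda>(i :: (('x \<times> bool) \<times> ('x \<times> bool)) \<times> ('x \<times> bool)) (j :: (('x \<times> bool) \<times> ('x \<times> bool)) \<times> ('x \<times> bool)). a (fst i) (fst j))"
    and "b' = (\<lambda>(i :: (('x \<times> bool) \<times> ('x \<times> bool)) \<times> ('x \<times> bool)) (j :: (('x \<times> bool) \<times> ('x \<times> bool)) \<times> ('x \<times> bool)). b (fst i) (fst j))"
    and "d' = (\<lambda>(i :: (('x \<times> bool) \<times> ('x \<times> bool)) \<times> ('x \<times> bool)) (j :: (('x \<times> bool) \<times> ('x \<times> bool)) \<times> ('x \<times> bool)). d (snd i) (snd j))"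
  have Z: "a' \<in> Z1 G ?E" "b' \<in> Z1 G ?E" "d' \<in> Z1 G ?E"
    unfolding a'_def b'_def d'_def using Z1_refine [OF E(2)] Z1_refine [OF E(3)] C C' by blast+
  have e: "A = lcls ?E a'" "B = lcls ?E b'" "D = lcls ?E d'"
    unfolding a'_def b'_def d'_def C(4,5) C'(3)
    using lcls_refine [OF C(1,2) E(1,2)] lcls_refine [OF C(1,3) E(1,2)] lcls_refine [OF C'(1,2) E(1,3)] by simp_all
  show "A \<otimes>\<^bsub>Pic\<^esub> B \<otimes>\<^bsub>Pic\<^esub> D = A \<otimes>\<^bsub>Pic\<^esub> (B \<otimes>\<^bsub>Pic\<^esub> D)"
    unfolding e lcls_mult [OF E(1) Z(1,2)] lcls_mult [OF E(1) Z(2,3)]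
      lcls_mult [OF E(1) Z1_mult [OF Z(1,2)] Z(3)] lcls_mult [OF E(1) Z(1) Z1_mult [OF Z(2,3)]]
    by (simp add: mult.assoc)
next
  fix A assume A: "A \<in> carrier Pic"
  obtain C :: "('x \<times> bool, 'x) rcov" and c where C: "rcover G C" "c \<in> Z1 G C" "A = lcls C c"
    using Pic_obtain [OF A] .
  show "\<one>\<^bsub>Pic\<^esub> \<otimes>\<^bsub>Pic\<^esub> A = A"
    unfolding lcls_one [OF C(1)] C(3) lcls_mult [OF C(1) Z1_one C(2)] by simp
  have "lcls C (\<lambda>i j g. cnj (c i j g)) \<otimes>\<^bsub>Pic\<^esub> A = \<one>\<^bsub>Pic\<^esub>"
    unfolding lcls_one [OF C(1)] C(3) lcls_mult [OF C(1) Z1_inverse [OF C(2)] C(2)]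
  proof (rule cls_cong)
    fix i j g assume *: "i \<in> Idx C" "j \<in> Idx C" "g \<in> edges G (Opn C i) (Opn C j)"
    show "cnj (c i j g) * c i j g = 1"
      using Z1D(2) [OF C(2) *] by (simp add: complex_norm_square [symmetric] mult.commute)
  qed
  then show "\<exists>B\<in>carrier Pic. B \<otimes>\<^bsub>Pic\<^esub> A = \<one>\<^bsub>Pic\<^esub>"
    using lcls_carrier [OF C(1) Z1_inverse [OF C(2)]] by blast
qed

end


section \<open>The nerve in low degrees\<close>

definition vert :: "nat \<Rightarrow> nat \<Rightarrow> nat" where
  "vert i = (\<lambda>k\<in>{..0}. i)"

definition edge :: "nat \<Rightarrow> nat \<Rightarrow> nat \<Rightarrow> nat" where
  "edge i j = (\<lambda>k\<in>{..1}. if k = 0 then i else j)"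

text \<open>The chain whose arrow from vertex \<open>j\<close> to vertex \<open>i\<close> is \<open>a i \<cdot> a j\<^sup>-\<^sup>1\<close>, the \<open>a i\<close> having a common source.\<close>

definition fan :: "('g, 'x) real_groupoid \<Rightarrow> nat \<Rightarrow> (nat \<Rightarrow> 'g) \<Rightarrow> nat \<times> nat \<Rightarrow> 'g" where
  "fan G n a = (\<lambda>p\<in>{..n} \<times> {..n}. gcomp G (a (fst p)) (ginv G (a (snd p))))"

definition pt :: "('g, 'x) real_groupoid \<Rightarrow> 'x \<Rightarrow> nat \<times> nat \<Rightarrow> 'g" where
  "pt G x = fan G 0 (\<lambda>_. ident G x)"

text \<open>With these exponents the entry \<open>(0, 1)\<close> is \<open>g\<close> itself; vertex
  0 carries the range and vertex 1 the source.\<close>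

definition ch1 :: "('g, 'x) real_groupoid \<Rightarrow> 'g \<Rightarrow> nat \<times> nat \<Rightarrow> 'g" where
  "ch1 G g = fan G 1 (\<lambda>i. if i = 0 then g else ident G (src G g))"

text \<open>The exponents lead from the source of \<open>h\<close> to the three vertices, so that
  the entries \<open>(0, 1)\<close>, \<open>(1, 2)\<close> and \<open>(0, 2)\<close> are
  \<open>g\<close>, \<open>h\<close> and their product.\<close>

definition ch2 :: "('g, 'x) real_groupoid \<Rightarrow> 'g \<Rightarrow> 'g \<Rightarrow> nat \<times> nat \<Rightarrow> 'g" where
  "ch2 G g h = fan G 2 (\<lambda>i. if i = 0 then gcomp G g h else if i = 1 then h else ident G (src G h))"

lemma hom_Delta'_0: "\<phi> \<in> hom_Delta' 0 n \<longleftrightarrow> (\<exists>i\<le>n. \<phi> = vert i)"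
proof
  assume "\<phi> \<in> hom_Delta' 0 n"
  then have f: "\<phi> \<in> {..0} \<rightarrow>\<^sub>E {..n}" by (simp add: hom_Delta'_def)
  then have "\<phi> = vert (\<phi> 0)"
    by (intro ext) (auto simp: vert_def PiE_def extensional_def)
  moreover have "\<phi> 0 \<le> n" using f by auto
  ultimately show "\<exists>i\<le>n. \<phi> = vert i" by blast
qed (auto simp: hom_Delta'_def vert_def strict_mono_on_def split: if_splits)

lemma hom_Delta'_1: "\<phi> \<in> hom_Delta' 1 n \<longleftrightarrow> (\<exists>i j. i < j \<and> j \<le> n \<and> \<phi> = edge i j)"
proof
  assume "\<phi> \<in> hom_Delta' 1 n"
  then have f: "\<phi> \<in> {..1} \<rightarrow>\<^sub>E {..n}" and m: "strict_mono_on {..1} \<phi>" by (auto simp: hom_Delta'_def)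
  have "\<phi> = edge (\<phi> 0) (\<phi> 1)"
  proof
    fix k show "\<phi> k = edge (\<phi> 0) (\<phi> 1) k"
      using PiE_arb [OF f, of k] by (cases "k = 0"; cases "k = 1") (auto simp: edge_def)
  qed
  moreover have "\<phi> 0 < \<phi> 1" using m by (simp add: strict_mono_on_def)
  moreover have "\<phi> 1 \<le> n" using f by auto
  ultimately show "\<exists>i j. i < j \<and> j \<le> n \<and> \<phi> = edge i j" by blast
qed (auto simp: hom_Delta'_def edge_def strict_mono_on_def split: if_splits)

lemma vert_0 [simp]: "vert i 0 = i"
  and edge_0 [simp]: "edge i j 0 = i"
  and edge_1 [simp]: "edge i j (Suc 0) = j"
  by (auto simp: vert_def edge_def)

lemma compose_vert: "compose {..0} f (vert i) = vert (f i)"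
  by (auto simp: compose_def vert_def)

lemma compose_edge: "compose {..Suc 0} f (edge i j) = edge (f i) (f j)"
  by (auto simp: compose_def edge_def)

lemma omit_1 [simp]:
  "omit (Suc 0) 0 0 = 1" "omit (Suc 0) 0 (Suc 0) = 2" "omit (Suc 0) (Suc 0) 0 = 0" "omit (Suc 0) (Suc 0) (Suc 0) = 2"
  "omit (Suc 0) 2 0 = 0" "omit (Suc 0) 2 (Suc 0) = 1" "omit 0 0 0 = 1" "omit 0 (Suc 0) 0 = 0"
  by (simp_all add: omit_def)

lemma fan_apply [simp]: "i \<le> n \<Longrightarrow> j \<le> n \<Longrightarrow> fan G n a (i, j) = gcomp G (a i) (ginv G (a j))"
  by (simp add: fan_def)

lemma fan_cong: "(\<And>i. i \<le> n \<Longrightarrow> a i = b i) \<Longrightarrow> fan G n a = fan G n b"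
  by (auto simp: fan_def restrict_def)

lemma pull_fan: "(\<And>i. i \<le> m \<Longrightarrow> f i \<le> n) \<Longrightarrow> pull m f (fan G n a) = fan G m (\<lambda>i. a (f i))"
  by (auto simp: pull_def fan_def restrict_def)

section \<open>Chains as fans and the maps between nerves\<close>

context real_grpd
begin

lemma ginv_unique:
  assumes "g \<in> Ar" "h \<in> Ar" "src G g = rng G h" "gcomp G g h = ident G (rng G g)"
  shows "h = ginv G g"
proof -
  have "h = gcomp G (gcomp G (ginv G g) g) h" using assms by simp
  also have "\<dots> = gcomp G (ginv G g) (gcomp G g h)" using assms by (intro gcomp_assoc) auto
  also have "\<dots> = ginv G g" using assms by simp
  finally show ?thesis .
qed

lemma ginv_ident [simp]: "x \<in> Ob \<Longrightarrow> ginv G (ident G x) = ident G x"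
  by (rule ginv_unique [symmetric]) auto

lemma rho_ginv [simp]:
  assumes g: "g \<in> Ar"
  shows "rho G (ginv G g) = ginv G (rho G g)"
proof (rule ginv_unique)
  show "gcomp G (rho G g) (rho G (ginv G g)) = ident G (rng G (rho G g))"
    using rho_gcomp [of g "ginv G g"] g by simp
qed (use g in auto)

lemma gcomp_ginv_cancel:
  assumes "g \<in> Ar" "h \<in> Ar" "src G g = rng G h"
  shows "gcomp G (gcomp G g h) (ginv G h) = g"
  using gcomp_assoc [of g h "ginv G h"] assms by simp

lemma nerve_set_PiE:
  assumes "\<gamma> \<in> nerve_set G n"
  shows "\<gamma> \<in> {..n} \<times> {..n} \<rightarrow>\<^sub>E Ar"
  using assms unfolding nerve_set_def mem_Collect_eq by (rule conjunct1)

lemma topspace_nerve [simp]: "topspace (nerve G n) = nerve_set G n"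
  using nerve_set_PiE by (simp add: nerve_def Int_absorb1 subsetI)

lemma nerve_setD:
  assumes "\<gamma> \<in> nerve_set G n" "i \<le> n" "j \<le> n"
  shows "\<gamma> (i, j) \<in> Ar" "\<gamma> (i, i) \<in> ident G ` Ob"
    "k \<le> n \<Longrightarrow> src G (\<gamma> (i, j)) = rng G (\<gamma> (j, k))"
    "k \<le> n \<Longrightarrow> \<gamma> (i, k) = gcomp G (\<gamma> (i, j)) (\<gamma> (j, k))"
proof -
  show "\<gamma> (i, j) \<in> Ar" using PiE_mem [OF nerve_set_PiE [OF assms(1)], of "(i, j)"] assms(2,3) by simp
  show "\<gamma> (i, i) \<in> ident G ` Ob" using assms unfolding nerve_set_def by blast
  show "k \<le> n \<Longrightarrow> src G (\<gamma> (i, j)) = rng G (\<gamma> (j, k))" "k \<le> n \<Longrightarrow> \<gamma> (i, k) = gcomp G (\<gamma> (i, j)) (\<gamma> (j, k))"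
    using assms unfolding nerve_set_def by (blast, blast)
qed

lemma nerve_diag:
  assumes "\<gamma> \<in> nerve_set G n" "i \<le> n" "j \<le> n"
  shows "\<gamma> (i, i) = ident G (rng G (\<gamma> (i, j)))" "\<gamma> (j, j) = ident G (src G (\<gamma> (i, j)))"
proof -
  obtain x where x: "x \<in> Ob" "\<gamma> (i, i) = ident G x" using nerve_setD(2) [OF assms(1,2,2)] by blast
  then show "\<gamma> (i, i) = ident G (rng G (\<gamma> (i, j)))"
    using nerve_setD(3) [OF assms(1,2,2,3)] by simp
  obtain y where y: "y \<in> Ob" "\<gamma> (j, j) = ident G y" using nerve_setD(2) [OF assms(1,3,3)] by blast
  then show "\<gamma> (j, j) = ident G (src G (\<gamma> (i, j)))"
    using nerve_setD(3) [OF assms assms(3)] by simp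
qed

lemma fan_in:
  assumes "\<And>i. i \<le> n \<Longrightarrow> a i \<in> Ar \<and> src G (a i) = x"
  shows "fan G n a \<in> nerve_set G n"
proof -
  have c: "gcomp G (gcomp G (a i) (ginv G (a j))) (gcomp G (a j) (ginv G (a k))) = gcomp G (a i) (ginv G (a k))"
    if "i \<le> n" "j \<le> n" "k \<le> n" for i j k
  proof -
    note a = assms [OF that(1)] assms [OF that(2)] assms [OF that(3)]
    have "gcomp G (gcomp G (a i) (ginv G (a j))) (gcomp G (a j) (ginv G (a k))) =
      gcomp G (gcomp G (gcomp G (a i) (ginv G (a j))) (a j)) (ginv G (a k))"
      using a by (intro gcomp_assoc [symmetric]) auto
    also have "gcomp G (gcomp G (a i) (ginv G (a j))) (a j) = a i"
      using gcomp_assoc [of "a i" "ginv G (a j)" "a j"] a by simp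
    finally show ?thesis .
  qed
  have 1: "fan G n a \<in> {..n} \<times> {..n} \<rightarrow>\<^sub>E Ar"
    using assms by (auto simp: fan_def intro!: gcomp_in)
  have 2: "fan G n a (i, i) \<in> ident G ` Ob" if "i \<le> n" for i
    using assms [OF that] that by simp
  have 3: "src G (fan G n a (i, j)) = rng G (fan G n a (j, k)) \<and>
       fan G n a (i, k) = gcomp G (fan G n a (i, j)) (fan G n a (j, k))" if "i \<le> n" "j \<le> n" "k \<le> n" for i j k
    using c [OF that] assms that by simp
  show ?thesis
    unfolding nerve_set_def using 1 2 3 by blast
qed

text \<open>The entries in the last column share their source, and \<open>\<gamma> (n, j)\<close> is
  the inverse of \<open>\<gamma> (j, n)\<close>, so the column determines the chain. Pullbacks and
  involutions of arbitrary chains can therefore be computed on fans.\<close>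

lemma nerve_eq_fan:
  assumes "\<gamma> \<in> nerve_set G n"
  shows "\<gamma> = fan G n (\<lambda>i. \<gamma> (i, n))"
proof
  fix p :: "nat \<times> nat"
  obtain i j where p: "p = (i, j)" by (cases p) blast
  show "\<gamma> p = fan G n (\<lambda>i. \<gamma> (i, n)) p"
  proof (cases "i \<le> n \<and> j \<le> n")
    case True
    then have i: "i \<le> n" and j: "j \<le> n" by auto
    have "\<gamma> (n, j) = ginv G (\<gamma> (j, n))"
    proof (rule ginv_unique)
      show "\<gamma> (j, n) \<in> Ar" "\<gamma> (n, j) \<in> Ar" using nerve_setD(1) [OF assms] j by simp_all
      show "src G (\<gamma> (j, n)) = rng G (\<gamma> (n, j))" using nerve_setD(3) [OF assms j le_refl j] .
      show "gcomp G (\<gamma> (j, n)) (\<gamma> (n, j)) = ident G (rng G (\<gamma> (j, n)))"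
        using nerve_setD(4) [OF assms j le_refl j] nerve_diag(1) [OF assms j le_refl] by simp
    qed
    then show ?thesis
      using nerve_setD(4) [OF assms i _ j, of n] i j by (simp add: p)
  next
    case False
    then show ?thesis
      using PiE_arb [OF nerve_set_PiE [OF assms], of p] by (auto simp: p fan_def)
  qed
qed

lemma pt_in [simp]: "x \<in> Ob \<Longrightarrow> pt G x \<in> nerve_set G 0"
  unfolding pt_def by (rule fan_in [of _ _ x]) simp

lemma ch1_in [simp]: "g \<in> Ar \<Longrightarrow> ch1 G g \<in> nerve_set G (Suc 0)"
  unfolding ch1_def One_nat_def by (rule fan_in [of _ _ "src G g"]) simp

lemma ch2_in [simp]: "\<lbrakk>g \<in> Ar; h \<in> Ar; src G g = rng G h\<rbrakk> \<Longrightarrow> ch2 G g h \<in> nerve_set G 2"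
  unfolding ch2_def by (rule fan_in [of _ _ "src G h"]) simp

lemma pt_00 [simp]: "x \<in> Ob \<Longrightarrow> pt G x (0, 0) = ident G x"
  by (simp add: pt_def)

lemma ch1_01 [simp]: "g \<in> Ar \<Longrightarrow> ch1 G g (0, Suc 0) = g"
  by (simp add: ch1_def)

lemma nerve_0_eq:
  assumes "\<gamma> \<in> nerve_set G 0"
  shows "\<gamma> = pt G (src G (\<gamma> (0, 0)))"
proof -
  have "fan G 0 (\<lambda>i. \<gamma> (i, 0)) = pt G (src G (\<gamma> (0, 0)))"
    unfolding pt_def
  proof (rule fan_cong)
    fix i :: nat assume "i \<le> 0"
    then show "\<gamma> (i, 0) = ident G (src G (\<gamma> (0, 0)))"
      using nerve_diag(2) [OF assms, of 0 0] by simp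
  qed
  then show ?thesis using nerve_eq_fan [OF assms] by simp
qed

lemma nerve_1_eq:
  assumes "\<gamma> \<in> nerve_set G 1"
  shows "\<gamma> = ch1 G (\<gamma> (0, Suc 0))"
proof -
  have "fan G 1 (\<lambda>i. \<gamma> (i, 1)) = ch1 G (\<gamma> (0, Suc 0))"
    unfolding ch1_def
  proof (rule fan_cong)
    fix i :: nat assume "i \<le> 1"
    then have "i = 0 \<or> i = 1" by auto
    then show "\<gamma> (i, 1) = (if i = 0 then \<gamma> (0, Suc 0) else ident G (src G (\<gamma> (0, Suc 0))))"
      using nerve_diag [OF assms, of 0 1] by auto
  qed
  then show ?thesis using nerve_eq_fan [OF assms] by simp
qed

lemma pull_vert:
  assumes "\<gamma> \<in> nerve_set G n" "i \<le> n" "j \<le> n"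
  shows "pull 0 (vert i) \<gamma> = pt G (rng G (\<gamma> (i, j)))" "pull 0 (vert j) \<gamma> = pt G (src G (\<gamma> (i, j)))"
proof -
  have *: "pull 0 (vert i) \<gamma> = pt G (src G (\<gamma> (i, i)))" if i: "i \<le> n" for i
  proof -
    obtain x where "x \<in> Ob" "\<gamma> (i, i) = ident G x" using nerve_setD(2) [OF assms(1) i i] by blast
    then show ?thesis
      by (auto simp: pull_def pt_def fan_def restrict_def intro!: ext)
  qed
  show "pull 0 (vert i) \<gamma> = pt G (rng G (\<gamma> (i, j)))" "pull 0 (vert j) \<gamma> = pt G (src G (\<gamma> (i, j)))"
    using * [OF assms(2)] * [OF assms(3)] nerve_diag [OF assms] nerve_setD(1) [OF assms] by simp_all
qed

lemma pull_in:
  assumes "\<gamma> \<in> nerve_set G n" "\<And>i. i \<le> m \<Longrightarrow> f i \<le> n"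
  shows "pull m f \<gamma> \<in> nerve_set G m"
proof -
  have "pull m f \<gamma> = fan G m (\<lambda>i. \<gamma> (f i, n))"
    using pull_fan [of m f n G "\<lambda>i. \<gamma> (i, n)"] assms nerve_eq_fan [OF assms(1)] by simp
  moreover have "fan G m (\<lambda>i. \<gamma> (f i, n)) \<in> nerve_set G m"
    by (rule fan_in [of _ _ "rng G (\<gamma> (n, n))"])
      (use nerve_setD(1,3) [OF assms(1) assms(2), of _ n] in auto)
  ultimately show ?thesis by simp
qed

lemma pull_id:
  assumes "\<gamma> \<in> nerve_set G n" "\<And>i. i \<le> n \<Longrightarrow> f i = i"
  shows "pull n f \<gamma> = \<gamma>"
proof
  fix p show "pull n f \<gamma> p = \<gamma> p"
    using PiE_arb [OF nerve_set_PiE [OF assms(1)], of p] assms(2)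
    by (cases p) (auto simp: pull_def restrict_def)
qed

lemma rho_fan:
  assumes "\<And>i. i \<le> n \<Longrightarrow> a i \<in> Ar \<and> src G (a i) = x"
  shows "rho_nerve G n (fan G n a) = fan G n (\<lambda>i. rho G (a i))"
proof
  fix p :: "nat \<times> nat"
  obtain i j where p: "p = (i, j)" by (cases p) blast
  show "rho_nerve G n (fan G n a) p = fan G n (\<lambda>i. rho G (a i)) p"
    using assms [of i] assms [of j] by (cases "i \<le> n \<and> j \<le> n") (auto simp: p rho_nerve_def fan_def)
qed

lemma rho_pt [simp]: "x \<in> Ob \<Longrightarrow> rho_nerve G 0 (pt G x) = pt G (rho_obj G x)"
  unfolding pt_def by (subst rho_fan [of _ _ x]) auto

lemma rho_ch1 [simp]: "g \<in> Ar \<Longrightarrow> rho_nerve G (Suc 0) (ch1 G g) = ch1 G (rho G g)"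
  unfolding ch1_def One_nat_def by (subst rho_fan [of _ _ "src G g"]) (auto intro!: fan_cong)

lemma rho_nerve_in:
  assumes "\<gamma> \<in> nerve_set G n"
  shows "rho_nerve G n \<gamma> \<in> nerve_set G n"
proof -
  have a: "\<gamma> (i, n) \<in> Ar \<and> src G (\<gamma> (i, n)) = rng G (\<gamma> (n, n))" if "i \<le> n" for i
    using nerve_setD(1) [OF assms that le_refl] nerve_setD(3) [OF assms that le_refl le_refl] by simp
  have "rho_nerve G n \<gamma> = fan G n (\<lambda>i. rho G (\<gamma> (i, n)))"
    by (subst nerve_eq_fan [OF assms]) (rule rho_fan [OF a])
  moreover have "fan G n (\<lambda>i. rho G (\<gamma> (i, n))) \<in> nerve_set G n"
    by (rule fan_in [of _ _ "rho_obj G (rng G (\<gamma> (n, n)))"]) (use a in simp)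
  ultimately show ?thesis by simp
qed

lemma rho_nerve_rho_nerve:
  assumes "\<gamma> \<in> nerve_set G n"
  shows "rho_nerve G n (rho_nerve G n \<gamma>) = \<gamma>"
proof
  fix p show "rho_nerve G n (rho_nerve G n \<gamma>) p = \<gamma> p"
    using PiE_arb [OF nerve_set_PiE [OF assms], of p] PiE_mem [OF nerve_set_PiE [OF assms], of p]
    by (auto simp: rho_nerve_def restrict_def)
qed

lemma rho_nerve_apply [simp]: "i \<le> n \<Longrightarrow> j \<le> n \<Longrightarrow> rho_nerve G n \<gamma> (i, j) = rho G (\<gamma> (i, j))"
  by (simp add: rho_nerve_def)

lemma pull_rho_nerve: "(\<And>i. i \<le> m \<Longrightarrow> f i \<le> n) \<Longrightarrow> pull m f (rho_nerve G n \<gamma>) = rho_nerve G m (pull m f \<gamma>)"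
  by (rule ext) (auto simp: pull_def rho_nerve_def restrict_def)

text \<open>The topology of the nerve is induced from a product, so continuity is checked entrywise.
  This yields the continuity of \<open>pt G\<close> and \<open>ch1 G\<close>.\<close>

lemma continuous_map_fan:
  assumes "\<And>i. i \<le> n \<Longrightarrow> continuous_map T (arrows G) (\<lambda>t. a t i)"
    and "\<And>i t. i \<le> n \<Longrightarrow> t \<in> topspace T \<Longrightarrow> src G (a t i) = f t"
  shows "continuous_map T (nerve G n) (\<lambda>t. fan G n (a t))"
proof -
  have a: "a t i \<in> Ar" if "i \<le> n" "t \<in> topspace T" for t i
    using continuous_map_in_topspace [OF assms(1) [OF that(1)] that(2)] .
  have c: "continuous_map T (arrows G) (\<lambda>t. gcomp G (a t i) (ginv G (a t j)))" if ij: "i \<le> n" "j \<le> n" for i j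
  proof -
    have "continuous_map T (arrows G) (\<lambda>t. ginv G (a t j))"
      using continuous_map_compose [OF assms(1) [OF ij(2)] cont_ginv] by (simp add: o_def)
    then have 1: "continuous_map T (prod_topology (arrows G) (arrows G)) (\<lambda>t. (a t i, ginv G (a t j)))"
      using assms(1) [OF ij(1)] by (simp add: continuous_map_pairedI)
    have "(\<lambda>t. (a t i, ginv G (a t j))) ` topspace T \<subseteq> composable G"
      using a ij assms(2) by (auto simp: composable_def)
    from continuous_map_into_subtopology_compose [OF 1 cont_gcomp this] show ?thesis by simp
  qed
  have "continuous_map T (product_topology (\<lambda>_. arrows G) ({..n} \<times> {..n})) (\<lambda>t. fan G n (a t))"
    unfolding continuous_map_componentwise
    using c by (auto simp: fan_def)
  moreover have "fan G n (a t) \<in> nerve_set G n" if "t \<in> topspace T" for t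
    by (rule fan_in [of _ _ "f t"]) (use a assms(2) that in auto)
  ultimately show ?thesis
    by (auto simp: nerve_def continuous_map_in_subtopology)
qed

lemma cont_pt: "continuous_map (objects G) (nerve G 0) (pt G)"
  unfolding pt_def [abs_def] by (rule continuous_map_fan [of _ _ _ "\<lambda>x. x"]) (auto simp: cont_ident)

lemma cont_ch1: "continuous_map (arrows G) (nerve G 1) (ch1 G)"
  unfolding ch1_def [abs_def]
proof (rule continuous_map_fan [of _ _ _ "src G"])
  fix i :: nat
  have "continuous_map (arrows G) (arrows G) (\<lambda>g. ident G (src G g))"
    using continuous_map_compose [OF cont_src cont_ident] by (simp add: o_def)
  then show "continuous_map (arrows G) (arrows G) (\<lambda>g. if i = 0 then g else ident G (src G g))"
    by (cases "i = 0") simp_all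
qed auto

lemma cont_nerve_apply: "i \<le> n \<Longrightarrow> j \<le> n \<Longrightarrow> continuous_map (nerve G n) (arrows G) (\<lambda>\<gamma>. \<gamma> (i, j))"
  unfolding nerve_def
  by (intro continuous_map_from_subtopology continuous_map_product_projection) simp

lemma cont_nerve_0: "continuous_map (nerve G 0) (objects G) (\<lambda>\<gamma>. src G (\<gamma> (0, 0)))"
  using continuous_map_compose [OF cont_nerve_apply [of 0 0 0] cont_src] by (simp add: o_def)

end


section \<open>Real Cech cochains in degrees zero and one\<close>

text \<open>Degree 0 of the nerve is the object space embedded by \<open>pt G\<close>; the cover in
  degree 0 is pulled back along this embedding.\<close>

definition deg0 :: "('g, 'x) real_groupoid \<Rightarrow> ('i, 'g) cover_seq \<Rightarrow> ('i, 'x) rcov" where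
  "deg0 G U = \<lparr>Idx = cidx U 0, Bar = cbar U 0, Opn = (\<lambda>j. {x \<in> topspace (objects G). pt G x \<in> copn U 0 j})\<rparr>"

text \<open>The vertex components of the multi-index select the entry of the cocycle. The edge
  component influences the domain \<open>Lam_set\<close>, but not the value.\<close>

definition lift :: "('g, 'x) real_groupoid \<Rightarrow> ('i, 'g) cover_seq \<Rightarrow> ('i \<Rightarrow> 'i \<Rightarrow> 'g \<Rightarrow> complex) \<Rightarrow>
    ('i, 'g, complex) cochain" where
  "lift G U z = (\<lambda>l\<in>Lam U 1. \<lambda>\<gamma>\<in>Lam_set G U 1 l. z (l 0 (vert 0)) (l 0 (vert 1)) (\<gamma> (0, 1)))"

definition lift0 :: "('g, 'x) real_groupoid \<Rightarrow> ('i, 'g) cover_seq \<Rightarrow> ('i \<Rightarrow> 'x \<Rightarrow> complex) \<Rightarrow>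
    ('i, 'g, complex) cochain" where
  "lift0 G U b = (\<lambda>l\<in>Lam U 0. \<lambda>\<gamma>\<in>Lam_set G U 0 l. b (l 0 (vert 0)) (src G (\<gamma> (0, 0))))"

text \<open>The multi-index with values \<open>v\<close>, \<open>e\<close>, \<open>f\<close> on vertices, edges and faces, meant for \<open>n \<le> 2\<close>.\<close>

definition mk :: "nat \<Rightarrow> (nat \<Rightarrow> 'i) \<Rightarrow> (nat \<Rightarrow> nat \<Rightarrow> 'i) \<Rightarrow> 'i \<Rightarrow> 'i multi_index" where
  "mk n v e f = (\<lambda>d\<in>{..n}. \<lambda>\<phi>\<in>hom_Delta' d n.
     if d = 0 then v (\<phi> 0) else if d = 1 then e (\<phi> 0) (\<phi> 1) else f)"

lemma circle_carrier [simp]: "carrier circle_group = sphere 0 1"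
  and circle_mult [simp]: "x \<otimes>\<^bsub>circle_group\<^esub> y = x * y"
  and circle_one [simp]: "\<one>\<^bsub>circle_group\<^esub> = 1"
  and circle_gbar [simp]: "gbar circle_group = cnj"
  and circle_gtop [simp]: "gtop circle_group = top_of_set (sphere 0 1)"
  by (simp_all add: circle_group_def)

lemma circle_comm_group: "comm_group circle_group"
proof (rule comm_groupI)
  fix x assume "x \<in> carrier circle_group"
  then have "cmod x = 1" "x \<noteq> 0" by auto
  then show "\<exists>y\<in>carrier circle_group. y \<otimes>\<^bsub>circle_group\<^esub> x = \<one>\<^bsub>circle_group\<^esub>"
    by (intro bexI [of _ "inverse x"]) (auto simp: norm_inverse)
qed (auto simp: norm_mult)

lemma circle_int_pow:
  assumes "x \<in> sphere 0 1"
  shows "x [^]\<^bsub>circle_group\<^esub> ((-1) ^ k :: int) = (if even k then x else inverse x)"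
proof -
  interpret comm_group circle_group by (rule circle_comm_group)
  have "x \<noteq> 0" using assms by auto
  then have "inv\<^bsub>circle_group\<^esub> x = inverse x"
    by (intro inv_equality) (use assms in \<open>auto simp: norm_inverse\<close>)
  then show ?thesis
    using assms int_pow_neg [of x 1] by (simp add: int_pow_1)
qed

text \<open>The alternating products of the differential in degrees 0 and 1, expressed by division
  of complex numbers so that later calculations are ordinary arithmetic.\<close>

lemma circle_alternating_prod:
  assumes "\<And>k. k \<le> Suc n \<Longrightarrow> f k \<in> sphere 0 1"
  shows "n = 0 \<Longrightarrow> (\<Otimes>\<^bsub>circle_group\<^esub>k\<in>{..Suc n}. f k [^]\<^bsub>circle_group\<^esub> ((-1) ^ k :: int)) = f 0 / f 1"
    "n = 1 \<Longrightarrow> (\<Otimes>\<^bsub>circle_group\<^esub>k\<in>{..Suc n}. f k [^]\<^bsub>circle_group\<^esub> ((-1) ^ k :: int)) = f 0 / f 1 * f 2"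
proof -
  interpret comm_group circle_group by (rule circle_comm_group)
  let ?F = "\<lambda>k. if even k then f k else inverse (f k)"
  have *: "(\<Otimes>\<^bsub>circle_group\<^esub>k\<in>{..Suc n}. f k [^]\<^bsub>circle_group\<^esub> ((-1) ^ k :: int)) =
      (\<Otimes>\<^bsub>circle_group\<^esub>k\<in>{..Suc n}. ?F k)"
    by (rule finprod_cong') (use assms circle_int_pow in \<open>auto simp: norm_inverse\<close>)
  have F: "?F \<in> {..m} \<rightarrow> carrier circle_group" if "m \<le> Suc n" for m
    using assms that by (auto simp: norm_inverse)
  have 0: "(\<Otimes>\<^bsub>circle_group\<^esub>k\<in>{..0}. ?F k) = f 0"
    using finprod_0 [of ?F] F [of 0] by simp
  have 1: "(\<Otimes>\<^bsub>circle_group\<^esub>k\<in>{..Suc 0}. ?F k) = f 0 / f 1"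
    using finprod_Suc [OF F [of "Suc 0"]] 0 by (simp add: divide_inverse mult.commute)
  show "n = 0 \<Longrightarrow> (\<Otimes>\<^bsub>circle_group\<^esub>k\<in>{..Suc n}. f k [^]\<^bsub>circle_group\<^esub> ((-1) ^ k :: int)) = f 0 / f 1"
    unfolding * using 1 by simp
  show "(\<Otimes>\<^bsub>circle_group\<^esub>k\<in>{..Suc n}. f k [^]\<^bsub>circle_group\<^esub> ((-1) ^ k :: int)) = f 0 / f 1 * f 2" if n: "n = 1"
  proof -
    have "(\<Otimes>\<^bsub>circle_group\<^esub>k\<in>{..Suc n}. ?F k) = f 0 / f 1 * f 2"
      using finprod_Suc [OF F [of "Suc (Suc 0)"]] 1 n by (simp add: mult.commute numeral_2_eq_2)
    then show ?thesis by (simp only: *)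
  qed
qed

lemma hom_Delta'_compose: "f \<in> hom_Delta' m n \<Longrightarrow> \<phi> \<in> hom_Delta' k m \<Longrightarrow> compose {..k} f \<phi> \<in> hom_Delta' k n"
  by (fastforce simp: hom_Delta'_def compose_def strict_mono_on_def PiE_def Pi_def)

lemma omit_hom_Delta': "omit n k \<in> hom_Delta' n (Suc n)"
  by (auto simp: hom_Delta'_def omit_def strict_mono_on_def)

lemma vert_hom_Delta' [simp]: "i \<le> n \<Longrightarrow> vert i \<in> hom_Delta' 0 n"
  using hom_Delta'_0 by blast

lemma edge_hom_Delta' [simp]: "i < j \<Longrightarrow> j \<le> n \<Longrightarrow> edge i j \<in> hom_Delta' (Suc 0) n"
  using hom_Delta'_1 [of "edge i j" n] by auto

lemma hom_Delta'_refl: "\<phi> \<in> hom_Delta' 2 2 \<Longrightarrow> i \<le> 2 \<Longrightarrow> \<phi> i = i"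
proof -
  assume "\<phi> \<in> hom_Delta' 2 2"
  then have m: "strict_mono_on {..2} \<phi>" and P: "\<phi> \<in> {..2} \<rightarrow>\<^sub>E {..2}" by (auto simp: hom_Delta'_def)
  have "\<phi> 0 < \<phi> 1" "\<phi> 1 < \<phi> 2" using m by (auto simp: strict_mono_on_def)
  moreover have "\<phi> 2 \<le> 2" using PiE_mem [OF P, of 2] by simp
  moreover assume "i \<le> 2"
  ultimately show ?thesis
    by (auto simp: le_Suc_eq numeral_2_eq_2)
qed

lemma Lam_mem: "l \<in> Lam U n \<Longrightarrow> k \<le> n \<Longrightarrow> \<phi> \<in> hom_Delta' k n \<Longrightarrow> l k \<phi> \<in> cidx U k"
  unfolding Lam_def by (auto dest!: PiE_mem)

lemma LamI:
  assumes "\<And>k \<phi>. k \<le> n \<Longrightarrow> \<phi> \<in> hom_Delta' k n \<Longrightarrow> F k \<phi> \<in> cidx U k"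
  shows "(\<lambda>k\<in>{..n}. \<lambda>\<phi>\<in>hom_Delta' k n. F k \<phi>) \<in> Lam U n"
  unfolding Lam_def using assms by (auto intro!: restrict_PiE)

lemma Lam_pull_in:
  assumes "l \<in> Lam U n" "m \<le> n" "f \<in> hom_Delta' m n"
  shows "Lam_pull m f l \<in> Lam U m"
  unfolding Lam_pull_def
proof (rule LamI)
  fix k \<phi> assume "k \<le> m" "\<phi> \<in> hom_Delta' k m"
  then show "l k (compose {..k} f \<phi>) \<in> cidx U k"
    using Lam_mem [OF assms(1) _ hom_Delta'_compose [OF assms(3)]] assms(2) by simp
qed

lemma Lam_pull_vert [simp]: "i \<le> m \<Longrightarrow> Lam_pull m f l 0 (vert i) = l 0 (vert (f i))"
  by (simp add: Lam_pull_def compose_vert [unfolded atMost_0])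

lemma Lam_pull_edge [simp]: "i < j \<Longrightarrow> j \<le> m \<Longrightarrow> Lam_pull m f l (Suc 0) (edge i j) = l (Suc 0) (edge (f i) (f j))"
  by (simp add: Lam_pull_def compose_edge)

lemma Lam_bar_apply: "k \<le> n \<Longrightarrow> \<phi> \<in> hom_Delta' k n \<Longrightarrow> Lam_bar U n l k \<phi> = cbar U k (l k \<phi>)"
  by (simp add: Lam_bar_def)

lemma mk_vert [simp]: "i \<le> n \<Longrightarrow> mk n v e f 0 (vert i) = v i"
  and mk_edge [simp]: "i < j \<Longrightarrow> j \<le> n \<Longrightarrow> mk n v e f (Suc 0) (edge i j) = e i j"
  by (simp_all add: mk_def)

lemma mk_in:
  assumes "n \<le> 2" "\<And>i. i \<le> n \<Longrightarrow> v i \<in> cidx U 0" "\<And>i j. i < j \<Longrightarrow> j \<le> n \<Longrightarrow> e i j \<in> cidx U (Suc 0)"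
    "n = 2 \<Longrightarrow> f \<in> cidx U 2"
  shows "mk n v e f \<in> Lam U n"
  unfolding mk_def
proof (rule LamI)
  fix k \<phi> assume k: "k \<le> n" and \<phi>: "\<phi> \<in> hom_Delta' k n"
  consider "k = 0" | "k = 1" | "k = 2" "n = 2" using k assms(1) by linarith
  then show "(if k = 0 then v (\<phi> 0) else if k = 1 then e (\<phi> 0) (\<phi> 1) else f) \<in> cidx U k"
  proof cases
    case 1
    then show ?thesis using \<phi> assms(2) by (auto simp: hom_Delta'_0)
  next
    case 2
    then obtain i j where "i < j" "j \<le> n" "\<phi> = edge i j"
      using \<phi> hom_Delta'_1 by blast
    then show ?thesis using 2 assms(3) by simp
  next
    case 3
    then show ?thesis using assms(4) by simp
  qed
qed

text \<open>Up to degree 1 the strictly increasing maps are the vertices and, in degree 1, the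
  single edge from 0 to 1.\<close>

lemma Lam_eqI:
  assumes "l \<in> Lam U n" "l' \<in> Lam U n" "n \<le> 1" "\<And>i. i \<le> n \<Longrightarrow> l 0 (vert i) = l' 0 (vert i)"
    "n = 1 \<Longrightarrow> l (Suc 0) (edge 0 1) = l' (Suc 0) (edge 0 1)"
  shows "l = l'"
proof (rule PiE_ext [OF assms(1,2) [unfolded Lam_def]])
  fix k assume k: "k \<in> {..n}"
  then have m: "l k \<in> hom_Delta' k n \<rightarrow>\<^sub>E cidx U k" "l' k \<in> hom_Delta' k n \<rightarrow>\<^sub>E cidx U k"
    using assms(1,2) by (auto simp: Lam_def dest: PiE_mem)
  show "l k = l' k"
  proof (rule PiE_ext [OF m])
    fix \<phi> assume \<phi>: "\<phi> \<in> hom_Delta' k n"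
    consider "k = 0" | "k = 1" "n = 1" using k assms(3) by fastforce
    then show "l k \<phi> = l' k \<phi>"
    proof cases
      case 1
      then show ?thesis using \<phi> assms(4) by (auto simp: hom_Delta'_0)
    next
      case 2
      then obtain i j where "i < j" "j \<le> 1" "\<phi> = edge i j"
        using \<phi> hom_Delta'_1 [of \<phi> 1] by auto
      moreover from this have "i = 0" "j = 1" by auto
      ultimately show ?thesis using 2 assms(5) by simp
    qed
  qed
qed

section \<open>Cochains on a Real cover of the nerve\<close>

locale real_cover = real_grpd G for G :: "('g, 'x) real_groupoid" +
  fixes U :: "('i, 'g) cover_seq"
  assumes rc: "real_cover_seq G U"
begin

abbreviation "C \<equiv> deg0 G U"
abbreviation "O1 i \<equiv> {x \<in> Ob. pt G x \<in> copn U 0 i}"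

lemma C_simps [simp]: "Idx C = cidx U 0" "Bar C = cbar U 0" "Opn C i = O1 i"
  by (simp_all add: deg0_def)

lemma coverD:
  assumes "j \<in> cidx U n"
  shows "openin (nerve G n) (copn U n j)" "cbar U n j \<in> cidx U n" "cbar U n (cbar U n j) = j"
    "copn U n (cbar U n j) = rho_nerve G n ` copn U n j" "copn U n j \<subseteq> nerve_set G n"
  using rc assms openin_subset [of "nerve G n" "copn U n j"]
  unfolding real_cover_seq_def real_open_cover_def by auto

lemma cover_ex:
  assumes "\<gamma> \<in> nerve_set G n"
  obtains j where "j \<in> cidx U n" "\<gamma> \<in> copn U n j"
proof -
  have "\<Union> (copn U n ` cidx U n) = nerve_set G n"
    using rc unfolding real_cover_seq_def real_open_cover_def by simp
  then show thesis using assms that by blast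
qed

lemma deg0_cover: "rcover G C"
  unfolding rcover_def real_open_cover_def
proof (intro conjI ballI)
  fix j assume "j \<in> Idx C"
  then have j: "j \<in> cidx U 0" by simp
  note c = coverD [OF j]
  show "openin (objects G) (Opn C j)"
    using openin_continuous_map_preimage [OF cont_pt c(1)] by simp
  show "Bar C j \<in> Idx C" "Bar C (Bar C j) = j" using c by simp_all
  show "Opn C (Bar C j) = rho_obj G ` Opn C j"
  proof (intro equalityI subsetI)
    fix x assume "x \<in> Opn C (Bar C j)"
    then have x: "x \<in> Ob" "pt G x \<in> rho_nerve G 0 ` copn U 0 j" using c by auto
    then obtain \<gamma> where \<gamma>: "pt G x = rho_nerve G 0 \<gamma>" "\<gamma> \<in> copn U 0 j" by blast
    then have "\<gamma> = rho_nerve G 0 (pt G x)"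
      using rho_nerve_rho_nerve [of \<gamma> 0] c(5) by auto
    also have "\<dots> = pt G (rho_obj G x)" by (rule rho_pt [OF x(1)])
    finally have "pt G (rho_obj G x) \<in> copn U 0 j" using \<gamma>(2) by simp
    then have "rho_obj G x \<in> Opn C j" using x by simp
    then show "x \<in> rho_obj G ` Opn C j" using x by (intro image_eqI [of _ _ "rho_obj G x"]) auto
  next
    fix x assume "x \<in> rho_obj G ` Opn C j"
    then obtain y where y: "x = rho_obj G y" "y \<in> Ob" "pt G y \<in> copn U 0 j" by auto
    then have "pt G x \<in> rho_nerve G 0 ` copn U 0 j"
      using imageI [OF y(3), of "rho_nerve G 0"] by simp
    then show "x \<in> Opn C (Bar C j)" using y(1,2) c(4) by simp
  qed
next
  show "\<Union> (Opn C ` Idx C) = Ob"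
  proof (intro equalityI subsetI)
    fix x assume x: "x \<in> Ob"
    obtain j where "j \<in> cidx U 0" "pt G x \<in> copn U 0 j" using cover_ex [OF pt_in [OF x]] .
    then show "x \<in> \<Union> (Opn C ` Idx C)" using x by auto
  qed auto
qed

lemma pull_vert_in_iff:
  assumes "\<gamma> \<in> nerve_set G n" "i \<le> n" "j \<le> n"
  shows "pull 0 (vert i) \<gamma> \<in> copn U 0 k \<longleftrightarrow> rng G (\<gamma> (i, j)) \<in> O1 k"
    "pull 0 (vert j) \<gamma> \<in> copn U 0 k \<longleftrightarrow> src G (\<gamma> (i, j)) \<in> O1 k"
  unfolding pull_vert [OF assms] using nerve_setD(1) [OF assms] by auto

lemma pull_1:
  assumes "\<gamma> \<in> nerve_set G n" "f 0 \<le> n" "f (Suc 0) \<le> n"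
  shows "pull (Suc 0) f \<gamma> = ch1 G (\<gamma> (f 0, f (Suc 0)))"
proof -
  have i: "f i \<le> n" if "i \<le> 1" for i
  proof -
    have "i = 0 \<or> i = 1" using that by auto
    then show ?thesis using assms(2,3) by auto
  qed
  have "pull 1 f \<gamma> = ch1 G (pull 1 f \<gamma> (0, Suc 0))"
    by (rule nerve_1_eq [OF pull_in [OF assms(1) i]])
  moreover have "pull 1 f \<gamma> (0, Suc 0) = \<gamma> (f 0, f (Suc 0))" by (simp add: pull_def)
  ultimately show ?thesis by (simp only: One_nat_def)
qed

lemma Lam_set_edges:
  assumes "l \<in> Lam U n" "\<gamma> \<in> Lam_set G U n l" "i \<le> n" "j \<le> n"
  shows "\<gamma> (i, j) \<in> edges G (O1 (l 0 (vert i))) (O1 (l 0 (vert j)))"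
proof -
  have n: "\<gamma> \<in> nerve_set G n" using assms(2) by (simp add: Lam_set_def)
  have "pull 0 (vert i) \<gamma> \<in> copn U 0 (l 0 (vert i))" "pull 0 (vert j) \<gamma> \<in> copn U 0 (l 0 (vert j))"
    using assms by (simp_all add: Lam_set_def)
  then show ?thesis
    unfolding pull_vert_in_iff [OF n assms(3,4)] using nerve_setD(1) [OF n assms(3,4)] by (simp add: edges_def)
qed

lemma Lam_set_0: "\<gamma> \<in> Lam_set G U 0 l \<longleftrightarrow> \<gamma> \<in> nerve_set G 0 \<and> src G (\<gamma> (0, 0)) \<in> O1 (l 0 (vert 0))"
proof -
  have "\<gamma> \<in> Lam_set G U 0 l \<longleftrightarrow> \<gamma> \<in> nerve_set G 0 \<and> pull 0 (vert 0) \<gamma> \<in> copn U 0 (l 0 (vert 0))"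
    by (auto simp: Lam_set_def hom_Delta'_0)
  then show ?thesis using pull_vert_in_iff(2) [of \<gamma> 0 0 0] by auto
qed

lemma Lam_set_1: "\<gamma> \<in> Lam_set G U 1 l \<longleftrightarrow> \<gamma> \<in> nerve_set G 1 \<and>
    \<gamma> (0, 1) \<in> edges G (O1 (l 0 (vert 0))) (O1 (l 0 (vert 1))) \<and> \<gamma> \<in> copn U 1 (l 1 (edge 0 1))"
proof (cases "\<gamma> \<in> nerve_set G 1")
  case True
  have id: "pull (Suc 0) (edge 0 1) \<gamma> = \<gamma>"
    using pull_1 [OF True, of "edge 0 1"] nerve_1_eq [OF True] by simp
  have "(\<forall>k\<le>1. \<forall>\<phi>\<in>hom_Delta' k 1. pull k \<phi> \<gamma> \<in> copn U k (l k \<phi>)) \<longleftrightarrow>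
     pull 0 (vert 0) \<gamma> \<in> copn U 0 (l 0 (vert 0)) \<and> pull 0 (vert 1) \<gamma> \<in> copn U 0 (l 0 (vert 1)) \<and>
     pull 1 (edge 0 1) \<gamma> \<in> copn U 1 (l 1 (edge 0 1))" (is "?L \<longleftrightarrow> ?R")
  proof
    assume ?L then show ?R by simp
  next
    assume R: ?R
    show ?L
    proof (intro allI impI ballI)
      fix k \<phi> assume k: "k \<le> (1 :: nat)" and \<phi>: "\<phi> \<in> hom_Delta' k 1"
      from k consider "k = 0" | "k = 1" by linarith
      then show "pull k \<phi> \<gamma> \<in> copn U k (l k \<phi>)"
      proof cases
        case 1
        then obtain i where i: "i \<le> 1" "\<phi> = vert i" using \<phi> hom_Delta'_0 by blast
        from i(1) consider "i = 0" | "i = 1" by linarith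
        then show ?thesis using R 1 i by cases auto
      next
        case 2
        then obtain i j where ij: "i < j" "j \<le> 1" "\<phi> = edge i j"
          using \<phi> hom_Delta'_1 by blast
        have i: "i = 0" and j: "j = 1" using ij(1,2) by auto
        show ?thesis using R unfolding 2 ij(3) i j by blast
      qed
    qed
  qed
  then show ?thesis
    unfolding Lam_set_def mem_Collect_eq topspace_nerve
    using pull_vert_in_iff [OF True, of 0 1] id True nerve_setD(1) [OF True, of 0 1] by (auto simp: edges_def)
qed (simp add: Lam_set_def)

text \<open>The object at vertex \<open>i\<close> is the source of every entry with second index
  \<open>i\<close>, so testing it on \<open>(0, i)\<close> covers the vertex conditions. The only
  strictly increasing self-map of the vertices is the identity, which leaves a single face
  condition.\<close>

lemma Lam_set_2I:
  assumes \<gamma>: "\<gamma> \<in> nerve_set G 2" and v: "\<And>i. i \<le> 2 \<Longrightarrow> src G (\<gamma> (0, i)) \<in> O1 (v i)"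
    and e: "\<And>i j. i < j \<Longrightarrow> j \<le> 2 \<Longrightarrow> ch1 G (\<gamma> (i, j)) \<in> copn U 1 (e i j)" and f: "\<gamma> \<in> copn U 2 f"
  shows "\<gamma> \<in> Lam_set G U 2 (mk 2 v e f)"
  unfolding Lam_set_def mem_Collect_eq topspace_nerve
proof (intro conjI \<gamma> allI impI ballI)
  fix k \<phi> assume k: "k \<le> (2 :: nat)" and \<phi>: "\<phi> \<in> hom_Delta' k 2"
  from k consider "k = 0" | "k = 1" | "k = 2" by linarith
  then show "pull k \<phi> \<gamma> \<in> copn U k (mk 2 v e f k \<phi>)"
  proof cases
    case 1
    then obtain i where i: "i \<le> 2" "\<phi> = vert i" using \<phi> hom_Delta'_0 by blast
    show ?thesis
      using pull_vert_in_iff(2) [OF \<gamma> _ i(1), of 0] v [OF i(1)] i 1 by simp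
  next
    case 2
    then obtain i j where ij: "i < j" "j \<le> 2" "\<phi> = edge i j" using \<phi> hom_Delta'_1 by blast
    show ?thesis
      using e [OF ij(1,2)] pull_1 [OF \<gamma>, of "edge i j"] ij 2 by simp
  next
    case 3
    then have "pull 2 \<phi> \<gamma> = \<gamma>"
      using pull_id [OF \<gamma>] hom_Delta'_refl \<phi> by blast
    then show ?thesis using f 3 \<phi> by (simp add: mk_def)
  qed
qed

lemma Lam_set_pull:
  assumes "l \<in> Lam U n" "\<gamma> \<in> Lam_set G U n l" "f \<in> hom_Delta' m n" "m \<le> n"
  shows "pull m f \<gamma> \<in> Lam_set G U m (Lam_pull m f l)"
proof -
  have f: "f i \<le> n" if "i \<le> m" for i
    using assms(3) that by (auto simp: hom_Delta'_def)
  have n: "\<gamma> \<in> nerve_set G n" using assms(2) by (simp add: Lam_set_def)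
  have "pull k \<phi> (pull m f \<gamma>) = pull k (compose {..k} f \<phi>) \<gamma>" if "\<phi> \<in> hom_Delta' k m" for k \<phi>
    using that by (auto simp: pull_def compose_def restrict_def hom_Delta'_def PiE_def Pi_def intro!: ext)
  then show ?thesis
    using pull_in [OF n f] assms hom_Delta'_compose [OF assms(3)]
    by (simp add: Lam_set_def Lam_pull_def)
qed

lemma Lam_bar_in:
  assumes "l \<in> Lam U n"
  shows "Lam_bar U n l \<in> Lam U n"
  unfolding Lam_bar_def by (rule LamI, rule coverD(2), rule Lam_mem [OF assms])

lemma Lam_set_bar:
  assumes "l \<in> Lam U n" "\<gamma> \<in> Lam_set G U n l"
  shows "rho_nerve G n \<gamma> \<in> Lam_set G U n (Lam_bar U n l)"
proof -
  have n: "\<gamma> \<in> nerve_set G n" using assms(2) by (simp add: Lam_set_def)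
  have "pull k \<phi> (rho_nerve G n \<gamma>) \<in> copn U k (Lam_bar U n l k \<phi>)" if k: "k \<le> n" and \<phi>: "\<phi> \<in> hom_Delta' k n" for k \<phi>
  proof -
    have "pull k \<phi> (rho_nerve G n \<gamma>) = rho_nerve G k (pull k \<phi> \<gamma>)"
      by (rule pull_rho_nerve) (use \<phi> in \<open>auto simp: hom_Delta'_def\<close>)
    moreover have "pull k \<phi> \<gamma> \<in> copn U k (l k \<phi>)"
      using assms(2) k \<phi> by (simp add: Lam_set_def)
    ultimately show ?thesis
      using coverD(4) [OF Lam_mem [OF assms(1) k \<phi>]] k \<phi> by (simp add: Lam_bar_apply)
  qed
  then show ?thesis
    using rho_nerve_in [OF n] by (simp add: Lam_set_def)
qed

text \<open>Continuity into the circle is split into continuity as a complex function and modulus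
  one, the form in which \<open>Z1\<close> and \<open>C0\<close> state it.\<close>

lemma CR_carrier_iff:
  "c \<in> carrier (CR G circle_group U n) \<longleftrightarrow> c \<in> (\<Pi>\<^sub>E l\<in>Lam U n. extensional (Lam_set G U n l)) \<and>
    (\<forall>l\<in>Lam U n. continuous_map (subtopology (nerve G n) (Lam_set G U n l)) euclidean (c l) \<and>
      (\<forall>\<gamma>\<in>Lam_set G U n l. cmod (c l \<gamma>) = 1 \<and> c (Lam_bar U n l) (rho_nerve G n \<gamma>) = cnj (c l \<gamma>)))"
proof -
  have "continuous_map (subtopology (nerve G n) (Lam_set G U n l)) (gtop circle_group) (c l) \<longleftrightarrow>
    continuous_map (subtopology (nerve G n) (Lam_set G U n l)) euclidean (c l) \<and> (\<forall>\<gamma>\<in>Lam_set G U n l. cmod (c l \<gamma>) = 1)" for l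
  proof -
    have "topspace (subtopology (nerve G n) (Lam_set G U n l)) = Lam_set G U n l"
      by (auto simp: Lam_set_def)
    then show ?thesis
      by (auto simp: continuous_map_in_subtopology image_subset_iff)
  qed
  then show ?thesis
    unfolding CR_def by (auto simp del: circle_gtop)
qed

lemma CR_D:
  assumes "c \<in> carrier (CR G circle_group U n)" "l \<in> Lam U n"
  shows "continuous_map (subtopology (nerve G n) (Lam_set G U n l)) euclidean (c l)"
    "\<gamma> \<in> Lam_set G U n l \<Longrightarrow> cmod (c l \<gamma>) = 1"
    "\<gamma> \<in> Lam_set G U n l \<Longrightarrow> c (Lam_bar U n l) (rho_nerve G n \<gamma>) = cnj (c l \<gamma>)"
    "c \<in> (\<Pi>\<^sub>E l\<in>Lam U n. extensional (Lam_set G U n l))"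
  using assms unfolding CR_carrier_iff by (blast, blast, blast, blast)

lemma cochain_eqI:
  assumes "c \<in> (\<Pi>\<^sub>E l\<in>Lam U n. extensional (Lam_set G U n l))" "d \<in> (\<Pi>\<^sub>E l\<in>Lam U n. extensional (Lam_set G U n l))"
    "\<And>l \<gamma>. l \<in> Lam U n \<Longrightarrow> \<gamma> \<in> Lam_set G U n l \<Longrightarrow> c l \<gamma> = d l \<gamma>"
  shows "c = d"
proof (rule PiE_ext [OF assms(1,2)])
  fix l assume l: "l \<in> Lam U n"
  show "c l = d l"
    by (rule extensionalityI [OF PiE_mem [OF assms(1) l] PiE_mem [OF assms(2) l] assms(3) [OF l]])
qed

lemma restrict_cochain: "(\<lambda>l\<in>Lam U n. \<lambda>\<gamma>\<in>Lam_set G U n l. F l \<gamma>) \<in> (\<Pi>\<^sub>E l\<in>Lam U n. extensional (Lam_set G U n l))"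
  by (simp add: restrict_PiE_iff)

lemma differential_0:
  assumes c: "c \<in> carrier (CR G circle_group U 0)" and l: "l \<in> Lam U 1" and \<gamma>: "\<gamma> \<in> Lam_set G U 1 l"
  shows "differential G circle_group U 0 c l \<gamma> =
    c (Lam_pull 0 (omit 0 0) l) (pull 0 (omit 0 0) \<gamma>) / c (Lam_pull 0 (omit 0 1) l) (pull 0 (omit 0 1) \<gamma>)"
proof -
  have o: "omit 0 k \<in> hom_Delta' 0 1" for k
    using omit_hom_Delta' [of 0 k] by simp
  have "c (Lam_pull 0 (omit 0 k) l) (pull 0 (omit 0 k) \<gamma>) \<in> sphere 0 1" for k
    using CR_D(2) [OF c Lam_pull_in [OF l _ o] Lam_set_pull [OF l \<gamma> o]] by simp
  from circle_alternating_prod(1) [where n = 0, OF this] show ?thesis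
    using l \<gamma> by (simp add: differential_def)
qed

lemma differential_1:
  assumes c: "c \<in> carrier (CR G circle_group U 1)" and l: "l \<in> Lam U 2" and \<gamma>: "\<gamma> \<in> Lam_set G U 2 l"
  shows "differential G circle_group U 1 c l \<gamma> =
    c (Lam_pull 1 (omit 1 0) l) (pull 1 (omit 1 0) \<gamma>) / c (Lam_pull 1 (omit 1 1) l) (pull 1 (omit 1 1) \<gamma>) *
    c (Lam_pull 1 (omit 1 2) l) (pull 1 (omit 1 2) \<gamma>)"
proof -
  have o: "omit 1 k \<in> hom_Delta' 1 2" for k
    using omit_hom_Delta' [of 1 k] by (simp add: numeral_2_eq_2)
  have "c (Lam_pull 1 (omit 1 k) l) (pull 1 (omit 1 k) \<gamma>) \<in> sphere 0 1" for k
    using CR_D(2) [OF c Lam_pull_in [OF l _ o] Lam_set_pull [OF l \<gamma> o]] by simp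
  from circle_alternating_prod(2) [where n = 1, OF this] show ?thesis
    using l \<gamma> by (simp add: differential_def numeral_2_eq_2)
qed

lemma differential_ext: "differential G S U n c \<in> (\<Pi>\<^sub>E l\<in>Lam U (Suc n). extensional (Lam_set G U (Suc n) l))"
  unfolding differential_def by (rule restrict_cochain)

lemma cont_01: "continuous_map (subtopology (nerve G 1) (Lam_set G U 1 l)) (arrows G) (\<lambda>\<gamma>. \<gamma> (0, 1))"
  by (intro continuous_map_from_subtopology cont_nerve_apply) auto

lemma lift_carrier:
  assumes z: "z \<in> Z1 G C"
  shows "lift G U z \<in> carrier (CR G circle_group U 1)"
  unfolding CR_carrier_iff
proof (intro conjI ballI)
  show "lift G U z \<in> (\<Pi>\<^sub>E l\<in>Lam U 1. extensional (Lam_set G U 1 l))"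
    unfolding lift_def by (rule restrict_cochain)
  fix l assume l: "l \<in> Lam U 1"
  have v: "l 0 (vert 0) \<in> Idx C" "l 0 (vert 1) \<in> Idx C" using Lam_mem [OF l] by simp_all
  have "(\<lambda>\<gamma>. \<gamma> (0, 1)) ` topspace (subtopology (nerve G 1) (Lam_set G U 1 l)) \<subseteq>
      edges G (Opn C (l 0 (vert 0))) (Opn C (l 0 (vert 1)))"
    using Lam_set_1 [of _ l] by (auto simp del: One_nat_def)
  from continuous_map_into_subtopology_compose [OF cont_01 Z1D(1) [OF z v] this]
  have 1: "continuous_map (subtopology (nerve G 1) (Lam_set G U 1 l)) euclidean
      (\<lambda>\<gamma>. z (l 0 (vert 0)) (l 0 (vert 1)) (\<gamma> (0, 1)))" .
  show "continuous_map (subtopology (nerve G 1) (Lam_set G U 1 l)) euclidean (lift G U z l)"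
    by (rule continuous_map_eq [OF 1]) (use l in \<open>simp add: lift_def\<close>)
  fix \<gamma> assume \<gamma>: "\<gamma> \<in> Lam_set G U 1 l"
  have e: "\<gamma> (0, 1) \<in> edges G (Opn C (l 0 (vert 0))) (Opn C (l 0 (vert 1)))"
    using \<gamma> by (simp add: Lam_set_1 [unfolded One_nat_def])
  show "cmod (lift G U z l \<gamma>) = 1"
    using Z1D(2) [OF z v e] l \<gamma> by (simp add: lift_def)
  show "lift G U z (Lam_bar U 1 l) (rho_nerve G 1 \<gamma>) = cnj (lift G U z l \<gamma>)"
    using Z1D(4) [OF z v e] l \<gamma> Lam_bar_in [OF l] Lam_set_bar [OF l \<gamma>] by (simp add: lift_def Lam_bar_apply)
qed

text \<open>Faces 0, 1 and 2 of a chain carry the entries \<open>(1, 2)\<close>,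
  \<open>(0, 2)\<close> and \<open>(0, 1)\<close>, so the alternating product is trivial exactly by
  the cocycle equation for these three arrows.\<close>

lemma lift_cocycle:
  assumes z: "z \<in> Z1 G C"
  shows "lift G U z \<in> cocycles G circle_group U 1"
proof -
  note c = lift_carrier [OF z]
  have "differential G circle_group U 1 (lift G U z) = \<one>\<^bsub>CR G circle_group U 2\<^esub>"
  proof (rule cochain_eqI [where n = 2])
    show "differential G circle_group U 1 (lift G U z) \<in> (\<Pi>\<^sub>E l\<in>Lam U 2. extensional (Lam_set G U 2 l))"
      using differential_ext [of circle_group 1] by (simp add: numeral_2_eq_2)
    show "\<one>\<^bsub>CR G circle_group U 2\<^esub> \<in> (\<Pi>\<^sub>E l\<in>Lam U 2. extensional (Lam_set G U 2 l))"
      unfolding CR_def monoid.simps by (rule restrict_cochain)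
    fix l \<gamma> assume l: "l \<in> Lam U 2" and \<gamma>: "\<gamma> \<in> Lam_set G U 2 l"
    have n: "\<gamma> \<in> nerve_set G 2" using \<gamma> by (simp add: Lam_set_def)
    have o: "omit 1 k \<in> hom_Delta' 1 2" for k
      using omit_hom_Delta' [of 1 k] by (simp add: numeral_2_eq_2)
    have L: "lift G U z (Lam_pull 1 (omit 1 k) l) (pull 1 (omit 1 k) \<gamma>) =
        z (l 0 (vert (omit 1 k 0))) (l 0 (vert (omit 1 k 1))) (\<gamma> (omit 1 k 0, omit 1 k 1))" for k
      using Lam_pull_in [OF l _ o] Lam_set_pull [OF l \<gamma> o] by (simp add: lift_def pull_def)
    have v: "l 0 (vert i) \<in> Idx C" if "i \<le> 2" for i using Lam_mem [OF l] that by simp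
    have e: "\<gamma> (i, j) \<in> edges G (Opn C (l 0 (vert i))) (Opn C (l 0 (vert j)))" if "i \<le> 2" "j \<le> 2" for i j
      using Lam_set_edges [OF l \<gamma> that] by simp
    have "z (l 0 (vert 0)) (l 0 (vert 2)) (\<gamma> (0, 2)) =
        z (l 0 (vert 0)) (l 0 (vert 1)) (\<gamma> (0, 1)) * z (l 0 (vert 1)) (l 0 (vert 2)) (\<gamma> (1, 2))"
      using Z1D(5) [OF z v v v e e, of 0 1 2] nerve_setD(3,4) [OF n, of 0 1 2] by simp
    then show "differential G circle_group U 1 (lift G U z) l \<gamma> = \<one>\<^bsub>CR G circle_group U 2\<^esub> l \<gamma>"
      unfolding differential_1 [OF c l \<gamma>] L
      using Z1D(3) [OF z v v e, of 0 1] Z1D(3) [OF z v v e, of 1 2] l \<gamma> by (simp add: CR_def)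
  qed
  then show ?thesis
    using c by (simp add: cocycles_def kernel_def numeral_2_eq_2)
qed

section \<open>Descent of a Cech 1-cocycle to the cover of the objects\<close>

context
  fixes c assumes c: "c \<in> cocycles G circle_group U 1"
begin

lemma c_carrier: "c \<in> carrier (CR G circle_group U 1)"
  using c by (simp add: cocycles_def kernel_def)

lemma cocycle_identity:
  assumes l: "l \<in> Lam U 2" and \<gamma>: "\<gamma> \<in> Lam_set G U 2 l"
  shows "c (Lam_pull 1 (omit 1 0) l) (pull 1 (omit 1 0) \<gamma>) * c (Lam_pull 1 (omit 1 2) l) (pull 1 (omit 1 2) \<gamma>) =
    c (Lam_pull 1 (omit 1 1) l) (pull 1 (omit 1 1) \<gamma>)"
proof -
  have o: "omit 1 1 \<in> hom_Delta' 1 2"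
    using omit_hom_Delta' [of 1 1] by (simp add: numeral_2_eq_2)
  have "cmod (c (Lam_pull 1 (omit 1 1) l) (pull 1 (omit 1 1) \<gamma>)) = 1"
    by (rule CR_D(2) [OF c_carrier Lam_pull_in [OF l _ o] Lam_set_pull [OF l \<gamma> o]]) auto
  then have nz: "c (Lam_pull 1 (omit 1 1) l) (pull 1 (omit 1 1) \<gamma>) \<noteq> 0" by auto
  have "differential G circle_group U 1 c = \<one>\<^bsub>CR G circle_group U 2\<^esub>"
    using c by (simp add: cocycles_def kernel_def numeral_2_eq_2)
  then have "differential G circle_group U 1 c l \<gamma> = 1"
    using l \<gamma> by (simp add: CR_def)
  then show ?thesis
    unfolding differential_1 [OF c_carrier l \<gamma>] using nz by (simp add: field_simps)
qed

definition "ix i j k = mk 1 (\<lambda>n. if n = 0 then i else j) (\<lambda>_ _. k) k"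

lemma ix_in: "\<lbrakk>i \<in> cidx U 0; j \<in> cidx U 0; k \<in> cidx U 1\<rbrakk> \<Longrightarrow> ix i j k \<in> Lam U 1"
  unfolding ix_def by (rule mk_in) auto

lemma ix_simps [simp]: "ix i j k 0 (vert 0) = i" "ix i j k 0 (vert (Suc 0)) = j" "ix i j k (Suc 0) (edge 0 (Suc 0)) = k"
  by (simp_all add: ix_def)

lemma ix_Lam_set: "\<lbrakk>g \<in> edges G (O1 i) (O1 j); ch1 G g \<in> copn U 1 k\<rbrakk> \<Longrightarrow> ch1 G g \<in> Lam_set G U 1 (ix i j k)"
  unfolding Lam_set_1 using edgesD(1) [of g G] by simp

lemma eq_ix: "l \<in> Lam U 1 \<Longrightarrow> l = ix (l 0 (vert 0)) (l 0 (vert 1)) (l 1 (edge 0 1))"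
proof (rule Lam_eqI [where n = 1])
  assume l: "l \<in> Lam U 1"
  show "ix (l 0 (vert 0)) (l 0 (vert 1)) (l 1 (edge 0 1)) \<in> Lam U 1"
    by (rule ix_in) (use Lam_mem [OF l] in simp_all)
  fix n :: nat assume "n \<le> 1"
  then consider "n = 0" | "n = 1" by linarith
  then show "l 0 (vert n) = ix (l 0 (vert 0)) (l 0 (vert 1)) (l 1 (edge 0 1)) 0 (vert n)"
    by cases simp_all
qed simp_all

text \<open>The cocycle identity is applied to the chain of \<open>g\<close> and \<open>h\<close>. A
  multi-index in degree 2 may carry any edge indices \<open>a\<close>, \<open>b\<close>,
  \<open>d\<close> whose open sets contain the three edges, each chosen independently; some face
  index exists because the cover in degree 2 is a cover.\<close>

lemma cocycle_ix:
  assumes g: "g \<in> edges G (O1 i) (O1 j)" and h: "h \<in> edges G (O1 j) (O1 k)" and gh: "src G g = rng G h"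
    and ijk: "i \<in> cidx U 0" "j \<in> cidx U 0" "k \<in> cidx U 0"
    and a: "a \<in> cidx U 1" "ch1 G g \<in> copn U 1 a" and b: "b \<in> cidx U 1" "ch1 G h \<in> copn U 1 b"
    and d: "d \<in> cidx U 1" "ch1 G (gcomp G g h) \<in> copn U 1 d"
  shows "c (ix i j a) (ch1 G g) * c (ix j k b) (ch1 G h) = c (ix i k d) (ch1 G (gcomp G g h))"
proof -
  note g' = edgesD [OF g] and h' = edgesD [OF h]
  let ?\<gamma> = "ch2 G g h"
  have \<gamma>: "?\<gamma> \<in> nerve_set G 2" using g' h' gh by simp
  obtain f where f: "f \<in> cidx U 2" "?\<gamma> \<in> copn U 2 f" using cover_ex [OF \<gamma>] .
  have val: "?\<gamma> (0, Suc 0) = g" "?\<gamma> (Suc 0, 2) = h" "?\<gamma> (0, 2) = gcomp G g h" "src G (?\<gamma> (0, 0)) = rng G g"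
    using g' h' gh by (simp_all add: ch2_def gcomp_ginv_cancel)
  define v where "v = (\<lambda>n :: nat. if n = 0 then i else if n = 1 then j else k)"
  \<comment> \<open>Edge \<open>(0, 1)\<close>, the only one ending in vertex 1, gets
    \<open>a\<close>; edge \<open>(0, 2)\<close> gets \<open>d\<close> and edge
    \<open>(1, 2)\<close> gets \<open>b\<close>.\<close>
  define e where "e = (\<lambda>(m :: nat) (n :: nat). if n = 1 then a else if m = 0 then d else b)"
  let ?l = "mk 2 v e f"
  have l: "?l \<in> Lam U 2"
    by (rule mk_in) (use ijk a b d f in \<open>auto simp: v_def e_def\<close>)
  have m: "?\<gamma> \<in> Lam_set G U 2 ?l"
  proof (rule Lam_set_2I [OF \<gamma> _ _ f(2)])
    fix n :: nat assume "n \<le> 2"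
    then consider "n = 0" | "n = 1" | "n = 2" by linarith
    then show "src G (?\<gamma> (0, n)) \<in> O1 (v n)"
      using val g' h' gh by cases (simp_all add: v_def)
  next
    fix m n :: nat assume mn: "m < n" "n \<le> 2"
    then consider "m = 0" "n = 1" | "m = 0" "n = 2" | "m = 1" "n = 2" by linarith
    then show "ch1 G (?\<gamma> (m, n)) \<in> copn U 1 (e m n)"
      using val a b d by cases (simp_all add: e_def)
  qed
  have o: "omit 1 n \<in> hom_Delta' 1 2" for n
    using omit_hom_Delta' [of 1 n] by (simp add: numeral_2_eq_2)
  have p: "Lam_pull 1 (omit 1 n) ?l = ix (v (omit 1 n 0)) (v (omit 1 n 1)) (e (omit 1 n 0) (omit 1 n 1))"
    if n: "n = 0 \<or> n = 1 \<or> n = 2" for n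
  proof -
    have L: "Lam_pull 1 (omit 1 n) ?l \<in> Lam U 1" by (rule Lam_pull_in [OF l _ o]) simp
    have "omit 1 n 0 \<le> 2" "omit 1 n 1 \<le> 2" "omit 1 n 0 < omit 1 n 1" using n by auto
    then show ?thesis using eq_ix [OF L] by simp
  qed
  have q: "pull 1 (omit 1 n) ?\<gamma> = ch1 G (?\<gamma> (omit 1 n 0, omit 1 n 1))" if n: "n = 0 \<or> n = 1 \<or> n = 2" for n
    using pull_1 [OF \<gamma>, of "omit 1 n"] n by auto
  show ?thesis
    using cocycle_identity [OF l m] p [of 0] p [of 1] p [of 2] q [of 0] q [of 1] q [of 2] val
    by (simp add: v_def e_def mult.commute)
qed

text \<open>Degenerate chains show that a cocycle does not depend on the edge component of the index.\<close>

lemma cocycle_independent: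
  assumes g: "g \<in> edges G (O1 i) (O1 j)" and ij: "i \<in> cidx U 0" "j \<in> cidx U 0"
    and a: "a \<in> cidx U 1" "ch1 G g \<in> copn U 1 a" and b: "b \<in> cidx U 1" "ch1 G g \<in> copn U 1 b"
  shows "c (ix i j a) (ch1 G g) = c (ix i j b) (ch1 G g)"
proof -
  note g' = edgesD [OF g]
  let ?e = "ident G (src G g)"
  have e: "?e \<in> edges G (O1 j) (O1 j)" using g' by (intro ident_edges) auto
  have "ch1 G ?e \<in> nerve_set G 1" using g' by simp
  then obtain d where d: "d \<in> cidx U 1" "ch1 G ?e \<in> copn U 1 d" using cover_ex by blast
  \<comment> \<open>The product of \<open>g\<close> with the identity at its source is
    \<open>g\<close> again. The first edge keeps the index \<open>a\<close>, and only the index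
    \<open>x\<close> of the product edge varies, so the right side does not depend on
    \<open>x\<close>.\<close>
  have *: "c (ix i j a) (ch1 G g) * c (ix j j d) (ch1 G ?e) = c (ix i j x) (ch1 G g)"
    if "x \<in> cidx U 1" "ch1 G g \<in> copn U 1 x" for x
    using cocycle_ix [OF g e _ ij(1,2,2) a d, of x] g' that by simp
  show ?thesis
    using * [OF a] * [OF b] by simp
qed

text \<open>The edge index is chosen anew for every arrow. The resulting function on all of
  \<open>edges\<close> is thus defined without a continuous choice, and its continuity has to be
  recovered locally.\<close>

definition "ek g = (SOME k. k \<in> cidx U 1 \<and> ch1 G g \<in> copn U 1 k)"
definition "desc i j g = c (ix i j (ek g)) (ch1 G g)"

lemma ek: "g \<in> Ar \<Longrightarrow> ek g \<in> cidx U 1 \<and> ch1 G g \<in> copn U 1 (ek g)"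
  unfolding ek_def
proof (rule someI_ex)
  assume "g \<in> Ar"
  then have "ch1 G g \<in> nerve_set G 1" by simp
  then show "\<exists>k. k \<in> cidx U 1 \<and> ch1 G g \<in> copn U 1 k" using cover_ex by blast
qed

lemma desc_eq:
  assumes "g \<in> edges G (O1 i) (O1 j)" "i \<in> cidx U 0" "j \<in> cidx U 0" "a \<in> cidx U 1" "ch1 G g \<in> copn U 1 a"
  shows "desc i j g = c (ix i j a) (ch1 G g)"
  unfolding desc_def using cocycle_independent [OF assms(1-3)] ek [OF edgesD(1) [OF assms(1)]] assms(4,5) by blast

lemma desc_Z1: "desc \<in> Z1 G C"
  unfolding Z1_def C_simps
proof (intro CollectI conjI ballI impI)
  fix i j assume i: "i \<in> cidx U 0" and j: "j \<in> cidx U 0"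
  let ?E = "edges G (O1 i) (O1 j)"
  show "continuous_map (subtopology (arrows G) ?E) euclidean (desc i j)"
  proof (rule continuous_map_locally)
    fix g assume "g \<in> topspace (subtopology (arrows G) ?E)"
    then have g: "g \<in> ?E" "g \<in> Ar" by auto
    define k where "k = ek g"
    have k: "k \<in> cidx U 1" "ch1 G g \<in> copn U 1 k" using ek [OF g(2)] by (auto simp: k_def)
    \<comment> \<open>On this neighbourhood the index \<open>k\<close> chosen at \<open>g\<close> is
      admissible for every arrow. By independence \<open>desc\<close> agrees there with one fixed
      component of \<open>c\<close>, which is continuous.\<close>
    let ?N = "{h \<in> Ar. ch1 G h \<in> copn U 1 k}"
    have N: "openin (arrows G) ?N"
      by (rule openin_continuous_map_preimage [OF cont_ch1 coverD(1) [OF k(1)]])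
    have op: "openin (subtopology (arrows G) ?E) (?E \<inter> ?N)"
      by (rule openin_subtopology_Int2 [OF N])
    let ?S = "subtopology (subtopology (arrows G) ?E) (?E \<inter> ?N)"
    have 1: "continuous_map ?S (nerve G 1) (ch1 G)"
      by (intro continuous_map_from_subtopology cont_ch1)
    have sub: "ch1 G ` topspace ?S \<subseteq> Lam_set G U 1 (ix i j k)"
      using ix_Lam_set by auto
    have 2: "continuous_map ?S euclidean (\<lambda>h. c (ix i j k) (ch1 G h))"
      by (rule continuous_map_into_subtopology_compose [OF 1 CR_D(1) [OF c_carrier ix_in [OF i j k(1)]] sub])
    have "continuous_map ?S euclidean (desc i j)"
      by (rule continuous_map_eq [OF 2]) (use desc_eq [OF _ i j k(1)] in auto)
    then show "\<exists>V. openin (subtopology (arrows G) ?E) V \<and> g \<in> V \<and>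
        continuous_map (subtopology (subtopology (arrows G) ?E) V) euclidean (desc i j)"
      using op g k by blast
  qed
  fix g assume g: "g \<in> ?E"
  note k = ek [OF edgesD(1) [OF g]]
  note L = ix_in [OF i j conjunct1 [OF k]] ix_Lam_set [OF g conjunct2 [OF k]]
  show "cmod (desc i j g) = 1"
    unfolding desc_def by (rule CR_D(2) [OF c_carrier L])
  have "Lam_bar U 1 (ix i j (ek g)) = ix (cbar U 0 i) (cbar U 0 j) (cbar U 1 (ek g))"
    using eq_ix [OF Lam_bar_in [OF L(1)]] by (simp add: Lam_bar_apply)
  moreover have "rho_nerve G 1 (ch1 G g) = ch1 G (rho G g)"
    using edgesD(1) [OF g] by simp
  ultimately have R: "c (ix (cbar U 0 i) (cbar U 0 j) (cbar U 1 (ek g))) (ch1 G (rho G g)) = cnj (desc i j g)"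
    using CR_D(3) [OF c_carrier L] by (simp add: desc_def)
  have e: "rho G g \<in> edges G (O1 (cbar U 0 i)) (O1 (cbar U 0 j))"
    using rho_edges [OF deg0_cover, of i j g] i j g by simp
  have "ch1 G (rho G g) \<in> copn U 1 (cbar U 1 (ek g))"
    using coverD(4) [OF conjunct1 [OF k]] conjunct2 [OF k] edgesD(1) [OF g]
    by (metis One_nat_def imageI rho_ch1)
  then show "desc (cbar U 0 i) (cbar U 0 j) (rho G g) = cnj (desc i j g)"
    using desc_eq [OF e coverD(2) [OF i] coverD(2) [OF j] coverD(2) [OF conjunct1 [OF k]]] R by simp
next
  fix i j k g h
  assume *: "i \<in> cidx U 0" "j \<in> cidx U 0" "k \<in> cidx U 0" and g: "g \<in> edges G (O1 i) (O1 j)"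
    and h: "h \<in> edges G (O1 j) (O1 k)" and gh: "src G g = rng G h"
  note e = edgesD(1) [OF g] edgesD(1) [OF h] edgesD(1) [OF gcomp_edges [OF g h gh]]
  show "desc i k (gcomp G g h) = desc i j g * desc j k h"
    unfolding desc_def
    by (rule cocycle_ix [OF g h gh *, symmetric]) (use ek e in simp_all)
qed

lemma cocycle_eq_lift: "c = lift G U desc"
proof (rule cochain_eqI)
  show "c \<in> (\<Pi>\<^sub>E l\<in>Lam U 1. extensional (Lam_set G U 1 l))"
    using c_carrier unfolding CR_carrier_iff by blast
  show "lift G U desc \<in> (\<Pi>\<^sub>E l\<in>Lam U 1. extensional (Lam_set G U 1 l))"
    unfolding lift_def by (rule restrict_cochain)
  fix l \<gamma> assume l: "l \<in> Lam U 1" and \<gamma>: "\<gamma> \<in> Lam_set G U 1 l"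
  have 1: "\<gamma> \<in> nerve_set G 1" "\<gamma> (0, 1) \<in> edges G (O1 (l 0 (vert 0))) (O1 (l 0 (vert 1)))"
    "\<gamma> \<in> copn U 1 (l 1 (edge 0 1))"
    using \<gamma> by (auto simp: Lam_set_1 [unfolded One_nat_def])
  have eq: "ch1 G (\<gamma> (0, 1)) = \<gamma>" using nerve_1_eq [OF 1(1)] by simp
  have "desc (l 0 (vert 0)) (l 0 (vert 1)) (\<gamma> (0, 1)) = c (ix (l 0 (vert 0)) (l 0 (vert 1)) (l 1 (edge 0 1))) \<gamma>"
    using desc_eq [OF 1(2) Lam_mem [OF l] Lam_mem [OF l] Lam_mem [OF l], of "edge 0 1"] 1(3) eq by simp
  also have "\<dots> = c l \<gamma>" using eq_ix [OF l] by simp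
  finally show "c l \<gamma> = lift G U desc l \<gamma>" using l \<gamma> by (simp add: lift_def)
qed

end

lemma cocycles_eq: "cocycles G circle_group U 1 = lift G U ` Z1 G C"
proof (intro equalityI subsetI)
  fix c assume c: "c \<in> cocycles G circle_group U 1"
  show "c \<in> lift G U ` Z1 G C"
    using cocycle_eq_lift [OF c] desc_Z1 [OF c] by blast
next
  fix c assume "c \<in> lift G U ` Z1 G C"
  then show "c \<in> cocycles G circle_group U 1" using lift_cocycle by blast
qed

text \<open>Nothing on \<open>edges\<close> is lost: every arrow lies in some member of the cover in
  degree 1, so its value occurs in a suitable component of the lift. Values off \<open>edges\<close>
  never occur.\<close>

lemma lift_eq_iff:
  "lift G U z = lift G U w \<longleftrightarrow>
    (\<forall>i\<in>Idx C. \<forall>j\<in>Idx C. \<forall>g\<in>edges G (Opn C i) (Opn C j). z i j g = w i j g)"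
proof
  assume eq: "lift G U z = lift G U w"
  show "\<forall>i\<in>Idx C. \<forall>j\<in>Idx C. \<forall>g\<in>edges G (Opn C i) (Opn C j). z i j g = w i j g"
  proof (intro ballI)
    fix i j g assume "i \<in> Idx C" "j \<in> Idx C" "g \<in> edges G (Opn C i) (Opn C j)"
    then have *: "i \<in> cidx U 0" "j \<in> cidx U 0" and g: "g \<in> edges G (O1 i) (O1 j)" by simp_all
    have "ch1 G g \<in> nerve_set G 1" using edgesD(1) [OF g] by simp
    then obtain k where k: "k \<in> cidx U 1" "ch1 G g \<in> copn U 1 k" using cover_ex by blast
    define l where "l = mk 1 (\<lambda>n. if n = 0 then i else j) (\<lambda>_ _. k) k"
    have l: "l \<in> Lam U 1" unfolding l_def by (rule mk_in) (use * k in auto)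
    have L: "ch1 G g \<in> Lam_set G U 1 l"
      unfolding Lam_set_1 using edgesD(1) [OF g] g k by (simp add: l_def)
    have "lift G U z l (ch1 G g) = lift G U w l (ch1 G g)" using eq by simp
    then show "z i j g = w i j g"
      using l L edgesD(1) [OF g] by (simp add: lift_def l_def)
  qed
next
  assume eq: "\<forall>i\<in>Idx C. \<forall>j\<in>Idx C. \<forall>g\<in>edges G (Opn C i) (Opn C j). z i j g = w i j g"
  show "lift G U z = lift G U w"
    unfolding lift_def
  proof (rule cochain_eqI [OF restrict_cochain restrict_cochain])
    fix l \<gamma> assume l: "l \<in> Lam U 1" and \<gamma>: "\<gamma> \<in> Lam_set G U 1 l"
    have "l 0 (vert 0) \<in> Idx C" "l 0 (vert 1) \<in> Idx C" using Lam_mem [OF l] by simp_all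
    moreover have "\<gamma> (0, 1) \<in> edges G (Opn C (l 0 (vert 0))) (Opn C (l 0 (vert 1)))"
      using \<gamma> by (simp add: Lam_set_1 [unfolded One_nat_def])
    ultimately show "(\<lambda>l\<in>Lam U 1. \<lambda>\<gamma>\<in>Lam_set G U 1 l. z (l 0 (vert 0)) (l 0 (vert 1)) (\<gamma> (0, 1))) l \<gamma> =
      (\<lambda>l\<in>Lam U 1. \<lambda>\<gamma>\<in>Lam_set G U 1 l. w (l 0 (vert 0)) (l 0 (vert 1)) (\<gamma> (0, 1))) l \<gamma>"
      using eq l \<gamma> by simp
  qed
qed

lemma lift_mult: "lift G U z \<otimes>\<^bsub>CR G circle_group U 1\<^esub> lift G U w = lift G U (\<lambda>i j g. z i j g * w i j g)"
  unfolding CR_def lift_def by (simp cong: restrict_cong)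

text \<open>In degree 0 a multi-index is a single vertex index and a chain is a point
  \<open>pt G x\<close>, so 0-cochains are families of functions on the members of the object
  cover.\<close>

lemma carrier_CR_0: "carrier (CR G circle_group U 0) = lift0 G U ` C0 G C"
proof (intro equalityI subsetI)
  fix c assume "c \<in> lift0 G U ` C0 G C"
  then obtain b where b: "b \<in> C0 G C" and c: "c = lift0 G U b" by blast
  show "c \<in> carrier (CR G circle_group U 0)"
    unfolding c CR_carrier_iff
  proof (intro conjI ballI)
    show "lift0 G U b \<in> (\<Pi>\<^sub>E l\<in>Lam U 0. extensional (Lam_set G U 0 l))"
      unfolding lift0_def by (rule restrict_cochain)
    fix l assume l: "l \<in> Lam U 0"
    let ?i = "l 0 (vert 0)"
    have i: "?i \<in> Idx C" using Lam_mem [OF l] by simp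
    have "(\<lambda>\<gamma>. src G (\<gamma> (0, 0))) ` topspace (subtopology (nerve G 0) (Lam_set G U 0 l)) \<subseteq> Opn C ?i"
      using Lam_set_0 by auto
    from continuous_map_into_subtopology_compose [OF continuous_map_from_subtopology [OF cont_nerve_0] C0D(1) [OF b i] this]
    have 1: "continuous_map (subtopology (nerve G 0) (Lam_set G U 0 l)) euclidean (\<lambda>\<gamma>. b ?i (src G (\<gamma> (0, 0))))" .
    show "continuous_map (subtopology (nerve G 0) (Lam_set G U 0 l)) euclidean (lift0 G U b l)"
      by (rule continuous_map_eq [OF 1]) (use l in \<open>simp add: lift0_def\<close>)
    fix \<gamma> assume \<gamma>: "\<gamma> \<in> Lam_set G U 0 l"
    have n: "\<gamma> \<in> nerve_set G 0" and x: "src G (\<gamma> (0, 0)) \<in> Opn C ?i" using \<gamma> by (auto simp: Lam_set_0)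
    show "cmod (lift0 G U b l \<gamma>) = 1"
      using C0D(2) [OF b i x] l \<gamma> by (simp add: lift0_def)
    show "lift0 G U b (Lam_bar U 0 l) (rho_nerve G 0 \<gamma>) = cnj (lift0 G U b l \<gamma>)"
      using C0D(4) [OF b i x] l \<gamma> Lam_bar_in [OF l] Lam_set_bar [OF l \<gamma>] nerve_setD(1) [OF n, of 0 0]
      by (simp add: lift0_def Lam_bar_apply)
  qed
next
  fix c assume c: "c \<in> carrier (CR G circle_group U 0)"
  define ix where "ix i = mk 0 (\<lambda>_. i) (\<lambda>_ _. i) i" for i :: 'i
  have ix: "ix i \<in> Lam U 0" if "i \<in> cidx U 0" for i
    unfolding ix_def by (rule mk_in) (use that in auto)
  have ix0: "ix i 0 (vert 0) = i" for i by (simp add: ix_def)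
  have eq_ix: "l = ix (l 0 (vert 0))" if l: "l \<in> Lam U 0" for l
    by (rule Lam_eqI [OF l ix]) (use Lam_mem [OF l] ix0 in auto)
  define b where "b i x = c (ix i) (pt G x)" for i x
  have L: "pt G x \<in> Lam_set G U 0 (ix i)" if "x \<in> O1 i" for x i
    using that by (simp add: Lam_set_0 ix0)
  have "b \<in> C0 G C"
    unfolding C0_def C_simps
  proof (intro CollectI ballI conjI)
    fix i assume i: "i \<in> cidx U 0"
    show "continuous_map (subtopology (objects G) (O1 i)) euclidean (b i)"
      unfolding b_def
      by (rule continuous_map_into_subtopology_compose [OF continuous_map_from_subtopology [OF cont_pt] CR_D(1) [OF c ix [OF i]]])
        (use L in auto)
    fix x assume x: "x \<in> O1 i"
    show "cmod (b i x) = 1" unfolding b_def by (rule CR_D(2) [OF c ix [OF i] L [OF x]])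
    have "Lam_bar U 0 (ix i) = ix (cbar U 0 i)"
      using eq_ix [OF Lam_bar_in [OF ix [OF i]]] by (simp add: Lam_bar_apply ix0)
    then show "b (cbar U 0 i) (rho_obj G x) = cnj (b i x)"
      using CR_D(3) [OF c ix [OF i] L [OF x]] x by (simp add: b_def)
  qed
  moreover have "c = lift0 G U b"
  proof (rule cochain_eqI)
    show "c \<in> (\<Pi>\<^sub>E l\<in>Lam U 0. extensional (Lam_set G U 0 l))"
      using c unfolding CR_carrier_iff by blast
    show "lift0 G U b \<in> (\<Pi>\<^sub>E l\<in>Lam U 0. extensional (Lam_set G U 0 l))"
      unfolding lift0_def by (rule restrict_cochain)
    fix l \<gamma> assume l: "l \<in> Lam U 0" and \<gamma>: "\<gamma> \<in> Lam_set G U 0 l"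
    have "pt G (src G (\<gamma> (0, 0))) = \<gamma>" using nerve_0_eq \<gamma> Lam_set_0 by metis
    then show "c l \<gamma> = lift0 G U b l \<gamma>"
      using eq_ix [OF l] l \<gamma> by (simp add: lift0_def b_def)
  qed
  ultimately show "c \<in> lift0 G U ` C0 G C" by blast
qed

lemma differential_lift0:
  assumes b: "b \<in> C0 G C"
  shows "differential G circle_group U 0 (lift0 G U b) = lift G U (delta G b)"
proof (rule cochain_eqI)
  have c: "lift0 G U b \<in> carrier (CR G circle_group U 0)" using carrier_CR_0 b by blast
  show "differential G circle_group U 0 (lift0 G U b) \<in> (\<Pi>\<^sub>E l\<in>Lam U 1. extensional (Lam_set G U 1 l))"
    using differential_ext [of circle_group 0] by simp
  show "lift G U (delta G b) \<in> (\<Pi>\<^sub>E l\<in>Lam U 1. extensional (Lam_set G U 1 l))"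
    unfolding lift_def by (rule restrict_cochain)
  fix l \<gamma> assume l: "l \<in> Lam U 1" and \<gamma>: "\<gamma> \<in> Lam_set G U 1 l"
  have n: "\<gamma> \<in> nerve_set G 1" using \<gamma> by (simp add: Lam_set_def)
  have o: "omit 0 k \<in> hom_Delta' 0 1" for k using omit_hom_Delta' [of 0 k] by simp
  have L: "lift0 G U b (Lam_pull 0 (omit 0 k) l) (pull 0 (omit 0 k) \<gamma>) =
      b (l 0 (vert (omit 0 k 0))) (src G (\<gamma> (omit 0 k 0, omit 0 k 0)))" for k
    using Lam_pull_in [OF l _ o] Lam_set_pull [OF l \<gamma> o] by (simp add: lift0_def pull_def)
  have "src G (\<gamma> (0, 0)) = rng G (\<gamma> (0, 1))" "src G (\<gamma> (1, 1)) = src G (\<gamma> (0, 1))"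
    using nerve_diag [OF n, of 0 1] nerve_setD(1) [OF n, of 0 1] by simp_all
  then show "differential G circle_group U 0 (lift0 G U b) l \<gamma> = lift G U (delta G b) l \<gamma>"
    unfolding differential_0 [OF c l \<gamma>] L using l \<gamma> by (simp add: lift_def delta_def)
qed

lemma coboundaries_eq: "coboundaries G circle_group U 1 = (\<lambda>b. lift G U (delta G b)) ` C0 G C"
  unfolding coboundaries_def One_nat_def nat.case carrier_CR_0 image_image
  by (rule image_cong [OF refl differential_lift0])

end


section \<open>Cohomology classes and refinements\<close>

lemma (in real_grpd) cohom_mult:
  assumes "cohom G C z z'" "cohom G C w w'"
  shows "cohom G C (\<lambda>i j g. z i j g * w i j g) (\<lambda>i j g. z' i j g * w' i j g)"
proof -
  obtain a where a: "a \<in> C0 G C" "\<And>i j g. \<lbrakk>i \<in> Idx C; j \<in> Idx C; g \<in> edges G (Opn C i) (Opn C j)\<rbrakk> \<Longrightarrow>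
      z' i j g = z i j g * delta G a i j g"
    using assms(1) unfolding cohom_def by blast
  obtain b where b: "b \<in> C0 G C" "\<And>i j g. \<lbrakk>i \<in> Idx C; j \<in> Idx C; g \<in> edges G (Opn C i) (Opn C j)\<rbrakk> \<Longrightarrow>
      w' i j g = w i j g * delta G b i j g"
    using assms(2) unfolding cohom_def by blast
  have "(\<lambda>j x. a j x * b j x) \<in> C0 G C"
    using a(1) b(1) unfolding C0_def by (simp add: continuous_map_mult norm_mult)
  moreover have "z' i j g * w' i j g = z i j g * w i j g * delta G (\<lambda>j x. a j x * b j x) i j g"
    if "i \<in> Idx C" "j \<in> Idx C" "g \<in> edges G (Opn C i) (Opn C j)" for i j g
    using a(2) [OF that] b(2) [OF that] by (simp add: delta_def)
  ultimately show ?thesis unfolding cohom_def by blast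
qed

context real_cover
begin

abbreviation "H1 \<equiv> HR G circle_group U 1"

definition "coset z = {lift G U w | w. w \<in> Z1 G C \<and> cohom G C z w}"

lemma r_coset_eq:
  assumes z: "z \<in> Z1 G C"
  shows "coboundaries G circle_group U 1 #>\<^bsub>CR G circle_group U 1\<^esub> lift G U z = coset z"
proof (intro equalityI subsetI)
  fix u assume "u \<in> coboundaries G circle_group U 1 #>\<^bsub>CR G circle_group U 1\<^esub> lift G U z"
  then obtain b where b: "b \<in> C0 G C" and u: "u = lift G U (delta G b) \<otimes>\<^bsub>CR G circle_group U 1\<^esub> lift G U z"
    unfolding r_coset_def coboundaries_eq by blast
  have "cohom G C z (\<lambda>i j g. delta G b i j g * z i j g)"
    unfolding cohom_def by (rule bexI [OF _ b]) (simp add: mult.commute)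
  then show "u \<in> coset z"
    unfolding u lift_mult coset_def using Z1_mult [OF delta_Z1 [OF deg0_cover b] z] by blast
next
  fix u assume "u \<in> coset z"
  then obtain w where u: "u = lift G U w" and "cohom G C z w"
    by (auto simp: coset_def)
  then obtain b where b: "b \<in> C0 G C" and w: "\<forall>i\<in>Idx C. \<forall>j\<in>Idx C. \<forall>g\<in>edges G (Opn C i) (Opn C j).
      w i j g = z i j g * delta G b i j g"
    unfolding cohom_def by blast
  have "u = lift G U (delta G b) \<otimes>\<^bsub>CR G circle_group U 1\<^esub> lift G U z"
    unfolding u lift_mult lift_eq_iff using w by (simp add: mult.commute)
  then show "u \<in> coboundaries G circle_group U 1 #>\<^bsub>CR G circle_group U 1\<^esub> lift G U z"
    unfolding r_coset_def coboundaries_eq using b by blast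
qed

lemma carrier_H1: "carrier H1 = coset ` Z1 G C"
proof -
  have "carrier H1 = (\<lambda>c. coboundaries G circle_group U 1 #>\<^bsub>CR G circle_group U 1\<^esub> c) ` cocycles G circle_group U 1"
    by (simp add: HR_def carrier_FactGroup r_coset_def)
  then show ?thesis
    unfolding cocycles_eq image_image using r_coset_eq by (simp cong: image_cong)
qed

end

section \<open>The cohomology of one cover inside the Picard group\<close>

locale picard_cover = real_cover G U + real_picard G bundle_type
  for G :: "('g, 'x) real_groupoid" and U :: "('i, 'g) cover_seq" and bundle_type :: "'l itself"
begin

text \<open>Cohomology is traded for equality of bundle classes: a cohomology class collects all
  cocycles that present the same bundles.\<close>

lemma coset_eq: "z \<in> Z1 G C \<Longrightarrow> coset z = {lift G U w | w. w \<in> Z1 G C \<and> lcls C w = lcls C z}"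
  unfolding coset_def using lcls_eq_iff_cohom [OF deg0_cover] by blast

lemma coset_eq_iff:
  assumes z: "z \<in> Z1 G C" and w: "w \<in> Z1 G C"
  shows "coset z = coset w \<longleftrightarrow> lcls C z = lcls C w"
proof
  assume "coset z = coset w"
  moreover have "lift G U z \<in> coset z" using coset_eq [OF z] z by blast
  ultimately obtain v where "lift G U z = lift G U v" "lcls C v = lcls C w"
    using coset_eq [OF w] by auto
  then show "lcls C z = lcls C w"
    \<comment> \<open>Equal lifts give cocycles that agree on \<open>edges\<close> only, but
      \<open>cls\<close> depends on nothing else.\<close>
    unfolding lift_eq_iff using cls_cong [of C z v] by metis
qed (simp add: coset_eq z w)

lemma coset_mult:
  assumes z: "z \<in> Z1 G C" and w: "w \<in> Z1 G C"
  shows "coset z \<otimes>\<^bsub>H1\<^esub> coset w = coset (\<lambda>i j g. z i j g * w i j g)"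
proof -
  let ?zw = "\<lambda>i j g. z i j g * w i j g"
  have m: "coset z \<otimes>\<^bsub>H1\<^esub> coset w = (\<Union>a\<in>coset z. \<Union>b\<in>coset w. {a \<otimes>\<^bsub>CR G circle_group U 1\<^esub> b})"
    by (simp add: HR_def set_mult_def)
  show ?thesis
    unfolding m
  proof (intro equalityI subsetI)
    fix u assume "u \<in> (\<Union>a\<in>coset z. \<Union>b\<in>coset w. {a \<otimes>\<^bsub>CR G circle_group U 1\<^esub> b})"
    then obtain a b where a: "a \<in> Z1 G C" "cohom G C z a" and b: "b \<in> Z1 G C" "cohom G C w b"
      and u: "u = lift G U a \<otimes>\<^bsub>CR G circle_group U 1\<^esub> lift G U b"
      by (auto simp: coset_def)
    show "u \<in> coset ?zw"
      unfolding u lift_mult coset_def using Z1_mult [OF a(1) b(1)] cohom_mult [OF a(2) b(2)] by blast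
  next
    fix u assume "u \<in> coset ?zw"
    then obtain v where v: "u = lift G U v" "v \<in> Z1 G C" "cohom G C ?zw v"
      by (auto simp: coset_def)
    obtain b where b: "b \<in> C0 G C" "\<forall>i\<in>Idx C. \<forall>j\<in>Idx C. \<forall>g\<in>edges G (Opn C i) (Opn C j).
      v i j g = ?zw i j g * delta G b i j g"
      using v(3) unfolding cohom_def by blast
    \<comment> \<open>The whole coboundary is moved into the first factor, and \<open>w\<close> is
      kept as it is.\<close>
    let ?a = "\<lambda>i j g. z i j g * delta G b i j g"
    have "lift G U ?a \<in> coset z"
      unfolding coset_def cohom_def using Z1_mult [OF z delta_Z1 [OF deg0_cover b(1)]] b(1) by blast
    moreover have "lift G U w \<in> coset w" using coset_eq [OF w] w by blast
    moreover have "u = lift G U ?a \<otimes>\<^bsub>CR G circle_group U 1\<^esub> lift G U w"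
      unfolding v(1) lift_mult lift_eq_iff using b(2) by simp
    ultimately show "u \<in> (\<Union>a\<in>coset z. \<Union>b\<in>coset w. {a \<otimes>\<^bsub>CR G circle_group U 1\<^esub> b})" by blast
  qed
qed

text \<open>For a coset, the choice of the representative is harmless by
  \<open>coset_eq_iff\<close>, which also makes this map injective on the cohomology of the
  cover.\<close>

definition "bcls A = lcls C (SOME z. z \<in> Z1 G C \<and> A = coset z)"

lemma bcls_coset:
  assumes z: "z \<in> Z1 G C"
  shows "bcls (coset z) = lcls C z"
proof -
  let ?w = "SOME w. w \<in> Z1 G C \<and> coset z = coset w"
  have W: "?w \<in> Z1 G C \<and> coset z = coset ?w"
    using someI [of "\<lambda>w. w \<in> Z1 G C \<and> coset z = coset w" z] z by blast
  have "lcls C z = lcls C ?w"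
    using coset_eq_iff [OF z conjunct1 [OF W]] conjunct2 [OF W] by (rule iffD1)
  then show ?thesis unfolding bcls_def by (rule sym)
qed

lemma H1_obtain:
  assumes "A \<in> carrier H1"
  obtains z where "z \<in> Z1 G C" "A = coset z" "bcls A = lcls C z"
  using assms bcls_coset unfolding carrier_H1 by blast

lemma bcls_carrier: "A \<in> carrier H1 \<Longrightarrow> bcls A \<in> carrier Pic"
  using H1_obtain lcls_carrier [OF deg0_cover] by metis

lemma bcls_inj: "\<lbrakk>A \<in> carrier H1; B \<in> carrier H1; bcls A = bcls B\<rbrakk> \<Longrightarrow> A = B"
  using H1_obtain coset_eq_iff by metis

lemma bcls_mult:
  assumes "A \<in> carrier H1" "B \<in> carrier H1"
  shows "bcls (A \<otimes>\<^bsub>H1\<^esub> B) = bcls A \<otimes>\<^bsub>Pic\<^esub> bcls B" "A \<otimes>\<^bsub>H1\<^esub> B \<in> carrier H1"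
proof -
  obtain z where z: "z \<in> Z1 G C" "A = coset z" "bcls A = lcls C z" using H1_obtain [OF assms(1)] .
  obtain w where w: "w \<in> Z1 G C" "B = coset w" "bcls B = lcls C w" using H1_obtain [OF assms(2)] .
  note zw = Z1_mult [OF z(1) w(1)]
  have e: "A \<otimes>\<^bsub>H1\<^esub> B = coset (\<lambda>i j g. z i j g * w i j g)"
    unfolding z(2) w(2) by (rule coset_mult [OF z(1) w(1)])
  show "bcls (A \<otimes>\<^bsub>H1\<^esub> B) = bcls A \<otimes>\<^bsub>Pic\<^esub> bcls B"
    unfolding z(3) w(3) lcls_mult [OF deg0_cover z(1) w(1)] e by (rule bcls_coset [OF zw])
  show "A \<otimes>\<^bsub>H1\<^esub> B \<in> carrier H1"
    unfolding e carrier_H1 using zw by blast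
qed

end

section \<open>Refinement maps preserve the bundle class\<close>

context real_picard
begin

text \<open>The same map with the cover as an explicit argument, so that classes over different
  covers can be compared in one context.\<close>

definition bclass :: "('i, 'g) cover_seq \<Rightarrow> ('i, 'g, complex) cochain set \<Rightarrow> ('l, 'g, 'x) line_bundle set" where
  "bclass U A = picard_cover.bcls G U A"

lemma picard_coverI: "real_cover_seq G U \<Longrightarrow> picard_cover TYPE('l) G U"
  by unfold_locales

lemma refinement_rrefines:
  assumes "refinement n V U \<theta>"
  shows "rrefines (deg0 G V) (deg0 G U) (\<theta> 0)"
  using assms unfolding refinement_def rrefines_def deg0_def by auto

text \<open>The value of a lift is selected by vertex indices, so restriction amounts to
  substituting the degree 0 part of the refining map.\<close>

lemma cochain_restrict_lift:
  assumes U: "real_cover_seq G U" and V: "real_cover_seq G V" and r: "refinement n V U \<theta>"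
  shows "cochain_restrict G V 1 \<theta> (lift G U w) = lift G V (\<lambda>i j. w (\<theta> 0 i) (\<theta> 0 j))"
proof -
  interpret V: real_cover G V using V by unfold_locales
  have th: "\<theta> k i \<in> cidx U k" "copn V k i \<subseteq> copn U k (\<theta> k i)" if "i \<in> cidx V k" for k i
    using r that by (auto simp: refinement_def)
  show ?thesis
    unfolding cochain_restrict_def lift_def [of G V]
  proof (rule V.cochain_eqI [OF V.restrict_cochain V.restrict_cochain])
    fix l \<gamma> assume l: "l \<in> Lam V 1" and \<gamma>: "\<gamma> \<in> Lam_set G V 1 l"
    have L: "Lam_map 1 \<theta> l \<in> Lam U 1"
      unfolding Lam_map_def by (intro LamI th Lam_mem [OF l])
    have "pull k \<phi> \<gamma> \<in> copn U k (Lam_map 1 \<theta> l k \<phi>)" if k: "k \<le> 1" and \<phi>: "\<phi> \<in> hom_Delta' k 1" for k \<phi>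
    proof -
      have "pull k \<phi> \<gamma> \<in> copn V k (l k \<phi>)" using \<gamma> k \<phi> by (simp add: Lam_set_def)
      then have "pull k \<phi> \<gamma> \<in> copn U k (\<theta> k (l k \<phi>))"
        by (rule subsetD [OF th(2) [OF Lam_mem [OF l k \<phi>]]])
      then show ?thesis using k \<phi> by (simp add: Lam_map_def)
    qed
    then have "\<gamma> \<in> Lam_set G U 1 (Lam_map 1 \<theta> l)"
      using \<gamma> by (simp add: Lam_set_def)
    then show "(\<lambda>l\<in>Lam V 1. \<lambda>\<gamma>\<in>Lam_set G V 1 l. lift G U w (Lam_map 1 \<theta> l) \<gamma>) l \<gamma> =
      (\<lambda>l\<in>Lam V 1. \<lambda>\<gamma>\<in>Lam_set G V 1 l. w (\<theta> 0 (l 0 (vert 0))) (\<theta> 0 (l 0 (vert 1))) (\<gamma> (0, 1))) l \<gamma>"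
      using l \<gamma> L by (simp add: lift_def) (simp add: Lam_map_def)
  qed
qed

text \<open>All cocycles in \<open>A\<close> present the same bundles, and so do their restrictions.
  The cosets in the defining union therefore coincide, which makes restriction a map of classes;
  whichever refining map \<open>SOME\<close> returns, the bundle class is unchanged.\<close>

lemma HR_restrict:
  assumes U: "real_cover_seq G U" and V: "real_cover_seq G V" and r: "\<exists>\<theta>. refinement 1 V U \<theta>"
    and A: "A \<in> carrier (HR G circle_group U 1)"
  shows "HR_restrict G circle_group 1 U V A \<in> carrier (HR G circle_group V 1)"
    "bclass V (HR_restrict G circle_group 1 U V A) = bclass U A"
proof -
  interpret U: picard_cover G U "TYPE('l)" by (rule picard_coverI [OF U])
  interpret V: picard_cover G V "TYPE('l)" by (rule picard_coverI [OF V])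
  define \<theta> where "\<theta> = (SOME \<theta>. refinement 1 V U \<theta>)"
  have \<theta>: "refinement 1 V U \<theta>" unfolding \<theta>_def by (rule someI_ex [OF r])
  note rr = refinement_rrefines [OF \<theta>]
  obtain z where z: "z \<in> Z1 G U.C" "A = U.coset z" "U.bcls A = lcls U.C z" using U.H1_obtain [OF A] .
  let ?r = "\<lambda>w i j. w (\<theta> 0 i) (\<theta> 0 j)"
  have rZ: "?r w \<in> Z1 G V.C" and rc: "lcls V.C (?r w) = lcls U.C w" if "w \<in> Z1 G U.C" for w
    using Z1_refine [OF rr that] lcls_refine [OF U.deg0_cover that V.deg0_cover rr] by auto
  have each: "coboundaries G circle_group V 1 #>\<^bsub>CR G circle_group V 1\<^esub> cochain_restrict G V 1 \<theta> c = V.coset (?r z)"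
    if "c \<in> A" for c
  proof -
    obtain w where w: "c = lift G U w" "w \<in> Z1 G U.C" "lcls U.C w = lcls U.C z"
      using \<open>c \<in> A\<close> unfolding z(2) U.coset_eq [OF z(1)] by blast
    have "V.coset (?r w) = V.coset (?r z)"
      unfolding V.coset_eq_iff [OF rZ [OF w(2)] rZ [OF z(1)]] rc [OF w(2)] rc [OF z(1)] by (rule w(3))
    then show ?thesis
      unfolding w(1) cochain_restrict_lift [OF U V \<theta>] V.r_coset_eq [OF rZ [OF w(2)]] .
  qed
  have "lift G U z \<in> A" unfolding z(2) U.coset_eq [OF z(1)] using z(1) by blast
  then have e: "HR_restrict G circle_group 1 U V A = V.coset (?r z)"
    unfolding HR_restrict_def \<theta>_def [symmetric] using each by blast
  show "HR_restrict G circle_group 1 U V A \<in> carrier (HR G circle_group V 1)"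
    unfolding e V.carrier_H1 using rZ [OF z(1)] by blast
  show "bclass V (HR_restrict G circle_group 1 U V A) = bclass U A"
    unfolding bclass_def e V.bcls_coset [OF rZ [OF z(1)]] z(3) by (rule rc [OF z(1)])
qed

end


section \<open>Cofinality of the covers and the direct limit\<close>

text \<open>Pairs, and hence tuples, of indices can be coded in the index type itself, which keeps
  intersections of covers within one type.\<close>

lemma infinite_bij_pair:
  assumes "infinite (UNIV :: 'i set)"
  shows "\<exists>(pr :: 'i \<times> 'i \<Rightarrow> 'i) un. (\<forall>p. un (pr p) = p) \<and> (\<forall>k. pr (un k) = k)"
proof -
  obtain pr :: "'i \<times> 'i \<Rightarrow> 'i" where "bij_betw pr (UNIV \<times> UNIV) UNIV"
    using card_of_Times_same_infinite [OF assms] unfolding card_of_ordIso [symmetric] by blast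
  then have "bij pr" by simp
  then have "(\<forall>p. inv_into UNIV pr (pr p) = p) \<and> (\<forall>k. pr (inv_into UNIV pr k) = k)"
    by (simp add: bij_is_inj bij_is_surj surj_f_inv_f)
  then show ?thesis by blast
qed

text \<open>The two maps may be simplicial up to different levels; the smaller one works, since both
  are at least \<open>n + 1\<close>.\<close>

lemma refinement_trans:
  assumes "refinement n V U \<theta>" "refinement n W V \<eta>"
  shows "refinement n W U (\<lambda>k i. \<theta> k (\<eta> k i))"
proof -
  have t: "\<theta> k i \<in> cidx U k" "\<theta> k (cbar V k i) = cbar U k (\<theta> k i)" "copn V k i \<subseteq> copn U k (\<theta> k i)"
    if "i \<in> cidx V k" for k i
    using assms(1) that by (auto simp: refinement_def)
  have e: "\<eta> k i \<in> cidx V k" "\<eta> k (cbar W k i) = cbar V k (\<eta> k i)" "copn W k i \<subseteq> copn V k (\<eta> k i)"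
    if "i \<in> cidx W k" for k i
    using assms(2) that by (auto simp: refinement_def)
  obtain N where N: "n + 1 \<le> N" "N \<le> clevel V" "N \<le> clevel U"
    "\<And>m p f i. \<lbrakk>m \<le> N; p \<le> N; f \<in> hom_Delta m p; i \<in> cidx V p\<rbrakk> \<Longrightarrow> \<theta> m (cface V m p f i) = cface U m p f (\<theta> p i)"
    using assms(1) unfolding refinement_def by blast
  obtain M where M: "n + 1 \<le> M" "M \<le> clevel W" "M \<le> clevel V"
    "\<And>m p f i. \<lbrakk>m \<le> M; p \<le> M; f \<in> hom_Delta m p; i \<in> cidx W p\<rbrakk> \<Longrightarrow> \<eta> m (cface W m p f i) = cface V m p f (\<eta> p i)"
    using assms(2) unfolding refinement_def by blast
  have "\<forall>k. \<forall>i\<in>cidx W k. \<theta> k (\<eta> k i) \<in> cidx U k \<and> \<theta> k (\<eta> k (cbar W k i)) = cbar U k (\<theta> k (\<eta> k i)) \<and>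
      copn W k i \<subseteq> copn U k (\<theta> k (\<eta> k i))"
  proof (intro allI ballI conjI)
    fix k i assume i: "i \<in> cidx W k"
    note e' = e [OF i] and t' = t [OF e(1) [OF i]]
    show "\<theta> k (\<eta> k i) \<in> cidx U k" "\<theta> k (\<eta> k (cbar W k i)) = cbar U k (\<theta> k (\<eta> k i))"
      "copn W k i \<subseteq> copn U k (\<theta> k (\<eta> k i))"
      using e' t' by auto
  qed
  moreover have "\<forall>m p. m \<le> min N M \<and> p \<le> min N M \<longrightarrow> (\<forall>f\<in>hom_Delta m p. \<forall>i\<in>cidx W p.
      \<theta> m (\<eta> m (cface W m p f i)) = cface U m p f (\<theta> p (\<eta> p i)))"
    using N(4) M(4) e(1) by simp
  ultimately show ?thesis
    unfolding refinement_def using N(1-3) M(1-3) by (intro conjI exI [of _ "min N M"]) auto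
qed

text \<open>\<open>pr\<close> and \<open>un\<close> code pairs of indices. The factor
  \<open>bool\<close> in \<open>emb\<close> makes room for the covers produced by
  \<open>reindex\<close>, which have two indices per object.\<close>

locale cech_limit = real_picard G bundle_type for G :: "('g, 'x) real_groupoid" and bundle_type :: "'l itself" +
  fixes pr :: "'i \<times> 'i \<Rightarrow> 'i" and un :: "'i \<Rightarrow> 'i \<times> 'i"
  assumes un_pr [simp]: "un (pr p) = p" and pr_un [simp]: "pr (un k) = k"
    and emb: "topspace (objects G) \<times> (UNIV :: bool set) \<lesssim> (UNIV :: 'i set)"
begin

abbreviation CS :: "('i, 'g) cover_seq set" where "CS \<equiv> cover_system G 1"
abbreviation prec :: "('i, 'g) cover_seq \<Rightarrow> ('i, 'g) cover_seq \<Rightarrow> bool" where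
  "prec U V \<equiv> \<exists>\<theta>. refinement 1 V U \<theta>"
abbreviation HH :: "('i, 'g) cover_seq \<Rightarrow> ('i, 'g, complex) cochain set monoid" where
  "HH U \<equiv> HR G circle_group U 1"
abbreviation res :: "('i, 'g) cover_seq \<Rightarrow> ('i, 'g) cover_seq \<Rightarrow> ('i, 'g, complex) cochain set \<Rightarrow> ('i, 'g, complex) cochain set" where
  "res \<equiv> HR_restrict G circle_group 1"

lemma CS_D:
  assumes "U \<in> CS"
  shows "real_cover_seq G U" "simplicial_cover U" "2 \<le> clevel U" "real_cover G U" "picard_cover TYPE('l) G U"
proof -
  show r: "real_cover_seq G U" and "simplicial_cover U" "2 \<le> clevel U"
    using assms by (simp_all add: cover_system_def)
  show "real_cover G U" by unfold_locales (rule r)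
  show "picard_cover TYPE('l) G U" by (rule picard_coverI [OF r])
qed

lemma inj_on_rho_nerve: "inj_on (rho_nerve G n) (nerve_set G n)"
  by (rule inj_on_inverseI [of _ "rho_nerve G n"]) (rule rho_nerve_rho_nerve)

text \<open>The memberwise intersection in every degree, with componentwise simplicial structure. It
  provides the common upper bounds in the limit.\<close>

definition meet_cover :: "('i, 'g) cover_seq \<Rightarrow> ('i, 'g) cover_seq \<Rightarrow> ('i, 'g) cover_seq" where
  "meet_cover U V = \<lparr>cidx = (\<lambda>n. {k. fst (un k) \<in> cidx U n \<and> snd (un k) \<in> cidx V n}),
     cbar = (\<lambda>n k. pr (cbar U n (fst (un k)), cbar V n (snd (un k)))),
     copn = (\<lambda>n k. copn U n (fst (un k)) \<inter> copn V n (snd (un k))),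
     clevel = min (clevel U) (clevel V),
     cface = (\<lambda>m p f k. pr (cface U m p f (fst (un k)), cface V m p f (snd (un k))))\<rparr>"

lemma simplicialD:
  assumes "simplicial_cover U"
  shows "\<lbrakk>m \<le> clevel U; p \<le> clevel U; f \<in> hom_Delta m p; j \<in> cidx U p\<rbrakk> \<Longrightarrow> cface U m p f j \<in> cidx U m \<and>
      cface U m p f (cbar U p j) = cbar U m (cface U m p f j) \<and> pull m f ` copn U p j \<subseteq> copn U m (cface U m p f j)"
    "\<lbrakk>p \<le> clevel U; j \<in> cidx U p\<rbrakk> \<Longrightarrow> cface U p p (\<lambda>i\<in>{..p}. i) j = j"
    "\<lbrakk>l \<le> clevel U; m \<le> clevel U; p \<le> clevel U; e \<in> hom_Delta l m; f \<in> hom_Delta m p; j \<in> cidx U p\<rbrakk> \<Longrightarrow>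
      cface U l p (compose {..l} f e) j = cface U l m e (cface U m p f j)"
proof -
  note s = assms [unfolded simplicial_cover_def]
  show "\<lbrakk>m \<le> clevel U; p \<le> clevel U; f \<in> hom_Delta m p; j \<in> cidx U p\<rbrakk> \<Longrightarrow> cface U m p f j \<in> cidx U m \<and>
      cface U m p f (cbar U p j) = cbar U m (cface U m p f j) \<and> pull m f ` copn U p j \<subseteq> copn U m (cface U m p f j)"
    using conjunct1 [OF s] by blast
  show "\<lbrakk>p \<le> clevel U; j \<in> cidx U p\<rbrakk> \<Longrightarrow> cface U p p (\<lambda>i\<in>{..p}. i) j = j"
    using conjunct1 [OF conjunct2 [OF s]] by blast
  show "\<lbrakk>l \<le> clevel U; m \<le> clevel U; p \<le> clevel U; e \<in> hom_Delta l m; f \<in> hom_Delta m p; j \<in> cidx U p\<rbrakk> \<Longrightarrow>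
      cface U l p (compose {..l} f e) j = cface U l m e (cface U m p f j)"
    using conjunct2 [OF conjunct2 [OF s]] by blast
qed

lemma meet_cover:
  assumes U: "U \<in> CS" and V: "V \<in> CS"
  shows "meet_cover U V \<in> CS" "prec U (meet_cover U V)" "prec V (meet_cover U V)"
proof -
  interpret U: real_cover G U by (rule CS_D(4) [OF U])
  interpret V: real_cover G V by (rule CS_D(4) [OF V])
  note sU = simplicialD [OF CS_D(2) [OF U]] and sV = simplicialD [OF CS_D(2) [OF V]]
  let ?W = "meet_cover U V"
  have "real_cover_seq G ?W"
    unfolding real_cover_seq_def real_open_cover_def
  proof (intro allI conjI ballI)
    fix n k assume "k \<in> cidx ?W n"
    then have k: "fst (un k) \<in> cidx U n" "snd (un k) \<in> cidx V n" by (auto simp: meet_cover_def)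
    note cU = U.coverD [OF k(1)] and cV = V.coverD [OF k(2)]
    show "openin (nerve G n) (copn ?W n k)" "cbar ?W n k \<in> cidx ?W n" "cbar ?W n (cbar ?W n k) = k"
      using cU cV by (simp_all add: meet_cover_def openin_Int)
    show "copn ?W n (cbar ?W n k) = rho_nerve G n ` copn ?W n k"
      using cU(4) cV(4) inj_on_image_Int [OF inj_on_rho_nerve cU(5) cV(5)] by (simp add: meet_cover_def)
  next
    fix n
    show "\<Union> (copn ?W n ` cidx ?W n) = topspace (nerve G n)"
    proof (intro equalityI subsetI)
      fix \<gamma> assume "\<gamma> \<in> \<Union> (copn ?W n ` cidx ?W n)"
      then show "\<gamma> \<in> topspace (nerve G n)" using U.coverD(5) by (auto simp: meet_cover_def)
    next
      fix \<gamma> assume "\<gamma> \<in> topspace (nerve G n)"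
      then have \<gamma>: "\<gamma> \<in> nerve_set G n" by simp
      obtain i where i: "i \<in> cidx U n" "\<gamma> \<in> copn U n i" using U.cover_ex [OF \<gamma>] .
      obtain j where j: "j \<in> cidx V n" "\<gamma> \<in> copn V n j" using V.cover_ex [OF \<gamma>] .
      have "pr (i, j) \<in> cidx ?W n" "\<gamma> \<in> copn ?W n (pr (i, j))"
        using i j by (simp_all add: meet_cover_def)
      then show "\<gamma> \<in> \<Union> (copn ?W n ` cidx ?W n)" by blast
    qed
  qed
  moreover have "simplicial_cover ?W"
    unfolding simplicial_cover_def
  proof (intro conjI allI impI ballI)
    fix m p f k assume *: "m \<le> clevel ?W \<and> p \<le> clevel ?W" "f \<in> hom_Delta m p" "k \<in> cidx ?W p"
    then have k: "fst (un k) \<in> cidx U p" "snd (un k) \<in> cidx V p" by (auto simp: meet_cover_def)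
    have l: "m \<le> clevel U" "p \<le> clevel U" "m \<le> clevel V" "p \<le> clevel V" using *(1) by (auto simp: meet_cover_def)
    note fU = sU(1) [OF l(1,2) *(2) k(1)] and fV = sV(1) [OF l(3,4) *(2) k(2)]
    show "cface ?W m p f k \<in> cidx ?W m" "cface ?W m p f (cbar ?W p k) = cbar ?W m (cface ?W m p f k)"
      using fU fV by (simp_all add: meet_cover_def)
    show "pull m f ` copn ?W p k \<subseteq> copn ?W m (cface ?W m p f k)"
      using fU fV by (auto simp: meet_cover_def)
  next
    fix p k assume *: "p \<le> clevel ?W" "k \<in> cidx ?W p"
    then show "cface ?W p p (\<lambda>i\<in>{..p}. i) k = k"
      using sU(2) sV(2) by (simp add: meet_cover_def)
  next
    fix l m p e f k
    assume *: "l \<le> clevel ?W \<and> m \<le> clevel ?W \<and> p \<le> clevel ?W" "e \<in> hom_Delta l m" "f \<in> hom_Delta m p" "k \<in> cidx ?W p"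
    then show "cface ?W l p (compose {..l} f e) k = cface ?W l m e (cface ?W m p f k)"
      using sU(3) [of l m p e f "fst (un k)"] sV(3) [of l m p e f "snd (un k)"] by (simp add: meet_cover_def)
  qed
  moreover have c: "2 \<le> clevel ?W" using CS_D(3) [OF U] CS_D(3) [OF V] by (simp add: meet_cover_def)
  ultimately show "?W \<in> CS" by (simp add: cover_system_def)
  have "refinement 1 ?W U (\<lambda>_ k. fst (un k))"
    unfolding refinement_def
    by (intro conjI allI ballI exI [of _ "min (clevel U) (clevel V)"]) (use c in \<open>auto simp: meet_cover_def\<close>)
  then show "prec U ?W" by blast
  have "refinement 1 ?W V (\<lambda>_ k. snd (un k))"
    unfolding refinement_def
    by (intro conjI allI ballI exI [of _ "min (clevel U) (clevel V)"]) (use c in \<open>auto simp: meet_cover_def\<close>)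
  then show "prec V ?W" by blast
qed

lemma prec_trans: "prec U V \<Longrightarrow> prec V W \<Longrightarrow> prec U W"
  using refinement_trans by blast

text \<open>\<open>dec n\<close> decodes an index as a tuple of \<open>n + 1\<close> indices and \<open>enc n\<close> is its inverse.\<close>

primrec dec :: "nat \<Rightarrow> 'i \<Rightarrow> nat \<Rightarrow> 'i" where
  "dec 0 k = (\<lambda>i. k)"
| "dec (Suc n) k = (\<lambda>i. if i = Suc n then snd (un k) else dec n (fst (un k)) i)"

primrec enc :: "nat \<Rightarrow> (nat \<Rightarrow> 'i) \<Rightarrow> 'i" where
  "enc 0 f = f 0"
| "enc (Suc n) f = pr (enc n f, f (Suc n))"

lemma enc_cong: "(\<And>i. i \<le> n \<Longrightarrow> f i = g i) \<Longrightarrow> enc n f = enc n g"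
  by (induction n) auto

lemma dec_enc [simp]: "i \<le> n \<Longrightarrow> dec n (enc n f) i = f i"
  by (induction n) (auto simp: le_Suc_eq)

lemma enc_dec [simp]: "enc n (dec n k) = k"
proof (induction n arbitrary: k)
  case (Suc n)
  have "enc n (dec (Suc n) k) = enc n (dec n (fst (un k)))" by (rule enc_cong) simp
  then show ?case using Suc by simp
qed simp

text \<open>An index in degree \<open>n\<close> codes one member of \<open>D\<close> per vertex, and
  faces and degeneracies reindex these tuples. The truncation level 2 is the least that
  \<open>cover_system G 1\<close> admits.\<close>

definition ncov :: "('i, 'x) rcov \<Rightarrow> ('i, 'g) cover_seq" where
  "ncov D = \<lparr>cidx = (\<lambda>n. {k. \<forall>i\<le>n. dec n k i \<in> Idx D}),
     cbar = (\<lambda>n k. enc n (\<lambda>i. Bar D (dec n k i))),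
     copn = (\<lambda>n k. {\<gamma> \<in> nerve_set G n. \<forall>i\<le>n. src G (\<gamma> (i, i)) \<in> Opn D (dec n k i)}),
     clevel = 2, cface = (\<lambda>m p f k. enc m (\<lambda>i. dec p k (f i)))\<rparr>"

lemma ncov_CS:
  assumes D: "rcover G D"
  shows "ncov D \<in> CS"
proof -
  let ?W = "ncov D"
  have bb: "cbar ?W n k \<in> cidx ?W n" "cbar ?W n (cbar ?W n k) = k" if "k \<in> cidx ?W n" for n k
  proof -
    have k: "\<And>i. i \<le> n \<Longrightarrow> dec n k i \<in> Idx D" using that by (simp add: ncov_def)
    show "cbar ?W n k \<in> cidx ?W n" using rcoverD(2) [OF D k] by (simp add: ncov_def)
    have "enc n (\<lambda>i. Bar D (dec n (enc n (\<lambda>i. Bar D (dec n k i))) i)) = enc n (dec n k)"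
      by (rule enc_cong) (use rcoverD(3) [OF D k] in simp)
    then show "cbar ?W n (cbar ?W n k) = k" by (simp add: ncov_def)
  qed
  \<comment> \<open>This single inclusion yields both halves of the equality: for the reverse one it
    is applied to the conjugate index.\<close>
  have rho: "rho_nerve G n \<gamma> \<in> copn ?W n (cbar ?W n k)" if "k \<in> cidx ?W n" "\<gamma> \<in> copn ?W n k" for n k \<gamma>
  proof -
    have k: "\<And>i. i \<le> n \<Longrightarrow> dec n k i \<in> Idx D" using that by (simp add: ncov_def)
    have \<gamma>: "\<gamma> \<in> nerve_set G n" "\<And>i. i \<le> n \<Longrightarrow> src G (\<gamma> (i, i)) \<in> Opn D (dec n k i)"
      using that by (simp_all add: ncov_def)
    have "src G (rho_nerve G n \<gamma> (i, i)) \<in> Opn D (Bar D (dec n k i))" if i: "i \<le> n" for i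
      using rcoverD(6) [OF D k [OF i] \<gamma>(2) [OF i]] nerve_setD(1) [OF \<gamma>(1) i i] i by simp
    then show ?thesis using rho_nerve_in [OF \<gamma>(1)] by (simp add: ncov_def)
  qed
  have "real_cover_seq G ?W"
    unfolding real_cover_seq_def real_open_cover_def
  proof (intro allI conjI ballI)
    fix n k assume k: "k \<in> cidx ?W n"
    then have kD: "\<And>i. i \<le> n \<Longrightarrow> dec n k i \<in> Idx D" by (simp add: ncov_def)
    have "openin (nerve G n) (\<Inter>i\<in>{..n}. {\<gamma> \<in> topspace (nerve G n). src G (\<gamma> (i, i)) \<in> Opn D (dec n k i)})"
    proof (rule openin_INT2)
      fix i assume "i \<in> {..n}"
      then have i: "i \<le> n" by simp
      have "continuous_map (nerve G n) (objects G) (\<lambda>\<gamma>. src G (\<gamma> (i, i)))"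
        using continuous_map_compose [OF cont_nerve_apply [OF i i] cont_src] by (simp add: o_def)
      then show "openin (nerve G n) {\<gamma> \<in> topspace (nerve G n). src G (\<gamma> (i, i)) \<in> Opn D (dec n k i)}"
        by (rule openin_continuous_map_preimage [OF _ rcoverD(1) [OF D kD [OF i]]])
    qed auto
    moreover have "(\<Inter>i\<in>{..n}. {\<gamma> \<in> topspace (nerve G n). src G (\<gamma> (i, i)) \<in> Opn D (dec n k i)}) = copn ?W n k"
      by (auto simp: ncov_def)
    ultimately show "openin (nerve G n) (copn ?W n k)" by simp
    show "cbar ?W n k \<in> cidx ?W n" "cbar ?W n (cbar ?W n k) = k" using bb [OF k] .
    show "copn ?W n (cbar ?W n k) = rho_nerve G n ` copn ?W n k"
    proof (intro equalityI subsetI)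
      fix \<gamma> assume \<gamma>: "\<gamma> \<in> copn ?W n (cbar ?W n k)"
      then have "\<gamma> \<in> nerve_set G n" by (simp add: ncov_def)
      moreover have "rho_nerve G n \<gamma> \<in> copn ?W n k" using rho [OF bb(1) [OF k] \<gamma>] bb(2) [OF k] by simp
      ultimately show "\<gamma> \<in> rho_nerve G n ` copn ?W n k"
        by (intro image_eqI [of _ _ "rho_nerve G n \<gamma>"]) (simp_all add: rho_nerve_rho_nerve)
    next
      fix \<gamma> assume "\<gamma> \<in> rho_nerve G n ` copn ?W n k"
      then show "\<gamma> \<in> copn ?W n (cbar ?W n k)" using rho [OF k] by blast
    qed
  next
    fix n
    show "\<Union> (copn ?W n ` cidx ?W n) = topspace (nerve G n)"
    proof (intro equalityI subsetI)
      fix \<gamma> assume "\<gamma> \<in> \<Union> (copn ?W n ` cidx ?W n)"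
      then show "\<gamma> \<in> topspace (nerve G n)" by (auto simp: ncov_def)
    next
      fix \<gamma> assume "\<gamma> \<in> topspace (nerve G n)"
      then have \<gamma>: "\<gamma> \<in> nerve_set G n" by simp
      define f where "f i = pick D (src G (\<gamma> (i, i)))" for i
      have "f i \<in> Idx D \<and> src G (\<gamma> (i, i)) \<in> Opn D (f i)" if i: "i \<le> n" for i
        unfolding f_def using pick [OF D src_in [OF nerve_setD(1) [OF \<gamma> i i]]] by blast
      then have "enc n f \<in> cidx ?W n" "\<gamma> \<in> copn ?W n (enc n f)"
        using \<gamma> by (simp_all add: ncov_def)
      then show "\<gamma> \<in> \<Union> (copn ?W n ` cidx ?W n)" by blast
    qed
  qed
  moreover have "simplicial_cover ?W"
    unfolding simplicial_cover_def
  proof (intro conjI allI impI ballI)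
    fix m p f k assume *: "f \<in> hom_Delta m p" "k \<in> cidx ?W p"
    have f: "f i \<le> p" if "i \<le> m" for i using *(1) that by (auto simp: hom_Delta_def)
    show "cface ?W m p f k \<in> cidx ?W m" using *(2) f by (simp add: ncov_def)
    show "cface ?W m p f (cbar ?W p k) = cbar ?W m (cface ?W m p f k)"
      using f by (auto simp: ncov_def intro!: enc_cong)
    show "pull m f ` copn ?W p k \<subseteq> copn ?W m (cface ?W m p f k)"
    proof
      fix \<delta> assume "\<delta> \<in> pull m f ` copn ?W p k"
      then obtain \<gamma> where \<gamma>: "\<delta> = pull m f \<gamma>" "\<gamma> \<in> nerve_set G p" "\<And>i. i \<le> p \<Longrightarrow> src G (\<gamma> (i, i)) \<in> Opn D (dec p k i)"
        by (auto simp: ncov_def)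
      have "src G (pull m f \<gamma> (i, i)) \<in> Opn D (dec p k (f i))" if "i \<le> m" for i
        using \<gamma>(3) [OF f [OF that]] that by (simp add: pull_def)
      then show "\<delta> \<in> copn ?W m (cface ?W m p f k)"
        using pull_in [OF \<gamma>(2) f] by (simp add: \<gamma>(1) ncov_def)
    qed
  next
    fix p k
    have "enc p (\<lambda>i. dec p k ((\<lambda>i\<in>{..p}. i) i)) = enc p (dec p k)" by (rule enc_cong) simp
    then show "cface ?W p p (\<lambda>i\<in>{..p}. i) k = k" by (simp add: ncov_def)
  next
    fix l m p e f k assume *: "e \<in> hom_Delta l m"
    have e: "e i \<le> m" if "i \<le> l" for i using * that by (auto simp: hom_Delta_def)
    show "cface ?W l p (compose {..l} f e) k = cface ?W l m e (cface ?W m p f k)"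
      using e by (auto simp: ncov_def compose_def intro!: enc_cong)
  qed
  moreover have "2 \<le> clevel ?W" by (simp add: ncov_def)
  ultimately show ?thesis by (simp add: cover_system_def)
qed

lemma ncov_rrefines: "rrefines (deg0 G (ncov D)) D (\<lambda>k. k)"
  by (auto simp: rrefines_def deg0_def ncov_def)

text \<open>The cover of a cocycle presenting \<open>A\<close> is first reduced to two indices per
  object, then moved into \<open>'i\<close> along an injection, and finally extended to the nerve by
  \<open>ncov\<close>. Each step is a refinement of the previous cover, so the restricted cocycle
  still presents \<open>A\<close>.\<close>

lemma bclass_surj:
  assumes A: "A \<in> carrier Pic"
  obtains U x where "U \<in> CS" "x \<in> carrier (HH U)" "bclass U x = A"
proof -
  obtain C :: "('x \<times> bool, 'x) rcov" and c where C: "rcover G C" "c \<in> Z1 G C" "A = lcls C c"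
    using Pic_obtain [OF A] .
  let ?D = "reindex G C"
  obtain e :: "'x \<times> bool \<Rightarrow> 'i" where e: "inj_on e (Ob \<times> UNIV)"
    using emb by (auto simp: lepoll_def)
  have ID: "Idx ?D = Ob \<times> UNIV" by (simp add: reindex_def)
  define e' where "e' = inv_into (Idx ?D) e"
  have e'e: "e' (e j) = j" if "j \<in> Idx ?D" for j
    unfolding e'_def using e that by (simp add: ID)
  define E where "E = \<lparr>Idx = e ` Idx ?D, Bar = (\<lambda>k. e (Bar ?D (e' k))), Opn = (\<lambda>k. Opn ?D (e' k))\<rparr>"
  note D = reindex [OF C(1)]
  have E: "rcover G E"
    unfolding rcover_def real_open_cover_def
  proof (intro conjI ballI)
    fix k assume "k \<in> Idx E"
    then obtain j where j: "k = e j" "j \<in> Idx ?D" by (auto simp: E_def)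
    note r = rcoverD(1,2,3,5) [OF D(1) j(2)]
    show "openin (objects G) (Opn E k)" "Bar E k \<in> Idx E" "Bar E (Bar E k) = k" "Opn E (Bar E k) = rho_obj G ` Opn E k"
      using r e'e [OF j(2)] e'e [OF r(2)] by (simp_all add: E_def j(1))
  next
    have "\<Union> (Opn E ` Idx E) = \<Union> (Opn ?D ` Idx ?D)"
      using e'e by (simp add: E_def image_image)
    then show "\<Union> (Opn E ` Idx E) = Ob"
      using D(1) by (simp add: rcover_def real_open_cover_def)
  qed
  have r1: "rrefines E ?D e'"
    using e'e rcoverD(2) [OF D(1)] by (auto simp: rrefines_def E_def)
  let ?c1 = "\<lambda>i j. c (reindex_map C i) (reindex_map C j)"
  let ?c2 = "\<lambda>i j. ?c1 (e' i) (e' j)"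
  have 1: "?c1 \<in> Z1 G ?D" "lcls ?D ?c1 = A"
    using Z1_refine [OF D(2) C(2)] lcls_refine [OF C(1,2) D] C(3) by simp_all
  have 2: "?c2 \<in> Z1 G E" "lcls E ?c2 = A"
    using Z1_refine [OF r1 1(1)] lcls_refine [OF D(1) 1(1) E r1] 1(2) by simp_all
  let ?U = "ncov E"
  have U: "?U \<in> CS" by (rule ncov_CS [OF E])
  interpret U: picard_cover G ?U "TYPE('l)" by (rule CS_D(5) [OF U])
  have 3: "?c2 \<in> Z1 G U.C" "lcls U.C ?c2 = A"
    using Z1_refine [OF ncov_rrefines 2(1)] lcls_refine [OF E 2(1) U.deg0_cover ncov_rrefines] 2(2) by simp_all
  show thesis
  proof (rule that [OF U])
    show "U.coset ?c2 \<in> carrier (HH ?U)" unfolding U.carrier_H1 using 3(1) by blast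
    show "bclass ?U (U.coset ?c2) = A" unfolding bclass_def U.bcls_coset [OF 3(1)] by (rule 3(2))
  qed
qed

lemma res:
  assumes "U \<in> CS" "V \<in> CS" "prec U V" "x \<in> carrier (HH U)"
  shows "res U V x \<in> carrier (HH V)" "bclass V (res U V x) = bclass U x"
  using HR_restrict [OF CS_D(1) [OF assms(1)] CS_D(1) [OF assms(2)] assms(3,4)] by auto

lemma bclass_inj:
  assumes "U \<in> CS" "x \<in> carrier (HH U)" "y \<in> carrier (HH U)" "bclass U x = bclass U y"
  shows "x = y"
  using picard_cover.bcls_inj [OF CS_D(5) [OF assms(1)] assms(2,3)] assms(4) by (simp add: bclass_def)

lemma bclass_mult:
  assumes "U \<in> CS" "x \<in> carrier (HH U)" "y \<in> carrier (HH U)"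
  shows "x \<otimes>\<^bsub>HH U\<^esub> y \<in> carrier (HH U)" "bclass U (x \<otimes>\<^bsub>HH U\<^esub> y) = bclass U x \<otimes>\<^bsub>Pic\<^esub> bclass U y"
  using picard_cover.bcls_mult [OF CS_D(5) [OF assms(1)] assms(2,3)] by (auto simp: bclass_def)

lemma bclass_carrier: "U \<in> CS \<Longrightarrow> x \<in> carrier (HH U) \<Longrightarrow> bclass U x \<in> carrier Pic"
  using picard_cover.bcls_carrier [OF CS_D(5)] by (simp add: bclass_def)

text \<open>Restriction preserves the bundle class, and over the intersection of the two covers that
  class determines the cohomology class. The relation of the direct limit is therefore the kernel of
  \<open>bclass\<close>.\<close>

lemma bclass_eq_iff:
  assumes "U \<in> CS" "x \<in> carrier (HH U)" "V \<in> CS" "y \<in> carrier (HH V)"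
  shows "(\<exists>W\<in>CS. prec U W \<and> prec V W \<and> res U W x = res V W y) \<longleftrightarrow> bclass U x = bclass V y"
proof
  assume "\<exists>W\<in>CS. prec U W \<and> prec V W \<and> res U W x = res V W y"
  then obtain W where "W \<in> CS" "prec U W" "prec V W" "res U W x = res V W y" by blast
  then show "bclass U x = bclass V y"
    using res(2) [OF assms(1) _ _ assms(2), of W] res(2) [OF assms(3) _ _ assms(4), of W] by simp
next
  assume eq: "bclass U x = bclass V y"
  note W = meet_cover [OF assms(1,3)]
  note rU = res [OF assms(1) W(1,2) assms(2)] and rV = res [OF assms(3) W(1,3) assms(4)]
  have "res U (meet_cover U V) x = res V (meet_cover U V) y"
    by (rule bclass_inj [OF W(1) rU(1) rV(1)]) (simp only: rU(2) rV(2) eq)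
  then show "\<exists>W\<in>CS. prec U W \<and> prec V W \<and> res U W x = res V W y"
    using W by blast
qed

section \<open>Germs and the isomorphism with the direct limit\<close>

abbreviation "Cech \<equiv> CechHR TYPE('i) G circle_group 1"

text \<open>An element of the limit is the set of all its representatives over all covers, that is,
  a fibre of \<open>bclass\<close>.\<close>

definition germs :: "('l, 'g, 'x) line_bundle set \<Rightarrow> (('i, 'g) cover_seq \<times> ('i, 'g, complex) cochain set) set" where
  "germs A = {(U, x). U \<in> CS \<and> x \<in> carrier (HH U) \<and> bclass U x = A}"

lemma Cech_carrier: "carrier Cech = germs ` carrier Pic"
proof -
  let ?P = "SIGMA U:CS. carrier (HH U)"
  define Rel where "Rel = {((i, x), (j, y)). i \<in> CS \<and> x \<in> carrier (HH i) \<and> j \<in> CS \<and> y \<in> carrier (HH j) \<and>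
           (\<exists>m\<in>CS. prec i m \<and> prec j m \<and> res i m x = res j m y)}"
  have c: "carrier Cech = ?P // Rel"
    by (simp add: CechHR_def direct_limit_def Rel_def)
  have R: "Rel `` {(U, x)} = germs (bclass U x)" if "U \<in> CS" "x \<in> carrier (HH U)" for U x
  proof (intro Set.set_eqI)
    fix q :: "('i, 'g) cover_seq \<times> ('i, 'g, complex) cochain set"
    obtain V y where q: "q = (V, y)" by (cases q) blast
    show "q \<in> Rel `` {(U, x)} \<longleftrightarrow> q \<in> germs (bclass U x)"
      using bclass_eq_iff [OF that, of V y] that by (auto simp: q Rel_def germs_def)
  qed
  show ?thesis
  proof (intro equalityI subsetI)
    fix a assume "a \<in> carrier Cech"
    then obtain U x where "U \<in> CS" "x \<in> carrier (HH U)" "a = Rel `` {(U, x)}"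
      unfolding c quotient_def by blast
    then show "a \<in> germs ` carrier Pic" using R bclass_carrier by blast
  next
    fix a assume "a \<in> germs ` carrier Pic"
    then obtain A where A: "A \<in> carrier Pic" "a = germs A" by blast
    obtain U x where "U \<in> CS" "x \<in> carrier (HH U)" "bclass U x = A" using bclass_surj [OF A(1)] .
    then show "a \<in> carrier Cech"
      unfolding c quotient_def using R [of U x] A(2) by blast
  qed
qed

text \<open>Fibres of \<open>bclass\<close> over the Picard group are nonempty by surjectivity, and
  any representative recovers its bundle class.\<close>

lemma germs_inj: "inj_on germs (carrier Pic)"
proof (rule inj_onI)
  fix A B assume A: "A \<in> carrier Pic" and "germs A = germs B"
  moreover obtain U x where "U \<in> CS" "x \<in> carrier (HH U)" "bclass U x = A" using bclass_surj [OF A] .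
  ultimately have "(U, x) \<in> germs B" by (auto simp: germs_def)
  then show "A = B" using \<open>bclass U x = A\<close> by (simp add: germs_def)
qed

lemma germs_mult:
  assumes A: "A \<in> carrier Pic" and B: "B \<in> carrier Pic"
  shows "germs (A \<otimes>\<^bsub>Pic\<^esub> B) = germs A \<otimes>\<^bsub>Cech\<^esub> germs B"
proof -
  have m: "germs A \<otimes>\<^bsub>Cech\<^esub> germs B = {(k, z). k \<in> CS \<and> z \<in> carrier (HH k) \<and>
        (\<exists>(i, x)\<in>germs A. \<exists>(j, y)\<in>germs B. \<exists>m\<in>CS. prec i m \<and> prec j m \<and> prec k m \<and>
           res k m z = res i m x \<otimes>\<^bsub>HH m\<^esub> res j m y)}"
    by (simp add: CechHR_def direct_limit_def)
  have "bclass k z = A \<otimes>\<^bsub>Pic\<^esub> B \<longleftrightarrow> (\<exists>(i, x)\<in>germs A. \<exists>(j, y)\<in>germs B. \<exists>m\<in>CS. prec i m \<and> prec j m \<and> prec k m \<and>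
           res k m z = res i m x \<otimes>\<^bsub>HH m\<^esub> res j m y)" (is "?L \<longleftrightarrow> ?R")
    if k: "k \<in> CS" and z: "z \<in> carrier (HH k)" for k z
  proof
    assume ?R
    then obtain i x j y m where i: "i \<in> CS" "x \<in> carrier (HH i)" "bclass i x = A"
      and j: "j \<in> CS" "y \<in> carrier (HH j)" "bclass j y = B"
      and m: "m \<in> CS" "prec i m" "prec j m" "prec k m" and e: "res k m z = res i m x \<otimes>\<^bsub>HH m\<^esub> res j m y"
      unfolding germs_def by blast
    show ?L
      using res(2) [OF k m(1,4) z] e
        bclass_mult(2) [OF m(1) res(1) [OF i(1) m(1,2) i(2)] res(1) [OF j(1) m(1,3) j(2)]]
        res(2) [OF i(1) m(1,2) i(2)] res(2) [OF j(1) m(1,3) j(2)] i(3) j(3) by simp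
  next
    assume L: ?L
    obtain i x where i: "i \<in> CS" "x \<in> carrier (HH i)" "bclass i x = A" using bclass_surj [OF A] .
    obtain j y where j: "j \<in> CS" "y \<in> carrier (HH j)" "bclass j y = B" using bclass_surj [OF B] .
    note n = meet_cover [OF i(1) j(1)]
    \<comment> \<open>The product in the limit compares all three classes at one stage, so the cover
      \<open>k\<close> of the result is intersected as well.\<close>
    define m where "m = meet_cover (meet_cover i j) k"
    note m' = meet_cover [OF n(1) k, folded m_def]
    have m: "m \<in> CS" "prec i m" "prec j m" "prec k m"
      using m'(1) prec_trans [OF n(2) m'(2)] prec_trans [OF n(3) m'(2)] m'(3) .
    note ri = res [OF i(1) m(1,2) i(2)] and rj = res [OF j(1) m(1,3) j(2)] and rk = res [OF k m(1,4) z]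
    note rm = bclass_mult [OF m(1) ri(1) rj(1)]
    have e: "res k m z = res i m x \<otimes>\<^bsub>HH m\<^esub> res j m y"
      by (rule bclass_inj [OF m(1) rk(1) rm(1)]) (simp only: rk(2) rm(2) ri(2) rj(2) i(3) j(3) L)
    have "(i, x) \<in> germs A" "(j, y) \<in> germs B" using i j by (simp_all add: germs_def)
    then show ?R using m e by blast
  qed
  then show ?thesis
    unfolding m germs_def [of "A \<otimes>\<^bsub>Pic\<^esub> B"] by blast
qed

lemma Pic_iso_Cech: "Pic \<cong> Cech"
proof -
  have "germs \<in> hom Pic Cech"
    using germs_mult Cech_carrier by (auto simp: hom_def)
  moreover have "bij_betw germs (carrier Pic) (carrier Cech)"
    using germs_inj Cech_carrier by (simp add: bij_betw_def)
  ultimately show ?thesis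
    unfolding is_iso_def iso_def by blast
qed

end

text \<open>The bit is coded by one of two fixed distinct elements, paired with the image of the
  point.\<close>

lemma lepoll_times_bool:
  assumes inf: "infinite (UNIV :: 'i set)" and X: "X \<lesssim> (UNIV :: 'i set)"
  shows "X \<times> (UNIV :: bool set) \<lesssim> (UNIV :: 'i set)"
proof -
  obtain pr :: "'i \<times> 'i \<Rightarrow> 'i" and un where pr: "\<And>p. un (pr p) = p"
    using infinite_bij_pair [OF inf] by blast
  obtain e where e: "inj_on e X" "e ` X \<subseteq> (UNIV :: 'i set)" using X by (auto simp: lepoll_def)
  obtain a b :: 'i where ab: "a \<noteq> b"
    using inf by (metis UNIV_I finite.emptyI finite_insert finite_subset insertI1 subsetI)
  have "inj_on (\<lambda>(x, t). pr (e x, if t then a else b)) (X \<times> UNIV)"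
  proof (rule inj_onI)
    fix p q assume p: "p \<in> X \<times> (UNIV :: bool set)" and q: "q \<in> X \<times> (UNIV :: bool set)"
      and eq: "(case p of (x, t) \<Rightarrow> pr (e x, if t then a else b)) = (case q of (x, t) \<Rightarrow> pr (e x, if t then a else b))"
    have "(e (fst p), if snd p then a else b) = (e (fst q), if snd q then a else b)"
      using arg_cong [OF eq, of un] pr by (simp add: case_prod_beta)
    then have "e (fst p) = e (fst q)" "snd p = snd q" using ab by (auto split: if_splits)
    then show "p = q" using inj_onD [OF e(1)] p q by (auto simp: prod_eq_iff mem_Times_iff)
  qed
  then show ?thesis unfolding lepoll_def by blast
qed

theorem theorem2p55:
  fixes G :: "('g, 'x) real_groupoid"
  assumes "lch_real_groupoid G"
    and universe_bundles: "topspace (objects G) \<times> (UNIV :: complex set) \<lesssim> (UNIV :: 'l set)"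
    and universe_covers: "infinite (UNIV :: 'i set)" "topspace (objects G) \<lesssim> (UNIV :: 'i set)"
  shows "comm_group (PicR TYPE('l) G) \<and>
         PicR TYPE('l) G \<cong> CechHR TYPE('i) G circle_group 1"
proof -
  interpret real_picard G "TYPE('l)"
    by unfold_locales (use assms in auto)
  obtain pr :: "'i \<times> 'i \<Rightarrow> 'i" and un where pr: "\<forall>p. un (pr p) = p" "\<forall>k. pr (un k) = k"
    using infinite_bij_pair [OF universe_covers(1)] by blast
  interpret cech_limit G "TYPE('l)" pr un
    by unfold_locales (use pr lepoll_times_bool [OF universe_covers] in auto)
  show ?thesis
    using Pic_comm_group Pic_iso_Cech by (rule conjI)
qed

end
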